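(* Let $g\in M^1(\mathbb{R}^d)$ and let $\Lambda\subseteq\mathbb{R}^{2d}$ be relatively separated. Then $\mathcal{G}(g,\Lambda)$ is a frame for $L^2(\mathbb{R}^d)$ if and only if for every weak limit $\Gamma$ of translates of $\Lambda$ the map $f\mapsto(\langle f,\pi(\gamma)g\rangle)_{\gamma\in\Gamma}$ is one-to-one on the dual space $(M^1(\mathbb{R}^d))^*$.
   Context: For $z=(x,\xi)\in\mathbb{R}^d\times\mathbb{R}^d\simeq\mathbb{R}^{2d}$, the time-frequency shift is $\pi(z)g(t)=e^{2\pi i\xi\cdot t}g(t-x)$. For a fixed nonzero Schwartz function $\phi$, $V_\phi f(z)=\langle f,\pi(z)\phi\rangle$ is the short-time Fourier transform, and $M^p(\mathbb{R}^d)=\{f\in\mathcal{S}'(\mathbb{R}^d):V_\phi f\in L^p(\mathbb{R}^{2d})\}$ with norm $\|V_\phi f\|_{L^p}$ (different $\phi$ give equivalent norms). The dual of $M^1(\mathbb{R}^d)$ is $M^\infty(\mathbb{R}^d)$ via the pairing $\langle f,h\rangle$ extending the $L^2$ inner product (antilinear in the second argument). $\mathcal{G}(g,\Lambda)=\{\pi(\lambda)g:\lambda\in\Lambda\}$ is a frame for $L^2(\mathbb{R}^d)$ if there are constants $0<A\le B<\infty$ with $A\|f\|_2^2\le\sum_{\lambda\in\Lambda}|\langle f,\pi(\lambda)g\rangle|^2\le B\|f\|_2^2$ for all $f\in L^2(\mathbb{R}^d)$. A set $\Lambda\subseteq\mathbb{R}^{2d}$ is relatively separated if $\sup_{x\in\mathbb{R}^{2d}}\#(\Lambda\cap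 B_1(x))<\infty$, where $B_r(x)$ is the Euclidean ball. Weak convergence of sets: with the Hausdorff distance $d_H(X,Y)=\inf\{\varepsilon>0:X\subseteq Y+B_\varepsilon(0),\,Y\subseteq X+B_\varepsilon(0)\}$, a sequence of sets $\Lambda_n$ converges weakly to $\Gamma$ if for all $z\in\mathbb{R}^{2d}$ and $R>0$, $d_H\big((\Lambda_n\cap\bar B_R(z))\cup\partial\bar B_R(z),(\Gamma\cap\bar B_R(z))\cup\partial\bar B_R(z)\big)\to0$. A set $\Gamma\subseteq\mathbb{R}^{2d}$ is a weak limit of translates of $\Lambda$ if there is a sequence $(z_n)_{n\in\mathbb{N}}\subseteq\mathbb{R}^{2d}$ such that $\Lambda+z_n$ converges weakly to $\Gamma$. *)

theory Defs
  imports "HOL-Analysis.Analysis" "HOL-Library.FuncSet" "HOL-Library.Set_Algebras"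
begin

text \<open>
  Measurable functions are Borel measurable; every class of Lebesgue measurable functions modulo
  null sets has such a representative.
\<close>

section \<open>Schwartz functions and tempered distributions\<close>

primrec iterated_partial ::
    "'d list \<Rightarrow> (real^'d \<Rightarrow> complex) \<Rightarrow> real^'d \<Rightarrow> complex" where
  "iterated_partial [] f = f"
| "iterated_partial (j # js) f =
     (\<lambda>x. frechet_derivative (iterated_partial js f) (at x) (axis j 1))"

text \<open>Total differentiability of all iterated partial derivatives amounts to smoothness.\<close>

definition schwartz :: "(real^'d \<Rightarrow> complex) set" where
  "schwartz = {f. \<forall>js. (\<forall>x. iterated_partial js f differentiable (at x)) \<and>
     (\<forall>k::nat. bounded (range (\<lambda>x. norm x ^ k *\<^sub>R iterated_partial js f x)))}"

definition schwartz_seminorm :: "nat \<Rightarrow> 'd list \<Rightarrow> (real^'d \<Rightarrow> complex) \<Rightarrow> real" where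
  "schwartz_seminorm k js f = (SUP x. norm x ^ k * norm (iterated_partial js f x))"

definition schwartz_null_sequence :: "(nat \<Rightarrow> real^'d \<Rightarrow> complex) \<Rightarrow> bool" where
  "schwartz_null_sequence \<psi> \<longleftrightarrow>
     (\<forall>n. \<psi> n \<in> schwartz) \<and> (\<forall>k js. (\<lambda>n. schwartz_seminorm k js (\<psi> n)) \<longlonglongrightarrow> 0)"

text \<open>
  Linear functionals on a space of functions or distributions are total functions that vanish off
  that space, so that two of them are equal iff they agree on the space. The Schwartz space is
  metrizable, so that continuity of a linear functional is sequential continuity at zero.
\<close>

type_synonym 'd distribution = "(real^'d \<Rightarrow> complex) \<Rightarrow> complex"

definition tempered_distributions :: "('d::finite) distribution set" where
  "tempered_distributions = {T.
     (\<forall>\<psi>. \<psi> \<notin> schwartz \<longrightarrow> T \<psi> = 0) \<and>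
     (\<forall>\<psi>\<in>schwartz. \<forall>\<eta>\<in>schwartz. T (\<lambda>t. \<psi> t + \<eta> t) = T \<psi> + T \<eta>) \<and>
     (\<forall>c. \<forall>\<psi>\<in>schwartz. T (\<lambda>t. c * \<psi> t) = c * T \<psi>) \<and>
     (\<forall>\<psi>. schwartz_null_sequence \<psi> \<longrightarrow> (\<lambda>n. T (\<psi> n)) \<longlonglongrightarrow> 0)}"

text \<open>
  Distributions are linear functionals, while the pairing \<open>\<langle>T, \<psi>\<rangle>\<close> extends the \<open>L\<^sup>2\<close> inner product
  and is antilinear in \<open>\<psi>\<close>; hence the conjugate. The same convention is used for the dual of \<open>M\<^sup>1\<close>.
\<close>

definition distribution_pairing :: "('d::finite) distribution \<Rightarrow> (real^'d \<Rightarrow> complex) \<Rightarrow> complex" where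
  "distribution_pairing T \<psi> = T (\<lambda>t. cnj (\<psi> t))"

definition distribution_of :: "(real^'d \<Rightarrow> complex) \<Rightarrow> ('d::finite) distribution" where
  "distribution_of h = (\<lambda>\<psi>. if \<psi> \<in> schwartz then LINT t|lborel. h t * \<psi> t else 0)"


section \<open>The modulation space \<open>M\<^sup>1\<close> and its dual\<close>

definition tf_shift :: "(real^'d) \<times> (real^'d) \<Rightarrow> (real^'d \<Rightarrow> complex) \<Rightarrow> real^'d \<Rightarrow> complex" where
  "tf_shift z h = (\<lambda>t. cis (2 * pi * (snd z \<bullet> t)) * h (t - fst z))"

definition stft ::
    "(real^'d \<Rightarrow> complex) \<Rightarrow> ('d::finite) distribution \<Rightarrow> (real^'d) \<times> (real^'d) \<Rightarrow> complex" where
  "stft \<phi> T z = distribution_pairing T (tf_shift z \<phi>)"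

definition M1 :: "(real^'d \<Rightarrow> complex) \<Rightarrow> ('d::finite) distribution set" where
  "M1 \<phi> = {T \<in> tempered_distributions. integrable lborel (stft \<phi> T)}"

definition M1_norm :: "(real^'d \<Rightarrow> complex) \<Rightarrow> ('d::finite) distribution \<Rightarrow> real" where
  "M1_norm \<phi> T = (LINT z|lborel. norm (stft \<phi> T z))"

text \<open>
  Every element of \<open>M\<^sup>1\<close> is given by a function, which lies in \<open>L\<^sup>1 \<inter> L\<^sup>2\<close>. The following are the
  functions representing elements of \<open>M\<^sup>1\<close>; the integrability condition ensures that the integrals
  in \<^const>\<open>distribution_of\<close> are genuine, since divergent ones have value 0 in the library.
\<close>

definition M1_functions :: "(real^'d \<Rightarrow> complex) \<Rightarrow> (real^'d \<Rightarrow> complex) set" where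
  "M1_functions \<phi> = {h \<in> borel_measurable lborel.
     (\<forall>\<psi>\<in>schwartz. integrable lborel (\<lambda>t. h t * \<psi> t)) \<and> distribution_of h \<in> M1 \<phi>}"

definition M1_dual :: "(real^'d \<Rightarrow> complex) \<Rightarrow> (('d::finite) distribution \<Rightarrow> complex) set" where
  "M1_dual \<phi> = {F.
     (\<forall>T. T \<notin> M1 \<phi> \<longrightarrow> F T = 0) \<and>
     (\<forall>T\<in>M1 \<phi>. \<forall>U\<in>M1 \<phi>. F (\<lambda>\<psi>. T \<psi> + U \<psi>) = F T + F U) \<and>
     (\<forall>c. \<forall>T\<in>M1 \<phi>. F (\<lambda>\<psi>. c * T \<psi>) = c * F T) \<and>
     (\<exists>C. \<forall>T\<in>M1 \<phi>. norm (F T) \<le> C * M1_norm \<phi> T)}"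

text \<open>
  An \<open>L\<^sup>2\<close> function \<open>f\<close> acts on \<open>M\<^sup>1\<close> by \<open>h \<mapsto> \<integral> f h\<close>, for which the following gives \<open>\<integral> f cnj h\<close>.
\<close>

definition dual_pairing ::
    "(('d::finite) distribution \<Rightarrow> complex) \<Rightarrow> (real^'d \<Rightarrow> complex) \<Rightarrow> complex" where
  "dual_pairing F h = F (distribution_of (\<lambda>t. cnj (h t)))"


section \<open>Gabor frames\<close>

definition L2 :: "(real^'d \<Rightarrow> complex) set" where
  "L2 = {f \<in> borel_measurable lborel. integrable lborel (\<lambda>t. (norm (f t))\<^sup>2)}"

definition L2_inner :: "(real^'d \<Rightarrow> complex) \<Rightarrow> (real^'d \<Rightarrow> complex) \<Rightarrow> complex" where
  "L2_inner f h = (LINT t|lborel. f t * cnj (h t))"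

definition L2_norm :: "(real^'d \<Rightarrow> complex) \<Rightarrow> real" where
  "L2_norm f = sqrt (LINT t|lborel. (norm (f t))\<^sup>2)"

definition gabor_frame :: "(real^'d \<Rightarrow> complex) \<Rightarrow> ((real^'d) \<times> (real^'d)) set \<Rightarrow> bool" where
  "gabor_frame g \<Lambda> \<longleftrightarrow> (\<exists>A B. 0 < A \<and> A \<le> B \<and>
     (\<forall>f\<in>L2. (\<lambda>l. (norm (L2_inner f (tf_shift l g)))\<^sup>2) summable_on \<Lambda> \<and>
       A * (L2_norm f)\<^sup>2 \<le> (\<Sum>\<^sub>\<infinity>l\<in>\<Lambda>. (norm (L2_inner f (tf_shift l g)))\<^sup>2) \<and>
       (\<Sum>\<^sub>\<infinity>l\<in>\<Lambda>. (norm (L2_inner f (tf_shift l g)))\<^sup>2) \<le> B * (L2_norm f)\<^sup>2))"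


section \<open>Point sets and weak limits of translates\<close>

definition relatively_separated :: "'a::euclidean_space set \<Rightarrow> bool" where
  "relatively_separated \<Lambda> \<longleftrightarrow> (\<exists>N::nat. \<forall>x. finite (\<Lambda> \<inter> ball x 1) \<and> card (\<Lambda> \<inter> ball x 1) \<le> N)"

text \<open>
  The infimum is meaningful for nonempty bounded sets, the only ones to which it is applied below:
  the space \<^typ>\<open>(real^'d) \<times> (real^'d)\<close> is nontrivial, so that spheres are nonempty.
\<close>

definition hausdorff_distance :: "'a::euclidean_space set \<Rightarrow> 'a set \<Rightarrow> real" where
  "hausdorff_distance X Y = Inf {\<epsilon>. 0 < \<epsilon> \<and> X \<subseteq> Y + ball 0 \<epsilon> \<and> Y \<subseteq> X + ball 0 \<epsilon>}"

definition weakly_converges :: "(nat \<Rightarrow> 'a::euclidean_space set) \<Rightarrow> 'a set \<Rightarrow> bool" where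
  "weakly_converges S \<Gamma> \<longleftrightarrow> (\<forall>z. \<forall>R>0.
     (\<lambda>n. hausdorff_distance ((S n \<inter> cball z R) \<union> frontier (cball z R))
                             ((\<Gamma> \<inter> cball z R) \<union> frontier (cball z R))) \<longlonglongrightarrow> 0)"

definition weak_limit_of_translates :: "'a::euclidean_space set \<Rightarrow> 'a set \<Rightarrow> bool" where
  "weak_limit_of_translates \<Lambda> \<Gamma> \<longleftrightarrow> (\<exists>z. weakly_converges (\<lambda>n. (\<lambda>x. x + z n) ` \<Lambda>) \<Gamma>)"

end

theory Submission
  imports Defs "HOL-Complex_Analysis.Great_Picard" "HOL-Probability.Characteristic_Functions"
begin

text \<open>
  Let \<open>P\<close> be the reproducing kernel of the short-time Fourier transform with window \<open>\<phi>\<close>, and let \<open>G\<close> be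
  the kernel for which \<open>G (V f) z = \<langle>f, \<pi>(z) g\<rangle>\<close>. Both are invariant under translations up to phases and
  are dominated by an integrable function of \<open>z - w\<close>, since \<open>g\<close> lies in \<open>M\<^sup>1\<close>. Square integrable
  (bounded) functions \<open>U\<close> with \<open>P U = U\<close> correspond to elements of \<open>L\<^sup>2\<close> (of the dual of \<open>M\<^sup>1\<close>), and the
  coefficients with respect to \<open>\<pi>(\<gamma>) g\<close> are the values of \<open>G U\<close> at \<open>\<gamma>\<close>. So the theorem is about
  \<open>U = P U\<close> only.

  Suppose uniqueness holds for all weak limits. If \<open>G U\<close> were not bounded below on \<open>\<Lambda>\<close> in the supremum
  norm, normalized near-counterexamples, translated so that they are large at the origin, would by
  Arzela--Ascoli and the compactness of the weak convergence of relatively separated sets converge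
  to a nonzero bounded \<open>U\<close> with \<open>G U = 0\<close> on a weak limit of translates of \<open>\<Lambda>\<close>. The lower bound passes
  from the supremum norm to \<open>L\<^sup>2\<close> by cutting off at a large scale: the commutators of the kernels with
  the cutoffs are small by integrability of the envelope. Conversely, given the \<open>L\<^sup>2\<close> lower bound and a
  bounded \<open>U\<close> with \<open>G U = 0\<close> on a weak limit, the bound applied to translated cutoffs of \<open>U\<close> forces
  \<open>U = 0\<close>.
\<close>

section \<open>Integration on Euclidean spaces\<close>

text \<open>Both transfers between norms are absorption arguments: the cutoff errors are bounded by
  a small factor times the very quantity under estimation. A ball of radius \<open>4 * N\<close> or
  \<open>3 * N\<close> is covered by balls of radius \<open>N\<close> whose number does not depend
  on \<open>N\<close>, while \<open>reduced_mass\<close> tends to 0 as \<open>N\<close> grows; so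
  \<open>N\<close> can be chosen after all other constants. Absorption also requires that quantity
  to be finite beforehand. It is measured by local maxima in one direction and by L2 norms over
  balls in the other, to match the bound that is given. The points of \<Lambda> form a null set, so
  values there have to be controlled by integrals. For this the envelope dominates a kernel on whole
  unit neighbourhoods, and each point is averaged over a unit ball. For \<open>g\<close> in M1 such
  an envelope arises by smoothing the short-time Fourier transform of \<open>g\<close> with the
  reproducing kernel; its integrability alone says nothing about local maxima.\<close>

lemma cnj_borel_measurable [measurable]: "cnj \<in> borel_measurable borel"
  by (intro borel_measurable_continuous_onI continuous_intros)

lemma nn_integral_lborel_affine:
  fixes t :: "'a::euclidean_space"
  assumes [measurable]: "f \<in> borel_measurable borel" and c: "c \<noteq> 0"
  shows "(\<integral>\<^sup>+x. f x \<partial>lborel) = ennreal (\<bar>c\<bar> ^ DIM('a)) * (\<integral>\<^sup>+x. f (t + c *\<^sub>R x) \<partial>lborel)"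
  by (subst lborel_affine[OF c, of t])
     (simp add: nn_integral_density nn_integral_distr nn_integral_cmult)

lemma integrable_lborel_affine:
  fixes t :: "'a::euclidean_space" and f :: "'a \<Rightarrow> 'b::{banach, second_countable_topology}"
  assumes f: "integrable lborel f" and c: "c \<noteq> 0"
  shows "integrable lborel (\<lambda>x. f (t + c *\<^sub>R x))"
proof -
  have [measurable]: "f \<in> borel_measurable borel"
    using borel_measurable_integrable[OF f] by simp
  have "ennreal (\<bar>c\<bar> ^ DIM('a)) * (\<integral>\<^sup>+x. norm (f (t + c *\<^sub>R x)) \<partial>lborel) < \<infinity>"
    using f by (subst nn_integral_lborel_affine[OF _ c, of _ t, symmetric]) (simp_all add: integrable_iff_bounded)
  then have "(\<integral>\<^sup>+x. norm (f (t + c *\<^sub>R x)) \<partial>lborel) < \<infinity>"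
    using c by (auto simp: ennreal_mult_less_top)
  then show ?thesis
    by (simp add: integrable_iff_bounded)
qed

lemma integrable_lborel_affine_iff:
  fixes t :: "'a::euclidean_space" and f :: "'a \<Rightarrow> 'b::{banach, second_countable_topology}"
  assumes "c \<noteq> 0"
  shows "integrable lborel (\<lambda>x. f (t + c *\<^sub>R x)) \<longleftrightarrow> integrable lborel f"
  using integrable_lborel_affine[of f c t]
    integrable_lborel_affine[of "\<lambda>x. f (t + c *\<^sub>R x)" "1/c" "-(1/c) *\<^sub>R t"] assms
  by (auto simp: algebra_simps)

lemma integral_lborel_affine:
  fixes t :: "'a::euclidean_space" and f :: "'a \<Rightarrow> 'b::{banach, second_countable_topology}"
  assumes c: "c \<noteq> 0"
  shows "(LINT x|lborel. f x) = (\<bar>c\<bar> ^ DIM('a)) *\<^sub>R (LINT x|lborel. f (t + c *\<^sub>R x))"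
proof (cases "integrable lborel f")
  case True
  note [measurable] = borel_measurable_integrable[OF True]
  have [measurable]: "f \<in> borel_measurable borel"
    using borel_measurable_integrable[OF True] by simp
  show ?thesis using c integrable_lborel_affine[OF True c, of t]
    by (subst lborel_affine[OF c, of t]) (simp add: integral_density integral_distr)
next
  case False
  then show ?thesis using c
    by (simp add: integrable_lborel_affine_iff not_integrable_integral_eq)
qed

lemma integral_lborel_shift:
  fixes t :: "'a::euclidean_space" and f :: "'a \<Rightarrow> 'b::{banach, second_countable_topology}"
  shows "(LINT x|lborel. f (x + t)) = (LINT x|lborel. f x)"
    and "(LINT x|lborel. f (x - t)) = (LINT x|lborel. f x)"
    and "(LINT x|lborel. f (t - x)) = (LINT x|lborel. f x)"
  using integral_lborel_affine[of 1 f t] integral_lborel_affine[of 1 f "-t"]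
    integral_lborel_affine[of "-1" f t]
  by (auto simp: add.commute)

lemma integrable_lborel_shift_iff:
  fixes t :: "'a::euclidean_space" and f :: "'a \<Rightarrow> 'b::{banach, second_countable_topology}"
  shows "integrable lborel (\<lambda>x. f (x + t)) \<longleftrightarrow> integrable lborel f"
    and "integrable lborel (\<lambda>x. f (x - t)) \<longleftrightarrow> integrable lborel f"
    and "integrable lborel (\<lambda>x. f (t - x)) \<longleftrightarrow> integrable lborel f"
  using integrable_lborel_affine_iff[of 1 f t] integrable_lborel_affine_iff[of 1 f "-t"]
    integrable_lborel_affine_iff[of "-1" f t]
  by (auto simp: add.commute)

text \<open>The bound \<open>w\<close> on the slice norms turns the hypothesis of Fubini's theorem
  into a pointwise estimate, the form in which convolution bounds arise. Slices in the other
  direction are integrable only almost everywhere, hence \<open>fubini_dominated_AE\<close>.\<close>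

lemma fubini_dominated:
  fixes f :: "'a::euclidean_space \<Rightarrow> 'b::euclidean_space \<Rightarrow> 'c::{banach, second_countable_topology}"
  assumes m: "(\<lambda>p. f (fst p) (snd p)) \<in> borel_measurable borel"
    and i: "\<And>x. integrable lborel (f x)"
    and w: "\<And>x. (LINT y|lborel. norm (f x y)) \<le> w x" "integrable lborel w"
  shows fubini_dominated_integrable: "integrable lborel (\<lambda>p. f (fst p) (snd p))"
    and fubini_dominated_swap: "(LINT x|lborel. LINT y|lborel. f x y) = (LINT y|lborel. LINT x|lborel. f x y)"
    and fubini_dominated_fst: "integrable lborel (\<lambda>x. LINT y|lborel. f x y)"
    and fubini_dominated_snd: "integrable lborel (\<lambda>y. LINT x|lborel. f x y)"
    and fubini_dominated_AE: "AE y in lborel. integrable lborel (\<lambda>x. f x y)"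
proof -
  have [measurable]: "(\<lambda>p. f (fst p) (snd p)) \<in> borel_measurable (borel \<Otimes>\<^sub>M borel)"
    using m by (simp add: borel_prod)
  have M: "(\<lambda>p. f (fst p) (snd p)) \<in> borel_measurable (lborel \<Otimes>\<^sub>M lborel)"
    using m by (simp add: lborel_prod)
  have M': "(\<lambda>x. LINT y|lborel. norm (f x y)) \<in> borel_measurable lborel"
    by measurable
  have "integrable lborel (\<lambda>x. LINT y|lborel. norm (f x y))"
  proof (rule Bochner_Integration.integrable_bound[OF w(2) M'], rule AE_I2)
    fix x
    show "norm (LINT y|lborel. norm (f x y)) \<le> norm (w x)"
      using w(1)[of x] by simp
  qed
  then have I: "integrable (lborel \<Otimes>\<^sub>M lborel) (\<lambda>p. f (fst p) (snd p))"
    by (intro lborel_pair.Fubini_integrable[OF M]) (auto simp: i)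
  then have I': "integrable (lborel \<Otimes>\<^sub>M lborel) (case_prod f)"
    by (simp add: case_prod_unfold)
  show "integrable lborel (\<lambda>p. f (fst p) (snd p))"
    using I by (simp add: lborel_prod)
  show "(LINT x|lborel. LINT y|lborel. f x y) = (LINT y|lborel. LINT x|lborel. f x y)"
    using lborel_pair.Fubini_integral[OF I'] by simp
  show "integrable lborel (\<lambda>x. LINT y|lborel. f x y)"
    using lborel_pair.integrable_fst'[OF I'] by simp
  show "integrable lborel (\<lambda>y. LINT x|lborel. f x y)"
    using lborel_pair.integrable_snd[OF I'] by simp
  show "AE y in lborel. integrable lborel (\<lambda>x. f x y)"
    using lborel_pair.AE_integrable_snd[OF I'] by simp
qed

lemma integrable_norm_le:
  fixes f :: "'a \<Rightarrow> 'b::{banach, second_countable_topology}"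
  assumes "integrable M g" "f \<in> borel_measurable M" "\<And>x. norm (f x) \<le> g x"
  shows "integrable M f"
proof (rule Bochner_Integration.integrable_bound[OF assms(1,2)], rule AE_I2)
  show "norm (f x) \<le> norm (g x)" for x
    using assms(3)[of x] by simp
qed

text \<open>If \<open>f\<close> is not integrable its integral is 0 by convention, and the claim
  reduces to the nonnegativity of the integral of the majorant.\<close>

lemma norm_integral_le:
  fixes f :: "'a \<Rightarrow> 'b::{banach, second_countable_topology}"
  assumes "integrable M g" "\<And>x. norm (f x) \<le> g x"
  shows "norm (integral\<^sup>L M f) \<le> integral\<^sup>L M g"
proof (cases "integrable M f")
  case True
  have "norm (integral\<^sup>L M f) \<le> (LINT x|M. norm (f x))"
    by simp
  also have "\<dots> \<le> integral\<^sup>L M g"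
    by (intro integral_mono assms integrable_norm True)
  finally show ?thesis .
next
  case False
  have "0 \<le> integral\<^sup>L M g"
    by (intro Bochner_Integration.integral_nonneg) (use assms(2) in \<open>metis norm_ge_zero order_trans\<close>)
  then show ?thesis using False by (simp add: not_integrable_integral_eq)
qed

lemma tendsto_integral_dominated:
  fixes s :: "nat \<Rightarrow> 'a \<Rightarrow> 'b::{banach, second_countable_topology}"
  assumes w: "integrable M w" and m: "\<And>n. s n \<in> borel_measurable M" "f \<in> borel_measurable M"
    and lim: "\<And>x. (\<lambda>n. s n x) \<longlonglongrightarrow> f x" and le: "\<And>n x. norm (s n x) \<le> w x"
  shows "(\<lambda>n. LINT x|M. s n x) \<longlonglongrightarrow> (LINT x|M. f x)"
  by (rule integral_dominated_convergence[OF m(2,1) w]) (use lim le in auto)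

section \<open>Cauchy-Schwarz inequalities for integrals\<close>

lemma cauchy_schwarz_integral:
  fixes f g :: "'a \<Rightarrow> real"
  assumes "integrable M (\<lambda>x. (f x)\<^sup>2)" "integrable M (\<lambda>x. (g x)\<^sup>2)" "integrable M (\<lambda>x. f x * g x)"
  shows "(LINT x|M. f x * g x)\<^sup>2 \<le> (LINT x|M. (f x)\<^sup>2) * (LINT x|M. (g x)\<^sup>2)"
proof -
  let ?a = "LINT x|M. (f x)\<^sup>2" and ?b = "LINT x|M. f x * g x" and ?c = "LINT x|M. (g x)\<^sup>2"
  have q: "0 \<le> ?a * t\<^sup>2 - 2 * ?b * t + ?c" for t
  proof -
    have "0 \<le> (LINT x|M. (t * f x - g x)\<^sup>2)" by simp
    also have "\<dots> = (LINT x|M. t\<^sup>2 * (f x)\<^sup>2 - 2 * t * (f x * g x) + (g x)\<^sup>2)"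
      by (rule Bochner_Integration.integral_cong) (auto simp: power2_eq_square algebra_simps)
    also have "\<dots> = ?a * t\<^sup>2 - 2 * ?b * t + ?c"
      using assms by simp
    finally show ?thesis .
  qed
  have a: "0 \<le> ?a" and c: "0 \<le> ?c" by auto
  show ?thesis
  proof (cases "?a = 0")
    case True
    have "?b = 0"
    proof (rule ccontr)
      assume b: "?b \<noteq> 0"
      \<comment> \<open>With \<open>?a = 0\<close> the quadratic is affine with nonzero slope; this
        argument makes its value -1.\<close>
      have "0 \<le> ?a * ((?c + 1) / (2 * ?b))\<^sup>2 - 2 * ?b * ((?c + 1) / (2 * ?b)) + ?c" by (rule q)
      also have "\<dots> = -1" using b True by simp
      finally show False by simp
    qed
    then show ?thesis using True by simp
  next
    case False
    \<comment> \<open>\<open>?b / ?a\<close> is the minimizer of the quadratic.\<close>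
    have "0 \<le> ?a * (?a * (?b / ?a)\<^sup>2 - 2 * ?b * (?b / ?a) + ?c)"
      using q[of "?b / ?a"] a by simp
    also have "\<dots> = ?a * ?c - ?b\<^sup>2"
      using False by (simp add: field_simps power2_eq_square)
    finally show ?thesis by simp
  qed
qed

text \<open>Cauchy-Schwarz for the measure with density \<open>k\<close>: the weight is split into
  two factors \<open>sqrt (k x)\<close>. This is the Schur test in the form in which kernels with an
  integrable envelope are bounded on L2.\<close>

lemma weighted_cauchy_schwarz:
  fixes k u :: "'a \<Rightarrow> real"
  assumes "integrable M k" "integrable M (\<lambda>x. k x * (u x)\<^sup>2)" "\<And>x. 0 \<le> k x"
    and [measurable]: "u \<in> borel_measurable M"
  shows "integrable M (\<lambda>x. k x * u x)"
    and "(LINT x|M. k x * u x)\<^sup>2 \<le> (LINT x|M. k x) * (LINT x|M. k x * (u x)\<^sup>2)"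
proof -
  have [measurable]: "k \<in> borel_measurable M" using assms(1) by auto
  have sq: "(sqrt (k x))\<^sup>2 = k x" "(sqrt (k x) * u x)\<^sup>2 = k x * (u x)\<^sup>2"
    "sqrt (k x) * (sqrt (k x) * u x) = k x * u x" for x
    using assms(3)[of x] by (auto simp: power_mult_distrib simp flip: mult.assoc)
  show int: "integrable M (\<lambda>x. k x * u x)"
  proof (rule integrable_norm_le)
    show "integrable M (\<lambda>x. k x + k x * (u x)\<^sup>2)"
      using assms by simp
    fix x
    have "\<bar>u x\<bar> \<le> 1 + (u x)\<^sup>2"
    proof -
      have "0 \<le> (\<bar>u x\<bar> - 1)\<^sup>2" by simp
      then have "0 \<le> (u x)\<^sup>2 - 2 * \<bar>u x\<bar> + 1" by (simp add: power2_diff)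
      then show ?thesis using zero_le_power2[of "u x"] by linarith
    qed
    then have "k x * \<bar>u x\<bar> \<le> k x * (1 + (u x)\<^sup>2)"
      using assms(3) by (intro mult_left_mono)
    then show "norm (k x * u x) \<le> k x + k x * (u x)\<^sup>2"
      using assms(3)[of x] by (simp add: abs_mult algebra_simps)
  qed simp
  show "(LINT x|M. k x * u x)\<^sup>2 \<le> (LINT x|M. k x) * (LINT x|M. k x * (u x)\<^sup>2)"
    using cauchy_schwarz_integral[of M "\<lambda>x. sqrt (k x)" "\<lambda>x. sqrt (k x) * u x"] assms int
    by (simp add: sq)
qed

text \<open>Compactness of one closed ball, rescaled. The order of the quantifiers matters:
  \<open>Y\<close> is fixed before \<open>N\<close>, so the number of covering balls stays bounded
  as the scale grows.\<close>

lemma ball_cover_scaled: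
  "\<exists>Y :: 'a::euclidean_space set. finite Y \<and>
     (\<forall>w N. 0 < N \<longrightarrow> ball w (R * N) \<subseteq> (\<Union>y\<in>Y. ball (w + N *\<^sub>R y) N))"
proof -
  have "cball (0::'a) R \<subseteq> (\<Union>y\<in>UNIV. ball y 1)"
  proof
    fix x :: 'a
    have "x \<in> ball x 1" by simp
    then show "x \<in> (\<Union>y\<in>UNIV. ball y 1)" by (rule UN_I[OF UNIV_I])
  qed
  then obtain Y where Y: "finite Y" "cball (0::'a) R \<subseteq> (\<Union>y\<in>Y. ball y 1)"
    by (rule compactE_image[OF compact_cball open_ball])
  have "ball w (R * N) \<subseteq> (\<Union>y\<in>Y. ball (w + N *\<^sub>R y) N)" if "0 < N" for w N
  proof
    fix z assume "z \<in> ball w (R * N)"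
    then have "norm (z - w) \<le> R * N"
      unfolding mem_ball dist_norm norm_minus_commute[of z w] by (rule less_imp_le)
    then have "norm ((1 / N) *\<^sub>R (z - w)) \<le> R"
      using that by (simp add: divide_le_eq)
    then have "(1 / N) *\<^sub>R (z - w) \<in> (\<Union>y\<in>Y. ball y 1)"
      using Y(2) unfolding subset_iff mem_cball dist_0_norm by blast
    then obtain y where y: "y \<in> Y" "norm (y - (1 / N) *\<^sub>R (z - w)) < 1"
      unfolding UN_iff mem_ball dist_norm by blast
    have "w + N *\<^sub>R y - z = N *\<^sub>R (y - (1 / N) *\<^sub>R (z - w))"
      using that by (simp add: scaleR_diff_right)
    then have "norm (w + N *\<^sub>R y - z) = N * norm (y - (1 / N) *\<^sub>R (z - w))"
      using that by simp
    also have "\<dots> < N"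
      using y(2) that by simp
    finally show "z \<in> (\<Union>y\<in>Y. ball (w + N *\<^sub>R y) N)"
      using y(1) by (auto simp: dist_norm)
  qed
  then show ?thesis using Y(1) by blast
qed

text \<open>The shell of points with norm between \<open>n\<close> and \<open>n + 1\<close> lies in
  a ball of measure proportional to \<open>(1 + n) ^ DIM('a)\<close>; the exponent
  \<open>DIM('a) + 2\<close> leaves the convergent series of \<open>1 / (1 + n) ^ 2\<close>.\<close>

lemma integrable_inverse_power_norm:
  "integrable lborel (\<lambda>x::'a::euclidean_space. 1 / (1 + norm x) ^ (DIM('a) + 2))"
proof -
  let ?D = "DIM('a)" and ?M = "DIM('a) + 2"
  let ?\<omega> = "measure lborel (ball (0::'a) 1)"
  have em: "emeasure lborel (ball (0::'a) r) = ennreal (r ^ ?D * ?\<omega>)" if "0 \<le> r" for r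
    using content_ball_conv_unit_ball[OF that, of "0::'a"] emeasure_lborel_ball_finite[of "0::'a" r]
    by (simp add: emeasure_eq_ennreal_measure)
  have "(\<integral>\<^sup>+x. ennreal (1 / (1 + norm (x::'a)) ^ ?M) \<partial>lborel)
     \<le> (\<integral>\<^sup>+x. (\<Sum>n. ennreal (1 / (1 + real n) ^ ?M) * indicator (ball 0 (1 + real n)) (x::'a)) \<partial>lborel)"
  proof (rule nn_integral_mono)
    fix x :: 'a
    define n where "n = nat \<lfloor>norm x\<rfloor>"
    have n: "real n \<le> norm x" "norm x < 1 + real n"
      unfolding n_def using norm_ge_zero[of x] by (simp_all add: of_nat_nat, linarith+)
    have "ennreal (1 / (1 + norm x) ^ ?M) \<le> ennreal (1 / (1 + real n) ^ ?M)"
      using n by (intro ennreal_leI divide_left_mono power_mono) auto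
    also have "\<dots> = (\<Sum>k\<in>{n}. ennreal (1 / (1 + real k) ^ ?M) * indicator (ball 0 (1 + real k)) x)"
      using n by simp
    also have "\<dots> \<le> (\<Sum>k. ennreal (1 / (1 + real k) ^ ?M) * indicator (ball 0 (1 + real k)) x)"
      by (rule sum_le_suminf) auto
    finally show "ennreal (1 / (1 + norm x) ^ ?M)
      \<le> (\<Sum>k. ennreal (1 / (1 + real k) ^ ?M) * indicator (ball 0 (1 + real k)) x)" .
  qed
  also have "\<dots> = (\<Sum>n. ennreal (1 / (1 + real n) ^ ?M) * emeasure lborel (ball (0::'a) (1 + real n)))"
  proof (subst nn_integral_suminf)
    show "(\<Sum>i. \<integral>\<^sup>+x. ennreal (1 / (1 + real i) ^ ?M) * indicator (ball 0 (1 + real i)) (x::'a) \<partial>lborel)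
      = (\<Sum>n. ennreal (1 / (1 + real n) ^ ?M) * emeasure lborel (ball (0::'a) (1 + real n)))"
      by (intro suminf_cong nn_integral_cmult_indicator) simp
  qed (intro borel_measurable_times_ennreal borel_measurable_indicator borel_measurable_const; simp)
  also have "\<dots> = (\<Sum>n. ennreal (?\<omega> * (1 / (1 + real n) ^ 2)))"
  proof (rule suminf_cong)
    fix n
    show "ennreal (1 / (1 + real n) ^ ?M) * emeasure lborel (ball (0::'a) (1 + real n))
      = ennreal (?\<omega> * (1 / (1 + real n) ^ 2))"
    proof -
      define a where "a = 1 + real n"
      have "a \<noteq> 0" by (simp add: a_def add_nonneg_eq_0_iff)
      then have "1 / a ^ ?M * (a ^ ?D * ?\<omega>) = ?\<omega> * (1 / a ^ 2)"
        by (simp add: power_add power2_eq_square)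
      moreover have "0 \<le> 1 / a ^ ?M" by (simp add: a_def)
      ultimately show ?thesis
        using em[of a] by (simp add: a_def ennreal_mult'[symmetric] del: power_Suc power_add add_2_eq_Suc add_2_eq_Suc')
    qed
  qed
  also have "\<dots> < \<infinity>"
  proof -
    have "summable (\<lambda>n. 1 / (real n) ^ 2)"
      using inverse_power_summable[of 2, where 'a=real] by (simp add: inverse_eq_divide)
    then have "summable (\<lambda>n. 1 / (1 + real n) ^ 2)"
      by (subst (asm) summable_Suc_iff[symmetric]) (simp add: add.commute)
    then have "summable (\<lambda>n. ?\<omega> * (1 / (1 + real n) ^ 2))"
      by (rule summable_mult)
    then show ?thesis
      by (subst suminf_ennreal2) (auto simp: measure_nonneg)
  qed
  finally show ?thesis
    by (intro integrableI_bounded) auto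
qed

lemma integrable_decay:
  fixes f :: "'a::euclidean_space \<Rightarrow> 'b::{banach, second_countable_topology}"
  assumes "f \<in> borel_measurable borel" "\<And>x. norm (f x) \<le> C / (1 + norm x) ^ (DIM('a) + 2)"
  shows "integrable lborel f"
proof (rule integrable_norm_le)
  show "integrable lborel (\<lambda>x::'a. C * (1 / (1 + norm x) ^ (DIM('a) + 2)))"
    by (intro integrable_mult_right integrable_inverse_power_norm)
qed (use assms in auto)

text \<open>Each value \<open>g l\<close> is averaged over the unit ball about \<open>l\<close>, on
  which \<open>f\<close> dominates it. A point \<open>z\<close> lies in at most \<open>N\<close> of
  these balls, so the sum of the integrals is at most \<open>N\<close> times the integral of
  \<open>f\<close>.\<close>

lemma relatively_separated_sum_le:
  fixes \<Lambda> :: "'a::euclidean_space set"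
  assumes \<Lambda>: "\<And>x. finite (\<Lambda> \<inter> ball x 1) \<and> card (\<Lambda> \<inter> ball x 1) \<le> N"
    and F: "finite F" "F \<subseteq> \<Lambda>"
    and f: "integrable lborel f" "\<And>z. 0 \<le> f z"
    and g: "\<And>l z. l \<in> F \<Longrightarrow> dist l z < 1 \<Longrightarrow> g l \<le> f z"
  shows "(\<Sum>l\<in>F. g l) \<le> real N / measure lborel (ball (0::'a) 1) * (LINT z|lborel. f z)"
proof -
  let ?\<omega> = "measure lborel (ball (0::'a) 1)"
  have \<omega>: "0 < ?\<omega>" by (rule content_ball_pos) simp
  have mb: "(LINT z|lborel. indicator (ball l 1) z * g l) = g l * ?\<omega>" for l :: 'a
    using content_ball_conv_unit_ball[of 1 l] by simp
  have int: "integrable lborel (\<lambda>z. indicator (ball l 1) z * g l)" for l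
    using emeasure_lborel_ball_finite[of l 1] by (intro integrable_mult_left) auto
  have "(\<Sum>l\<in>F. g l) * ?\<omega> = (\<Sum>l\<in>F. (LINT z|lborel. indicator (ball l 1) z * g l))"
    by (simp only: mb sum_distrib_right)
  also have "\<dots> = (LINT z|lborel. (\<Sum>l\<in>F. indicator (ball l 1) z * g l))"
    using int by (subst Bochner_Integration.integral_sum) auto
  also have "\<dots> \<le> (LINT z|lborel. real N * f z)"
  proof (rule integral_mono)
    fix z
    have "(\<Sum>l\<in>F. indicator (ball l 1) z * g l) \<le> (\<Sum>l\<in>F. if l \<in> ball z 1 then f z else 0)"
    proof (rule sum_mono)
      fix l assume "l \<in> F"
      then show "indicator (ball l 1) z * g l \<le> (if l \<in> ball z 1 then f z else 0)"
        using g[of l z] by (cases "dist l z < 1") (simp_all add: dist_commute)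
    qed
    also have "\<dots> = (\<Sum>l\<in>F \<inter> ball z 1. f z)"
      by (rule sum.inter_restrict[OF F(1), symmetric])
    also have "\<dots> = real (card (F \<inter> ball z 1)) * f z" by simp
    also have "\<dots> \<le> real N * f z"
    proof (rule mult_right_mono[OF _ f(2)])
      have "card (F \<inter> ball z 1) \<le> card (\<Lambda> \<inter> ball z 1)"
        using \<Lambda>[of z] F(2) by (intro card_mono) auto
      then show "real (card (F \<inter> ball z 1)) \<le> real N" using \<Lambda>[of z] by linarith
    qed
    finally show "(\<Sum>l\<in>F. indicator (ball l 1) z * g l) \<le> real N * f z" .
  qed (use f int in auto)
  finally show ?thesis using \<omega> by (simp add: field_simps)
qed

section \<open>Weak limits of point sets\<close>

text \<open>Nonempty and bounded sets have some admissible radius, so an infimum below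
  \<open>e\<close> is witnessed by a radius below \<open>e\<close>; the infimum of an empty set of
  radii would carry no information.\<close>

lemma hausdorff_distance_lessD:
  assumes "hausdorff_distance X Y < e" "X \<noteq> {}" "Y \<noteq> {}" "bounded X" "bounded Y"
  shows "\<And>x. x \<in> X \<Longrightarrow> \<exists>y\<in>Y. dist x y < e" and "\<And>y. y \<in> Y \<Longrightarrow> \<exists>x\<in>X. dist x y < e"
proof -
  let ?D = "{\<epsilon>. 0 < \<epsilon> \<and> X \<subseteq> Y + ball 0 \<epsilon> \<and> Y \<subseteq> X + ball 0 \<epsilon>}"
  have mem: "x \<in> A + ball 0 r \<longleftrightarrow> (\<exists>a\<in>A. dist x a < r)" for x :: 'a and A r
  proof
    assume "x \<in> A + ball 0 r"
    then obtain a b where "a \<in> A" "b \<in> ball 0 r" "x = a + b" by (rule set_plus_elim)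
    then show "\<exists>a\<in>A. dist x a < r" by (intro bexI[of _ a]) (auto simp: dist_norm)
  next
    assume "\<exists>a\<in>A. dist x a < r"
    then obtain a where "a \<in> A" "dist x a < r" by blast
    then have "a + (x - a) \<in> A + ball 0 r"
      by (intro set_plus_intro) (auto simp: dist_norm norm_minus_commute)
    then show "x \<in> A + ball 0 r" by simp
  qed
  obtain r where r: "\<And>x y. x \<in> X \<Longrightarrow> y \<in> Y \<Longrightarrow> dist x y \<le> r"
    using bounded_two_points[of "X \<union> Y"] assms(4,5) by (meson UnI1 UnI2 bounded_Un)
  have "?D \<noteq> {}"
  proof -
    obtain x0 y0 where "x0 \<in> X" "y0 \<in> Y" using assms by blast
    have "\<exists>a\<in>Y. dist x a < \<bar>r\<bar> + 1" if "x \<in> X" for x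
      using r[OF that \<open>y0 \<in> Y\<close>] \<open>y0 \<in> Y\<close> by (intro bexI[of _ y0]) auto
    moreover have "\<exists>a\<in>X. dist y a < \<bar>r\<bar> + 1" if "y \<in> Y" for y
      using r[OF \<open>x0 \<in> X\<close> that] \<open>x0 \<in> X\<close> by (intro bexI[of _ x0]) (auto simp: dist_commute)
    ultimately have "\<bar>r\<bar> + 1 \<in> ?D"
      unfolding mem_Collect_eq subset_iff mem by auto
    then show ?thesis by blast
  qed
  then obtain d where d: "d \<in> ?D" "d < e"
    using assms(1) unfolding hausdorff_distance_def by (meson cInf_lessD)
  then show "\<And>x. x \<in> X \<Longrightarrow> \<exists>y\<in>Y. dist x y < e" "\<And>y. y \<in> Y \<Longrightarrow> \<exists>x\<in>X. dist x y < e"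
    unfolding mem_Collect_eq subset_iff mem by (meson order.strict_trans dist_commute_lessI)+
qed

lemma hausdorff_distance_le:
  assumes "0 < e" "\<And>x. x \<in> X \<Longrightarrow> \<exists>y\<in>Y. dist x y < e" "\<And>y. y \<in> Y \<Longrightarrow> \<exists>x\<in>X. dist x y < e"
  shows "0 \<le> hausdorff_distance X Y" "hausdorff_distance X Y \<le> e"
proof -
  let ?D = "{\<epsilon>. 0 < \<epsilon> \<and> X \<subseteq> Y + ball 0 \<epsilon> \<and> Y \<subseteq> X + ball 0 \<epsilon>}"
  have mem: "x \<in> A + ball 0 r" if "a \<in> A" "dist x a < r" for x a :: 'a and A r
  proof -
    have "a + (x - a) \<in> A + ball 0 r"
      using that by (intro set_plus_intro) (auto simp: dist_norm norm_minus_commute)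
    then show ?thesis by simp
  qed
  have D: "e \<in> ?D"
    using assms mem by (simp add: subset_iff) (metis dist_commute)
  have "bdd_below ?D" by (rule bdd_belowI[of _ 0]) auto
  with D show "hausdorff_distance X Y \<le> e"
    unfolding hausdorff_distance_def by (intro cInf_lower)
  show "0 \<le> hausdorff_distance X Y"
    unfolding hausdorff_distance_def using D by (intro cInf_greatest) (blast, auto)
qed

text \<open>The adjoined sphere could serve as a spurious partner of a point. The ball is therefore
  taken with radius \<open>\<bar>R\<bar> + 2\<close> and the tolerance is capped at 1: a point of
  \<open>cball w R\<close>, or the center \<open>\<gamma>\<close> itself, is then too far from the
  sphere.\<close>

lemma weakly_converges_eventually_near:
  fixes \<Gamma> :: "'a::euclidean_space set"
  assumes S: "weakly_converges S \<Gamma>" and e: "0 < e"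
  shows "\<forall>\<^sub>F n in sequentially. \<forall>l\<in>S n \<inter> cball w R. \<exists>\<gamma>\<in>\<Gamma>. dist l \<gamma> < e"
    and "\<gamma> \<in> \<Gamma> \<Longrightarrow> \<forall>\<^sub>F n in sequentially. \<exists>l\<in>S n. dist l \<gamma> < e"
proof -
  let ?r = "\<bar>R\<bar> + 2"
  let ?B = "\<lambda>A z. (A \<inter> cball z ?r) \<union> frontier (cball z ?r)"
  define d where "d = min e 1"
  have fr: "frontier (cball z ?r) \<noteq> {}" for z :: 'a
    by (simp add: frontier_cball)
  have bd: "bounded (?B A z)" for A and z :: 'a
    by (simp add: frontier_cball bounded_Int)
  have ev: "\<forall>\<^sub>F n in sequentially. hausdorff_distance (?B (S n) z) (?B \<Gamma> z) < d" for z
  proof -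
    have "(\<lambda>n. hausdorff_distance (?B (S n) z) (?B \<Gamma> z)) \<longlonglongrightarrow> 0"
      using S unfolding weakly_converges_def by simp
    then show ?thesis
      by (rule order_tendstoD(2)) (use e in \<open>simp add: d_def\<close>)
  qed
  show "\<forall>\<^sub>F n in sequentially. \<forall>l\<in>S n \<inter> cball w R. \<exists>\<gamma>\<in>\<Gamma>. dist l \<gamma> < e"
    using ev[of w]
  proof eventually_elim
    case (elim n)
    show ?case
    proof
      fix l assume l: "l \<in> S n \<inter> cball w R"
      then have "l \<in> ?B (S n) w" by auto
      from hausdorff_distance_lessD(1)[OF elim _ _ bd bd this]
      obtain y where y: "y \<in> ?B \<Gamma> w" "dist l y < d" using fr by blast
      have "y \<notin> frontier (cball w ?r)"
      proof
        assume "y \<in> frontier (cball w ?r)"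
        then have "dist w y = ?r" by (simp add: frontier_cball)
        moreover have "dist w y \<le> dist w l + dist l y" by (rule dist_triangle)
        ultimately show False using l y(2) by (auto simp: d_def)
      qed
      then show "\<exists>\<gamma>\<in>\<Gamma>. dist l \<gamma> < e" using y by (auto simp: d_def)
    qed
  qed
  show "\<forall>\<^sub>F n in sequentially. \<exists>l\<in>S n. dist l \<gamma> < e" if \<gamma>: "\<gamma> \<in> \<Gamma>"
    using ev[of \<gamma>]
  proof eventually_elim
    case (elim n)
    have "\<gamma> \<in> ?B \<Gamma> \<gamma>" using \<gamma> by auto
    from hausdorff_distance_lessD(2)[OF elim _ _ bd bd this]
    obtain x where x: "x \<in> ?B (S n) \<gamma>" "dist x \<gamma> < d" using fr by blast
    have "x \<notin> frontier (cball \<gamma> ?r)"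
      using x(2) by (auto simp: frontier_cball d_def dist_commute)
    then show ?case using x by (auto simp: d_def)
  qed
qed

text \<open>When the partner of a point falls outside the ball, the segment to it crosses the
  sphere, and the crossing point replaces the partner at no greater distance. This is the purpose of
  adjoining the sphere in the definition of weak convergence.\<close>

lemma frontier_point_near:
  fixes x y z :: "'a::euclidean_space"
  assumes "x \<in> cball z R" "y \<notin> cball z R"
  shows "\<exists>p\<in>frontier (cball z R). dist x p \<le> dist x y"
proof -
  have "closed_segment x y \<inter> frontier (cball z R) \<noteq> {}"
    using assms by (intro connected_Int_frontier) (auto intro!: exI[of _ x] exI[of _ y])
  then obtain p where p: "p \<in> closed_segment x y" "p \<in> frontier (cball z R)" by blast
  then show ?thesis using dist_in_closed_segment[OF p(1)] by (auto simp: dist_commute)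
qed

text \<open>A diagonal extraction over a countable basis makes it eventually constant whether the
  sets meet a given basic open set. The limit consists of the points all of whose basic
  neighbourhoods are eventually met; compactness of balls upgrades this to convergence in the
  Hausdorff distance.\<close>

lemma weakly_convergent_subsequence:
  fixes S :: "nat \<Rightarrow> 'a::euclidean_space set"
  obtains k \<Gamma> where "strict_mono (k :: nat \<Rightarrow> nat)" "weakly_converges (\<lambda>n. S (k n)) \<Gamma>"
proof -
  obtain \<B> :: "'a set set" where \<B>: "countable \<B>" "topological_basis \<B>"
    using ex_countable_basis by blast
  \<comment> \<open>The event that a set meets \<open>B\<close> is encoded as a number 0 or 1, so
    that convergence of the sequence decides the event eventually.\<close>
  obtain k where k: "strict_mono (k :: nat \<Rightarrow> nat)"
    "\<And>B. B \<in> \<B> \<Longrightarrow> \<exists>l. (\<lambda>n. of_bool (S (k n) \<inter> B \<noteq> {}) :: real) \<longlonglongrightarrow> l"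
    using function_convergent_subsequence[OF \<B>(1), of "\<lambda>n B. of_bool (S n \<inter> B \<noteq> {}) :: real" 1]
    by auto
  define hit where "hit B \<longleftrightarrow> (\<forall>\<^sub>F n in sequentially. S (k n) \<inter> B \<noteq> {})" for B
  have nohit: "\<forall>\<^sub>F n in sequentially. S (k n) \<inter> B = {}" if B: "B \<in> \<B>" "\<not> hit B" for B
  proof -
    obtain l :: real where l: "(\<lambda>n. of_bool (S (k n) \<inter> B \<noteq> {}) :: real) \<longlonglongrightarrow> l"
      using k(2)[OF B(1)] by blast
    show ?thesis
    proof (cases "l > 0")
      case True
      have "hit B"
        unfolding hit_def using order_tendstoD(1)[OF l True]
        by eventually_elim (auto split: if_splits)
      then show ?thesis using B by blast
    next
      case False
      then have "l < 1" by simp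
      from order_tendstoD(2)[OF l this] show ?thesis
        by eventually_elim (auto split: if_splits)
    qed
  qed
  define \<Gamma> where "\<Gamma> = {x. \<forall>B\<in>\<B>. x \<in> B \<longrightarrow> hit B}"
  have near: "\<forall>\<^sub>F n in sequentially. (\<forall>x\<in>S (k n) \<inter> cball z R. \<exists>\<gamma>\<in>\<Gamma>. dist x \<gamma> < e) \<and>
      (\<forall>\<gamma>\<in>\<Gamma> \<inter> cball z R. \<exists>x\<in>S (k n). dist x \<gamma> < e)" if e: "0 < e" for e R z
  proof -
    \<comment> \<open>Outside \<open>\<Gamma>\<close> the small neighbourhood must also fail to be
      hit. Shrinking preserves this, since meeting a smaller set implies meeting the larger
      one.\<close>
    have "\<exists>B\<in>\<B>. x \<in> B \<and> B \<subseteq> ball x (e/2) \<and> (x \<notin> \<Gamma> \<longrightarrow> \<not> hit B)" for x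
    proof (cases "x \<in> \<Gamma>")
      case True
      then show ?thesis
        using topological_basisE[OF \<B>(2), of "ball x (e/2)" x] e by (metis centre_in_ball half_gt_zero open_ball)
    next
      case False
      then obtain B where B: "B \<in> \<B>" "x \<in> B" "\<not> hit B" unfolding \<Gamma>_def by blast
      have "open (B \<inter> ball x (e/2))"
        using topological_basis_open[OF \<B>(2) B(1)] by blast
      then obtain B' where B': "B' \<in> \<B>" "x \<in> B'" "B' \<subseteq> B \<inter> ball x (e/2)"
        using topological_basisE[OF \<B>(2), of "B \<inter> ball x (e/2)" x] B(2) e by force
      have "\<not> hit B'"
      proof
        assume "hit B'"
        then have "hit B"
          unfolding hit_def by (rule eventually_mono) (use B'(3) in blast)
        with B(3) show False ..
      qed
      then show ?thesis using B' by blast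
    qed
    then obtain b where b: "\<And>x. b x \<in> \<B>" "\<And>x. x \<in> b x" "\<And>x. b x \<subseteq> ball x (e/2)"
      "\<And>x. x \<notin> \<Gamma> \<Longrightarrow> \<not> hit (b x)"
      by metis
    have "cball z R \<subseteq> (\<Union>x\<in>cball z R. b x)"
      using b(2) by blast
    then obtain X where X: "finite X" "X \<subseteq> cball z R" "cball z R \<subseteq> (\<Union>x\<in>X. b x)"
      using compactE_image[OF compact_cball, of "cball z R" b z R] topological_basis_open[OF \<B>(2) b(1)]
      by metis
    have "\<forall>\<^sub>F n in sequentially. \<forall>x\<in>X. S (k n) \<inter> b x \<noteq> {} \<longleftrightarrow> hit (b x)"
    proof (rule eventually_ball_finite[OF X(1)], rule ballI)
      fix x
      show "\<forall>\<^sub>F n in sequentially. S (k n) \<inter> b x \<noteq> {} \<longleftrightarrow> hit (b x)"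
      proof (cases "hit (b x)")
        case True
        then have "\<forall>\<^sub>F n in sequentially. S (k n) \<inter> b x \<noteq> {}" by (simp add: hit_def)
        then show ?thesis by eventually_elim (simp add: True)
      next
        case False
        from nohit[OF b(1) this] show ?thesis by eventually_elim (simp add: False)
      qed
    qed
    then show ?thesis
    proof eventually_elim
      case (elim n)
      show ?case
      proof (intro conjI ballI)
        fix x assume x: "x \<in> S (k n) \<inter> cball z R"
        then obtain y where y: "y \<in> X" "x \<in> b y" using X(3) by blast
        then have "hit (b y)" using elim x by blast
        then have "y \<in> \<Gamma>" using b(4) by blast
        moreover have "dist x y < e" using b(3)[of y] y(2) e by (auto simp: dist_commute)
        ultimately show "\<exists>\<gamma>\<in>\<Gamma>. dist x \<gamma> < e" by blast
      next
        fix \<gamma> assume \<gamma>: "\<gamma> \<in> \<Gamma> \<inter> cball z R"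
        then obtain y where y: "y \<in> X" "\<gamma> \<in> b y" using X(3) by blast
        then have "hit (b y)" using \<gamma> b(1) unfolding \<Gamma>_def by blast
        then obtain x where x: "x \<in> S (k n)" "x \<in> b y" using elim y by blast
        have "dist x \<gamma> \<le> dist x y + dist \<gamma> y" by (rule dist_triangle2)
        also have "\<dots> < e"
        proof -
          have "x \<in> ball y (e/2)" "\<gamma> \<in> ball y (e/2)" using b(3)[of y] x(2) y(2) by blast+
          then show ?thesis by (simp add: dist_commute)
        qed
        finally show "\<exists>x\<in>S (k n). dist x \<gamma> < e" using x by blast
      qed
    qed
  qed
  have "weakly_converges (\<lambda>n. S (k n)) \<Gamma>"
    unfolding weakly_converges_def
  proof (intro allI impI tendstoI)
    fix z :: 'a and R e :: real assume R: "0 < R" and e: "0 < e"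
    let ?F = "frontier (cball z R)"
    have e2: "0 < e/2" using e by simp
    show "\<forall>\<^sub>F n in sequentially. dist (hausdorff_distance (S (k n) \<inter> cball z R \<union> ?F) (\<Gamma> \<inter> cball z R \<union> ?F)) 0 < e"
      using near[OF e2, of z R]
    proof eventually_elim
      case (elim n)
      have aux: "\<exists>y\<in>B \<inter> cball z R \<union> ?F. dist x y < e/2"
        if xA: "x \<in> A \<inter> cball z R \<union> ?F" "\<And>x. x \<in> A \<inter> cball z R \<Longrightarrow> \<exists>y\<in>B. dist x y < e/2" for x A B
      proof (cases "x \<in> ?F")
        case True
        then show ?thesis using e by (intro bexI[of _ x]) auto
      next
        case False
        then have x: "x \<in> A \<inter> cball z R" using xA by blast
        then obtain y where y: "y \<in> B" "dist x y < e/2" using xA(2) by blast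
        show ?thesis
        proof (cases "y \<in> cball z R")
          case True
          then show ?thesis using y by blast
        next
          case False
          then obtain p where "p \<in> ?F" "dist x p \<le> dist x y"
            using frontier_point_near[of x z R y] x by blast
          then show ?thesis using y(2) by (intro bexI[of _ p]) auto
        qed
      qed
      have 1: "\<exists>y\<in>\<Gamma> \<inter> cball z R \<union> ?F. dist x y < e/2" if "x \<in> S (k n) \<inter> cball z R \<union> ?F" for x
        by (rule aux[OF that]) (use elim in auto)
      have 2: "\<exists>x\<in>S (k n) \<inter> cball z R \<union> ?F. dist x y < e/2" if "y \<in> \<Gamma> \<inter> cball z R \<union> ?F" for y
      proof -
        have "\<exists>x\<in>S (k n). dist y x < e/2" if "y \<in> \<Gamma> \<inter> cball z R" for y
          using elim that by (metis dist_commute)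
        from aux[OF that this] show ?thesis by (metis dist_commute)
      qed
      show ?case
        using hausdorff_distance_le[OF e2 1 2] e by (simp add: dist_real_def)
    qed
  qed
  with k(1) show ?thesis by (rule that)
qed

lemma relatively_separated_ball_card:
  fixes \<Lambda> :: "'a::euclidean_space set"
  assumes "\<And>x. finite (\<Lambda> \<inter> ball x 1) \<and> card (\<Lambda> \<inter> ball x 1) \<le> N"
  shows "\<exists>N'. \<forall>x. finite (\<Lambda> \<inter> ball x r) \<and> card (\<Lambda> \<inter> ball x r) \<le> N'"
proof -
  obtain Y where Y: "finite Y" "\<And>w. ball w (r * 1) \<subseteq> (\<Union>y\<in>Y. ball (w + 1 *\<^sub>R y :: 'a) 1)"
    using ball_cover_scaled[of r, where 'a='a] by (metis zero_less_one)
  have "finite (\<Lambda> \<inter> ball x r) \<and> card (\<Lambda> \<inter> ball x r) \<le> card Y * N" for x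
  proof -
    have sub: "\<Lambda> \<inter> ball x r \<subseteq> (\<Union>y\<in>Y. \<Lambda> \<inter> ball (x + y) 1)"
      using Y(2)[of x] by auto
    have fin: "finite (\<Union>y\<in>Y. \<Lambda> \<inter> ball (x + y) 1)"
      using Y(1) assms by blast
    have "card (\<Lambda> \<inter> ball x r) \<le> card (\<Union>y\<in>Y. \<Lambda> \<inter> ball (x + y) 1)"
      by (rule card_mono[OF fin sub])
    also have "\<dots> \<le> (\<Sum>y\<in>Y. card (\<Lambda> \<inter> ball (x + y) 1))"
      by (rule card_UN_le[OF Y(1)])
    also have "\<dots> \<le> (\<Sum>y\<in>Y. N)"
      by (rule sum_mono) (use assms in blast)
    finally show ?thesis using finite_subset[OF sub fin] by simp
  qed
  then show ?thesis by blast
qed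

lemma relatively_separated_shift:
  fixes \<Lambda> :: "'a::euclidean_space set"
  assumes "\<And>x. finite (\<Lambda> \<inter> ball x r) \<and> card (\<Lambda> \<inter> ball x r) \<le> N"
  shows "finite ((\<lambda>x. x + a) ` \<Lambda> \<inter> ball x r) \<and> card ((\<lambda>x. x + a) ` \<Lambda> \<inter> ball x r) \<le> N"
proof -
  have "(\<lambda>x. x + a) ` \<Lambda> \<inter> ball x r = (\<lambda>x. x + a) ` (\<Lambda> \<inter> ball (x - a) r)"
    by (auto simp: dist_norm algebra_simps)
  then show ?thesis
    using assms[of "x - a"] by (simp add: card_image)
qed

section \<open>Localized kernels\<close>

definition square_integrable :: "('a::euclidean_space \<Rightarrow> complex) \<Rightarrow> bool" where
  "square_integrable U \<longleftrightarrow> U \<in> borel_measurable borel \<and> integrable lborel (\<lambda>u. (norm (U u))\<^sup>2)"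

definition kernel_apply :: "('a::euclidean_space \<Rightarrow> 'a \<Rightarrow> complex) \<Rightarrow> ('a \<Rightarrow> complex) \<Rightarrow> 'a \<Rightarrow> complex" where
  "kernel_apply K U z = (LINT w|lborel. K z w * U w)"

text \<open>The value is 1 up to distance \<open>N\<close> and 0 beyond \<open>2 * N\<close>, with
  Lipschitz constant \<open>1 / N\<close>; over a fixed distance it varies little once
  \<open>N\<close> is large.\<close>

definition cutoff :: "real \<Rightarrow> 'a::euclidean_space \<Rightarrow> 'a \<Rightarrow> real" where
  "cutoff N w z = max 0 (min 1 (2 - dist z w / N))"

lemma cutoff_bounds: "0 \<le> cutoff N w z" "cutoff N w z \<le> 1"
  by (auto simp: cutoff_def)

lemma cutoff_eq_1: "0 < N \<Longrightarrow> dist z w \<le> N \<Longrightarrow> cutoff N w z = 1"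
  by (simp add: cutoff_def field_simps)

lemma cutoff_eq_0: "0 < N \<Longrightarrow> 2 * N \<le> dist z w \<Longrightarrow> cutoff N w z = 0"
  by (simp add: cutoff_def field_simps)

lemma cutoff_diff_le: "0 < N \<Longrightarrow> \<bar>cutoff N w z - cutoff N w u\<bar> \<le> min 1 (dist z u / N)"
proof -
  assume N: "0 < N"
  have "\<bar>cutoff N w z - cutoff N w u\<bar> \<le> \<bar>(2 - dist z w / N) - (2 - dist u w / N)\<bar>"
    unfolding cutoff_def by linarith
  also have "\<dots> = \<bar>dist u w - dist z w\<bar> / N"
    using N by (simp add: diff_divide_distrib[symmetric])
  also have "\<dots> \<le> dist z u / N"
    using N dist_triangle[of u w z] dist_triangle[of z w u]
    by (intro divide_right_mono) (auto simp: dist_commute)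
  finally have "\<bar>cutoff N w z - cutoff N w u\<bar> \<le> dist z u / N" .
  moreover have "\<bar>cutoff N w z - cutoff N w u\<bar> \<le> 1"
    using cutoff_bounds[of N w z] cutoff_bounds[of N w u] by linarith
  ultimately show ?thesis by simp
qed

lemma cutoff_measurable [measurable]: "cutoff N w \<in> borel_measurable borel"
  unfolding cutoff_def by measurable

text \<open>\<open>\<Theta> v\<close> dominates the kernel at all displacements within distance 1 of
  \<open>v\<close>, so that values at single points are controlled by integrals. Integrability of
  \<open>\<Theta>\<close> gives the Schur bounds, its boundedness the estimate of the supremum by
  the L2 norm. The unimodular phases \<open>\<kappa>\<close> describe how the kernel changes when
  both arguments are translated.\<close>

locale localized_kernel =
  fixes K :: "'a::euclidean_space \<Rightarrow> 'a \<Rightarrow> complex" and \<Theta> :: "'a \<Rightarrow> real" and B :: real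
    and \<kappa> :: "'a \<Rightarrow> 'a \<Rightarrow> complex"
  assumes continuous: "continuous_on UNIV (\<lambda>p. K (fst p) (snd p))"
    and envelope_integrable: "integrable lborel \<Theta>"
    and envelope_bounded: "\<Theta> v \<le> B"
    and envelope: "dist v (z - w) \<le> 1 \<Longrightarrow> norm (K z w) \<le> \<Theta> v"
    and phase_norm: "norm (\<kappa> a z) = 1"
    and phase_measurable: "\<kappa> a \<in> borel_measurable borel"
    and covariant: "K (z + a) (w + a) = \<kappa> a z * cnj (\<kappa> a w) * K z w"
begin

definition mass :: real where "mass = (LINT v|lborel. \<Theta> v)"

lemma envelope_nonneg: "0 \<le> \<Theta> v"
  using order_trans[OF norm_ge_zero envelope[of v v 0]] by simp

lemma mass_nonneg: "0 \<le> mass"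
  unfolding mass_def by (simp add: envelope_nonneg)

lemma envelope_measurable [measurable]: "\<Theta> \<in> borel_measurable borel"
  using envelope_integrable by (simp add: borel_measurable_integrable)

lemma kernel_pair_measurable: "(\<lambda>p. K (fst p) (snd p)) \<in> borel_measurable borel"
  using continuous by (rule borel_measurable_continuous_onI)

lemma kernel_measurable2 [measurable]: "(\<lambda>(z, w). K z w) \<in> borel_measurable (borel \<Otimes>\<^sub>M borel)"
  using kernel_pair_measurable by (simp add: borel_prod case_prod_unfold)

lemma kernel_measurable [measurable]: "K z \<in> borel_measurable borel" "(\<lambda>z. K z w) \<in> borel_measurable borel"
  by measurable

lemma norm_kernel_le: "norm (K z w) \<le> \<Theta> (z - w)"
  by (rule envelope) simp

lemma shifted_envelope:
  "integrable lborel (\<lambda>w. \<Theta> (z - w))" "(LINT w|lborel. \<Theta> (z - w)) = mass"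
  "integrable lborel (\<lambda>z. \<Theta> (z - w))" "(LINT z|lborel. \<Theta> (z - w)) = mass"
  using integrable_lborel_shift_iff[of \<Theta>] integral_lborel_shift[where f=\<Theta>] envelope_integrable
  by (auto simp: mass_def)

lemma kernel_integrable: "integrable lborel (K z)" "(LINT w|lborel. norm (K z w)) \<le> mass"
proof -
  show 1: "integrable lborel (K z)"
    by (rule integrable_norm_le[OF shifted_envelope(1)[of z]]) (auto intro: norm_kernel_le)
  show "(LINT w|lborel. norm (K z w)) \<le> mass"
    unfolding shifted_envelope(2)[of z, symmetric]
    by (intro integral_mono integrable_norm 1 shifted_envelope norm_kernel_le)
qed

lemma apply_bounded:
  assumes [measurable]: "U \<in> borel_measurable borel" and U: "\<And>u. norm (U u) \<le> M"
  shows "integrable lborel (\<lambda>w. K z w * U w)" "norm (kernel_apply K U z) \<le> mass * M"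
proof -
  have le: "norm (K z w * U w) \<le> \<Theta> (z - w) * M" for w
    unfolding norm_mult using norm_kernel_le U envelope_nonneg by (intro mult_mono) auto
  have int: "integrable lborel (\<lambda>w. \<Theta> (z - w) * M)"
    using shifted_envelope(1) by simp
  show "integrable lborel (\<lambda>w. K z w * U w)"
    by (rule integrable_norm_le[OF int _ le]) measurable
  have "norm (kernel_apply K U z) \<le> (LINT w|lborel. \<Theta> (z - w) * M)"
    unfolding kernel_apply_def by (rule norm_integral_le[OF int le])
  then show "norm (kernel_apply K U z) \<le> mass * M"
    using shifted_envelope by simp
qed

lemma apply_measurable [measurable]:
  assumes [measurable]: "U \<in> borel_measurable borel"
  shows "kernel_apply K U \<in> borel_measurable borel"
  unfolding kernel_apply_def by measurable

text \<open>Near \<open>z\<close> the single function \<open>\<Theta> (z - w)\<close> dominates all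
  kernels \<open>K (x n)\<close>, because the envelope covers displacements within distance 1. The
  first \<open>m\<close> terms are dropped to get there before dominated convergence is
  applied.\<close>

lemma kernel_continuous_L1:
  assumes "x \<longlonglongrightarrow> z"
  shows "(\<lambda>n. LINT w|lborel. norm (K (x n) w - K z w)) \<longlonglongrightarrow> 0"
proof -
  have "\<forall>\<^sub>F n in sequentially. dist (x n) z < 1"
    using assms by (rule tendstoD) simp
  then obtain m where m: "\<And>n. m \<le> n \<Longrightarrow> dist (x n) z < 1"
    by (auto simp: eventually_sequentially)
  have x: "(\<lambda>n. x (n + m)) \<longlonglongrightarrow> z"
    using assms by (rule LIMSEQ_ignore_initial_segment)
  have "(\<lambda>n. LINT w|lborel. norm (K (x (n + m)) w - K z w)) \<longlonglongrightarrow> (LINT w::'a|lborel. (0::real))"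
  proof (rule tendsto_integral_dominated)
    show "integrable lborel (\<lambda>w. \<Theta> (z - w) + \<Theta> (z - w))"
      using shifted_envelope by simp
    fix w
    have "isCont (\<lambda>p. K (fst p) (snd p)) (z, w)"
      using continuous by (simp add: continuous_on_eq_continuous_at)
    then have "(\<lambda>n. K (fst (x (n + m), w)) (snd (x (n + m), w))) \<longlonglongrightarrow> K (fst (z, w)) (snd (z, w))"
      by (rule isCont_tendsto_compose) (intro tendsto_Pair x tendsto_const)
    then show "(\<lambda>n. norm (K (x (n + m)) w - K z w)) \<longlonglongrightarrow> 0"
      by (simp add: LIM_zero tendsto_norm_zero)
    show "norm (norm (K (x (n + m)) w - K z w)) \<le> \<Theta> (z - w) + \<Theta> (z - w)" for n
    proof -
      have "dist (z - w) (x (n + m) - w) \<le> 1"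
        using m[of "n + m"] by (simp add: dist_norm norm_minus_commute)
      then have "norm (K (x (n + m)) w) \<le> \<Theta> (z - w)" by (rule envelope)
      then show ?thesis
        using norm_kernel_le[of z w] norm_triangle_ineq4[of "K (x (n + m)) w" "K z w"] by simp
    qed
  qed measurable
  then show ?thesis
    by (simp add: LIMSEQ_offset[of _ m])
qed

text \<open>The modulus of continuity depends on the kernel alone, so the images of a uniformly
  bounded family of functions are equicontinuous: the input for Arzela-Ascoli.\<close>

lemma kernel_equicontinuous:
  assumes "0 < e"
  shows "\<exists>d>0. \<forall>x. dist x z < d \<longrightarrow> (LINT w|lborel. norm (K x w - K z w)) < e"
proof -
  have "((\<lambda>x. LINT w|lborel. norm (K x w - K z w)) \<longlongrightarrow> 0) (at z)"
    by (subst tendsto_at_iff_sequentially) (auto simp: o_def intro: kernel_continuous_L1)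
  then have "\<forall>\<^sub>F x in at z. (LINT w|lborel. norm (K x w - K z w)) < e"
    by (rule order_tendstoD(2)[OF _ assms])
  then obtain d where d: "0 < d"
    "\<And>x. x \<noteq> z \<Longrightarrow> dist x z < d \<Longrightarrow> (LINT w|lborel. norm (K x w - K z w)) < e"
    unfolding eventually_at by blast
  have "(LINT w|lborel. norm (K x w - K z w)) < e" if "dist x z < d" for x
    using d(2)[OF _ that] assms by (cases "x = z") simp_all
  then show ?thesis using d(1) by blast
qed

lemma apply_diff_le:
  assumes [measurable]: "U \<in> borel_measurable borel" and U: "\<And>u. norm (U u) \<le> M"
  shows "norm (kernel_apply K U x - kernel_apply K U z) \<le> (LINT w|lborel. norm (K x w - K z w)) * M"
proof -
  have "kernel_apply K U x - kernel_apply K U z = (LINT w|lborel. (K x w - K z w) * U w)"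
    unfolding kernel_apply_def
    by (simp add: left_diff_distrib apply_bounded(1)[OF assms])
  also have "norm \<dots> \<le> (LINT w|lborel. norm (K x w - K z w) * M)"
  proof (rule norm_integral_le)
    show "integrable lborel (\<lambda>w. norm (K x w - K z w) * M)"
      by (intro integrable_mult_left integrable_norm Bochner_Integration.integrable_diff kernel_integrable)
    show "norm ((K x w - K z w) * U w) \<le> norm (K x w - K z w) * M" for w
      unfolding norm_mult by (intro mult_left_mono U norm_ge_zero)
  qed
  finally show ?thesis by simp
qed

lemma envelope_square_integrable:
  assumes "square_integrable U"
  shows "integrable lborel (\<lambda>w. \<Theta> (v - w) * (norm (U w))\<^sup>2)"
proof (rule integrable_norm_le)
  have [measurable]: "U \<in> borel_measurable borel" using assms by (simp add: square_integrable_def)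
  show "integrable lborel (\<lambda>w. B * (norm (U w))\<^sup>2)"
    using assms by (simp add: square_integrable_def)
  show "(\<lambda>w. \<Theta> (v - w) * (norm (U w))\<^sup>2) \<in> borel_measurable lborel" by measurable
  show "norm (\<Theta> (v - w) * (norm (U w))\<^sup>2) \<le> B * (norm (U w))\<^sup>2" for w
    using envelope_nonneg[of "v - w"] mult_right_mono[OF envelope_bounded[of "v - w"], of "(norm (U w))\<^sup>2"] by simp
qed

text \<open>The majorant may be evaluated at any \<open>v\<close> within distance 1 of
  \<open>z\<close>. This freedom allows a sum over separated points to be replaced by an integral
  over \<open>v\<close>.\<close>

lemma apply_square_integrable:
  assumes U: "square_integrable U" and v: "dist v z \<le> 1"
  shows "integrable lborel (\<lambda>w. K z w * U w)"
    and "(norm (kernel_apply K U z))\<^sup>2 \<le> mass * (LINT w|lborel. \<Theta> (v - w) * (norm (U w))\<^sup>2)"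
proof -
  have [measurable]: "U \<in> borel_measurable borel" using U by (simp add: square_integrable_def)
  note cs = weighted_cauchy_schwarz[OF shifted_envelope(1) envelope_square_integrable[OF U] envelope_nonneg, of v]
  have le: "norm (K z w * U w) \<le> \<Theta> (v - w) * norm (U w)" for w
    unfolding norm_mult by (intro mult_right_mono envelope) (use v in \<open>auto simp: dist_norm\<close>)
  have int: "integrable lborel (\<lambda>w. \<Theta> (v - w) * norm (U w))"
    by (rule cs(1)) measurable
  show "integrable lborel (\<lambda>w. K z w * U w)"
    by (rule integrable_norm_le[OF int _ le]) measurable
  have "norm (kernel_apply K U z) \<le> (LINT w|lborel. \<Theta> (v - w) * norm (U w))"
    unfolding kernel_apply_def by (rule norm_integral_le[OF int le])
  then have "(norm (kernel_apply K U z))\<^sup>2 \<le> (LINT w|lborel. \<Theta> (v - w) * norm (U w))\<^sup>2"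
    by (intro power_mono) auto
  also have "\<dots> \<le> mass * (LINT w|lborel. \<Theta> (v - w) * (norm (U w))\<^sup>2)"
    unfolding shifted_envelope(2)[of v, symmetric] by (rule cs(2)) measurable
  finally show "(norm (kernel_apply K U z))\<^sup>2 \<le> mass * (LINT w|lborel. \<Theta> (v - w) * (norm (U w))\<^sup>2)" .
qed

lemma envelope_convolution:
  assumes U: "square_integrable U"
  shows "integrable lborel (\<lambda>v. LINT w|lborel. \<Theta> (v - w) * (norm (U w))\<^sup>2)"
    and "(LINT v|lborel. LINT w|lborel. \<Theta> (v - w) * (norm (U w))\<^sup>2) = mass * (LINT w|lborel. (norm (U w))\<^sup>2)"
proof -
  have [measurable]: "U \<in> borel_measurable borel" using U by (simp add: square_integrable_def)
  let ?f = "\<lambda>w v. \<Theta> (v - w) * (norm (U w))\<^sup>2"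
  have m: "(\<lambda>p. ?f (fst p) (snd p)) \<in> borel_measurable borel"
    unfolding borel_prod[symmetric] by measurable
  have i: "integrable lborel (?f w)" for w
    using shifted_envelope(3) by simp
  have w: "(LINT v|lborel. norm (?f w v)) \<le> mass * (norm (U w))\<^sup>2" for w
    using shifted_envelope(4)[of w] by (simp add: envelope_nonneg)
  have iw: "integrable lborel (\<lambda>w. mass * (norm (U w))\<^sup>2)"
    using U by (simp add: square_integrable_def)
  note fub = fubini_dominated[where f = ?f, OF m i w iw]
  show "integrable lborel (\<lambda>v. LINT w|lborel. \<Theta> (v - w) * (norm (U w))\<^sup>2)"
    by (rule fub(4))
  have "(LINT v|lborel. LINT w|lborel. \<Theta> (v - w) * (norm (U w))\<^sup>2)
      = (LINT w|lborel. LINT v|lborel. \<Theta> (v - w) * (norm (U w))\<^sup>2)"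
    by (rule fub(2)[symmetric])
  also have "\<dots> = mass * (LINT w|lborel. (norm (U w))\<^sup>2)"
    using shifted_envelope(4) by simp
  finally show "(LINT v|lborel. LINT w|lborel. \<Theta> (v - w) * (norm (U w))\<^sup>2) = mass * (LINT w|lborel. (norm (U w))\<^sup>2)" .
qed

text \<open>A square integrable function that is fixed by the kernel is therefore bounded, so that
  its local maxima are finite.\<close>

lemma apply_L2_bounded:
  assumes U: "square_integrable U"
  shows "norm (kernel_apply K U z) \<le> sqrt (mass * (B * (LINT w|lborel. (norm (U w))\<^sup>2)))"
proof (rule real_le_rsqrt)
  have "(norm (kernel_apply K U z))\<^sup>2 \<le> mass * (LINT w|lborel. \<Theta> (z - w) * (norm (U w))\<^sup>2)"
    by (rule apply_square_integrable[OF U]) simp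
  also have "\<dots> \<le> mass * (LINT w|lborel. B * (norm (U w))\<^sup>2)"
    using U envelope_square_integrable[OF U]
    by (intro mult_left_mono[OF _ mass_nonneg] integral_mono mult_right_mono envelope_bounded)
       (auto simp: square_integrable_def)
  finally show "(norm (kernel_apply K U z))\<^sup>2 \<le> mass * (B * (LINT w|lborel. (norm (U w))\<^sup>2))" by simp
qed

lemma apply_square_integrable_bound:
  assumes U: "square_integrable U"
  shows "square_integrable (kernel_apply K U)"
    and "(LINT z|lborel. (norm (kernel_apply K U z))\<^sup>2) \<le> mass\<^sup>2 * (LINT w|lborel. (norm (U w))\<^sup>2)"
proof -
  have [measurable]: "U \<in> borel_measurable borel" using U by (simp add: square_integrable_def)
  have int: "integrable lborel (\<lambda>z. mass * (LINT w|lborel. \<Theta> (z - w) * (norm (U w))\<^sup>2))"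
    by (intro integrable_mult_right envelope_convolution U)
  have le: "(norm (kernel_apply K U z))\<^sup>2 \<le> mass * (LINT w|lborel. \<Theta> (z - w) * (norm (U w))\<^sup>2)" for z
    by (rule apply_square_integrable[OF U]) simp
  show sq: "square_integrable (kernel_apply K U)"
    unfolding square_integrable_def
    by (intro conjI apply_measurable integrable_norm_le[OF int]) (use le in auto)
  have "(LINT z|lborel. (norm (kernel_apply K U z))\<^sup>2) \<le> (LINT z|lborel. mass * (LINT w|lborel. \<Theta> (z - w) * (norm (U w))\<^sup>2))"
    using sq by (intro integral_mono int le) (simp add: square_integrable_def)
  also have "\<dots> = mass\<^sup>2 * (LINT w|lborel. (norm (U w))\<^sup>2)"
    using envelope_convolution(2)[OF U] by (simp add: power2_eq_square)
  finally show "(LINT z|lborel. (norm (kernel_apply K U z))\<^sup>2) \<le> mass\<^sup>2 * (LINT w|lborel. (norm (U w))\<^sup>2)" .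
qed

lemma bessel:
  assumes U: "square_integrable U"
    and \<Lambda>: "\<And>x. finite (\<Lambda> \<inter> ball x 1) \<and> card (\<Lambda> \<inter> ball x 1) \<le> N"
    and F: "finite F" "F \<subseteq> \<Lambda>"
  shows "(\<Sum>l\<in>F. (norm (kernel_apply K U l))\<^sup>2)
    \<le> real N / measure lborel (ball (0::'a) 1) * (mass\<^sup>2 * (LINT w|lborel. (norm (U w))\<^sup>2))"
proof -
  have "(\<Sum>l\<in>F. (norm (kernel_apply K U l))\<^sup>2) \<le> real N / measure lborel (ball (0::'a) 1) *
      (LINT v|lborel. mass * (LINT w|lborel. \<Theta> (v - w) * (norm (U w))\<^sup>2))"
  proof (rule relatively_separated_sum_le[OF \<Lambda> F])
    show "integrable lborel (\<lambda>v. mass * (LINT w|lborel. \<Theta> (v - w) * (norm (U w))\<^sup>2))"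
      by (intro integrable_mult_right envelope_convolution U)
    show "0 \<le> mass * (LINT w|lborel. \<Theta> (v - w) * (norm (U w))\<^sup>2)" for v
      using mass_nonneg envelope_nonneg by simp
    show "(norm (kernel_apply K U l))\<^sup>2 \<le> mass * (LINT w|lborel. \<Theta> (v - w) * (norm (U w))\<^sup>2)"
      if "dist l v < 1" for l v
      using that by (intro apply_square_integrable[OF U]) (simp add: dist_commute)
  qed
  then show ?thesis
    using envelope_convolution(2)[OF U] by (simp add: power2_eq_square mult.assoc)
qed

text \<open>The operator maps the twisted translate of \<open>U\<close> to the twisted translate of
  its image, so the modulus of the image is merely translated.\<close>

lemma apply_shift:
  "kernel_apply K (\<lambda>w. cnj (\<kappa> a w) * U (w + a)) z = cnj (\<kappa> a z) * kernel_apply K U (z + a)"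
proof -
  have "cnj (\<kappa> a z) * \<kappa> a z = 1" for z
    using phase_norm[of a z] by (metis complex_norm_square mult.commute of_real_1 power_one)
  then have *: "K z w * cnj (\<kappa> a w) = cnj (\<kappa> a z) * K (z + a) (w + a)" for w
    by (simp add: covariant mult.assoc[symmetric])
  have "kernel_apply K (\<lambda>w. cnj (\<kappa> a w) * U (w + a)) z
      = (LINT w|lborel. cnj (\<kappa> a z) * (K (z + a) (w + a) * U (w + a)))"
    unfolding kernel_apply_def
    by (intro Bochner_Integration.integral_cong refl) (simp only: mult.assoc[symmetric] *)
  also have "\<dots> = cnj (\<kappa> a z) * (LINT w|lborel. K (z + a) (w + a) * U (w + a))"
    by simp
  also have "(LINT w|lborel. K (z + a) (w + a) * U (w + a)) = (LINT w|lborel. K (z + a) w * U w)"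
    by (rule integral_lborel_shift)
  finally show ?thesis by (simp add: kernel_apply_def)
qed

end

section \<open>Commutators of kernels with slowly varying cutoffs\<close>

definition reduced_envelope :: "('a::euclidean_space \<Rightarrow> real) \<Rightarrow> real \<Rightarrow> 'a \<Rightarrow> real" where
  "reduced_envelope \<Theta> N v = \<Theta> v * min 1 ((norm v + 1) / N)"

definition reduced_mass :: "('a::euclidean_space \<Rightarrow> real) \<Rightarrow> real \<Rightarrow> real" where
  "reduced_mass \<Theta> N = (LINT v|lborel. reduced_envelope \<Theta> N v)"

text \<open>The commutator of the operator of \<open>K\<close> with multiplication by the cutoff,
  written as one integral; the difference of two values of the cutoff is what makes it
  small.\<close>

definition commutator ::
    "('a::euclidean_space \<Rightarrow> 'a \<Rightarrow> complex) \<Rightarrow> real \<Rightarrow> 'a \<Rightarrow> ('a \<Rightarrow> complex) \<Rightarrow> 'a \<Rightarrow> complex" where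
  "commutator K N w U z = (LINT u|lborel. K z u * (of_real (cutoff N w z - cutoff N w u) * U u))"

context localized_kernel
begin

lemma reduced_envelope_bounds: "0 < N \<Longrightarrow> 0 \<le> reduced_envelope \<Theta> N v" "reduced_envelope \<Theta> N v \<le> \<Theta> v"
  using envelope_nonneg[of v] mult_left_mono[of "min 1 ((norm v + 1) / N)" 1 "\<Theta> v"]
  by (auto simp: reduced_envelope_def)

lemma reduced_envelope_measurable [measurable]: "reduced_envelope \<Theta> N \<in> borel_measurable borel"
  unfolding reduced_envelope_def by measurable

lemma reduced_envelope_integrable:
  assumes "0 < N"
  shows "integrable lborel (reduced_envelope \<Theta> N)"
  by (rule integrable_norm_le[OF envelope_integrable]) (use reduced_envelope_bounds assms in auto)

lemma reduced_envelope_shift: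
  assumes "0 < N"
  shows "integrable lborel (\<lambda>u. reduced_envelope \<Theta> N (v - u))"
    and "(LINT u|lborel. reduced_envelope \<Theta> N (v - u)) = reduced_mass \<Theta> N"
  using integrable_lborel_shift_iff(3)[of "reduced_envelope \<Theta> N"] reduced_envelope_integrable[OF assms]
    integral_lborel_shift(3)[where f="reduced_envelope \<Theta> N"]
  by (auto simp: reduced_mass_def)

lemma reduced_mass_nonneg: "0 < N \<Longrightarrow> 0 \<le> reduced_mass \<Theta> N"
  unfolding reduced_mass_def by (intro Bochner_Integration.integral_nonneg reduced_envelope_bounds)

text \<open>Dominated convergence: at each \<open>v\<close> the reduction factor tends to 0 as
  \<open>N\<close> grows, and \<open>\<Theta>\<close> dominates. For an envelope known only to be
  integrable there is no rate in \<open>N\<close>.\<close>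

lemma reduced_mass_small:
  assumes "0 < e"
  shows "\<exists>N\<ge>1. reduced_mass \<Theta> N < e"
proof -
  have "(\<lambda>n. reduced_mass \<Theta> (real (Suc n))) \<longlonglongrightarrow> (LINT v::'a|lborel. (0::real))"
    unfolding reduced_mass_def
  proof (rule tendsto_integral_dominated[OF envelope_integrable])
    fix v :: 'a
    have "(\<lambda>n. (norm v + 1) / real (Suc n)) \<longlonglongrightarrow> 0"
      using LIMSEQ_Suc[OF lim_const_over_n[of "norm v + 1"]] by simp
    then have "(\<lambda>n. \<Theta> v * min 1 ((norm v + 1) / real (Suc n))) \<longlonglongrightarrow> \<Theta> v * min 1 0"
      by (intro tendsto_intros)
    then show "(\<lambda>n. reduced_envelope \<Theta> (real (Suc n)) v) \<longlonglongrightarrow> 0"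
      by (simp add: reduced_envelope_def)
    show "norm (reduced_envelope \<Theta> (real (Suc n)) v) \<le> \<Theta> v" for n
      using reduced_envelope_bounds[of "real (Suc n)" v] by simp
  qed auto
  then have "\<forall>\<^sub>F n in sequentially. reduced_mass \<Theta> (real (Suc n)) < e"
    by (intro order_tendstoD(2)[OF _ assms]) simp
  then obtain n where "reduced_mass \<Theta> (real (Suc n)) < e"
    by (auto simp: eventually_sequentially)
  then show ?thesis by (intro exI[of _ "real (Suc n)"]) auto
qed

lemma cutoff_apply:
  assumes [measurable]: "U \<in> borel_measurable borel" and U: "\<And>u. norm (U u) \<le> M"
  shows "of_real (cutoff N w z) * kernel_apply K U z
    = kernel_apply K (\<lambda>u. of_real (cutoff N w u) * U u) z + commutator K N w U z"
proof -
  have b: "norm (of_real (cutoff N w u) * U u) \<le> M" for u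
    using mult_mono[OF cutoff_bounds(2)[of N w u] U[of u]] cutoff_bounds(1)[of N w u]
    by (simp add: norm_mult)
  have 1: "integrable lborel (\<lambda>u. K z u * (of_real (cutoff N w u) * U u))"
    by (rule apply_bounded(1)[OF _ b]) measurable
  have 2: "integrable lborel (\<lambda>u. K z u * U u)"
    by (rule apply_bounded(1)[OF _ U]) measurable
  have "commutator K N w U z
      = (LINT u|lborel. of_real (cutoff N w z) * (K z u * U u) - K z u * (of_real (cutoff N w u) * U u))"
    unfolding commutator_def by (intro Bochner_Integration.integral_cong) (auto simp: algebra_simps)
  also have "\<dots> = of_real (cutoff N w z) * kernel_apply K U z - kernel_apply K (\<lambda>u. of_real (cutoff N w u) * U u) z"
    unfolding kernel_apply_def using 1 2 by simp
  finally show ?thesis by simp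
qed

text \<open>The 1 in \<open>(norm v + 1) / N\<close> pays for replacing \<open>z\<close> by a point
  \<open>v\<close> within distance 1: the distance of \<open>z\<close> and \<open>u\<close> is at
  most \<open>norm (v - u) + 1\<close>.\<close>

lemma kernel_cutoff_le:
  assumes N: "1 \<le> N" and v: "dist v z \<le> 1"
  shows "norm (K z u) * \<bar>cutoff N w z - cutoff N w u\<bar> \<le> reduced_envelope \<Theta> N (v - u)"
proof -
  have "dist z u \<le> norm (v - u) + 1"
    using dist_triangle[of z u v] v by (simp add: dist_norm[of v u, symmetric] dist_commute)
  then have "dist z u / N \<le> (norm (v - u) + 1) / N"
    using N by (intro divide_right_mono) auto
  then have "\<bar>cutoff N w z - cutoff N w u\<bar> \<le> min 1 ((norm (v - u) + 1) / N)"
    using cutoff_diff_le[of N w z u] N by linarith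
  moreover have "norm (K z u) \<le> \<Theta> (v - u)"
    by (rule envelope) (use v in \<open>simp add: dist_norm\<close>)
  ultimately show ?thesis
    unfolding reduced_envelope_def by (intro mult_mono envelope_nonneg) auto
qed

text \<open>The majorant \<open>q\<close> is a function of \<open>v\<close> that is valid for all
  \<open>z\<close> within distance 1, so it serves for integrals and for sums over separated points
  alike. Only pairs with \<open>v\<close> or \<open>u\<close> within \<open>3 * N\<close> of
  \<open>w\<close> contribute; the two alternatives account for the factor 2, the Schur test for the
  square of \<open>reduced_mass\<close>.\<close>

lemma commutator_L2:
  assumes N: "1 \<le> N" and [measurable]: "U \<in> borel_measurable borel" and U: "\<And>u. norm (U u) \<le> M"
    and S: "\<And>y. (LINT u|lborel. indicator (ball y (3 * N)) u * (norm (U u))\<^sup>2) \<le> S"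
  shows "\<exists>q. integrable lborel q \<and> (\<forall>v. 0 \<le> q v) \<and> (LINT v|lborel. q v) \<le> 2 * (reduced_mass \<Theta> N)\<^sup>2 * S \<and>
    (\<forall>z v. dist v z \<le> 1 \<longrightarrow> (norm (commutator K N w U z))\<^sup>2 \<le> q v)"
proof -
  let ?r = "reduced_envelope \<Theta> N" and ?m = "reduced_mass \<Theta> N"
  have N0: "0 < N" using N by simp
  define I :: "'a \<Rightarrow> 'a \<Rightarrow> real" where "I v u = max (indicator (ball w (3 * N)) v) (indicator (ball w (3 * N)) u)" for v u
  have I: "0 \<le> I v u" "I v u \<le> 1" "I v u \<le> indicator (ball w (3 * N)) v + indicator (ball w (3 * N)) u" for v u
    by (auto simp: I_def indicator_def)
  have [measurable]: "(\<lambda>(v, u). I v u) \<in> borel_measurable (borel \<Otimes>\<^sub>M borel)"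
    unfolding I_def indicator_def mem_ball by measurable
  define k where "k v u = ?r (v - u) * I v u" for v u
  have [measurable]: "(\<lambda>(v, u). k v u) \<in> borel_measurable (borel \<Otimes>\<^sub>M borel)"
    unfolding k_def by measurable
  have k: "0 \<le> k v u" "k v u \<le> ?r (v - u)" for v u
    unfolding k_def using I[of v u] reduced_envelope_bounds(1)[OF N0, of "v - u"]
    by (auto intro: mult_left_le)
  have k_int: "integrable lborel (k v)" for v
    by (rule integrable_norm_le[OF reduced_envelope_shift(1)[OF N0]]) (use k in \<open>auto simp: abs_of_nonneg\<close>)
  have k_mass: "(LINT u|lborel. k v u) \<le> ?m" for v
    unfolding reduced_envelope_shift(2)[OF N0, of v, symmetric]
    by (intro integral_mono k_int reduced_envelope_shift N0 k)
  have U2: "(norm (U u))\<^sup>2 \<le> M\<^sup>2" for u using U[of u] by (intro power_mono) auto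
  have kU_int: "integrable lborel (\<lambda>u. k v u * (norm (U u))\<^sup>2)" for v
  proof (rule integrable_norm_le)
    show "integrable lborel (\<lambda>u. ?r (v - u) * M\<^sup>2)"
      by (intro integrable_mult_left reduced_envelope_shift N0)
    show "norm (k v u * (norm (U u))\<^sup>2) \<le> ?r (v - u) * M\<^sup>2" for u
      using mult_mono[OF k(2) U2] k reduced_envelope_bounds(1)[OF N0] by simp
  qed measurable
  define q where "q v = ?m * (LINT u|lborel. k v u * (norm (U u))\<^sup>2)" for v
  have ptw: "norm (K z u * (of_real (cutoff N w z - cutoff N w u) * U u)) \<le> k v u * norm (U u)"
    if v: "dist v z \<le> 1" for z v u
  proof -
    have "norm (K z u) * \<bar>cutoff N w z - cutoff N w u\<bar> \<le> k v u"
    proof (cases "v \<in> ball w (3 * N) \<or> u \<in> ball w (3 * N)")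
      case True
      then have "I v u = 1" by (auto simp: I_def indicator_def)
      then show ?thesis using kernel_cutoff_le[OF N v] by (simp add: k_def)
    next
      \<comment> \<open>The cutoff vanishes beyond \<open>2 * N\<close>, and passing from
        \<open>v\<close> to \<open>z\<close> costs at most 1, which is at most \<open>N\<close>;
        hence the radius \<open>3 * N\<close>.\<close>
      case False
      have "dist w v \<le> dist w z + dist v z" by (metis dist_commute dist_triangle)
      then have "2 * N \<le> dist z w" using False v N by (auto simp: dist_commute)
      then have "cutoff N w z = 0" using N0 by (rule cutoff_eq_0[rotated])
      moreover have "cutoff N w u = 0"
        using False N by (intro cutoff_eq_0) (auto simp: dist_commute)
      ultimately show ?thesis using k(1) by simp
    qed
    then show ?thesis
      using mult_right_mono[of "norm (K z u) * \<bar>cutoff N w z - cutoff N w u\<bar>" "k v u" "norm (U u)"]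
      by (simp only: norm_mult norm_of_real mult.assoc norm_ge_zero)
  qed
  have "(norm (commutator K N w U z))\<^sup>2 \<le> q v" if v: "dist v z \<le> 1" for z v
  proof -
    note cs = weighted_cauchy_schwarz[OF k_int kU_int k(1), of v]
    have "norm (commutator K N w U z) \<le> (LINT u|lborel. k v u * norm (U u))"
      unfolding commutator_def by (rule norm_integral_le[OF cs(1) ptw[OF v]]) measurable
    then have "(norm (commutator K N w U z))\<^sup>2 \<le> (LINT u|lborel. k v u * norm (U u))\<^sup>2"
      by (intro power_mono) auto
    also have "\<dots> \<le> (LINT u|lborel. k v u) * (LINT u|lborel. k v u * (norm (U u))\<^sup>2)"
      by (rule cs(2)) measurable
    also have "\<dots> \<le> q v"
      unfolding q_def using k by (intro mult_right_mono k_mass Bochner_Integration.integral_nonneg) auto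
    finally show ?thesis .
  qed
  moreover have "0 \<le> q v" for v
    unfolding q_def using k(1) reduced_mass_nonneg[OF N0] by simp
  moreover
  \<comment> \<open>In the variable \<open>t = v - u\<close> the reduced envelope factors out, and
    the integral over \<open>v\<close> for fixed \<open>t\<close> is bounded by the squared L2 norms
    of \<open>U\<close> over two balls of radius \<open>3 * N\<close>.\<close>
  define f where "f t v = ?r t * (I v (v - t) * (norm (U (v - t)))\<^sup>2)" for t v
  have mf: "(\<lambda>p. f (fst p) (snd p)) \<in> borel_measurable borel"
    unfolding f_def borel_prod[symmetric] by measurable
  have b1: "integrable lborel (\<lambda>v. indicator (ball a (3 * N)) v * (norm (U (v - t)))\<^sup>2)" for a t
  proof (rule integrable_norm_le)
    show "integrable lborel (\<lambda>v. indicator (ball a (3 * N)) v * M\<^sup>2)"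
      using emeasure_lborel_ball_finite[of a "3 * N"] by (intro integrable_mult_left) auto
  qed (use U2 in \<open>auto simp: indicator_def\<close>)
  have b2: "integrable lborel (\<lambda>v. indicator (ball a (3 * N)) (v - t) * (norm (U (v - t)))\<^sup>2)" for a t
    using b1[of a 0] integrable_lborel_shift_iff(2)[of "\<lambda>v. indicator (ball a (3 * N)) v * (norm (U v))\<^sup>2" t]
    by simp
  have s1: "(LINT v|lborel. indicator (ball w (3 * N)) v * (norm (U (v - t)))\<^sup>2) \<le> S" for t
  proof -
    have "(LINT v|lborel. indicator (ball w (3 * N)) v * (norm (U (v - t)))\<^sup>2)
        = (LINT v|lborel. indicator (ball w (3 * N)) (v + t) * (norm (U (v + t - t)))\<^sup>2)"
      by (rule integral_lborel_shift(1)[symmetric])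
    also have "\<dots> = (LINT v|lborel. indicator (ball (w - t) (3 * N)) v * (norm (U v))\<^sup>2)"
      by (intro Bochner_Integration.integral_cong) (auto simp: indicator_def dist_norm algebra_simps)
    also have "\<dots> \<le> S" by (rule S)
    finally show ?thesis .
  qed
  have s2: "(LINT v|lborel. indicator (ball w (3 * N)) (v - t) * (norm (U (v - t)))\<^sup>2) \<le> S" for t
    using integral_lborel_shift(2)[of "\<lambda>v. indicator (ball w (3 * N)) v * (norm (U v))\<^sup>2" t] S[of w] by simp
  have le: "I v (v - t) * (norm (U (v - t)))\<^sup>2 \<le>
      indicator (ball w (3 * N)) v * (norm (U (v - t)))\<^sup>2 + indicator (ball w (3 * N)) (v - t) * (norm (U (v - t)))\<^sup>2" for t v
    using mult_right_mono[OF I(3)[of v "v - t"], of "(norm (U (v - t)))\<^sup>2"] by (simp add: distrib_right)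
  have I_int: "integrable lborel (\<lambda>v. I v (v - t) * (norm (U (v - t)))\<^sup>2)" for t
    by (rule integrable_norm_le[OF Bochner_Integration.integrable_add[OF b1 b2], of _ w t w t])
       (use le[of _ t] I(1) in \<open>auto simp: abs_mult\<close>)
  have I_le: "(LINT v|lborel. I v (v - t) * (norm (U (v - t)))\<^sup>2) \<le> 2 * S" for t
  proof -
    have "(LINT v|lborel. I v (v - t) * (norm (U (v - t)))\<^sup>2) \<le> (LINT v|lborel.
      indicator (ball w (3 * N)) v * (norm (U (v - t)))\<^sup>2 + indicator (ball w (3 * N)) (v - t) * (norm (U (v - t)))\<^sup>2)"
      by (intro integral_mono I_int Bochner_Integration.integrable_add b1 b2 le)
    also have "\<dots> \<le> S + S"
      using s1[of t] s2[of t] by (simp add: b1 b2)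
    finally show ?thesis by simp
  qed
  have f_int: "integrable lborel (f t)" for t
    unfolding f_def by (intro integrable_mult_right I_int)
  have f_nonneg: "0 \<le> f t v" for t v
    unfolding f_def using I reduced_envelope_bounds(1)[OF N0] by simp
  have f_le: "(LINT v|lborel. f t v) \<le> ?r t * (2 * S)" for t
    unfolding f_def using mult_left_mono[OF I_le reduced_envelope_bounds(1)[OF N0], of t t] by simp
  have fw: "(LINT v|lborel. norm (f t v)) \<le> ?r t * (2 * S)" for t
    using f_le[of t] f_nonneg by simp
  have r_int: "integrable lborel (\<lambda>t. ?r t * (2 * S))"
    by (intro integrable_mult_left reduced_envelope_integrable N0)
  note fub = fubini_dominated[where f=f, OF mf f_int fw r_int]
  have q_eq: "q v = ?m * (LINT t|lborel. f t v)" for v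
    using integral_lborel_shift(3)[of "\<lambda>u. k v u * (norm (U u))\<^sup>2" v]
    by (simp add: q_def f_def k_def mult.assoc)
  have "integrable lborel q"
    unfolding q_eq by (intro integrable_mult_right fub(4))
  moreover have "(LINT v|lborel. q v) \<le> 2 * ?m\<^sup>2 * S"
  proof -
    have "(LINT v|lborel. q v) = ?m * (LINT t|lborel. LINT v|lborel. f t v)"
      unfolding q_eq using fub(2) by simp
    also have "\<dots> \<le> ?m * (LINT t|lborel. ?r t * (2 * S))"
      by (intro mult_left_mono reduced_mass_nonneg N0 integral_mono fub(3) r_int f_le)
    also have "\<dots> = 2 * ?m\<^sup>2 * S"
      by (simp add: reduced_mass_def power2_eq_square)
    finally show ?thesis .
  qed
  ultimately show ?thesis by blast
qed

lemma reduced_convolution_integrable: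
  assumes N: "0 < N" and [measurable]: "s \<in> borel_measurable borel" and s: "\<And>v. \<bar>s v\<bar> \<le> (M::real)"
  shows "integrable lborel (\<lambda>v. reduced_envelope \<Theta> N v * s (w - v))"
proof (rule integrable_norm_le)
  show "integrable lborel (\<lambda>v. reduced_envelope \<Theta> N v * M)"
    by (intro integrable_mult_left reduced_envelope_integrable N)
  show "norm (reduced_envelope \<Theta> N v * s (w - v)) \<le> reduced_envelope \<Theta> N v * M" for v
    using mult_left_mono[OF s reduced_envelope_bounds(1)[OF N]] reduced_envelope_bounds(1)[OF N, of v]
    by (simp add: abs_mult)
qed measurable

text \<open>A contribution requires \<open>z\<close> or \<open>u\<close> to be near
  \<open>w\<close>. If \<open>u\<close> is near, \<open>U u\<close> is bounded by
  \<open>s w\<close>; if \<open>z\<close> is near, it is bounded by \<open>s\<close> at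
  \<open>w - (z - u)\<close>, whose distance from \<open>u\<close> is that of \<open>w\<close> from
  \<open>z\<close>. Integration gives a multiple of \<open>s w\<close> and a convolution.\<close>

lemma commutator_sup:
  assumes N: "1 \<le> N" and [measurable]: "U \<in> borel_measurable borel" "s \<in> borel_measurable borel"
    and s: "\<And>v. 0 \<le> s v" "\<And>v. s v \<le> M" and Us: "\<And>u v. dist u v < 4 * N \<Longrightarrow> norm (U u) \<le> s v"
  shows "norm (commutator K N w U z)
    \<le> reduced_mass \<Theta> N * s w + (LINT v|lborel. reduced_envelope \<Theta> N v * s (w - v))"
proof -
  let ?r = "reduced_envelope \<Theta> N"
  have N0: "0 < N" using N by simp
  have abs_s: "\<bar>s v\<bar> \<le> M" for v using s[of v] by simp
  have conv: "integrable lborel (\<lambda>v. ?r v * s (w - v))"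
    by (rule reduced_convolution_integrable[OF N0 _ abs_s]) measurable
  have conv': "integrable lborel (\<lambda>u. ?r (z - u) * s (w - (z - u)))"
    using integrable_lborel_shift_iff(3)[of "\<lambda>v. ?r v * s (w - v)" z] conv by simp
  have int: "integrable lborel (\<lambda>u. ?r (z - u) * s w + ?r (z - u) * s (w - (z - u)))"
    by (intro Bochner_Integration.integrable_add conv' integrable_mult_left reduced_envelope_shift N0)
  have "norm (K z u * (of_real (cutoff N w z - cutoff N w u) * U u))
      \<le> ?r (z - u) * s w + ?r (z - u) * s (w - (z - u))" for u
  proof -
    have r: "norm (K z u) * \<bar>cutoff N w z - cutoff N w u\<bar> \<le> ?r (z - u)"
      by (rule kernel_cutoff_le[OF N]) simp
    have r0: "0 \<le> ?r (z - u)" by (rule reduced_envelope_bounds(1)[OF N0])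
    have eq: "norm (K z u * (of_real (cutoff N w z - cutoff N w u) * U u))
        = (norm (K z u) * \<bar>cutoff N w z - cutoff N w u\<bar>) * norm (U u)"
      by (simp only: norm_mult norm_of_real mult.assoc)
    have "\<dots> \<le> ?r (z - u) * (s w + s (w - (z - u)))"
    proof (cases "dist z w < 4 * N \<or> dist u w < 4 * N")
      case True
      then have "norm (U u) \<le> s w + s (w - (z - u))"
        using Us[of u w] Us[of u "w - (z - u)"] s(1)[of w] s(1)[of "w - (z - u)"]
        by (auto simp: dist_norm algebra_simps)
      then show ?thesis using r r0 by (intro mult_mono) auto
    next
      case False
      then have "cutoff N w z = 0" "cutoff N w u = 0"
        using N by (auto intro!: cutoff_eq_0)
      then show ?thesis using r0 s by simp
    qed
    then show ?thesis using eq by (simp add: distrib_left)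
  qed
  from norm_integral_le[OF int this]
  have "norm (commutator K N w U z) \<le> (LINT u|lborel. ?r (z - u) * s w + ?r (z - u) * s (w - (z - u)))"
    unfolding commutator_def .
  also have "\<dots> = reduced_mass \<Theta> N * s w + (LINT u|lborel. ?r (z - u) * s (w - (z - u)))"
    using conv' reduced_envelope_shift[OF N0, of z] by simp
  also have "(LINT u|lborel. ?r (z - u) * s (w - (z - u))) = (LINT v|lborel. ?r v * s (w - v))"
    by (rule integral_lborel_shift(3))
  finally show ?thesis .
qed

text \<open>Young's inequality for an integrable and a square integrable factor; boundedness of
  \<open>s\<close> makes the convolution converge at every point.\<close>

lemma reduced_convolution_L2:
  assumes N: "0 < N" and [measurable]: "s \<in> borel_measurable borel" and s: "\<And>v. \<bar>s v\<bar> \<le> (M::real)"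
    and s2: "integrable lborel (\<lambda>v. (s v)\<^sup>2)"
  shows "integrable lborel (\<lambda>w. (LINT v|lborel. reduced_envelope \<Theta> N v * s (w - v))\<^sup>2)"
    and "(LINT w|lborel. (LINT v|lborel. reduced_envelope \<Theta> N v * s (w - v))\<^sup>2)
      \<le> (reduced_mass \<Theta> N)\<^sup>2 * (LINT v|lborel. (s v)\<^sup>2)"
proof -
  let ?r = "reduced_envelope \<Theta> N" and ?m = "reduced_mass \<Theta> N"
  have s2': "\<bar>(s v)\<^sup>2\<bar> \<le> M\<^sup>2" for v
    using power_mono[OF s[of v], of 2] by simp
  have i2: "integrable lborel (\<lambda>v. ?r v * (s (w - v))\<^sup>2)" for w
    by (rule reduced_convolution_integrable[OF N _ s2']) measurable
  let ?f = "\<lambda>v w. ?r v * (s (w - v))\<^sup>2"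
  have m: "(\<lambda>p. ?f (fst p) (snd p)) \<in> borel_measurable borel"
    unfolding borel_prod[symmetric] by measurable
  have sh: "integrable lborel (\<lambda>w. (s (w - v))\<^sup>2)" "(LINT w|lborel. (s (w - v))\<^sup>2) = (LINT v|lborel. (s v)\<^sup>2)" for v
    using s2 integrable_lborel_shift_iff(2)[of "\<lambda>v. (s v)\<^sup>2" v] integral_lborel_shift(2)[of "\<lambda>v. (s v)\<^sup>2" v] by auto
  have i: "integrable lborel (?f v)" for v
    by (intro integrable_mult_right sh)
  have w: "(LINT w|lborel. norm (?f v w)) \<le> ?r v * (LINT v|lborel. (s v)\<^sup>2)" for v
    using sh(2)[of v] reduced_envelope_bounds(1)[OF N, of v] by simp
  have wi: "integrable lborel (\<lambda>v. ?r v * (LINT v|lborel. (s v)\<^sup>2))"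
    by (intro integrable_mult_left reduced_envelope_integrable N)
  note fub = fubini_dominated[where f="?f", OF m i w wi]
  have cs: "(LINT v|lborel. ?r v * s (w - v))\<^sup>2 \<le> ?m * (LINT v|lborel. ?f v w)" for w
    unfolding reduced_mass_def
    by (rule weighted_cauchy_schwarz(2)[OF reduced_envelope_integrable[OF N] i2 reduced_envelope_bounds(1)[OF N]]) measurable
  have int: "integrable lborel (\<lambda>w. ?m * (LINT v|lborel. ?f v w))"
    by (intro integrable_mult_right fub(4))
  show int': "integrable lborel (\<lambda>w. (LINT v|lborel. ?r v * s (w - v))\<^sup>2)"
    by (rule integrable_norm_le[OF int]) (measurable, simp add: cs)
  have "(LINT w|lborel. (LINT v|lborel. ?r v * s (w - v))\<^sup>2) \<le> (LINT w|lborel. ?m * (LINT v|lborel. ?f v w))"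
    by (intro integral_mono int int' cs)
  also have "\<dots> = ?m * (LINT v|lborel. LINT w|lborel. ?f v w)"
    using fub(2) by simp
  also have "\<dots> = ?m\<^sup>2 * (LINT v|lborel. (s v)\<^sup>2)"
    using sh(2) by (simp add: power2_eq_square reduced_mass_def)
  finally show "(LINT w|lborel. (LINT v|lborel. ?r v * s (w - v))\<^sup>2) \<le> ?m\<^sup>2 * (LINT v|lborel. (s v)\<^sup>2)" .
qed

end

section \<open>Pairs of kernels and the compactness argument\<close>

lemma kernel_apply_compose:
  assumes K: "localized_kernel K \<Theta> B \<kappa>" and H: "localized_kernel H \<Theta> B \<kappa>"
    and KH: "\<And>z w. (LINT u|lborel. K z u * H u w) = K z w"
    and [measurable]: "W \<in> borel_measurable borel" and W: "\<And>u. norm (W u) \<le> M"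
  shows "kernel_apply K (kernel_apply H W) z = kernel_apply K W z"
proof -
  interpret K: localized_kernel K \<Theta> B \<kappa> by (rule K)
  interpret H: localized_kernel H \<Theta> B \<kappa> by (rule H)
  let ?f = "\<lambda>u w. K z u * (H u w * W w)"
  have m: "(\<lambda>p. ?f (fst p) (snd p)) \<in> borel_measurable borel"
    unfolding borel_prod[symmetric] by measurable
  have i: "integrable lborel (?f u)" for u
    by (intro integrable_mult_right H.apply_bounded(1)[OF _ W]) measurable
  have M: "0 \<le> M" using W[of 0] norm_ge_zero order_trans by blast
  have w: "(LINT w|lborel. norm (?f u w)) \<le> norm (K z u) * (K.mass * M)" for u
  proof -
    have "(LINT w|lborel. norm (H u w * W w)) \<le> (LINT w|lborel. norm (H u w) * M)"
      using H.apply_bounded(1)[of W M u, OF _ W] W H.kernel_integrable(1)[of u]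
      by (intro integral_mono integrable_norm integrable_mult_left) (auto simp: norm_mult intro!: mult_left_mono)
    also have "\<dots> \<le> K.mass * M"
      using H.kernel_integrable(2)[of u] M by (simp add: mult_right_mono)
    finally show ?thesis
      by (simp add: norm_mult mult_left_mono)
  qed
  have wi: "integrable lborel (\<lambda>u. norm (K z u) * (K.mass * M))"
    by (intro integrable_mult_left integrable_norm K.kernel_integrable)
  have "kernel_apply K (kernel_apply H W) z = (LINT u|lborel. LINT w|lborel. ?f u w)"
    unfolding kernel_apply_def by simp
  also have "\<dots> = (LINT w|lborel. LINT u|lborel. ?f u w)"
    by (rule fubini_dominated_swap[where f="?f", OF m i w wi])
  also have "\<dots> = (LINT w|lborel. (LINT u|lborel. K z u * H u w) * W w)"
    by (simp add: mult.assoc[symmetric])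
  also have "\<dots> = kernel_apply K W z"
    by (simp add: KH kernel_apply_def)
  finally show ?thesis .
qed

text \<open>\<open>H\<close> is idempotent, and \<open>G\<close> sees a function only through its
  image under \<open>H\<close>. A common envelope and common phases allow one cutoff scale and one
  twisted translation to serve both kernels.\<close>

locale localized_kernel_pair =
  H: localized_kernel H \<Theta> B \<kappa> + G: localized_kernel G \<Theta> B \<kappa>
  for H G :: "'a::euclidean_space \<Rightarrow> 'a \<Rightarrow> complex" and \<Theta> B \<kappa> +
  assumes HH: "(LINT u|lborel. H z u * H u w) = H z w"
    and GH: "(LINT u|lborel. G z u * H u w) = G z w"
begin

lemma H_apply_H:
  assumes "W \<in> borel_measurable borel" "\<And>u. norm (W u) \<le> M"
  shows "kernel_apply H (kernel_apply H W) z = kernel_apply H W z"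
  by (rule kernel_apply_compose[OF H.localized_kernel_axioms H.localized_kernel_axioms HH assms])

lemma G_apply_H:
  assumes "W \<in> borel_measurable borel" "\<And>u. norm (W u) \<le> M"
  shows "kernel_apply G (kernel_apply H W) z = kernel_apply G W z"
  by (rule kernel_apply_compose[OF G.localized_kernel_axioms H.localized_kernel_axioms GH assms])

text \<open>The fixed point equation holds at every point, not just almost everywhere, so that
  suprema and values at single points make sense.\<close>

definition bounded_fixed :: "('a \<Rightarrow> complex) \<Rightarrow> bool" where
  "bounded_fixed U \<longleftrightarrow> U \<in> borel_measurable borel \<and> bounded (range U) \<and> kernel_apply H U = U"

lemma kernel_apply_scale: "kernel_apply K (\<lambda>w. c * U w) z = c * kernel_apply K U z"
  unfolding kernel_apply_def by (simp add: mult.left_commute)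

text \<open>\<open>U\<close> is divided by its supremum \<open>M\<close> and translated to a point
  \<open>y\<close> where more than half of it is attained. The last assumption makes
  \<open>M\<close> exceed \<open>(n + 1) * s\<close>, hence the bound \<open>1 / (n + 1)\<close> on
  the translated point set.\<close>

lemma bounded_fixed_normalize:
  assumes U: "bounded_fixed U" and s: "0 \<le> s" "\<And>l. l \<in> \<Lambda> \<Longrightarrow> norm (kernel_apply G U l) \<le> s"
    and z: "(real n + 1) * s < norm (U z)"
  shows "\<exists>V y. bounded_fixed V \<and> (\<forall>u. norm (V u) \<le> 1) \<and> 1/2 \<le> norm (V 0) \<and>
    (\<forall>l\<in>\<Lambda>. norm (kernel_apply G V (l - y)) \<le> 1 / (real n + 1))"
proof -
  have [measurable]: "U \<in> borel_measurable borel" and fixd: "\<And>z. kernel_apply H U z = U z"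
    and bd: "bounded (range U)"
    using U by (auto simp: bounded_fixed_def)
  define M where "M = (SUP u. norm (U u))"
  have "bdd_above (range (\<lambda>u. norm (U u)))"
    using bd unfolding bounded_iff by (auto intro: bdd_aboveI)
  then have le_M: "norm (U u) \<le> M" for u
    unfolding M_def by (rule cSUP_upper[OF UNIV_I])
  have M: "0 < M" and sM: "(real n + 1) * s < M"
  proof -
    show "(real n + 1) * s < M" using z le_M[of z] by linarith
    moreover have "0 \<le> (real n + 1) * s" using s(1) by simp
    ultimately show "0 < M" by linarith
  qed
  have "\<exists>y. M / 2 < norm (U y)"
  proof (rule ccontr)
    assume "\<not> ?thesis"
    then have "M \<le> M / 2" unfolding M_def by (intro cSUP_least) (auto simp: not_less M_def)
    with M show False by simp
  qed
  then obtain y where y: "M / 2 < norm (U y)" ..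
  define V where "V w = of_real (1 / M) * (cnj (\<kappa> y w) * U (w + y))" for w
  have [measurable]: "\<kappa> y \<in> borel_measurable borel" by (rule H.phase_measurable)
  have norm_V: "norm (V w) = norm (U (w + y)) / M" for w
    using M by (simp add: V_def norm_mult norm_divide H.phase_norm)
  have V_le: "norm (V u) \<le> 1" for u
    using le_M[of "u + y"] M by (simp add: norm_V)
  have HV: "kernel_apply H V z = V z" for z
    unfolding V_def kernel_apply_scale H.apply_shift by (simp add: fixd)
  have GV: "norm (kernel_apply G V z) = norm (kernel_apply G U (z + y)) / M" for z
    unfolding V_def kernel_apply_scale G.apply_shift using M by (simp add: norm_mult norm_divide H.phase_norm)
  have "norm (kernel_apply G V (l - y)) \<le> 1 / (real n + 1)" if "l \<in> \<Lambda>" for l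
  proof -
    have "norm (kernel_apply G U l) * (real n + 1) \<le> s * (real n + 1)"
      using s(2)[OF that] by (intro mult_right_mono) auto
    also have "s * (real n + 1) \<le> M"
      using sM by (simp add: mult.commute)
    finally show ?thesis using M by (simp add: GV field_simps)
  qed
  moreover have "bounded_fixed V"
    unfolding bounded_fixed_def
  proof (intro conjI)
    show "V \<in> borel_measurable borel" unfolding V_def by measurable
    show "bounded (range V)" using V_le by (auto simp: bounded_iff)
    show "kernel_apply H V = V" using HV by blast
  qed
  moreover have "1/2 \<le> norm (V 0)" using y M by (simp add: norm_V field_simps)
  ultimately show ?thesis using V_le by blast
qed

text \<open>A subsequence converges on a countable dense set, and equicontinuity, available because
  each function is its own image under \<open>H\<close>, spreads this to all points. Pointwise
  convergence and domination by the kernels then suffice to pass to the limit in both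
  operators.\<close>

lemma bounded_fixed_subsequence:
  assumes V: "\<And>n. bounded_fixed (V n)" "\<And>n u. norm (V n u) \<le> 1"
  shows "\<exists>k W. strict_mono (k :: nat \<Rightarrow> nat) \<and> bounded_fixed W \<and> (\<forall>z. (\<lambda>n. V (k n) z) \<longlonglongrightarrow> W z) \<and>
    (\<forall>z. (\<lambda>n. kernel_apply G (V (k n)) z) \<longlonglongrightarrow> kernel_apply G W z)"
proof -
  have [measurable]: "V n \<in> borel_measurable borel" and fixd: "\<And>z. kernel_apply H (V n) z = V n z" for n
    using V(1)[of n] by (auto simp: bounded_fixed_def)
  obtain D :: "'a set" where D: "countable D" "\<And>X. open X \<Longrightarrow> X \<noteq> {} \<Longrightarrow> \<exists>d\<in>D. d \<in> X"
    using countable_dense_exists by blast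
  obtain k where k: "strict_mono (k :: nat \<Rightarrow> nat)" "\<And>x. x \<in> D \<Longrightarrow> \<exists>l. (\<lambda>n. V (k n) x) \<longlonglongrightarrow> l"
    using function_convergent_subsequence[OF D(1), of V 1] V(2) by metis
  have "convergent (\<lambda>n. V (k n) z)" for z
  proof -
    have "Cauchy (\<lambda>n. V (k n) z)"
    proof (rule metric_CauchyI)
      fix e :: real assume e: "0 < e"
      obtain d where d: "0 < d" "\<And>x. dist x z < d \<Longrightarrow> (LINT w|lborel. norm (H x w - H z w)) < e / 3"
        using H.kernel_equicontinuous[of "e/3" z] e by auto
      obtain x where x: "x \<in> D" "dist x z < d"
        using D(2)[of "ball z d"] d(1) by (auto simp: dist_commute)
      have close: "dist (V (k n) x) (V (k n) z) < e / 3" for n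
      proof -
        have "norm (kernel_apply H (V (k n)) x - kernel_apply H (V (k n)) z) \<le> (LINT w|lborel. norm (H x w - H z w)) * 1"
          by (rule H.apply_diff_le[OF _ V(2)]) measurable
        then show ?thesis using d(2)[OF x(2)] by (simp add: fixd dist_norm)
      qed
      have "Cauchy (\<lambda>n. V (k n) x)"
        using k(2)[OF x(1)] convergent_Cauchy convergent_def by blast
      then obtain N where N: "\<And>m n. N \<le> m \<Longrightarrow> N \<le> n \<Longrightarrow> dist (V (k m) x) (V (k n) x) < e / 3"
        using metric_CauchyD[of "\<lambda>n. V (k n) x" "e/3"] e by auto
      have "dist (V (k m) z) (V (k n) z) < e" if "N \<le> m" "N \<le> n" for m n
      proof -
        have "dist (V (k m) z) (V (k n) z)
          \<le> dist (V (k m) x) (V (k m) z) + dist (V (k m) x) (V (k n) x) + dist (V (k n) x) (V (k n) z)"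
          using dist_triangle[of "V (k m) z" "V (k n) z" "V (k m) x"] dist_triangle[of "V (k m) x" "V (k n) z" "V (k n) x"]
          by (simp add: dist_commute)
        then show ?thesis using close[of m] close[of n] N[OF that] by linarith
      qed
      then show "\<exists>M. \<forall>m\<ge>M. \<forall>n\<ge>M. dist (V (k m) z) (V (k n) z) < e" by blast
    qed
    then show ?thesis by (simp add: Cauchy_convergent_iff)
  qed
  then obtain W where W: "\<And>z. (\<lambda>n. V (k n) z) \<longlonglongrightarrow> W z"
    unfolding convergent_def by metis
  have [measurable]: "W \<in> borel_measurable borel"
    by (rule borel_measurable_LIMSEQ_metric[where f="\<lambda>n. V (k n)"]) (use W in auto)
  have W_le: "norm (W z) \<le> 1" for z
    using V(2) by (intro LIMSEQ_le_const2[OF tendsto_norm[OF W]]) auto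
  have app: "(\<lambda>n. kernel_apply K (V (k n)) z) \<longlonglongrightarrow> kernel_apply K W z"
    if K: "localized_kernel K \<Theta> B \<kappa>" for K z
  proof -
    interpret K: localized_kernel K \<Theta> B \<kappa> by (rule K)
    show ?thesis
      unfolding kernel_apply_def
    proof (rule tendsto_integral_dominated)
      show "integrable lborel (\<lambda>w. norm (K z w))"
        by (intro integrable_norm K.kernel_integrable)
      show "(\<lambda>n. K z x * V (k n) x) \<longlonglongrightarrow> K z x * W x" for x
        by (intro tendsto_mult tendsto_const W)
      show "norm (K z x * V (k n) x) \<le> norm (K z x)" for n x
        using mult_left_mono[OF V(2)[of "k n" x], of "norm (K z x)"] by (simp add: norm_mult)
    qed measurable
  qed
  have "kernel_apply H W z = W z" for z
    using LIMSEQ_unique[OF app[OF H.localized_kernel_axioms] W[of z, folded fixd]] .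
  then have "bounded_fixed W"
    using W_le by (auto simp: bounded_fixed_def bounded_iff)
  then show ?thesis using k(1) W app[OF G.localized_kernel_axioms] by blast
qed

lemma bounded_lower_bound:
  assumes inj: "\<And>\<Gamma> U. weak_limit_of_translates \<Lambda> \<Gamma> \<Longrightarrow> bounded_fixed U \<Longrightarrow>
      (\<And>\<gamma>. \<gamma> \<in> \<Gamma> \<Longrightarrow> kernel_apply G U \<gamma> = 0) \<Longrightarrow> U = (\<lambda>z. 0)"
  shows "\<exists>C>0. \<forall>U s. bounded_fixed U \<longrightarrow> 0 \<le> s \<longrightarrow> (\<forall>l\<in>\<Lambda>. norm (kernel_apply G U l) \<le> s) \<longrightarrow>
    (\<forall>z. norm (U z) \<le> C * s)"
proof (rule ccontr)
  assume neg: "\<not> ?thesis"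
  have "\<exists>V y. bounded_fixed V \<and> (\<forall>u. norm (V u) \<le> 1) \<and> 1/2 \<le> norm (V 0) \<and>
    (\<forall>l\<in>\<Lambda>. norm (kernel_apply G V (l - y)) \<le> 1 / (real n + 1))" for n
  proof -
    have "0 < real n + 1" by simp
    with neg obtain U s z where "bounded_fixed U" "0 \<le> s" "\<forall>l\<in>\<Lambda>. norm (kernel_apply G U l) \<le> s"
      "\<not> norm (U z) \<le> (real n + 1) * s" by blast
    then show ?thesis by (intro bounded_fixed_normalize[of U s \<Lambda> n z]) auto
  qed
  then obtain V y where V: "\<And>n. bounded_fixed (V n)" "\<And>n u. norm (V n u) \<le> 1" "\<And>n. 1/2 \<le> norm (V n 0)"
    and GV: "\<And>n l. l \<in> \<Lambda> \<Longrightarrow> norm (kernel_apply G (V n) (l - y n)) \<le> 1 / (real n + 1)"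
    by metis
  \<comment> \<open>The point sets are translated along with the functions, so that the image of
    \<open>V n\<close> under \<open>G\<close> is known to be small exactly on the
    \<open>n\<close>-th set.\<close>
  obtain k1 \<Gamma> where k1: "strict_mono (k1 :: nat \<Rightarrow> nat)"
    "weakly_converges (\<lambda>n. (\<lambda>x. x + (- y (k1 n))) ` \<Lambda>) \<Gamma>"
    by (rule weakly_convergent_subsequence[of "\<lambda>n. (\<lambda>x. x + (- y n)) ` \<Lambda>"])
  obtain k2 W where k2: "strict_mono (k2 :: nat \<Rightarrow> nat)" and W: "bounded_fixed W"
    "\<And>z. (\<lambda>n. V (k1 (k2 n)) z) \<longlonglongrightarrow> W z"
    "\<And>z. (\<lambda>n. kernel_apply G (V (k1 (k2 n))) z) \<longlonglongrightarrow> kernel_apply G W z"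
    using bounded_fixed_subsequence[of "\<lambda>n. V (k1 n)"] V by blast
  define k where "k n = k1 (k2 n)" for n
  have k: "strict_mono k" using k1(1) k2 by (auto simp: k_def strict_mono_def)
  define S where "S n = (\<lambda>x. x + (- y (k n))) ` \<Lambda>" for n
  have S: "weakly_converges S \<Gamma>"
    using k1(2) unfolding weakly_converges_def S_def k_def
    by (auto intro: LIMSEQ_subseq_LIMSEQ[OF _ k2, unfolded o_def])
  then have lim: "weak_limit_of_translates \<Lambda> \<Gamma>"
    unfolding weak_limit_of_translates_def S_def by (intro exI[of _ "\<lambda>n. - y (k n)"])
  have "kernel_apply G W \<gamma> = 0" if \<gamma>: "\<gamma> \<in> \<Gamma>" for \<gamma>
  proof -
    have "norm (kernel_apply G W \<gamma>) \<le> e" if e: "0 < e" for e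
    proof (rule LIMSEQ_le)
      show "(\<lambda>n. norm (kernel_apply G (V (k n)) \<gamma>)) \<longlonglongrightarrow> norm (kernel_apply G W \<gamma>)"
        unfolding k_def by (intro tendsto_norm W)
      have "(\<lambda>n. 1 / (real n + 1)) \<longlonglongrightarrow> 0"
        using LIMSEQ_inverse_real_of_nat by (simp add: inverse_eq_divide add.commute)
      then have "(\<lambda>n. 1 / (real (k n) + 1)) \<longlonglongrightarrow> 0"
        using LIMSEQ_subseq_LIMSEQ[OF _ k] by (fastforce simp: o_def)
      then have "(\<lambda>n. 1 / (real (k n) + 1) + e) \<longlonglongrightarrow> 0 + e"
        by (intro tendsto_add tendsto_const)
      then show "(\<lambda>n. 1 / (real (k n) + 1) + e) \<longlonglongrightarrow> e" by simp
      \<comment> \<open>Points of the translated sets only approach \<open>\<gamma>\<close>; the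
        continuity modulus of \<open>G\<close>, which does not depend on \<open>n\<close>, bridges
        the gap at the cost of \<open>e\<close>.\<close>
      obtain d where d: "0 < d" "\<And>x. dist x \<gamma> < d \<Longrightarrow> (LINT w|lborel. norm (G x w - G \<gamma> w)) < e"
        using G.kernel_equicontinuous[OF e, of \<gamma>] by auto
      have "\<forall>\<^sub>F n in sequentially. norm (kernel_apply G (V (k n)) \<gamma>) \<le> 1 / (real (k n) + 1) + e"
        using weakly_converges_eventually_near(2)[OF S d(1) \<gamma>]
      proof eventually_elim
        case (elim n)
        then obtain l where l: "l \<in> \<Lambda>" "dist (l - y (k n)) \<gamma> < d" by (auto simp: S_def)
        have "norm (kernel_apply G (V (k n)) (l - y (k n)) - kernel_apply G (V (k n)) \<gamma>)
          \<le> (LINT w|lborel. norm (G (l - y (k n)) w - G \<gamma> w)) * 1"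
          using V by (intro G.apply_diff_le) (auto simp: bounded_fixed_def)
        then have "norm (kernel_apply G (V (k n)) (l - y (k n)) - kernel_apply G (V (k n)) \<gamma>) \<le> e"
          using d(2)[OF l(2)] by simp
        then show ?case
          using GV[OF l(1), of "k n"]
            norm_triangle_sub[of "kernel_apply G (V (k n)) \<gamma>" "kernel_apply G (V (k n)) (l - y (k n))"]
          by (simp add: norm_minus_commute)
      qed
      then show "\<exists>N. \<forall>n\<ge>N. norm (kernel_apply G (V (k n)) \<gamma>) \<le> 1 / (real (k n) + 1) + e"
        by (simp add: eventually_sequentially)
    qed
    then show ?thesis using field_le_epsilon[of "norm (kernel_apply G W \<gamma>)" 0] by simp
  qed
  from inj[OF lim W(1) this] have "W 0 = 0" by simp
  moreover have "1/2 \<le> norm (W 0)"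
    using V(3) by (intro LIMSEQ_le_const[OF tendsto_norm[OF W(2)]]) auto
  ultimately show False by simp
qed

end

section \<open>Transfer of bounds between the supremum norm and L2\<close>

lemma integrable_indicator_ball:
  "integrable lborel (\<lambda>u. indicator (ball c r) u * (k::real))" for c :: "'a::euclidean_space"
  using emeasure_lborel_ball_finite[of c r] by (intro integrable_mult_left) auto

definition local_sup :: "('a::euclidean_space \<Rightarrow> complex) \<Rightarrow> real \<Rightarrow> 'a \<Rightarrow> real" where
  "local_sup U r v = (SUP u\<in>ball v r. norm (U u))"

text \<open>Suprema over open balls have superlevel sets that are unions of open balls, hence open;
  this gives the measurability.\<close>

lemma local_sup:
  assumes U: "\<And>u. norm (U u) \<le> M" and r: "0 < r"
  shows local_sup_upper: "dist u v < r \<Longrightarrow> norm (U u) \<le> local_sup U r v"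
    and local_sup_bounds: "0 \<le> local_sup U r v" "local_sup U r v \<le> M"
    and local_sup_measurable: "local_sup U r \<in> borel_measurable borel"
    and local_sup_square_le: "(\<And>u. dist u v < r \<Longrightarrow> (norm (U u))\<^sup>2 \<le> X) \<Longrightarrow> (local_sup U r v)\<^sup>2 \<le> X"
proof -
  have bdd: "bdd_above ((\<lambda>u. norm (U u)) ` ball v r)" for v
    by (rule bdd_aboveI2[of _ _ M]) (rule U)
  have ne: "ball v r \<noteq> {}" for v :: 'a using r by simp
  show up: "norm (U u) \<le> local_sup U r v" if "dist u v < r" for u v
    unfolding local_sup_def using that by (intro cSUP_upper bdd) (simp add: dist_commute)
  show nn: "0 \<le> local_sup U r v" for v
    by (rule order_trans[OF norm_ge_zero up[of v v]]) (use r in simp)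
  show "local_sup U r v \<le> M"
    unfolding local_sup_def using U by (intro cSUP_least ne)
  show "local_sup U r \<in> borel_measurable borel"
    unfolding borel_measurable_iff_greater
  proof
    fix t
    have "{v. t < local_sup U r v} = (\<Union>u\<in>{u. t < norm (U u)}. ball u r)"
      unfolding local_sup_def less_cSUP_iff[OF ne bdd] by (auto simp: dist_commute)
    then have "open {v. t < local_sup U r v}" by auto
    then show "{v \<in> space borel. t < local_sup U r v} \<in> sets borel" by simp
  qed
  show "(local_sup U r v)\<^sup>2 \<le> X" if X: "\<And>u. dist u v < r \<Longrightarrow> (norm (U u))\<^sup>2 \<le> X"
  proof -
    have "0 \<le> X" by (rule order_trans[OF zero_le_power2 X[of v]]) (use r in simp)
    have "local_sup U r v \<le> sqrt X"
      unfolding local_sup_def by (intro cSUP_least ne real_le_rsqrt X) (simp add: dist_commute)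
    then have "(local_sup U r v)\<^sup>2 \<le> (sqrt X)\<^sup>2" by (intro power_mono nn)
    with \<open>0 \<le> X\<close> show ?thesis by simp
  qed
qed

lemma infsum_le_of_finite_sums:
  fixes f :: "'b \<Rightarrow> real"
  assumes "\<And>F. finite F \<Longrightarrow> F \<subseteq> X \<Longrightarrow> sum f F \<le> b"
  shows "infsum f X \<le> b"
proof (cases "f summable_on X")
  case True
  then show ?thesis by (rule infsum_le_finite_sums) (use assms in auto)
next
  case False
  then show ?thesis using assms[of "{}"] by (simp add: infsum_not_exists)
qed

lemma square_add_le: "(a + b)\<^sup>2 \<le> 2 * a\<^sup>2 + 2 * (b::real)\<^sup>2"
proof -
  have "0 \<le> (a - b)\<^sup>2" by simp
  then show ?thesis by (simp add: power2_eq_square algebra_simps)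
qed

lemma norm_square_add_le:
  fixes a b :: "'b::real_normed_vector"
  shows "(norm (a + b))\<^sup>2 \<le> 2 * (norm a)\<^sup>2 + 2 * (norm b)\<^sup>2"
  by (rule order_trans[OF power_mono[OF norm_triangle_ineq norm_ge_zero] square_add_le])

lemma (in localized_kernel) apply_continuous:
  assumes "U \<in> borel_measurable borel" and U: "\<And>u. norm (U u) \<le> M"
  shows "continuous_on UNIV (kernel_apply K U)"
  unfolding continuous_on_sequentially o_def
proof (intro allI ballI impI, elim conjE)
  fix x :: "nat \<Rightarrow> 'a" and z assume x: "x \<longlonglongrightarrow> z"
  have "(\<lambda>n. (LINT w|lborel. norm (K (x n) w - K z w)) * M) \<longlonglongrightarrow> 0 * M"
    by (intro tendsto_mult kernel_continuous_L1[OF x] tendsto_const)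
  then have "(\<lambda>n. kernel_apply K U (x n) - kernel_apply K U z) \<longlonglongrightarrow> 0"
    by (intro Lim_null_comparison[OF always_eventually[OF allI[OF apply_diff_le[OF assms]]]]) simp
  then show "(\<lambda>n. kernel_apply K U (x n)) \<longlonglongrightarrow> kernel_apply K U z"
    by (simp add: LIM_zero_iff)
qed

lemma (in localized_kernel) bessel_summable:
  assumes U: "square_integrable U"
    and \<Lambda>: "\<And>x. finite (\<Lambda> \<inter> ball x 1) \<and> card (\<Lambda> \<inter> ball x 1) \<le> N"
  shows "(\<lambda>l. (norm (kernel_apply K U l))\<^sup>2) summable_on \<Lambda>"
    and "(\<Sum>\<^sub>\<infinity>l\<in>\<Lambda>. (norm (kernel_apply K U l))\<^sup>2)
      \<le> real N / measure lborel (ball (0::'a) 1) * (mass\<^sup>2 * (LINT w|lborel. (norm (U w))\<^sup>2))"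
proof -
  show "(\<lambda>l. (norm (kernel_apply K U l))\<^sup>2) summable_on \<Lambda>"
    by (rule nonneg_bdd_above_summable_on) (auto intro!: bdd_aboveI2 bessel[OF U \<Lambda>])
  show "(\<Sum>\<^sub>\<infinity>l\<in>\<Lambda>. (norm (kernel_apply K U l))\<^sup>2)
      \<le> real N / measure lborel (ball (0::'a) 1) * (mass\<^sup>2 * (LINT w|lborel. (norm (U w))\<^sup>2))"
    by (rule infsum_le_of_finite_sums) (rule bessel[OF U \<Lambda>])
qed

context localized_kernel_pair
begin

text \<open>At each \<open>w\<close> the supremum bound is applied to the image under
  \<open>H\<close> of the cutoff of \<open>U\<close> at \<open>w\<close>. It bounds the local
  maximum \<open>a w\<close> by the largest nearby value of \<open>kernel_apply G U\<close> on
  \<open>\<Lambda>\<close> and by commutators. Squaring and integrating over \<open>w\<close> leaves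
  an error of at most half the squared norm of \<open>a\<close>, which is absorbed.\<close>

lemma square_integrable_lower_bound:
  assumes \<Lambda>: "\<And>x. finite (\<Lambda> \<inter> ball x 1) \<and> card (\<Lambda> \<inter> ball x 1) \<le> N0"
    and C: "0 < C" "\<And>U s z. bounded_fixed U \<Longrightarrow> 0 \<le> s \<Longrightarrow>
      (\<And>l. l \<in> \<Lambda> \<Longrightarrow> norm (kernel_apply G U l) \<le> s) \<Longrightarrow> norm (U z) \<le> C * s"
  shows "\<exists>A>0. \<forall>U. square_integrable U \<longrightarrow> kernel_apply H U = U \<longrightarrow>
    A * (LINT u|lborel. (norm (U u))\<^sup>2) \<le> (\<Sum>\<^sub>\<infinity>l\<in>\<Lambda>. (norm (kernel_apply G U l))\<^sup>2)"
proof -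
  \<comment> \<open>The covering comes first: \<open>e\<close> depends on its cardinality, and
    \<open>N\<close> depends on \<open>e\<close>.\<close>
  obtain Y :: "'a set" where Y: "finite Y"
    "\<And>w N. 0 < N \<Longrightarrow> ball w (4 * N) \<subseteq> (\<Union>y\<in>Y. ball (w + N *\<^sub>R y) N)"
    using ball_cover_scaled[of 4, where 'a='a] by blast
  define L where "L = real (card Y)"
  \<comment> \<open>Chosen to make \<open>2 * (C + 1)\<^sup>2 * (4 * e\<^sup>2 * L)\<close> at most
    1/2; \<open>L + 1\<close> keeps the denominator positive.\<close>
  define e where "e = 1 / (4 * (C + 1) * sqrt (L + 1))"
  have L: "0 \<le> L" by (simp add: L_def)
  have e: "0 < e" using C(1) L unfolding e_def by (intro divide_pos_pos mult_pos_pos) auto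
  obtain N where N: "1 \<le> N" "reduced_mass \<Theta> N < e" using H.reduced_mass_small[OF e] by blast
  let ?r = "reduced_envelope \<Theta> N"
  define m where "m = reduced_mass \<Theta> N"
  have N_pos: "0 < N" "0 < 4 * N" using N(1) by auto
  have m: "0 \<le> m" "m < e" using N H.reduced_mass_nonneg[OF N_pos(1)] by (auto simp: m_def)
  have small: "2 * (C + 1)\<^sup>2 * (4 * m\<^sup>2 * L) \<le> 1 / 2"
  proof -
    have "m\<^sup>2 \<le> e\<^sup>2" using m by (intro power_mono) auto
    also have "e\<^sup>2 = 1 / (16 * (C + 1)\<^sup>2 * (L + 1))"
      unfolding e_def power_divide power_mult_distrib using L by (simp del: distrib_left_numeral)
    finally have "2 * (C + 1)\<^sup>2 * (4 * m\<^sup>2 * L) \<le> 2 * (C + 1)\<^sup>2 * (4 * (1 / (16 * (C + 1)\<^sup>2 * (L + 1))) * L)"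
      using L by (intro mult_left_mono mult_right_mono) auto
    also have "\<dots> = (1 / 2) * (L / (L + 1))"
      using C(1) L by (simp add: divide_simps)
    also have "\<dots> \<le> 1 / 2" using L by (simp add: divide_simps)
    finally show ?thesis .
  qed
  \<comment> \<open>Here \<open>N\<close> is already fixed, so this covering by unit balls may
    depend on it; it serves only to show that the local maximum is square integrable.\<close>
  obtain Y1 :: "'a set" where Y1: "finite Y1" "\<And>w. ball w (N * 1) \<subseteq> (\<Union>y\<in>Y1. ball (w + 1 *\<^sub>R y) 1)"
    using ball_cover_scaled[of N, where 'a='a] by (metis zero_less_one)
  define \<beta> where "\<beta> = measure lborel (ball (0::'a) (2 * N))"
  have \<beta>: "0 < \<beta>" unfolding \<beta>_def using N_pos by (intro content_ball_pos) simp
  have \<beta>_eq: "measure lborel (ball l (2 * N)) = \<beta>" for l :: 'a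
    using content_ball_conv_unit_ball[of "2 * N" l] content_ball_conv_unit_ball[of "2 * N" "0::'a"] N_pos
    by (simp add: \<beta>_def)
  have "1 / (4 * C\<^sup>2 * \<beta>) * (LINT u|lborel. (norm (U u))\<^sup>2) \<le> (\<Sum>\<^sub>\<infinity>l\<in>\<Lambda>. (norm (kernel_apply G U l))\<^sup>2)"
    if U: "square_integrable U" and fixd: "kernel_apply H U = U" for U
  proof -
    have [measurable]: "U \<in> borel_measurable borel" using U by (simp add: square_integrable_def)
    obtain M where M: "\<And>u. norm (U u) \<le> M" using H.apply_L2_bounded[OF U] fixd by metis
    let ?\<Sigma> = "\<Sum>\<^sub>\<infinity>l\<in>\<Lambda>. (norm (kernel_apply G U l))\<^sup>2"
    note summ = G.bessel_summable(1)[OF U \<Lambda>]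
    define a where "a = local_sup U N"
    define s where "s = local_sup U (4 * N)"
    note la = local_sup[where U=U and M=M, OF M N_pos(1), folded a_def]
    note ls = local_sup[where U=U and M=M, OF M N_pos(2), folded s_def]
    have [measurable]: "a \<in> borel_measurable borel" "s \<in> borel_measurable borel"
      by (rule la(4), rule ls(4))
    let ?q = "\<lambda>v. LINT w|lborel. \<Theta> (v - w) * (norm (U w))\<^sup>2"
    have q_nonneg: "0 \<le> H.mass * ?q v" for v
      using H.mass_nonneg H.envelope_nonneg by simp
    \<comment> \<open>Square integrability of the local maximum has to be known beforehand, or the
      final absorption of \<open>X / 2\<close> would be void. It follows from the pointwise bound on
      the image under \<open>H\<close>, applied on each of the covering unit balls.\<close>
    have a2: "integrable lborel (\<lambda>v. (a v)\<^sup>2)"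
    proof (rule integrable_norm_le)
      have "integrable lborel (\<lambda>v. H.mass * ?q v)"
        by (intro integrable_mult_right H.envelope_convolution U)
      then have "integrable lborel (\<lambda>v. H.mass * ?q (v + 1 *\<^sub>R y))" for y
        by (rule iffD2[OF integrable_lborel_shift_iff(1)])
      then show "integrable lborel (\<lambda>v. \<Sum>y\<in>Y1. H.mass * ?q (v + 1 *\<^sub>R y))"
        by (rule Bochner_Integration.integrable_sum)
      have "(a v)\<^sup>2 \<le> (\<Sum>y\<in>Y1. H.mass * ?q (v + 1 *\<^sub>R y))" for v
      proof (rule la(5))
        fix u assume "dist u v < N"
        then have "u \<in> ball v (N * 1)" by (simp add: dist_commute)
        then obtain y where y: "y \<in> Y1" "u \<in> ball (v + 1 *\<^sub>R y) 1" using Y1(2) by blast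
        have "(norm (kernel_apply H U u))\<^sup>2 \<le> H.mass * ?q (v + 1 *\<^sub>R y)"
          using y(2) by (intro H.apply_square_integrable U) simp
        also have "\<dots> \<le> (\<Sum>y\<in>Y1. H.mass * ?q (v + 1 *\<^sub>R y))"
          by (intro member_le_sum y(1) Y1(1) q_nonneg)
        finally show "(norm (U u))\<^sup>2 \<le> (\<Sum>y\<in>Y1. H.mass * ?q (v + 1 *\<^sub>R y))" by (simp add: fixd)
      qed
      then show "norm ((a v)\<^sup>2) \<le> (\<Sum>y\<in>Y1. H.mass * ?q (v + 1 *\<^sub>R y))" for v by simp
    qed measurable
    define X where "X = (LINT v|lborel. (a v)\<^sup>2)"
    have a2s: "integrable lborel (\<lambda>v. (a (v + t))\<^sup>2)" "(LINT v|lborel. (a (v + t))\<^sup>2) = X" for t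
      using a2 integrable_lborel_shift_iff(1)[of "\<lambda>v. (a v)\<^sup>2" t] integral_lborel_shift(1)[of "\<lambda>v. (a v)\<^sup>2" t]
      by (auto simp: X_def)
    have s_le: "(s v)\<^sup>2 \<le> (\<Sum>y\<in>Y. (a (v + N *\<^sub>R y))\<^sup>2)" for v
    proof (rule ls(5))
      fix u assume "dist u v < 4 * N"
      then have "u \<in> ball v (4 * N)" by (simp add: dist_commute)
      then obtain y where y: "y \<in> Y" "u \<in> ball (v + N *\<^sub>R y) N" using Y(2)[OF N_pos(1)] by blast
      then have "norm (U u) \<le> a (v + N *\<^sub>R y)" by (intro la(1)) (simp add: dist_commute)
      then have "(norm (U u))\<^sup>2 \<le> (a (v + N *\<^sub>R y))\<^sup>2" by (intro power_mono) auto
      also have "\<dots> \<le> (\<Sum>y\<in>Y. (a (v + N *\<^sub>R y))\<^sup>2)"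
        by (rule member_le_sum[OF y(1) _ Y(1)]) simp
      finally show "(norm (U u))\<^sup>2 \<le> (\<Sum>y\<in>Y. (a (v + N *\<^sub>R y))\<^sup>2)" .
    qed
    have s_int: "integrable lborel (\<lambda>v. \<Sum>y\<in>Y. (a (v + N *\<^sub>R y))\<^sup>2)"
      by (intro Bochner_Integration.integrable_sum a2s)
    have s2: "integrable lborel (\<lambda>v. (s v)\<^sup>2)"
      by (rule integrable_norm_le[OF s_int]) (measurable, simp add: s_le)
    have s2_le: "(LINT v|lborel. (s v)\<^sup>2) \<le> L * X"
    proof -
      have "(LINT v|lborel. (s v)\<^sup>2) \<le> (LINT v|lborel. (\<Sum>y\<in>Y. (a (v + N *\<^sub>R y))\<^sup>2))"
        by (intro integral_mono s2 s_int s_le)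
      also have "\<dots> = L * X"
        by (subst Bochner_Integration.integral_sum) (simp_all add: a2s L_def)
      finally show ?thesis .
    qed
    define t where "t w = (LINT v|lborel. ?r v * s (w - v))" for w
    have s_abs: "\<bar>s v\<bar> \<le> M" for v using ls(2,3)[of v] by simp
    note t2 = H.reduced_convolution_L2[OF N_pos(1) ls(4) s_abs s2, folded t_def m_def]
    have t_nonneg: "0 \<le> t w" for w
      unfolding t_def using H.reduced_envelope_bounds(1)[OF N_pos(1)] ls(2) by simp
    define c where "c w = m * s w + t w" for w
    have c_nonneg: "0 \<le> c w" for w unfolding c_def using m(1) ls(2) t_nonneg by simp
    have com: "norm (commutator H N w U z) \<le> c w" "norm (commutator G N w U z) \<le> c w" for w z
      unfolding c_def t_def m_def
      by (rule H.commutator_sup[OF N(1) _ ls(4,2,3,1)], measurable)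
         (rule G.commutator_sup[OF N(1) _ ls(4,2,3,1)], measurable)
    have c2_le: "(c w)\<^sup>2 \<le> 2 * (m\<^sup>2 * (s w)\<^sup>2) + 2 * (t w)\<^sup>2" for w
      using square_add_le[of "m * s w" "t w"] by (simp add: c_def power_mult_distrib)
    define D where "D w = 2 * (m\<^sup>2 * (s w)\<^sup>2) + 2 * (t w)\<^sup>2" for w
    have D_int: "integrable lborel D"
      unfolding D_def by (intro Bochner_Integration.integrable_add integrable_mult_right s2 t2)
    have D_nonneg: "0 \<le> D w" for w by (simp add: D_def)
    have D_le: "(LINT w|lborel. D w) \<le> 4 * m\<^sup>2 * L * X"
    proof -
      have "(LINT w|lborel. D w) = 2 * (m\<^sup>2 * (LINT w|lborel. (s w)\<^sup>2)) + 2 * (LINT w|lborel. (t w)\<^sup>2)"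
        unfolding D_def using s2 t2(1) by simp
      also have "\<dots> \<le> 2 * (m\<^sup>2 * (LINT w|lborel. (s w)\<^sup>2)) + 2 * (m\<^sup>2 * (LINT w|lborel. (s w)\<^sup>2))"
        using t2(2) by simp
      also have "\<dots> = 4 * (m\<^sup>2 * (LINT w|lborel. (s w)\<^sup>2))" by simp
      also have "\<dots> \<le> 4 * (m\<^sup>2 * (L * X))"
        using s2_le by (intro mult_left_mono) auto
      finally show ?thesis by (simp add: mult.assoc)
    qed
    \<comment> \<open>\<open>\<sigma>\<close> bounds only the values at points within
      \<open>2 * N\<close> of \<open>w\<close>, where the cutoff lives. The commutator with
      \<open>G\<close> enters through the supremum bound with weight \<open>C\<close>, the one with
      \<open>H\<close> with weight 1.\<close>
    have a_le: "a w \<le> C * \<sigma> + (C + 1) * c w"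
      if \<sigma>: "0 \<le> \<sigma>" "\<And>l. l \<in> \<Lambda> \<Longrightarrow> dist l w < 2 * N \<Longrightarrow> norm (kernel_apply G U l) \<le> \<sigma>" for w \<sigma>
    proof -
      let ?W = "\<lambda>u. of_real (cutoff N w u) * U u"
      have W: "?W \<in> borel_measurable borel" by measurable
      have W_le: "norm (?W u) \<le> M" for u
        using mult_mono[OF cutoff_bounds(2)[of N w u] M[of u]] cutoff_bounds(1)[of N w u]
        by (simp add: norm_mult)
      have fix_HW: "bounded_fixed (kernel_apply H ?W)"
        unfolding bounded_fixed_def
        using W H_apply_H[OF W W_le] H.apply_bounded(2)[OF W W_le] by (auto simp: bounded_iff)
      have GW: "norm (kernel_apply G (kernel_apply H ?W) l) \<le> \<sigma> + c w" if l: "l \<in> \<Lambda>" for l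
      proof -
        have "kernel_apply G ?W l = of_real (cutoff N w l) * kernel_apply G U l - commutator G N w U l"
          using G.cutoff_apply[of U M N w l] M by simp
        then have "norm (kernel_apply G ?W l) \<le> norm (of_real (cutoff N w l) * kernel_apply G U l) + c w"
          using norm_triangle_ineq4[of "of_real (cutoff N w l) * kernel_apply G U l" "commutator G N w U l"] com(2)[of w l]
          by simp
        moreover have "norm (of_real (cutoff N w l) * kernel_apply G U l) \<le> \<sigma>"
        proof (cases "dist l w < 2 * N")
          case True
          then show ?thesis
            using mult_mono[OF cutoff_bounds(2)[of N w l] \<sigma>(2)[OF l True]] cutoff_bounds(1)[of N w l]
            by (simp add: norm_mult)
        next
          case False
          then show ?thesis using cutoff_eq_0[OF N_pos(1), of l w] \<sigma>(1) by simp
        qed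
        ultimately show ?thesis by (simp add: G_apply_H[OF W W_le])
      qed
      have HW: "norm (kernel_apply H ?W z) \<le> C * (\<sigma> + c w)" for z
        by (rule C(2)[OF fix_HW _ GW]) (use \<sigma>(1) c_nonneg in auto)
      have "norm (U u) \<le> C * \<sigma> + (C + 1) * c w" if u: "dist u w < N" for u
      proof -
        have "U u = kernel_apply H ?W u + commutator H N w U u"
          using H.cutoff_apply[of U M N w u] M cutoff_eq_1[OF N_pos(1), of u w] u by (simp add: fixd)
        then have "norm (U u) \<le> norm (kernel_apply H ?W u) + norm (commutator H N w U u)"
          using norm_triangle_ineq[of "kernel_apply H ?W u"] by metis
        also have "\<dots> \<le> C * (\<sigma> + c w) + c w" by (intro add_mono HW com)
        finally show ?thesis by (simp add: algebra_simps)
      qed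
      then show ?thesis
        unfolding a_def local_sup_def using N_pos by (intro cSUP_least) (auto simp: dist_commute)
    qed
    have fin: "finite (\<Lambda> \<inter> ball x r)" for x r
      using relatively_separated_ball_card[OF \<Lambda>] by blast
    let ?g = "\<lambda>l. (norm (kernel_apply G U l))\<^sup>2"
    \<comment> \<open>Over a ball only finitely many points of \<open>\<Lambda>\<close> are
      involved, so the sum of their contributions is integrated termwise; \<open>R\<close> tends to
      infinity afterwards.\<close>
    have partial: "(LINT w|lborel. indicator (ball 0 R) w * (a w)\<^sup>2) \<le> 2 * C\<^sup>2 * (\<beta> * ?\<Sigma>) + X / 2" for R
    proof -
      define F where "F = \<Lambda> \<inter> ball 0 (R + 2 * N)"
      have F: "finite F" unfolding F_def by (rule fin)
      \<comment> \<open>\<open>sqrt (P w)\<close> dominates every value at a point of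
        \<open>F\<close> within \<open>2 * N\<close> of \<open>w\<close>, and integrating
        \<open>P\<close> weights each squared value by the volume \<open>\<beta>\<close> of a ball
        of that radius.\<close>
      define P where "P w = (\<Sum>l\<in>F. indicator (ball l (2 * N)) w * ?g l)" for w
      have P_int: "integrable lborel P"
        unfolding P_def by (intro Bochner_Integration.integrable_sum integrable_indicator_ball)
      have P_nonneg: "0 \<le> P w" for w unfolding P_def by (intro sum_nonneg) simp
      have "indicator (ball 0 R) w * (a w)\<^sup>2 \<le> 2 * C\<^sup>2 * P w + 2 * (C + 1)\<^sup>2 * D w" for w
      proof (cases "w \<in> ball 0 R")
        case True
        have gP: "?g l \<le> P w" if "l \<in> \<Lambda>" "dist l w < 2 * N" for l
        proof -
          have "dist 0 l \<le> dist 0 w + dist w l" by (rule dist_triangle)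
          then have "l \<in> F" using that True by (auto simp: F_def dist_commute)
          then have "indicator (ball l (2 * N)) w * ?g l \<le> P w"
            unfolding P_def by (intro member_le_sum F) auto
          then show ?thesis using that by simp
        qed
        have "a w \<le> C * sqrt (P w) + (C + 1) * c w"
          by (rule a_le) (use P_nonneg gP in \<open>auto intro: real_le_rsqrt\<close>)
        moreover have "0 \<le> a w" by (rule la(2))
        ultimately have "(a w)\<^sup>2 \<le> (C * sqrt (P w) + (C + 1) * c w)\<^sup>2" by (intro power_mono)
        also have "\<dots> \<le> 2 * (C * sqrt (P w))\<^sup>2 + 2 * ((C + 1) * c w)\<^sup>2" by (rule square_add_le)
        also have "\<dots> = 2 * C\<^sup>2 * P w + 2 * (C + 1)\<^sup>2 * (c w)\<^sup>2"
          using P_nonneg by (simp add: power_mult_distrib)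
        also have "\<dots> \<le> 2 * C\<^sup>2 * P w + 2 * (C + 1)\<^sup>2 * D w"
          using c2_le[of w] unfolding D_def[symmetric] by (intro add_left_mono mult_left_mono) auto
        finally show ?thesis using True by simp
      next
        case False
        then show ?thesis using P_nonneg D_nonneg by simp
      qed
      then have "(LINT w|lborel. indicator (ball 0 R) w * (a w)\<^sup>2)
          \<le> (LINT w|lborel. 2 * C\<^sup>2 * P w + 2 * (C + 1)\<^sup>2 * D w)"
        by (intro integral_mono Bochner_Integration.integrable_add integrable_mult_right P_int D_int)
           (auto intro!: integrable_norm_le[OF a2] simp: indicator_def)
      also have "\<dots> = 2 * C\<^sup>2 * (LINT w|lborel. P w) + 2 * (C + 1)\<^sup>2 * (LINT w|lborel. D w)"
        using P_int D_int by simp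
      also have "(LINT w|lborel. P w) = (\<Sum>l\<in>F. \<beta> * ?g l)"
        unfolding P_def
        by (subst Bochner_Integration.integral_sum[OF integrable_indicator_ball]) (simp add: \<beta>_eq)
      also have "\<dots> = \<beta> * (\<Sum>l\<in>F. ?g l)" by (simp add: sum_distrib_left)
      also have "(\<Sum>l\<in>F. ?g l) \<le> ?\<Sigma>"
        by (rule finite_sum_le_infsum[OF summ F]) (auto simp: F_def)
      also have "2 * (C + 1)\<^sup>2 * (LINT w|lborel. D w) \<le> 2 * (C + 1)\<^sup>2 * (4 * m\<^sup>2 * L * X)"
        by (intro mult_left_mono D_le) auto
      also have "2 * (C + 1)\<^sup>2 * (4 * m\<^sup>2 * L * X) = 2 * (C + 1)\<^sup>2 * (4 * m\<^sup>2 * L) * X" by simp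
      also have "\<dots> \<le> 1 / 2 * X"
        by (intro mult_right_mono small) (simp add: X_def)
      finally show ?thesis using \<beta> C(1) by (simp add: mult_left_mono)
    qed
    have "(\<lambda>n. LINT w|lborel. indicator (ball 0 (real n)) w * (a w)\<^sup>2) \<longlonglongrightarrow> X"
      unfolding X_def
    proof (rule tendsto_integral_dominated[OF a2])
      fix w :: 'a
      obtain n0 where n0: "norm w < real n0" using reals_Archimedean2 by blast
      have "\<forall>\<^sub>F n in sequentially. indicator (ball 0 (real n)) w * (a w)\<^sup>2 = (a w)\<^sup>2"
        using eventually_ge_at_top[of n0] by eventually_elim (use n0 in auto)
      then show "(\<lambda>n. indicator (ball 0 (real n)) w * (a w)\<^sup>2) \<longlonglongrightarrow> (a w)\<^sup>2"
        by (rule tendsto_eventually)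
    qed (auto simp: indicator_def)
    then have "X \<le> 2 * C\<^sup>2 * (\<beta> * ?\<Sigma>) + X / 2"
      by (rule LIMSEQ_le_const2) (use partial in blast)
    then have X_le: "X \<le> 4 * C\<^sup>2 * \<beta> * ?\<Sigma>" by simp
    have "(LINT u|lborel. (norm (U u))\<^sup>2) \<le> X"
      unfolding X_def using U a2 la(1)[of u u for u] N_pos
      by (intro integral_mono power_mono) (auto simp: square_integrable_def)
    then have "(LINT u|lborel. (norm (U u))\<^sup>2) \<le> 4 * C\<^sup>2 * \<beta> * ?\<Sigma>" using X_le by linarith
    then show ?thesis using \<beta> C(1) by (simp add: field_simps)
  qed
  then show ?thesis
    using \<beta> C(1) by (intro exI[of _ "1 / (4 * C\<^sup>2 * \<beta>)"]) auto
qed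

text \<open>The quantity to be absorbed is \<open>T\<close>, the supremum of the squared L2 norms of
  \<open>U\<close> over balls of radius \<open>N\<close>. The lower bound is tested on a compactly
  supported cutoff of \<open>U\<close>. As \<open>kernel_apply G U\<close> vanishes on
  \<open>\<Gamma>\<close>, it is arbitrarily small on a suitable translate of
  \<open>\<Lambda>\<close> near the support of the cutoff, and only commutators remain.\<close>

lemma bounded_fixed_eq_zero:
  assumes \<Lambda>: "\<And>x. finite (\<Lambda> \<inter> ball x 1) \<and> card (\<Lambda> \<inter> ball x 1) \<le> N0"
    and A: "0 < A" "\<And>W. W \<in> borel_measurable borel \<Longrightarrow> bounded (range W) \<Longrightarrow> \<exists>r. \<forall>z. r \<le> norm z \<longrightarrow> W z = 0 \<Longrightarrow>
      A * (LINT z|lborel. (norm (kernel_apply H W z))\<^sup>2) \<le> (\<Sum>\<^sub>\<infinity>l\<in>\<Lambda>. (norm (kernel_apply G W l))\<^sup>2)"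
    and \<Gamma>: "weak_limit_of_translates \<Lambda> \<Gamma>"
    and U: "bounded_fixed U" "\<And>\<gamma>. \<gamma> \<in> \<Gamma> \<Longrightarrow> kernel_apply G U \<gamma> = 0"
  shows "U = (\<lambda>z. 0)"
proof -
  have [measurable]: "U \<in> borel_measurable borel" and fixd: "\<And>z. kernel_apply H U z = U z"
    and "bounded (range U)"
    using U(1) by (auto simp: bounded_fixed_def)
  then obtain M where M: "\<And>u. norm (U u) \<le> M" by (auto simp: bounded_iff)
  obtain \<tau> where "weakly_converges (\<lambda>n. (\<lambda>x. x + \<tau> n) ` \<Lambda>) \<Gamma>"
    using \<Gamma> unfolding weak_limit_of_translates_def by blast
  define S where "S n = (\<lambda>x. x + \<tau> n) ` \<Lambda>" for n
  have S: "weakly_converges S \<Gamma>" unfolding S_def by fact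
  have S_sep: "finite (S n \<inter> ball x 1) \<and> card (S n \<inter> ball x 1) \<le> N0" for n x
    unfolding S_def by (rule relatively_separated_shift[OF \<Lambda>])
  obtain Y :: "'a set" where Y: "finite Y"
    "\<And>w N. 0 < N \<Longrightarrow> ball w (3 * N) \<subseteq> (\<Union>y\<in>Y. ball (w + N *\<^sub>R y) N)"
    using ball_cover_scaled[of 3, where 'a='a] by blast
  define \<omega> where "\<omega> = measure lborel (ball (0::'a) 1)"
  have \<omega>: "0 < \<omega>" unfolding \<omega>_def by (rule content_ball_pos) simp
  define L where "L = real (card Y)"
  \<comment> \<open>The summand with \<open>N0\<close> comes from the commutator of \<open>G\<close>
    summed over separated points, the 4 from the commutator of \<open>H\<close>. The numerical
    factors collect two uses of \<open>norm_square_add_le\<close> and the factor 2 of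
    \<open>commutator_L2\<close>.\<close>
  define C where "C = 8 * real N0 / (\<omega> * A) + 4"
  have L: "0 \<le> L" and C: "0 < C"
    using \<omega> A(1) by (auto simp: L_def C_def add_nonneg_pos)
  define e where "e = sqrt (1 / (2 * C * (L + 1)))"
  have e: "0 < e" using C L by (simp add: e_def)
  obtain N where N: "1 \<le> N" "reduced_mass \<Theta> N < e" using H.reduced_mass_small[OF e] by blast
  have N_pos: "0 < N" using N(1) by simp
  define m where "m = reduced_mass \<Theta> N"
  have m: "0 \<le> m" "m < e" using N H.reduced_mass_nonneg[OF N_pos] by (auto simp: m_def)
  have small: "C * m\<^sup>2 * L \<le> 1 / 2"
  proof -
    have "m\<^sup>2 \<le> e\<^sup>2" using m by (intro power_mono) auto
    also have "e\<^sup>2 = 1 / (2 * C * (L + 1))" using C L by (simp add: e_def)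
    finally have "C * m\<^sup>2 * L \<le> C * (1 / (2 * C * (L + 1))) * L"
      using C L by (intro mult_left_mono mult_right_mono) auto
    also have "\<dots> = (1 / 2) * (L / (L + 1))" using C L by (simp add: divide_simps)
    also have "\<dots> \<le> 1 / 2" using L by (simp add: divide_simps)
    finally show ?thesis .
  qed
  define J where "J r w = (LINT u|lborel. indicator (ball w r) u * (norm (U u))\<^sup>2)" for r w
  have U2: "(norm (U u))\<^sup>2 \<le> M\<^sup>2" for u using M[of u] by (intro power_mono) auto
  have J_int: "integrable lborel (\<lambda>u. indicator (ball w r) u * (norm (U u))\<^sup>2)" for r w
    by (rule integrable_norm_le[OF integrable_indicator_ball[of w r "M\<^sup>2"]]) (use U2 in \<open>auto simp: indicator_def\<close>)
  have J_nonneg: "0 \<le> J r w" for r w unfolding J_def by simp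
  have J_bdd: "bdd_above (range (J N))"
  proof (rule bdd_aboveI2)
    fix w
    have "J N w \<le> (LINT u|lborel. indicator (ball w N) u * M\<^sup>2)"
      unfolding J_def by (intro integral_mono J_int integrable_indicator_ball mult_left_mono U2) simp
    also have "\<dots> = measure lborel (ball w N) * M\<^sup>2" by simp
    also have "\<dots> = measure lborel (ball (0::'a) N) * M\<^sup>2"
      using content_ball_conv_unit_ball[of N w] content_ball_conv_unit_ball[of N "0::'a"] N_pos by simp
    finally show "J N w \<le> measure lborel (ball (0::'a) N) * M\<^sup>2" .
  qed
  define T where "T = (SUP w. J N w)"
  have J_le_T: "J N w \<le> T" for w unfolding T_def by (intro cSUP_upper J_bdd) simp
  have T: "0 \<le> T" using J_le_T[of 0] J_nonneg[of N 0] by linarith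
  have J3: "J (3 * N) w \<le> L * T" for w
  proof -
    have "J (3 * N) w \<le> (LINT u|lborel. (\<Sum>y\<in>Y. indicator (ball (w + N *\<^sub>R y) N) u * (norm (U u))\<^sup>2))"
      unfolding J_def
    proof (intro integral_mono J_int Bochner_Integration.integrable_sum)
      fix u
      show "indicator (ball w (3 * N)) u * (norm (U u))\<^sup>2 \<le> (\<Sum>y\<in>Y. indicator (ball (w + N *\<^sub>R y) N) u * (norm (U u))\<^sup>2)"
      proof (cases "u \<in> ball w (3 * N)")
        case True
        then obtain y where y: "y \<in> Y" "u \<in> ball (w + N *\<^sub>R y) N" using Y(2)[OF N_pos] by blast
        have "indicator (ball (w + N *\<^sub>R y) N) u * (norm (U u))\<^sup>2
          \<le> (\<Sum>y\<in>Y. indicator (ball (w + N *\<^sub>R y) N) u * (norm (U u))\<^sup>2)"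
          by (rule member_le_sum[OF y(1) _ Y(1)]) simp
        then show ?thesis using True y(2) by simp
      qed (simp add: sum_nonneg)
    qed
    also have "\<dots> = (\<Sum>y\<in>Y. J N (w + N *\<^sub>R y))"
      unfolding J_def by (rule Bochner_Integration.integral_sum) (rule J_int)
    also have "\<dots> \<le> (\<Sum>y\<in>Y. T)" by (intro sum_mono J_le_T)
    finally show ?thesis by (simp add: L_def)
  qed
  obtain N1 where N1: "\<And>x. finite (\<Lambda> \<inter> ball x (2 * N)) \<and> card (\<Lambda> \<inter> ball x (2 * N)) \<le> N1"
    using relatively_separated_ball_card[OF \<Lambda>] by blast
  have S_card: "finite (S n \<inter> ball x (2 * N)) \<and> card (S n \<inter> ball x (2 * N)) \<le> N1" for n x
    unfolding S_def by (rule relatively_separated_shift[OF N1])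
  \<comment> \<open>Twisting a translate of \<open>W\<close> by phases leaves all moduli intact, so
    the lower bound for \<open>\<Lambda>\<close> holds for its translates with the same
    \<open>A\<close>.\<close>
  have translated: "A * (LINT z|lborel. (norm (kernel_apply H W z))\<^sup>2)
      \<le> (\<Sum>\<^sub>\<infinity>l\<in>\<Lambda>. (norm (kernel_apply G W (l + a)))\<^sup>2)"
    if W: "W \<in> borel_measurable borel" "bounded (range W)" "\<And>z. r \<le> norm z \<Longrightarrow> W z = 0" for W a r
  proof -
    let ?W = "\<lambda>z. cnj (\<kappa> a z) * W (z + a)"
    have [measurable]: "\<kappa> a \<in> borel_measurable borel" "W \<in> borel_measurable borel"
      by (rule H.phase_measurable, rule W(1))
    have "?W \<in> borel_measurable borel" by measurable
    moreover have "bounded (range ?W)"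
      using W(2) by (auto simp: bounded_iff norm_mult H.phase_norm)
    moreover have "?W z = 0" if z: "r + norm a \<le> norm z" for z
    proof -
      have "norm z \<le> norm (z + a) + norm a" using norm_triangle_ineq4[of "z + a" a] by simp
      then show ?thesis using W(3)[of "z + a"] z by simp
    qed
    ultimately have "A * (LINT z|lborel. (norm (kernel_apply H ?W z))\<^sup>2) \<le> (\<Sum>\<^sub>\<infinity>l\<in>\<Lambda>. (norm (kernel_apply G ?W l))\<^sup>2)"
      by (intro A(2)) blast+
    then show ?thesis
      unfolding H.apply_shift G.apply_shift
      using integral_lborel_shift(1)[of "\<lambda>z. (norm (kernel_apply H W z))\<^sup>2" a]
      by (simp add: norm_mult H.phase_norm)
  qed
  have key: "J N w \<le> C * m\<^sup>2 * (L * T) + 4 * real N1 * \<delta>\<^sup>2 / A" if \<delta>: "0 < \<delta>" for w \<delta>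
  proof -
    let ?W = "\<lambda>u. of_real (cutoff N w u) * U u"
    let ?cH = "\<lambda>z. commutator H N w U z" and ?cG = "\<lambda>z. commutator G N w U z"
    have W[measurable]: "?W \<in> borel_measurable borel" by measurable
    have W_le: "norm (?W u) \<le> M" for u
      using mult_mono[OF cutoff_bounds(2)[of N w u] M[of u]] cutoff_bounds(1)[of N w u]
      by (simp add: norm_mult)
    have W_supp: "?W z = 0" if "norm w + 2 * N \<le> norm z" for z
    proof -
      have "norm z \<le> dist z w + norm w" using norm_triangle_sub[of z w] by (simp add: dist_norm)
      then show ?thesis using cutoff_eq_0[OF N_pos, of z w] that by simp
    qed
    have W_sq: "square_integrable ?W"
      unfolding square_integrable_def
    proof (intro conjI W integrable_norm_le[OF integrable_indicator_ball[of w "2 * N" "M\<^sup>2"]])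
      fix u
      show "norm ((norm (?W u))\<^sup>2) \<le> indicator (ball w (2 * N)) u * M\<^sup>2"
      proof (cases "u \<in> ball w (2 * N)")
        case True
        then show ?thesis using power_mono[OF W_le, of u 2] by simp
      next
        case False
        then show ?thesis using cutoff_eq_0[OF N_pos, of u w] by (simp add: dist_commute)
      qed
    qed measurable
    obtain qH where qH: "integrable lborel qH" "\<And>v. 0 \<le> qH v" "(LINT v|lborel. qH v) \<le> 2 * m\<^sup>2 * (L * T)"
      "\<And>z v. dist v z \<le> 1 \<Longrightarrow> (norm (?cH z))\<^sup>2 \<le> qH v"
      using H.commutator_L2[OF N(1) _ M J3[unfolded J_def], of w] unfolding m_def by auto
    obtain qG where qG: "integrable lborel qG" "\<And>v. 0 \<le> qG v" "(LINT v|lborel. qG v) \<le> 2 * m\<^sup>2 * (L * T)"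
      "\<And>z v. dist v z \<le> 1 \<Longrightarrow> (norm (?cG z))\<^sup>2 \<le> qG v"
      using G.commutator_L2[OF N(1) _ M J3[unfolded J_def], of w] unfolding m_def by auto
    \<comment> \<open>The radius exceeds \<open>2 * N\<close> by 1, since the partner in
      \<open>\<Gamma>\<close> of a point within \<open>2 * N\<close> may lie up to 1 further
      away.\<close>
    have "uniformly_continuous_on (cball w (2 * N + 1)) (kernel_apply G U)"
    proof (rule compact_uniformly_continuous[OF continuous_on_subset])
      show "continuous_on UNIV (kernel_apply G U)" by (rule G.apply_continuous[OF _ M]) measurable
    qed auto
    then obtain d where d: "0 < d" "\<And>x y. x \<in> cball w (2 * N + 1) \<Longrightarrow> y \<in> cball w (2 * N + 1) \<Longrightarrow> dist x y < d \<Longrightarrow>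
        dist (kernel_apply G U x) (kernel_apply G U y) < \<delta>"
      using \<delta> unfolding uniformly_continuous_on_def by (metis dist_commute)
    have "\<forall>\<^sub>F n in sequentially. \<forall>l\<in>S n \<inter> cball w (2 * N). \<exists>\<gamma>\<in>\<Gamma>. dist l \<gamma> < min d 1"
      by (rule weakly_converges_eventually_near(1)[OF S]) (use d(1) in simp)
    then obtain n where n: "\<And>l. l \<in> S n \<inter> cball w (2 * N) \<Longrightarrow> \<exists>\<gamma>\<in>\<Gamma>. dist l \<gamma> < min d 1"
      unfolding eventually_sequentially by blast
    have GU_small: "norm (kernel_apply G U l) \<le> \<delta>" if l: "l \<in> S n" "dist l w < 2 * N" for l
    proof -
      obtain \<gamma> where \<gamma>: "\<gamma> \<in> \<Gamma>" "dist l \<gamma> < d" "dist l \<gamma> < 1"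
        using n[of l] l by (auto simp: dist_commute)
      have "dist w \<gamma> \<le> dist w l + dist l \<gamma>" by (rule dist_triangle)
      then have "dist (kernel_apply G U l) (kernel_apply G U \<gamma>) < \<delta>"
        using l \<gamma> by (intro d(2)) (auto simp: dist_commute)
      then show ?thesis using U(2)[OF \<gamma>(1)] by (simp add: dist_norm)
    qed
    have "(\<Sum>\<^sub>\<infinity>l\<in>\<Lambda>. (norm (kernel_apply G ?W (l + \<tau> n)))\<^sup>2) \<le> 2 * (real N1 * \<delta>\<^sup>2) + 2 * (real N0 / \<omega> * (2 * m\<^sup>2 * (L * T)))"
    proof (rule infsum_le_of_finite_sums)
      fix F assume F: "finite F" "F \<subseteq> \<Lambda>"
      let ?F = "(\<lambda>x. x + \<tau> n) ` F"
      have F': "finite ?F" "?F \<subseteq> S n" using F by (auto simp: S_def)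
      have "(\<Sum>l\<in>F. (norm (kernel_apply G ?W (l + \<tau> n)))\<^sup>2) = (\<Sum>l\<in>?F. (norm (kernel_apply G ?W l))\<^sup>2)"
        by (subst sum.reindex) (auto simp: inj_on_def)
      also have "\<dots> \<le> (\<Sum>l\<in>?F. 2 * (norm (of_real (cutoff N w l) * kernel_apply G U l))\<^sup>2 + 2 * (norm (?cG l))\<^sup>2)"
      proof (rule sum_mono)
        fix l
        have "kernel_apply G ?W l = of_real (cutoff N w l) * kernel_apply G U l + (- ?cG l)"
          using G.cutoff_apply[of U M N w l] M by simp
        then show "(norm (kernel_apply G ?W l))\<^sup>2 \<le> 2 * (norm (of_real (cutoff N w l) * kernel_apply G U l))\<^sup>2 + 2 * (norm (?cG l))\<^sup>2"
          using norm_square_add_le[of "of_real (cutoff N w l) * kernel_apply G U l" "- ?cG l"] by simp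
      qed
      also have "\<dots> = 2 * (\<Sum>l\<in>?F. (norm (of_real (cutoff N w l) * kernel_apply G U l))\<^sup>2) + 2 * (\<Sum>l\<in>?F. (norm (?cG l))\<^sup>2)"
        by (simp add: sum.distrib sum_distrib_left)
      also have "(\<Sum>l\<in>?F. (norm (?cG l))\<^sup>2) \<le> real N0 / \<omega> * (LINT v|lborel. qG v)"
        unfolding \<omega>_def using qG
        by (intro relatively_separated_sum_le[OF S_sep F']) (auto simp: dist_commute)
      also have "real N0 / \<omega> * (LINT v|lborel. qG v) \<le> real N0 / \<omega> * (2 * m\<^sup>2 * (L * T))"
        using \<omega> by (intro mult_left_mono qG) auto
      also have "(\<Sum>l\<in>?F. (norm (of_real (cutoff N w l) * kernel_apply G U l))\<^sup>2) \<le> real N1 * \<delta>\<^sup>2"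
      proof -
        have "(\<Sum>l\<in>?F. (norm (of_real (cutoff N w l) * kernel_apply G U l))\<^sup>2)
            = (\<Sum>l\<in>?F \<inter> ball w (2 * N). (norm (of_real (cutoff N w l) * kernel_apply G U l))\<^sup>2)"
        proof (rule sum.mono_neutral_right[OF F'(1)])
          show "\<forall>l\<in>?F - ?F \<inter> ball w (2 * N). (norm (of_real (cutoff N w l) * kernel_apply G U l))\<^sup>2 = 0"
          proof
            fix l assume "l \<in> ?F - ?F \<inter> ball w (2 * N)"
            then have "2 * N \<le> dist l w" by (auto simp: dist_commute not_less)
            then show "(norm (of_real (cutoff N w l) * kernel_apply G U l))\<^sup>2 = 0"
              using cutoff_eq_0[OF N_pos, of l w] by simp
          qed
        qed simp
        also have "\<dots> \<le> (\<Sum>l\<in>?F \<inter> ball w (2 * N). \<delta>\<^sup>2)"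
        proof (intro sum_mono power_mono)
          fix l assume l: "l \<in> ?F \<inter> ball w (2 * N)"
          then have "norm (kernel_apply G U l) \<le> \<delta>" using F'(2) by (intro GU_small) (auto simp: dist_commute)
          then show "norm (of_real (cutoff N w l) * kernel_apply G U l) \<le> \<delta>"
            using mult_mono[OF cutoff_bounds(2)[of N w l]] cutoff_bounds(1)[of N w l] by (fastforce simp: norm_mult)
        qed simp
        also have "\<dots> = real (card (?F \<inter> ball w (2 * N))) * \<delta>\<^sup>2" by simp
        also have "\<dots> \<le> real N1 * \<delta>\<^sup>2"
        proof (intro mult_right_mono)
          have "card (?F \<inter> ball w (2 * N)) \<le> card (S n \<inter> ball w (2 * N))"
            using S_card F'(2) by (intro card_mono) auto
          also have "\<dots> \<le> N1" using S_card by blast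
          finally show "real (card (?F \<inter> ball w (2 * N))) \<le> real N1" by simp
        qed simp
        finally show ?thesis .
      qed
      finally show "(\<Sum>l\<in>F. (norm (kernel_apply G ?W (l + \<tau> n)))\<^sup>2) \<le> 2 * (real N1 * \<delta>\<^sup>2) + 2 * (real N0 / \<omega> * (2 * m\<^sup>2 * (L * T)))"
        by simp
    qed
    moreover have "A * (LINT z|lborel. (norm (kernel_apply H ?W z))\<^sup>2) \<le> (\<Sum>\<^sub>\<infinity>l\<in>\<Lambda>. (norm (kernel_apply G ?W (l + \<tau> n)))\<^sup>2)"
      by (rule translated[OF W _ W_supp]) (use W_le in \<open>auto simp: bounded_iff\<close>)
    ultimately have "A * (LINT z|lborel. (norm (kernel_apply H ?W z))\<^sup>2) \<le> 2 * (real N1 * \<delta>\<^sup>2) + 2 * (real N0 / \<omega> * (2 * m\<^sup>2 * (L * T)))"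
      by linarith
    then have HW: "(LINT z|lborel. (norm (kernel_apply H ?W z))\<^sup>2) \<le> (2 * (real N1 * \<delta>\<^sup>2) + 2 * (real N0 / \<omega> * (2 * m\<^sup>2 * (L * T)))) / A"
      using A(1) by (simp add: pos_le_divide_eq mult.commute)
    have HW_sq: "integrable lborel (\<lambda>z. (norm (kernel_apply H ?W z))\<^sup>2)"
      using H.apply_square_integrable_bound(1)[OF W_sq] by (simp add: square_integrable_def)
    have "J N w \<le> (LINT z|lborel. 2 * (norm (kernel_apply H ?W z))\<^sup>2 + 2 * qH z)"
      unfolding J_def
    proof (intro integral_mono J_int Bochner_Integration.integrable_add integrable_mult_right HW_sq qH)
      fix z
      show "indicator (ball w N) z * (norm (U z))\<^sup>2 \<le> 2 * (norm (kernel_apply H ?W z))\<^sup>2 + 2 * qH z"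
      proof (cases "z \<in> ball w N")
        case True
        then have "U z = kernel_apply H ?W z + ?cH z"
          using H.cutoff_apply[of U M N w z] M cutoff_eq_1[OF N_pos, of z w] by (simp add: fixd dist_commute)
        then have "(norm (U z))\<^sup>2 \<le> 2 * (norm (kernel_apply H ?W z))\<^sup>2 + 2 * (norm (?cH z))\<^sup>2"
          using norm_square_add_le by metis
        also have "\<dots> \<le> 2 * (norm (kernel_apply H ?W z))\<^sup>2 + 2 * qH z" using qH(4)[of z z] by simp
        finally show ?thesis using True by simp
      qed (simp add: qH)
    qed
    also have "\<dots> = 2 * (LINT z|lborel. (norm (kernel_apply H ?W z))\<^sup>2) + 2 * (LINT z|lborel. qH z)"
      using HW_sq qH(1) by simp
    also have "\<dots> \<le> 2 * ((2 * (real N1 * \<delta>\<^sup>2) + 2 * (real N0 / \<omega> * (2 * m\<^sup>2 * (L * T)))) / A) + 2 * (2 * m\<^sup>2 * (L * T))"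
      using HW qH(3) by linarith
    also have "\<dots> = C * m\<^sup>2 * (L * T) + 4 * real N1 * \<delta>\<^sup>2 / A"
      using A(1) \<omega> by (simp add: C_def field_simps)
    finally show ?thesis .
  qed
  have "J N w \<le> T / 2" for w
  proof -
    have "(\<lambda>n. C * m\<^sup>2 * (L * T) + 4 * real N1 * (inverse (real (Suc n)))\<^sup>2 / A) \<longlonglongrightarrow> C * m\<^sup>2 * (L * T) + 4 * real N1 * 0\<^sup>2 / A"
      using A(1) by (intro tendsto_intros LIMSEQ_inverse_real_of_nat) auto
    then have "J N w \<le> C * m\<^sup>2 * (L * T) + 4 * real N1 * 0\<^sup>2 / A"
      by (rule LIMSEQ_le_const) (use key in auto)
    also have "\<dots> \<le> T / 2"
      using mult_right_mono[OF small T] by (simp add: mult.assoc)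
    finally show ?thesis .
  qed
  then have "T \<le> T / 2" unfolding T_def by (intro cSUP_least) (auto simp: T_def)
  then have "T = 0" using T by simp
  then have J0: "J N w = 0" for w using J_le_T[of w] J_nonneg[of N w] by simp
  obtain D :: "'a set" where D: "countable D" "\<And>X. open X \<Longrightarrow> X \<noteq> {} \<Longrightarrow> \<exists>d\<in>D. d \<in> X"
    using countable_dense_exists by blast
  have "AE u in lborel. indicator (ball w N) u * (norm (U u))\<^sup>2 = 0" for w
    using J0[of w] integral_nonneg_eq_0_iff_AE[OF J_int[of w N]] by (simp add: J_def)
  then have "AE u in lborel. \<forall>w\<in>D. indicator (ball w N) u * (norm (U u))\<^sup>2 = 0"
    unfolding AE_ball_countable[OF D(1)] by blast
  then have U0: "AE u in lborel. U u = 0"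
  proof eventually_elim
    case (elim u)
    obtain w where w: "w \<in> D" "w \<in> ball u N" using D(2)[of "ball u N"] N_pos by auto
    then have "u \<in> ball w N" by (simp add: dist_commute)
    with elim w(1) show ?case by fastforce
  qed
  \<comment> \<open>\<open>U\<close> vanishes almost everywhere, and being its own image under
    \<open>H\<close> it vanishes everywhere.\<close>
  have "U z = 0" for z
  proof -
    have "kernel_apply H U z = (LINT w::'a|lborel. 0)"
      unfolding kernel_apply_def by (rule integral_cong_AE) (use U0 in auto)
    then show ?thesis by (simp add: fixd)
  qed
  then show ?thesis by blast
qed

end

section \<open>Fourier analysis with Gaussian summation\<close>

lemma cis_borel_measurable [measurable]: "cis \<in> borel_measurable borel"
  by (intro borel_measurable_continuous_onI continuous_on_cis continuous_on_id)

lemma integrable_integral_lborel_prod: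
  fixes f :: "'a::euclidean_space \<Rightarrow> real \<Rightarrow> complex"
  assumes f: "\<And>b. b \<in> Basis \<Longrightarrow> integrable lborel (f b)"
  shows integrable_lborel_prod: "integrable lborel (\<lambda>x::'a. \<Prod>b\<in>Basis. f b (x \<bullet> b))"
    and integral_lborel_prod: "(LINT x|lborel. (\<Prod>b\<in>Basis. f b ((x::'a) \<bullet> b))) = (\<Prod>b\<in>Basis. (LINT y|lborel. f b y))"
proof -
  interpret product_sigma_finite "\<lambda>b::'a. lborel :: real measure"
    by standard
  let ?T = "\<lambda>g. \<Sum>b\<in>Basis. g b *\<^sub>R b :: 'a"
  let ?P = "\<Pi>\<^sub>M b\<in>(Basis :: 'a set). (lborel :: real measure)"
  have [measurable]: "f b \<in> borel_measurable borel" if "b \<in> Basis" for b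
    using borel_measurable_integrable[OF f[OF that]] by simp
  have L: "(lborel :: 'a measure) = distr ?P borel ?T" by (rule lborel_eq)
  have T: "?T \<in> ?P \<rightarrow>\<^sub>M borel" by measurable
  have m: "(\<lambda>x::'a. \<Prod>b\<in>Basis. f b (x \<bullet> b)) \<in> borel_measurable borel" by measurable
  have "integrable ?P (\<lambda>g. \<Prod>b\<in>Basis. f b (g b))"
    by (rule product_integrable_prod) (use f in auto)
  then have "integrable ?P (\<lambda>g. \<Prod>b\<in>Basis. f b (?T g \<bullet> b))"
    by (simp add: inner_sum_left_Basis cong: prod.cong)
  then show "integrable lborel (\<lambda>x::'a. \<Prod>b\<in>Basis. f b (x \<bullet> b))"
    by (subst L) (subst integrable_distr_eq[OF T m])
  have "(LINT x|lborel. (\<Prod>b\<in>Basis. f b ((x::'a) \<bullet> b))) = (LINT g|?P. (\<Prod>b\<in>Basis. f b (?T g \<bullet> b)))"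
    by (subst L) (rule integral_distr[OF T m])
  also have "\<dots> = (LINT g|?P. (\<Prod>b\<in>Basis. f b (g b)))"
    by (simp add: inner_sum_left_Basis cong: prod.cong)
  also have "\<dots> = (\<Prod>b\<in>Basis. (LINT y|lborel. f b y))"
    by (rule product_integral_prod) (use f in auto)
  finally show "(LINT x|lborel. (\<Prod>b\<in>Basis. f b ((x::'a) \<bullet> b))) = (\<Prod>b\<in>Basis. (LINT y|lborel. f b y))" .
qed

definition gauss :: "'a::euclidean_space \<Rightarrow> real" where
  "gauss x = (\<Prod>b\<in>Basis. std_normal_density (x \<bullet> b))"

text \<open>With the kernel \<open>cis (2 * pi * (\<xi> \<bullet> v))\<close> the Fourier transform
  of \<open>gauss\<close> is \<open>gauss 0\<close> times this probability density; hence the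
  standard deviation \<open>1 / (2 * pi)\<close>.\<close>

definition gauss_dual :: "'a::euclidean_space \<Rightarrow> real" where
  "gauss_dual x = (\<Prod>b\<in>Basis. normal_density 0 (1 / (2 * pi)) (x \<bullet> b))"

lemma gauss_nonneg: "0 \<le> gauss x" "0 \<le> gauss_dual x"
  by (auto simp: gauss_def gauss_dual_def intro!: prod_nonneg)

lemma gauss_0_pos: "0 < gauss 0"
  unfolding gauss_def by (intro prod_pos) (simp add: std_normal_density_def)

lemma gauss_measurable [measurable]: "gauss \<in> borel_measurable borel" "gauss_dual \<in> borel_measurable borel"
  unfolding gauss_def gauss_dual_def by measurable

lemma gauss_integrable: "integrable lborel (gauss :: 'a::euclidean_space \<Rightarrow> real)"
proof -
  have "integrable lborel (\<lambda>x::'a. \<Prod>b\<in>Basis. complex_of_real (std_normal_density (x \<bullet> b)))"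
    by (rule integrable_lborel_prod) (intro integrable_of_real integrable_normal_density; simp)
  then have "integrable lborel (\<lambda>x::'a. norm (\<Prod>b\<in>Basis. complex_of_real (std_normal_density (x \<bullet> b))))"
    by (rule integrable_norm)
  then show ?thesis
    by (simp add: gauss_def[abs_def] prod_norm[symmetric])
qed

lemma gauss_dual_integral:
  "integrable lborel (gauss_dual :: 'a::euclidean_space \<Rightarrow> real)" "(LINT x::'a|lborel. gauss_dual x) = 1"
proof -
  let ?n = "normal_density 0 (1 / (2 * pi))"
  have i: "integrable lborel (\<lambda>y. complex_of_real (?n y))"
    by (intro integrable_of_real integrable_normal_density) simp
  have "integrable lborel (\<lambda>x::'a. \<Prod>b\<in>Basis. complex_of_real (?n (x \<bullet> b)))"
    by (rule integrable_lborel_prod[OF i])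
  then have "integrable lborel (\<lambda>x::'a. norm (\<Prod>b\<in>Basis. complex_of_real (?n (x \<bullet> b))))"
    by (rule integrable_norm)
  then show 1: "integrable lborel (gauss_dual :: 'a \<Rightarrow> real)"
    by (simp add: gauss_dual_def[abs_def] prod_norm[symmetric])
  have "complex_of_real (LINT x::'a|lborel. gauss_dual x) = (LINT x::'a|lborel. (\<Prod>b\<in>Basis. complex_of_real (?n (x \<bullet> b))))"
    by (simp add: gauss_dual_def integral_complex_of_real[symmetric] del: integral_complex_of_real)
  also have "\<dots> = 1"
    by (subst integral_lborel_prod[OF i]) simp
  finally show "(LINT x::'a|lborel. gauss_dual x) = 1" by simp
qed

text \<open>The integral factors over the coordinates into characteristic functions of the standard
  normal distribution.\<close>

lemma gauss_fourier:
  "(LINT \<xi>|lborel. complex_of_real (gauss \<xi>) * cis (2 * pi * (\<xi> \<bullet> v))) = of_real (gauss (0::'a) * gauss_dual v)"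
  for v :: "'a::euclidean_space"
proof -
  let ?f = "\<lambda>b y. complex_of_real (std_normal_density y) * cis (2 * pi * (v \<bullet> b) * y)"
  have i: "integrable lborel (?f b)" for b
    by (rule integrable_norm_le[OF integrable_normal_density[of 1 0]]) (auto simp: norm_mult)
  have one: "(LINT y|lborel. ?f b y) = of_real (std_normal_density 0 * normal_density 0 (1 / (2 * pi)) (v \<bullet> b))" for b
  proof -
    have "(LINT y|lborel. ?f b y) = char std_normal_distribution (2 * pi * (v \<bullet> b))"
      unfolding char_def
      by (subst integral_density) (auto simp: normal_density_nonneg cis_conv_exp scaleR_conv_of_real mult_ac)
    also have "\<dots> = of_real (exp (- ((2 * pi * (v \<bullet> b))\<^sup>2) / 2))"
      by (simp add: char_std_normal_distribution)
    also have "exp (- ((2 * pi * (v \<bullet> b))\<^sup>2) / 2) = std_normal_density 0 * normal_density 0 (1 / (2 * pi)) (v \<bullet> b)"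
    proof -
      have "sqrt (2 * pi * (1 / (2 * pi))\<^sup>2) = 1 / sqrt (2 * pi)"
        by (rule real_sqrt_unique) (simp_all add: power_divide power2_eq_square)
      then show ?thesis
        by (simp add: normal_density_def power_mult_distrib power_divide field_simps)
    qed
    finally show ?thesis .
  qed
  have "(LINT \<xi>|lborel. complex_of_real (gauss \<xi>) * cis (2 * pi * (\<xi> \<bullet> v))) = (LINT \<xi>|lborel. (\<Prod>b\<in>Basis. ?f b (\<xi> \<bullet> b)))"
  proof (rule Bochner_Integration.integral_cong[OF refl])
    fix \<xi> :: 'a
    have "2 * pi * (\<xi> \<bullet> v) = (\<Sum>b\<in>Basis. 2 * pi * (v \<bullet> b) * (\<xi> \<bullet> b))"
      by (subst euclidean_inner) (simp add: sum_distrib_left mult_ac)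
    then have "cis (2 * pi * (\<xi> \<bullet> v)) = (\<Prod>b\<in>Basis. cis (2 * pi * (v \<bullet> b) * (\<xi> \<bullet> b)))"
      by (simp only: cis_conv_exp of_real_sum sum_distrib_left exp_sum[OF finite_Basis])
    then show "complex_of_real (gauss \<xi>) * cis (2 * pi * (\<xi> \<bullet> v)) = (\<Prod>b\<in>Basis. ?f b (\<xi> \<bullet> b))"
      by (simp add: gauss_def prod.distrib)
  qed
  also have "\<dots> = of_real (gauss (0::'a) * gauss_dual v)"
    by (subst integral_lborel_prod[OF i]) (simp only: one, simp add: gauss_def gauss_dual_def prod.distrib)
  finally show ?thesis .
qed

section \<open>Gaussian summation, inversion and continuity of translation\<close>

definition fourier :: "('a::euclidean_space \<Rightarrow> complex) \<Rightarrow> 'a \<Rightarrow> complex" where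
  "fourier h \<xi> = (LINT s|lborel. h s * cis (- (2 * pi * (\<xi> \<bullet> s))))"

lemma fourier_bounded: "integrable lborel h \<Longrightarrow> norm (fourier h \<xi>) \<le> (LINT s|lborel. norm (h s))"
  unfolding fourier_def by (rule norm_integral_le) (auto simp: norm_mult)

lemma integrable_borelD: "integrable lborel h \<Longrightarrow> h \<in> borel_measurable borel"
  using borel_measurable_integrable by force

lemma integrable_mult_cis:
  assumes "integrable lborel (h :: 'a::euclidean_space \<Rightarrow> complex)" "f \<in> borel_measurable borel"
  shows "integrable lborel (\<lambda>s. h s * cis (f s))"
  by (rule integrable_norm_le[OF integrable_norm[OF assms(1)]])
     (use assms integrable_borelD[OF assms(1)] in \<open>auto simp: norm_mult\<close>)

lemma fourier_measurable [measurable]: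
  assumes [measurable]: "h \<in> borel_measurable borel"
  shows "fourier h \<in> borel_measurable borel"
  unfolding fourier_def by measurable

lemma gauss_scaled_integrable:
  "0 < e \<Longrightarrow> integrable lborel (\<lambda>\<xi>::'a::euclidean_space. gauss (e *\<^sub>R \<xi>))"
  using integrable_lborel_affine[OF gauss_integrable, of e 0] by simp

text \<open>A Gaussian factor makes the inversion integral absolutely convergent for every
  integrable \<open>h\<close>, and Fubini turns it into an average of \<open>h\<close> near
  \<open>t\<close> with weight \<open>gauss_dual\<close>. Inversion, uniqueness and Plancherel all
  result from letting \<open>e\<close> tend to 0 in this identity.\<close>

lemma gauss_summation:
  fixes h :: "'a::euclidean_space \<Rightarrow> complex"
  assumes h: "integrable lborel h" and e: "0 < e"
  shows "(LINT \<xi>|lborel. fourier h \<xi> * cis (2 * pi * (\<xi> \<bullet> t)) * of_real (gauss (e *\<^sub>R \<xi>)))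
    = of_real (gauss (0::'a)) * (LINT u|lborel. h (t - e *\<^sub>R u) * of_real (gauss_dual u))"
proof -
  have [measurable]: "h \<in> borel_measurable borel" by (rule integrable_borelD[OF h])
  let ?f = "\<lambda>\<xi> s. h s * cis (2 * pi * (\<xi> \<bullet> (t - s))) * of_real (gauss (e *\<^sub>R \<xi>))"
  have m: "(\<lambda>p. ?f (fst p) (snd p)) \<in> borel_measurable borel"
    unfolding borel_prod[symmetric] by measurable
  have i: "integrable lborel (?f \<xi>)" for \<xi>
    by (intro integrable_mult_left integrable_mult_cis h) measurable
  have w: "(LINT s|lborel. norm (?f \<xi> s)) \<le> (LINT s|lborel. norm (h s)) * gauss (e *\<^sub>R \<xi>)" for \<xi>
    using gauss_nonneg(1)[of "e *\<^sub>R \<xi>"] by (simp add: norm_mult)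
  have wi: "integrable lborel (\<lambda>\<xi>. (LINT s|lborel. norm (h s)) * gauss (e *\<^sub>R \<xi>))"
    by (intro integrable_mult_right gauss_scaled_integrable e)
  have "(LINT \<xi>|lborel. fourier h \<xi> * cis (2 * pi * (\<xi> \<bullet> t)) * of_real (gauss (e *\<^sub>R \<xi>)))
      = (LINT \<xi>|lborel. LINT s|lborel. ?f \<xi> s)"
  proof (rule Bochner_Integration.integral_cong[OF refl])
    fix \<xi> :: 'a
    have "fourier h \<xi> * cis (2 * pi * (\<xi> \<bullet> t)) * of_real (gauss (e *\<^sub>R \<xi>))
        = (LINT s|lborel. h s * cis (- (2 * pi * (\<xi> \<bullet> s))) * (cis (2 * pi * (\<xi> \<bullet> t)) * of_real (gauss (e *\<^sub>R \<xi>))))"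
      unfolding fourier_def
      by (subst mult.assoc) (rule Bochner_Integration.integral_mult_left_zero[symmetric])
    also have "\<dots> = (LINT s|lborel. ?f \<xi> s)"
    proof (rule Bochner_Integration.integral_cong[OF refl])
      fix s
      have "cis (2 * pi * (\<xi> \<bullet> (t - s))) = cis (- (2 * pi * (\<xi> \<bullet> s))) * cis (2 * pi * (\<xi> \<bullet> t))"
        by (simp add: cis_mult inner_diff_right right_diff_distrib)
      then show "h s * cis (- (2 * pi * (\<xi> \<bullet> s))) * (cis (2 * pi * (\<xi> \<bullet> t)) * of_real (gauss (e *\<^sub>R \<xi>))) = ?f \<xi> s"
        by (simp only: mult.assoc)
    qed
    finally show "fourier h \<xi> * cis (2 * pi * (\<xi> \<bullet> t)) * of_real (gauss (e *\<^sub>R \<xi>)) = (LINT s|lborel. ?f \<xi> s)" .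
  qed
  also have "\<dots> = (LINT s|lborel. LINT \<xi>|lborel. ?f \<xi> s)"
    by (rule fubini_dominated_swap[where f="?f", OF m i w wi])
  also have "\<dots> = (LINT s|lborel. h s * of_real (gauss (0::'a) * (gauss_dual ((1/e) *\<^sub>R (t - s)) / e ^ DIM('a))))"
  proof (rule Bochner_Integration.integral_cong[OF refl])
    fix s
    have "(LINT \<xi>|lborel. of_real (gauss \<xi>) * cis (2 * pi * (\<xi> \<bullet> ((1/e) *\<^sub>R (t - s)))))
        = (e ^ DIM('a)) *\<^sub>R (LINT \<xi>|lborel. of_real (gauss (e *\<^sub>R \<xi>)) * cis (2 * pi * (\<xi> \<bullet> (t - s))))"
      using integral_lborel_affine[of e "\<lambda>\<xi>. complex_of_real (gauss \<xi>) * cis (2 * pi * (\<xi> \<bullet> ((1/e) *\<^sub>R (t - s))))" 0] e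
      by simp
    then have "(LINT \<xi>|lborel. of_real (gauss (e *\<^sub>R \<xi>)) * cis (2 * pi * (\<xi> \<bullet> (t - s))))
        = of_real (gauss (0::'a) * gauss_dual ((1/e) *\<^sub>R (t - s)) / e ^ DIM('a))"
      using e unfolding gauss_fourier by (simp add: scaleR_conv_of_real field_simps)
    then have "h s * (LINT \<xi>|lborel. of_real (gauss (e *\<^sub>R \<xi>)) * cis (2 * pi * (\<xi> \<bullet> (t - s))))
        = h s * of_real (gauss (0::'a) * (gauss_dual ((1/e) *\<^sub>R (t - s)) / e ^ DIM('a)))" by simp
    then show "(LINT \<xi>|lborel. ?f \<xi> s) = h s * of_real (gauss (0::'a) * (gauss_dual ((1/e) *\<^sub>R (t - s)) / e ^ DIM('a)))"
      by (simp add: mult_ac flip: Bochner_Integration.integral_mult_right_zero)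
  qed
  also have "\<dots> = (e ^ DIM('a)) *\<^sub>R (LINT u|lborel. h (t - e *\<^sub>R u) * of_real (gauss (0::'a) * (gauss_dual u / e ^ DIM('a))))"
    using integral_lborel_affine[of "-e" "\<lambda>s. h s * of_real (gauss (0::'a) * (gauss_dual ((1/e) *\<^sub>R (t - s)) / e ^ DIM('a)))" t] e
    by simp
  also have "(LINT u|lborel. h (t - e *\<^sub>R u) * of_real (gauss (0::'a) * (gauss_dual u / e ^ DIM('a))))
      = (LINT u|lborel. of_real (gauss (0::'a) / e ^ DIM('a)) * (h (t - e *\<^sub>R u) * of_real (gauss_dual u)))"
    by (intro Bochner_Integration.integral_cong) (auto simp: mult_ac)
  also have "\<dots> = of_real (gauss (0::'a) / e ^ DIM('a)) * (LINT u|lborel. h (t - e *\<^sub>R u) * of_real (gauss_dual u))"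
    by (rule Bochner_Integration.integral_mult_right_zero)
  finally show ?thesis using e by (simp add: scaleR_conv_of_real)
qed

lemma inverse_Suc_scaleR_tendsto_0: "(\<lambda>n. inverse (real (Suc n)) *\<^sub>R u) \<longlonglongrightarrow> 0"
  for u :: "'a::real_normed_vector"
  using tendsto_scaleR[OF LIMSEQ_inverse_real_of_nat tendsto_const[of u]] by simp

lemma gauss_le_0: "gauss x \<le> gauss (0::'a)" for x :: "'a::euclidean_space"
  unfolding gauss_def by (intro prod_mono) (auto simp: std_normal_density_def divide_right_mono)

lemma gauss_scaled_tendsto: "(\<lambda>n. gauss (inverse (real (Suc n)) *\<^sub>R \<xi>)) \<longlonglongrightarrow> gauss (0::'a)"
  for \<xi> :: "'a::euclidean_space"
proof -
  have "isCont (gauss :: 'a \<Rightarrow> real) 0"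
    unfolding gauss_def std_normal_density_def by (intro continuous_intros) auto
  then show ?thesis
    by (rule isCont_tendsto_compose) (rule inverse_Suc_scaleR_tendsto_0)
qed

text \<open>Both sides of \<open>gauss_summation\<close> converge as the Gaussian widens: one is
  dominated by the integrable transform, the other by the bound on \<open>h\<close> together with
  its continuity at \<open>t\<close>. The common factor \<open>gauss 0\<close> cancels.\<close>

lemma fourier_inversion:
  fixes h :: "'a::euclidean_space \<Rightarrow> complex"
  assumes h: "integrable lborel h" "continuous_on UNIV h" "\<And>s. norm (h s) \<le> M"
    and fh: "integrable lborel (fourier h)"
  shows "(LINT \<xi>|lborel. fourier h \<xi> * cis (2 * pi * (\<xi> \<bullet> t))) = h t"
proof -
  have [measurable]: "h \<in> borel_measurable borel" by (rule integrable_borelD[OF h(1)])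
  let ?e = "\<lambda>n. inverse (real (Suc n))"
  have 1: "(\<lambda>n. LINT \<xi>|lborel. fourier h \<xi> * cis (2 * pi * (\<xi> \<bullet> t)) * of_real (gauss (?e n *\<^sub>R \<xi>)))
     \<longlonglongrightarrow> (LINT \<xi>|lborel. fourier h \<xi> * cis (2 * pi * (\<xi> \<bullet> t)) * of_real (gauss (0::'a)))"
  proof (rule tendsto_integral_dominated)
    show "integrable lborel (\<lambda>\<xi>. norm (fourier h \<xi>) * gauss (0::'a))"
      by (intro integrable_mult_left integrable_norm fh)
    show "norm (fourier h x * cis (2 * pi * (x \<bullet> t)) * of_real (gauss (?e n *\<^sub>R x))) \<le> norm (fourier h x) * gauss (0::'a)" for n x
      using gauss_nonneg(1)[of "?e n *\<^sub>R x"] gauss_le_0[of "?e n *\<^sub>R x"]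
      by (simp add: norm_mult mult_left_mono)
    show "(\<lambda>n. fourier h x * cis (2 * pi * (x \<bullet> t)) * of_real (gauss (?e n *\<^sub>R x)))
        \<longlonglongrightarrow> fourier h x * cis (2 * pi * (x \<bullet> t)) * of_real (gauss (0::'a))" for x
      by (intro tendsto_mult tendsto_const tendsto_of_real gauss_scaled_tendsto)
  qed measurable
  have 2: "(\<lambda>n. of_real (gauss (0::'a)) * (LINT u|lborel. h (t - ?e n *\<^sub>R u) * of_real (gauss_dual u)))
     \<longlonglongrightarrow> of_real (gauss (0::'a)) * (LINT u::'a|lborel. h t * of_real (gauss_dual u))"
  proof (rule tendsto_mult[OF tendsto_const], rule tendsto_integral_dominated)
    show "integrable lborel (\<lambda>u::'a. M * gauss_dual u)"
      by (intro integrable_mult_right gauss_dual_integral)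
    show "norm (h (t - ?e n *\<^sub>R x) * of_real (gauss_dual x)) \<le> M * gauss_dual x" for n x
      using h(3) gauss_nonneg(2)[of x] by (simp add: norm_mult mult_right_mono)
    have "(\<lambda>n. t - ?e n *\<^sub>R u) \<longlonglongrightarrow> t - 0" for u :: 'a
      by (intro tendsto_diff tendsto_const inverse_Suc_scaleR_tendsto_0)
    moreover have "isCont h t" using h(2) by (simp add: continuous_on_eq_continuous_at)
    ultimately show "(\<lambda>n. h (t - ?e n *\<^sub>R x) * of_real (gauss_dual x)) \<longlonglongrightarrow> h t * of_real (gauss_dual x)" for x
      by (intro tendsto_mult tendsto_const isCont_tendsto_compose[of t h]) auto
  qed measurable
  have 3: "(LINT u::'a|lborel. h t * of_real (gauss_dual u)) = h t"
    using gauss_dual_integral(2)[where 'a='a] by (simp add: integral_complex_of_real)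
  have "(LINT \<xi>|lborel. fourier h \<xi> * cis (2 * pi * (\<xi> \<bullet> t)) * of_real (gauss (?e n *\<^sub>R \<xi>)))
    = of_real (gauss (0::'a)) * (LINT u|lborel. h (t - ?e n *\<^sub>R u) * of_real (gauss_dual u))" for n
    by (rule gauss_summation[OF h(1)]) simp
  from LIMSEQ_unique[OF 1[unfolded this] 2]
  show ?thesis unfolding 3 using gauss_0_pos[where 'a='a] by simp
qed

text \<open>The property passes to L1 limits (\<open>approx\<close>). For indicators of open sets of
  finite measure it follows from dominated convergence, since \<open>s - v n\<close> eventually
  stays in the open set; outer regularity extends it to measurable sets and
  \<open>integrable_induct\<close> to all integrable functions.\<close>

lemma L1_translation_continuous:
  fixes h :: "'a::euclidean_space \<Rightarrow> 'b::{banach, second_countable_topology}"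
  assumes h: "integrable lborel h" and v: "v \<longlonglongrightarrow> 0"
  shows "(\<lambda>n. LINT s|lborel. norm (h (s - v n) - h s)) \<longlonglongrightarrow> 0"
proof -
  define P where "P f \<longleftrightarrow> (\<lambda>n. LINT s|lborel. norm (f (s - v n) - f s)) \<longlonglongrightarrow> 0" for f :: "'a \<Rightarrow> 'b"
  have sh: "integrable lborel (\<lambda>s. f (s - a))" if "integrable lborel f" for f :: "'a \<Rightarrow> 'b" and a
    using that integrable_lborel_shift_iff(2)[of f a] by simp
  have nn: "0 \<le> (LINT s|lborel. norm (f (s - v n) - f s))" for f :: "'a \<Rightarrow> 'b" and n by simp
  have approx: "P f"
    if f: "integrable lborel f" and g: "\<And>e. 0 < e \<Longrightarrow> \<exists>g. integrable lborel g \<and> P g \<and> (LINT s|lborel. norm (f s - g s)) < e"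
    for f
    unfolding P_def
  proof (rule LIMSEQ_I)
    fix r :: real assume "0 < r"
    then obtain g where g: "integrable lborel g" "P g" "(LINT s|lborel. norm (f s - g s)) < r / 3"
      using g[of "r/3"] by auto
    obtain n0 where n0: "\<And>n. n0 \<le> n \<Longrightarrow> (LINT s|lborel. norm (g (s - v n) - g s)) < r / 3"
      using LIMSEQ_D[OF g(2)[unfolded P_def], of "r/3"] \<open>0 < r\<close> by auto
    have "(LINT s|lborel. norm (f (s - v n) - f s)) < r" if n: "n0 \<le> n" for n
    proof -
      have fg: "integrable lborel (\<lambda>s. norm (f s - g s))" by (intro integrable_norm Bochner_Integration.integrable_diff f g)
      have fg': "integrable lborel (\<lambda>s. norm (f (s - v n) - g (s - v n)))"
        by (intro integrable_norm Bochner_Integration.integrable_diff sh f g)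
      have gg: "integrable lborel (\<lambda>s. norm (g (s - v n) - g s))"
        by (intro integrable_norm Bochner_Integration.integrable_diff sh f g)
      have "(LINT s|lborel. norm (f (s - v n) - f s))
        \<le> (LINT s|lborel. norm (f (s - v n) - g (s - v n)) + norm (g (s - v n) - g s) + norm (f s - g s))"
      proof (intro integral_mono Bochner_Integration.integrable_add fg fg' gg integrable_norm Bochner_Integration.integrable_diff sh f)
        fix s
        have "norm ((f (s - v n) - g (s - v n)) + (g (s - v n) - g s) + (g s - f s))
          \<le> norm (f (s - v n) - g (s - v n)) + norm (g (s - v n) - g s) + norm (g s - f s)"
          by (intro order_trans[OF norm_triangle_ineq] add_mono order_refl norm_triangle_ineq)
        then show "norm (f (s - v n) - f s) \<le> norm (f (s - v n) - g (s - v n)) + norm (g (s - v n) - g s) + norm (f s - g s)"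
          by (simp add: norm_minus_commute[of "g s" "f s"])
      qed
      also have "\<dots> = (LINT s|lborel. norm (f (s - v n) - g (s - v n))) + (LINT s|lborel. norm (g (s - v n) - g s)) + (LINT s|lborel. norm (f s - g s))"
        using fg fg' gg by simp
      also have "(LINT s|lborel. norm (f (s - v n) - g (s - v n))) = (LINT s|lborel. norm (f s - g s))"
        by (rule integral_lborel_shift)
      finally show ?thesis using g(3) n0[OF n] by linarith
    qed
    then show "\<exists>no. \<forall>n\<ge>no. norm ((LINT s|lborel. norm (f (s - v n) - f s)) - 0) < r"
      using nn by (intro exI[of _ n0]) auto
  qed
  have ind_open: "P (\<lambda>x. indicator U x *\<^sub>R c)" if U: "open U" "emeasure lborel U < \<infinity>" for U and c :: 'b
  proof -
    have [measurable]: "U \<in> sets borel" using U(1) by simp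
    have i: "integrable lborel (indicator U :: 'a \<Rightarrow> real)" using U(2) by simp
    have i': "integrable lborel (\<lambda>s. indicator U (s - a) :: real)" for a
      using i integrable_lborel_shift_iff(2)[of "indicator U :: 'a \<Rightarrow> real" a] by simp
    have ii: "integrable lborel (\<lambda>s. indicator U s * indicator U (s - a) :: real)" for a
      by (rule integrable_norm_le[OF i]) (auto simp: indicator_def)
    have "(LINT s|lborel. norm (indicator U (s - a) *\<^sub>R c - indicator U s *\<^sub>R c))
      = norm c * (2 * (LINT s|lborel. indicator U s) - 2 * (LINT s|lborel. indicator U s * indicator U (s - a)))" for a
    proof -
      have "norm (indicator U (s - a) *\<^sub>R c - indicator U s *\<^sub>R c)
        = norm c * (indicator U (s - a) + indicator U s - 2 * (indicator U s * indicator U (s - a)))" for s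
        by (auto simp: indicator_def)
      then have "(LINT s|lborel. norm (indicator U (s - a) *\<^sub>R c - indicator U s *\<^sub>R c))
        = (LINT s|lborel. norm c * (indicator U (s - a) + indicator U s - 2 * (indicator U s * indicator U (s - a))))" by simp
      also have "\<dots> = norm c * ((LINT s|lborel. indicator U (s - a)) + (LINT s|lborel. indicator U s) - 2 * (LINT s|lborel. indicator U s * indicator U (s - a)))"
        using i i' ii by simp
      also have "(LINT s|lborel. indicator U (s - a) :: real) = (LINT s|lborel. indicator U s)"
        by (rule integral_lborel_shift)
      finally show ?thesis by simp
    qed
    moreover have "(\<lambda>n. LINT s|lborel. indicator U s * indicator U (s - v n) :: real) \<longlonglongrightarrow> (LINT s|lborel. indicator U s)"
    proof (rule tendsto_integral_dominated[OF i])
      fix s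
      show "(\<lambda>n. indicator U s * indicator U (s - v n) :: real) \<longlonglongrightarrow> indicator U s"
      proof (cases "s \<in> U")
        case True
        have "(\<lambda>n. s - v n) \<longlonglongrightarrow> s - 0" by (intro tendsto_diff tendsto_const v)
        then have "\<forall>\<^sub>F n in sequentially. s - v n \<in> U"
          using topological_tendstoD[OF _ U(1)] True by fastforce
        then have "\<forall>\<^sub>F n in sequentially. indicator U s * indicator U (s - v n) = (indicator U s :: real)"
          by eventually_elim (use True in auto)
        then show ?thesis by (rule tendsto_eventually)
      qed auto
    qed (auto simp: indicator_def)
    then have "(\<lambda>n. norm c * (2 * (LINT s|lborel. indicator U s) - 2 * (LINT s|lborel. indicator U s * indicator U (s - v n))))
        \<longlonglongrightarrow> norm c * (2 * (LINT s|lborel. indicator U s) - 2 * (LINT s|lborel. indicator U s))"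
      by (intro tendsto_intros)
    ultimately show ?thesis by (simp add: P_def)
  qed
  from h have "P h"
  proof (induction rule: integrable_induct)
    case (base A c)
    then have A: "A \<in> sets borel" "emeasure lborel A < \<infinity>" by auto
    show ?case
    proof (rule approx)
      show "integrable lborel (\<lambda>x. indicator A x *\<^sub>R c)" using A by (intro integrable_scaleR_left) auto
      fix e :: real assume e: "0 < e"
      define d where "d = e / (norm c + 1)"
      have d: "0 < d" using e by (simp add: d_def add_nonneg_pos)
      obtain U where U: "open U" "A \<subseteq> U" "emeasure lborel (U - A) < d"
        using outer_regular_lborel[OF A(1) d] by blast
      have [measurable]: "U \<in> sets borel" "A \<in> sets borel" using U(1) A by auto
      have UA: "U = A \<union> (U - A)" using U(2) by blast
      have "emeasure lborel U \<le> emeasure lborel A + emeasure lborel (U - A)"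
        by (subst UA) (rule emeasure_subadditive; simp)
      also have "\<dots> < \<infinity>" using A(2) U(3) by (simp add: ennreal_add_less_top less_trans[OF U(3)])
      finally have Ufin: "emeasure lborel U < \<infinity>" .
      have fin: "emeasure lborel (U - A) < \<infinity>" using U(3) by (rule less_trans) simp
      have "(LINT s|lborel. norm (indicator A s *\<^sub>R c - indicator U s *\<^sub>R c)) = (LINT s|lborel. indicator (U - A) s * norm c)"
        using U(2) by (intro Bochner_Integration.integral_cong) (auto simp: indicator_def)
      also have "\<dots> = measure lborel (U - A) * norm c" by simp
      also have "\<dots> \<le> d * norm c"
        using U(3) fin d by (intro mult_right_mono) (auto simp: emeasure_eq_ennreal_measure ennreal_less_iff)
      also have "\<dots> < e" using e by (simp add: d_def divide_less_eq add_nonneg_pos)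
      finally show "\<exists>g. integrable lborel g \<and> P g \<and> (LINT s|lborel. norm (indicator A s *\<^sub>R c - g s)) < e"
        using Ufin U(1) by (intro exI[of _ "\<lambda>s. indicator U s *\<^sub>R c"] conjI ind_open integrable_scaleR_left) auto
    qed
  next
    case (add f g)
    have "(\<lambda>n. (LINT s|lborel. norm (f (s - v n) - f s)) + (LINT s|lborel. norm (g (s - v n) - g s))) \<longlonglongrightarrow> 0 + 0"
      using add(3,4) unfolding P_def by (intro tendsto_add)
    then have lim: "(\<lambda>n. (LINT s|lborel. norm (f (s - v n) - f s)) + (LINT s|lborel. norm (g (s - v n) - g s))) \<longlonglongrightarrow> 0"
      by simp
    have le: "norm (LINT s|lborel. norm (f (s - v n) + g (s - v n) - (f s + g s)))
      \<le> (LINT s|lborel. norm (f (s - v n) - f s)) + (LINT s|lborel. norm (g (s - v n) - g s))" for n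
    proof -
      have i: "integrable lborel (\<lambda>s. norm (f (s - v n) - f s))" "integrable lborel (\<lambda>s. norm (g (s - v n) - g s))"
        by (intro integrable_norm Bochner_Integration.integrable_diff sh add)+
      have "norm (LINT s|lborel. norm (f (s - v n) + g (s - v n) - (f s + g s)))
        \<le> (LINT s|lborel. norm (f (s - v n) - f s) + norm (g (s - v n) - g s))"
      proof (rule norm_integral_le)
        fix s
        have eq: "f (s - v n) + g (s - v n) - (f s + g s) = (f (s - v n) - f s) + (g (s - v n) - g s)" by simp
        show "norm (norm (f (s - v n) + g (s - v n) - (f s + g s))) \<le> norm (f (s - v n) - f s) + norm (g (s - v n) - g s)"
          unfolding eq real_norm_def abs_norm_cancel by (rule norm_triangle_ineq)
      qed (use i in simp)
      then show ?thesis using i by simp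
    qed
    show ?case
      unfolding P_def by (rule Lim_null_comparison[OF always_eventually lim]) (use le in blast)
  next
    case (lim f s)
    have [measurable]: "f \<in> borel_measurable borel" "s i \<in> borel_measurable borel" for i
      by (rule integrable_borelD lim)+
    have "(\<lambda>i. LINT x|lborel. norm (f x - s i x)) \<longlonglongrightarrow> (LINT x::'a|lborel. 0::real)"
    proof (rule tendsto_integral_dominated)
      show "integrable lborel (\<lambda>x. 3 * norm (f x))" using lim(4) by simp
      show "(\<lambda>n. norm (f x - s n x)) \<longlonglongrightarrow> 0" for x
        using tendsto_norm[OF tendsto_diff[OF tendsto_const[of "f x"] lim(2)[of x]]] by simp
      show "norm (norm (f x - s n x)) \<le> 3 * norm (f x)" for n x
        using norm_triangle_ineq4[of "f x" "s n x"] lim(3)[of x n] by simp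
    qed measurable
    then have *: "(\<lambda>i. LINT x|lborel. norm (f x - s i x)) \<longlonglongrightarrow> 0" by simp
    show ?case
    proof (rule approx[OF lim(4)])
      fix e :: real assume "0 < e"
      from order_tendstoD(2)[OF * this] obtain i where "(LINT x|lborel. norm (f x - s i x)) < e"
        by (auto simp: eventually_sequentially)
      then show "\<exists>g. integrable lborel g \<and> P g \<and> (LINT s|lborel. norm (f s - g s)) < e"
        using lim(1,5) by blast
    qed
  qed
  then show ?thesis by (simp add: P_def)
qed

section \<open>Uniqueness of the Fourier transform and the Plancherel identity\<close>

lemma integrable_square_norm_diff:
  fixes f g :: "'a \<Rightarrow> 'b::{real_normed_vector, banach, second_countable_topology}"
  assumes [measurable]: "f \<in> borel_measurable M" "g \<in> borel_measurable M"
    and i: "integrable M (\<lambda>s. (norm (f s))\<^sup>2)" "integrable M (\<lambda>s. (norm (g s))\<^sup>2)"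
  shows "integrable M (\<lambda>s. (norm (f s - g s))\<^sup>2)"
proof (rule integrable_norm_le)
  show "integrable M (\<lambda>s. 2 * (norm (f s))\<^sup>2 + 2 * (norm (g s))\<^sup>2)" using i by simp
  fix s
  have "(norm (f s - g s))\<^sup>2 \<le> (norm (f s) + norm (g s))\<^sup>2"
    by (intro power_mono norm_triangle_ineq4 norm_ge_zero)
  also have "\<dots> \<le> 2 * (norm (f s))\<^sup>2 + 2 * (norm (g s))\<^sup>2"
  proof -
    have "0 \<le> (norm (f s) - norm (g s))\<^sup>2" by simp
    then show ?thesis by (simp add: power2_eq_square algebra_simps)
  qed
  finally show "norm ((norm (f s - g s))\<^sup>2) \<le> 2 * (norm (f s))\<^sup>2 + 2 * (norm (g s))\<^sup>2" by simp
qed measurable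

text \<open>All Gaussian averages of \<open>h\<close> vanish, so almost everywhere
  \<open>h t\<close> is the average of the differences of \<open>h t\<close> and nearby values. The
  L1 norm of \<open>h\<close> is then bounded by averages of the translation modulus
  \<open>D\<close>, which tend to 0.\<close>

lemma fourier_unique:
  fixes h :: "'a::euclidean_space \<Rightarrow> complex"
  assumes h: "integrable lborel h" and 0: "\<And>\<xi>. fourier h \<xi> = 0"
  shows "AE s in lborel. h s = 0"
proof -
  have [measurable]: "h \<in> borel_measurable borel" by (rule integrable_borelD[OF h])
  let ?e = "\<lambda>n. inverse (real (Suc n))"
  define D where "D v = (LINT s|lborel. norm (h (s - v) - h s))" for v
  have hs: "integrable lborel (\<lambda>s. h (s - v))" for v
    using integrable_lborel_shift_iff(2)[of h v] h by simp
  have hh: "integrable lborel (\<lambda>s. norm (h (s - v) - h s))" for v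
    by (intro integrable_norm Bochner_Integration.integrable_diff hs h)
  have [measurable]: "D \<in> borel_measurable borel" unfolding D_def by measurable
  have D_le: "D v \<le> 2 * (LINT s|lborel. norm (h s))" for v
  proof -
    have "D v \<le> (LINT s|lborel. norm (h (s - v)) + norm (h s))"
      unfolding D_def
      by (intro integral_mono hh norm_triangle_ineq4 Bochner_Integration.integrable_add integrable_norm hs h)
    also have "\<dots> = (LINT s|lborel. norm (h (s - v))) + (LINT s|lborel. norm (h s))"
      using hs h by simp
    also have "(LINT s|lborel. norm (h (s - v))) = (LINT s|lborel. norm (h s))"
      by (rule integral_lborel_shift)
    finally show ?thesis by simp
  qed
  have D_nonneg: "0 \<le> D v" for v unfolding D_def by simp
  have le: "(LINT t|lborel. norm (h t)) \<le> (LINT u|lborel. gauss_dual u * D (?e n *\<^sub>R u))" for n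
  proof -
    let ?f = "\<lambda>u t. gauss_dual u * norm (h (t - ?e n *\<^sub>R u) - h t)"
    have m: "(\<lambda>p. ?f (fst p) (snd p)) \<in> borel_measurable borel"
      unfolding borel_prod[symmetric] by measurable
    have i: "integrable lborel (?f u)" for u by (intro integrable_mult_right hh)
    have w: "(LINT t|lborel. norm (?f u t)) \<le> gauss_dual u * (2 * (LINT s|lborel. norm (h s)))" for u
      using D_le[of "?e n *\<^sub>R u"] gauss_nonneg(2)[of u] by (simp add: D_def mult_left_mono)
    have wi: "integrable lborel (\<lambda>u::'a. gauss_dual u * (2 * (LINT s|lborel. norm (h s))))"
      by (intro integrable_mult_left gauss_dual_integral)
    note fub = fubini_dominated[where f="?f", OF m i w wi]
    have ptw: "AE t in lborel. norm (h t) \<le> (LINT u|lborel. ?f u t)"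
      using fub(5)
    proof eventually_elim
      case (elim t)
      have e: "0 < ?e n" by simp
      have "of_real (gauss (0::'a)) * (LINT u|lborel. h (t - ?e n *\<^sub>R u) * of_real (gauss_dual u)) = 0"
        unfolding gauss_summation[OF h e, of t, symmetric] by (simp add: 0)
      then have z: "(LINT u|lborel. h (t - ?e n *\<^sub>R u) * of_real (gauss_dual u)) = 0"
        using gauss_0_pos[where 'a='a] by simp
      have il: "integrable lborel (\<lambda>u::'a. h t * of_real (gauss_dual u))"
        by (intro integrable_mult_right integrable_of_real gauss_dual_integral)
      have id: "integrable lborel (\<lambda>u. (h (t - ?e n *\<^sub>R u) - h t) * of_real (gauss_dual u))"
        by (rule integrable_norm_le[OF elim]) (measurable, simp add: norm_mult abs_of_nonneg gauss_nonneg(2) mult.commute)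
      have "(LINT u|lborel. (h (t - ?e n *\<^sub>R u) - h t) * of_real (gauss_dual u)) + (LINT u::'a|lborel. h t * of_real (gauss_dual u))
          = (LINT u|lborel. (h (t - ?e n *\<^sub>R u) - h t) * of_real (gauss_dual u) + h t * of_real (gauss_dual u))"
        by (rule Bochner_Integration.integral_add[OF id il, symmetric])
      also have "\<dots> = 0" using z by (simp add: left_diff_distrib)
      finally have "h t = - (LINT u|lborel. (h (t - ?e n *\<^sub>R u) - h t) * of_real (gauss_dual u))"
        using gauss_dual_integral(2)[where 'a='a] by (simp add: integral_complex_of_real eq_neg_iff_add_eq_0 add.commute)
      then have "norm (h t) = norm (- (LINT u|lborel. (h (t - ?e n *\<^sub>R u) - h t) * of_real (gauss_dual u)))"
        by (rule arg_cong)
      also have "\<dots> = norm (LINT u|lborel. (h (t - ?e n *\<^sub>R u) - h t) * of_real (gauss_dual u))"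
        by (rule norm_minus_cancel)
      also have "\<dots> \<le> (LINT u|lborel. ?f u t)"
        by (rule norm_integral_le[OF elim]) (simp add: norm_mult abs_of_nonneg gauss_nonneg(2) mult.commute)
      finally show ?case .
    qed
    have "(LINT t|lborel. norm (h t)) \<le> (LINT t|lborel. LINT u|lborel. ?f u t)"
      by (intro integral_mono_AE integrable_norm h fub(4) ptw)
    also have "\<dots> = (LINT u|lborel. LINT t|lborel. ?f u t)" by (rule fub(2)[symmetric])
    also have "\<dots> = (LINT u|lborel. gauss_dual u * D (?e n *\<^sub>R u))" by (simp add: D_def)
    finally show ?thesis .
  qed
  have "(\<lambda>n. LINT u|lborel. gauss_dual u * D (?e n *\<^sub>R u)) \<longlonglongrightarrow> (LINT u::'a|lborel. 0::real)"
  proof (rule tendsto_integral_dominated)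
    show "integrable lborel (\<lambda>u::'a. gauss_dual u * (2 * (LINT s|lborel. norm (h s))))"
      by (intro integrable_mult_left gauss_dual_integral)
    show "norm (gauss_dual u * D (?e n *\<^sub>R u)) \<le> gauss_dual u * (2 * (LINT s|lborel. norm (h s)))" for n u
      using mult_left_mono[OF D_le gauss_nonneg(2)[of u]] gauss_nonneg(2)[of u] D_nonneg by simp
    have "(\<lambda>n. D (?e n *\<^sub>R u)) \<longlonglongrightarrow> 0" for u
      unfolding D_def by (rule L1_translation_continuous[OF h inverse_Suc_scaleR_tendsto_0])
    then show "(\<lambda>n. gauss_dual u * D (?e n *\<^sub>R u)) \<longlonglongrightarrow> 0" for u
      using tendsto_mult[OF tendsto_const[of "gauss_dual u"]] by fastforce
  qed measurable
  then have "(\<lambda>n. LINT u|lborel. gauss_dual u * D (?e n *\<^sub>R u)) \<longlonglongrightarrow> 0" by simp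
  then have "(LINT t|lborel. norm (h t)) \<le> 0"
    by (rule LIMSEQ_le_const) (use le in blast)
  then have "(LINT t|lborel. norm (h t)) = 0" by (intro antisym) auto
  then show ?thesis
    using integral_nonneg_eq_0_iff_AE[OF integrable_norm[OF h]] by simp
qed

text \<open>For nonnegative numbers the square of a difference is at most the modulus of the
  difference of the squares, which reduces the claim to continuity of translation in L1 for the
  square of \<open>r\<close>.\<close>

lemma L2_translation_continuous_nonneg:
  fixes r :: "'a::euclidean_space \<Rightarrow> real"
  assumes [measurable]: "r \<in> borel_measurable borel" and r: "\<And>s. 0 \<le> r s" "integrable lborel (\<lambda>s. (r s)\<^sup>2)" and v: "v \<longlonglongrightarrow> 0"
  shows "(\<lambda>n. LINT s|lborel. (r (s - v n) - r s)\<^sup>2) \<longlonglongrightarrow> 0"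
proof (rule Lim_null_comparison[OF always_eventually L1_translation_continuous[OF r(2) v]], rule allI)
  fix n
  have i: "integrable lborel (\<lambda>s. norm ((r (s - v n))\<^sup>2 - (r s)\<^sup>2))"
    using r(2) integrable_lborel_shift_iff(2)[of "\<lambda>s. (r s)\<^sup>2" "v n"] by simp
  show "norm (LINT s|lborel. (r (s - v n) - r s)\<^sup>2) \<le> (LINT s|lborel. norm ((r (s - v n))\<^sup>2 - (r s)\<^sup>2))"
  proof (rule norm_integral_le[OF i])
    fix s
    let ?a = "r (s - v n)" and ?b = "r s"
    have "(?a - ?b)\<^sup>2 = \<bar>?a - ?b\<bar> * \<bar>?a - ?b\<bar>" by (simp add: power2_eq_square)
    also have "\<dots> \<le> \<bar>?a - ?b\<bar> * \<bar>?a + ?b\<bar>"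
      using r(1)[of s] r(1)[of "s - v n"] by (intro mult_left_mono) auto
    also have "\<dots> = \<bar>?a\<^sup>2 - ?b\<^sup>2\<bar>"
      by (simp add: abs_mult[symmetric] power2_eq_square algebra_simps)
    finally show "norm ((?a - ?b)\<^sup>2) \<le> norm (?a\<^sup>2 - ?b\<^sup>2)" by simp
  qed
qed

text \<open>Reduction to nonnegative functions: the positive and negative parts of the real and the
  imaginary part, numbered 0 to 3.\<close>

lemma L2_translation_continuous:
  fixes h :: "'a::euclidean_space \<Rightarrow> complex"
  assumes [measurable]: "h \<in> borel_measurable borel" and h: "integrable lborel (\<lambda>s. (norm (h s))\<^sup>2)" and v: "v \<longlonglongrightarrow> 0"
  shows "(\<lambda>n. LINT s|lborel. (norm (h (s - v n) - h s))\<^sup>2) \<longlonglongrightarrow> 0"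
proof -
  define p where "p j s = (if j = 0 then max 0 (Re (h s)) else if j = 1 then max 0 (- Re (h s))
     else if j = 2 then max 0 (Im (h s)) else max 0 (- Im (h s)))" for j :: nat and s
  have [measurable]: "p j \<in> borel_measurable borel" for j unfolding p_def by measurable
  have p0: "0 \<le> p j s" for j s by (simp add: p_def)
  have p_le: "p j s \<le> norm (h s)" for j s
    using abs_Re_le_cmod[of "h s"] abs_Im_le_cmod[of "h s"] by (simp add: p_def abs_le_iff)
  have p2: "integrable lborel (\<lambda>s. (p j s)\<^sup>2)" for j
    by (rule integrable_norm_le[OF h]) (use p0 p_le in \<open>auto intro: power_mono\<close>)
  have p2s: "integrable lborel (\<lambda>s. (p j (s - a) - p j s)\<^sup>2)" for j a
    using integrable_square_norm_diff[of "\<lambda>s. p j (s - a)" lborel "p j"] p2[of j]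
      integrable_lborel_shift_iff(2)[of "\<lambda>s. (p j s)\<^sup>2" a] by simp
  have "(\<lambda>n. \<Sum>j<4. 2 * (LINT s|lborel. (p j (s - v n) - p j s)\<^sup>2)) \<longlonglongrightarrow> (\<Sum>j<(4::nat). 2 * 0)"
    by (intro tendsto_sum tendsto_mult tendsto_const L2_translation_continuous_nonneg p0 p2 v) measurable
  then have lim: "(\<lambda>n. \<Sum>j<4. 2 * (LINT s|lborel. (p j (s - v n) - p j s)\<^sup>2)) \<longlonglongrightarrow> 0" by simp
  have sq: "(a - b)\<^sup>2 \<le> 2 * a\<^sup>2 + 2 * b\<^sup>2" for a b :: real
  proof -
    have "0 \<le> (a + b)\<^sup>2" by simp
    then show ?thesis by (simp add: power2_eq_square algebra_simps)
  qed
  have le: "norm (LINT s|lborel. (norm (h (s - a) - h s))\<^sup>2) \<le> (\<Sum>j<(4::nat). 2 * (LINT s|lborel. (p j (s - a) - p j s)\<^sup>2))" for a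
  proof -
    have "norm (LINT s|lborel. (norm (h (s - a) - h s))\<^sup>2) \<le> (LINT s|lborel. (\<Sum>j<(4::nat). 2 * (p j (s - a) - p j s)\<^sup>2))"
    proof (rule norm_integral_le)
      fix s
      have Re: "Re (h (s - a) - h s) = (p 0 (s - a) - p 0 s) - (p 1 (s - a) - p 1 s)"
        and Im: "Im (h (s - a) - h s) = (p 2 (s - a) - p 2 s) - (p 3 (s - a) - p 3 s)"
        by (auto simp: p_def max_def)
      have "(norm (h (s - a) - h s))\<^sup>2 = (Re (h (s - a) - h s))\<^sup>2 + (Im (h (s - a) - h s))\<^sup>2"
        by (rule cmod_power2)
      also have "\<dots> \<le> (2 * (p 0 (s - a) - p 0 s)\<^sup>2 + 2 * (p 1 (s - a) - p 1 s)\<^sup>2)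
          + (2 * (p 2 (s - a) - p 2 s)\<^sup>2 + 2 * (p 3 (s - a) - p 3 s)\<^sup>2)"
        unfolding Re Im by (intro add_mono sq)
      also have "\<dots> = (\<Sum>j<(4::nat). 2 * (p j (s - a) - p j s)\<^sup>2)"
        by (simp add: numeral_eq_Suc)
      finally show "norm ((norm (h (s - a) - h s))\<^sup>2) \<le> (\<Sum>j<(4::nat). 2 * (p j (s - a) - p j s)\<^sup>2)" by simp
    qed (intro Bochner_Integration.integrable_sum integrable_mult_right p2s)
    also have "\<dots> = (\<Sum>j<(4::nat). 2 * (LINT s|lborel. (p j (s - a) - p j s)\<^sup>2))"
      by (subst Bochner_Integration.integral_sum) (auto intro: p2s)
    finally show ?thesis .
  qed
  show ?thesis
    by (rule Lim_null_comparison[OF always_eventually lim]) (use le in blast)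
qed

lemma gauss_mono: "0 \<le> a \<Longrightarrow> a \<le> b \<Longrightarrow> gauss (b *\<^sub>R \<xi>) \<le> gauss (a *\<^sub>R \<xi>)"
  for \<xi> :: "'a::euclidean_space"
  unfolding gauss_def std_normal_density_def
proof (intro prod_mono conjI)
  fix i :: 'a assume ab: "0 \<le> a" "a \<le> b"
  have "(a * (\<xi> \<bullet> i))\<^sup>2 \<le> (b * (\<xi> \<bullet> i))\<^sup>2"
    unfolding power_mult_distrib using ab by (intro mult_right_mono power_mono) auto
  then show "1 / sqrt (2 * pi) * exp (- ((b *\<^sub>R \<xi>) \<bullet> i)\<^sup>2 / 2) \<le> 1 / sqrt (2 * pi) * exp (- ((a *\<^sub>R \<xi>) \<bullet> i)\<^sup>2 / 2)"
    by (intro mult_left_mono) auto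
qed auto

text \<open>\<open>R\<close> is the autocorrelation of \<open>h\<close>. Gaussian means of the
  squared modulus of the transform are \<open>gauss 0\<close> times Gaussian averages of
  \<open>R\<close> near 0, and \<open>R\<close> is continuous there with value \<open>E\<close>. The
  Gaussian factors increase as they widen, so monotone convergence yields integrability along with
  the identity.\<close>

theorem plancherel:
  fixes h :: "'a::euclidean_space \<Rightarrow> complex"
  assumes h: "integrable lborel h" and h2: "integrable lborel (\<lambda>s. (norm (h s))\<^sup>2)"
  shows "integrable lborel (\<lambda>\<xi>. (norm (fourier h \<xi>))\<^sup>2)"
    and "(LINT \<xi>|lborel. (norm (fourier h \<xi>))\<^sup>2) = (LINT s|lborel. (norm (h s))\<^sup>2)"
proof -
  have [measurable]: "h \<in> borel_measurable borel" by (rule integrable_borelD[OF h])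
  let ?e = "\<lambda>n. inverse (real (Suc n))"
  define E where "E = (LINT s|lborel. (norm (h s))\<^sup>2)"
  define R where "R v = (LINT t|lborel. h (t - v) * cnj (h t))" for v
  have h2s: "integrable lborel (\<lambda>t. (norm (h (t - v)))\<^sup>2)" "(LINT t|lborel. (norm (h (t - v)))\<^sup>2) = E" for v
    using h2 integrable_lborel_shift_iff(2)[of "\<lambda>t. (norm (h t))\<^sup>2" v] integral_lborel_shift(2)[of "\<lambda>t. (norm (h t))\<^sup>2" v]
    by (auto simp: E_def)
  have prod_le: "norm (h (t - v) * cnj (h t)) \<le> ((norm (h (t - v)))\<^sup>2 + (norm (h t))\<^sup>2)" for t v
  proof -
    have "0 \<le> (norm (h (t - v)) - norm (h t))\<^sup>2" by simp
    then have "2 * (norm (h (t - v)) * norm (h t)) \<le> (norm (h (t - v)))\<^sup>2 + (norm (h t))\<^sup>2"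
      by (simp add: power2_diff)
    moreover have "0 \<le> norm (h (t - v)) * norm (h t)" by simp
    ultimately show ?thesis unfolding norm_mult complex_mod_cnj by linarith
  qed
  have prod_int: "integrable lborel (\<lambda>t. h (t - v) * cnj (h t))" for v
    by (rule integrable_norm_le[OF Bochner_Integration.integrable_add[OF h2s(1)[of v] h2]]) (measurable, rule prod_le)
  have prod_norm: "(LINT t|lborel. norm (h (t - v) * cnj (h t))) \<le> 2 * E" for v
  proof -
    have "(LINT t|lborel. norm (h (t - v) * cnj (h t))) \<le> (LINT t|lborel. (norm (h (t - v)))\<^sup>2 + (norm (h t))\<^sup>2)"
      by (intro integral_mono integrable_norm prod_int Bochner_Integration.integrable_add h2s h2 prod_le)
    also have "\<dots> = 2 * E" using h2s[of v] h2 by (simp add: E_def)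
    finally show ?thesis .
  qed
  have R_le: "norm (R v) \<le> 2 * E" for v
    unfolding R_def by (rule order_trans[OF integral_norm_bound prod_norm])
  have R0: "R 0 = of_real E"
  proof -
    have "R 0 = (LINT t|lborel. complex_of_real ((norm (h t))\<^sup>2))"
      unfolding R_def by (intro Bochner_Integration.integral_cong) (auto simp: complex_norm_square[symmetric] simp del: of_real_power)
    then show ?thesis unfolding E_def by (simp only: integral_complex_of_real)
  qed
  have R_lim: "(\<lambda>n. R (v n)) \<longlonglongrightarrow> of_real E" if v: "v \<longlonglongrightarrow> 0" for v
  proof -
    have "(\<lambda>n. sqrt (E * (LINT s|lborel. (norm (h (s - v n) - h s))\<^sup>2))) \<longlonglongrightarrow> sqrt (E * 0)"
      by (intro tendsto_intros L2_translation_continuous h2 v) measurable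
    then have lim: "(\<lambda>n. sqrt (E * (LINT s|lborel. (norm (h (s - v n) - h s))\<^sup>2))) \<longlonglongrightarrow> 0" by simp
    have "norm (R a - R 0) \<le> sqrt (E * (LINT s|lborel. (norm (h (s - a) - h s))\<^sup>2))" for a
    proof (rule real_le_rsqrt)
      have i1: "integrable lborel (\<lambda>s. (norm (h (s - a) - h s))\<^sup>2)"
        using integrable_square_norm_diff[of "\<lambda>s. h (s - a)" lborel h] h2s(1)[of a] h2 by simp
      have i2: "integrable lborel (\<lambda>s. norm (h s) * norm (h (s - a) - h s))"
      proof -
        have "integrable lborel (\<lambda>t. norm (h (t - a) * cnj (h t) - h (t - 0) * cnj (h t)))"
          by (intro integrable_norm Bochner_Integration.integrable_diff prod_int)
        moreover have "h (t - a) * cnj (h t) - h (t - 0) * cnj (h t) = cnj (h t) * (h (t - a) - h t)" for t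
          by (simp add: algebra_simps)
        ultimately show ?thesis by (simp only: norm_mult complex_mod_cnj)
      qed
      have "R a - R 0 = (LINT t|lborel. (h (t - a) - h t) * cnj (h t))"
        unfolding R_def using prod_int[of a] prod_int[of 0] by (simp add: left_diff_distrib)
      then have "norm (R a - R 0) \<le> (LINT s|lborel. norm (h s) * norm (h (s - a) - h s))"
        using norm_integral_le[OF i2, of "\<lambda>t. (h (t - a) - h t) * cnj (h t)"] by (simp add: norm_mult mult.commute)
      then have "(norm (R a - R 0))\<^sup>2 \<le> (LINT s|lborel. norm (h s) * norm (h (s - a) - h s))\<^sup>2"
        by (intro power_mono) auto
      also have "\<dots> \<le> E * (LINT s|lborel. (norm (h (s - a) - h s))\<^sup>2)"
        unfolding E_def by (rule cauchy_schwarz_integral[OF h2 i1 i2])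
      finally show "(norm (R a - R 0))\<^sup>2 \<le> E * (LINT s|lborel. (norm (h (s - a) - h s))\<^sup>2)" .
    qed
    then have "(\<lambda>n. R (v n) - R 0) \<longlonglongrightarrow> 0"
      by (intro Lim_null_comparison[OF always_eventually lim]) blast
    then show ?thesis by (simp add: LIM_zero_iff R0)
  qed
  have [measurable]: "R \<in> borel_measurable borel" unfolding R_def by measurable
  have key: "(LINT \<xi>|lborel. of_real ((norm (fourier h \<xi>))\<^sup>2 * gauss (e *\<^sub>R \<xi>)))
      = of_real (gauss (0::'a)) * (LINT u|lborel. of_real (gauss_dual u) * R (e *\<^sub>R u))" if e: "0 < e" for e
  proof -
    let ?B = "LINT s|lborel. norm (h s)"
    let ?f = "\<lambda>t \<xi>. fourier h \<xi> * cis (2 * pi * (\<xi> \<bullet> t)) * of_real (gauss (e *\<^sub>R \<xi>)) * cnj (h t)"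
    have mf: "(\<lambda>p. ?f (fst p) (snd p)) \<in> borel_measurable borel"
      unfolding borel_prod[symmetric] by measurable
    have f_le: "norm (?f t \<xi>) \<le> norm (h t) * ?B * gauss (e *\<^sub>R \<xi>)" for t \<xi> :: 'a
    proof -
      have "norm (?f t \<xi>) = norm (fourier h \<xi>) * (gauss (e *\<^sub>R \<xi>) * norm (h t))"
        using gauss_nonneg(1)[of "e *\<^sub>R \<xi>"] by (simp add: norm_mult)
      also have "\<dots> \<le> ?B * (gauss (e *\<^sub>R \<xi>) * norm (h t))"
        by (intro mult_right_mono fourier_bounded h mult_nonneg_nonneg norm_ge_zero gauss_nonneg(1))
      finally show ?thesis by (simp add: mult_ac)
    qed
    have gi: "integrable lborel (\<lambda>\<xi>::'a. norm (h t) * ?B * gauss (e *\<^sub>R \<xi>))" for t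
      by (intro integrable_mult_right gauss_scaled_integrable e)
    have fi: "integrable lborel (?f t)" for t
      by (rule integrable_norm_le[OF gi _ f_le]) measurable
    have fw: "(LINT \<xi>|lborel. norm (?f t \<xi>)) \<le> norm (h t) * (?B * (LINT \<xi>::'a|lborel. gauss (e *\<^sub>R \<xi>)))" for t
    proof -
      have "(LINT \<xi>|lborel. norm (?f t \<xi>)) \<le> (LINT \<xi>::'a|lborel. norm (h t) * ?B * gauss (e *\<^sub>R \<xi>))"
        by (intro integral_mono integrable_norm fi gi f_le)
      then show ?thesis by (simp add: mult.assoc)
    qed
    have fwi: "integrable lborel (\<lambda>t. norm (h t) * (?B * (LINT \<xi>::'a|lborel. gauss (e *\<^sub>R \<xi>))))"
      by (intro integrable_mult_left integrable_norm h)
    let ?g = "\<lambda>u t. of_real (gauss_dual u) * (h (t - e *\<^sub>R u) * cnj (h t))"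
    have mg: "(\<lambda>p. ?g (fst p) (snd p)) \<in> borel_measurable borel"
      unfolding borel_prod[symmetric] by measurable
    have gint: "integrable lborel (?g u)" for u by (intro integrable_mult_right prod_int)
    have gw: "(LINT t|lborel. norm (?g u t)) \<le> gauss_dual u * (2 * E)" for u
      using mult_left_mono[OF prod_norm[of "e *\<^sub>R u"] gauss_nonneg(2)[of u]] gauss_nonneg(2)[of u]
      by (simp add: norm_mult)
    have gwi: "integrable lborel (\<lambda>u::'a. gauss_dual u * (2 * E))"
      by (intro integrable_mult_left gauss_dual_integral)
    have "(LINT \<xi>|lborel. LINT t|lborel. ?f t \<xi>) = (LINT t|lborel. LINT \<xi>|lborel. ?f t \<xi>)"
      by (rule fubini_dominated_swap[where f="?f", OF mf fi fw fwi, symmetric])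
    also have "\<dots> = (LINT t|lborel. (LINT \<xi>|lborel. fourier h \<xi> * cis (2 * pi * (\<xi> \<bullet> t)) * of_real (gauss (e *\<^sub>R \<xi>))) * cnj (h t))"
      by simp
    also have "\<dots> = (LINT t|lborel. of_real (gauss (0::'a)) * (LINT u|lborel. ?g u t))"
    proof (rule Bochner_Integration.integral_cong[OF refl])
      fix t
      have "(LINT u|lborel. h (t - e *\<^sub>R u) * of_real (gauss_dual u)) * cnj (h t) = (LINT u|lborel. ?g u t)"
        by (simp add: mult_ac flip: Bochner_Integration.integral_mult_left_zero)
      then show "(LINT \<xi>|lborel. fourier h \<xi> * cis (2 * pi * (\<xi> \<bullet> t)) * of_real (gauss (e *\<^sub>R \<xi>))) * cnj (h t)
          = of_real (gauss (0::'a)) * (LINT u|lborel. ?g u t)"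
        unfolding gauss_summation[OF h e] by (simp only: mult.assoc)
    qed
    also have "\<dots> = of_real (gauss (0::'a)) * (LINT t|lborel. LINT u|lborel. ?g u t)" by simp
    also have "(LINT t|lborel. LINT u|lborel. ?g u t) = (LINT u|lborel. LINT t|lborel. ?g u t)"
      by (rule fubini_dominated_swap[where f="?g", OF mg gint gw gwi, symmetric])
    also have "\<dots> = (LINT u|lborel. of_real (gauss_dual u) * R (e *\<^sub>R u))"
      by (simp add: R_def)
    finally have 1: "(LINT \<xi>|lborel. LINT t|lborel. ?f t \<xi>)
        = of_real (gauss (0::'a)) * (LINT u|lborel. of_real (gauss_dual u) * R (e *\<^sub>R u))" .
    have "(LINT t|lborel. ?f t \<xi>) = of_real ((norm (fourier h \<xi>))\<^sup>2 * gauss (e *\<^sub>R \<xi>))" for \<xi>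
    proof -
      have "cnj (fourier h \<xi>) = (LINT t|lborel. cnj (h t * cis (- (2 * pi * (\<xi> \<bullet> t)))))"
        unfolding fourier_def by (rule Bochner_Integration.integral_cnj[symmetric])
      also have "\<dots> = (LINT t|lborel. cis (2 * pi * (\<xi> \<bullet> t)) * cnj (h t))"
        by (simp add: cis_cnj mult.commute)
      finally have c: "(LINT t|lborel. cis (2 * pi * (\<xi> \<bullet> t)) * cnj (h t)) = cnj (fourier h \<xi>)" by simp
      have "(LINT t|lborel. ?f t \<xi>) = (LINT t|lborel. (fourier h \<xi> * of_real (gauss (e *\<^sub>R \<xi>))) * (cis (2 * pi * (\<xi> \<bullet> t)) * cnj (h t)))"
        by (intro Bochner_Integration.integral_cong) (simp_all add: mult_ac)
      also have "\<dots> = fourier h \<xi> * of_real (gauss (e *\<^sub>R \<xi>)) * cnj (fourier h \<xi>)"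
        unfolding Bochner_Integration.integral_mult_right_zero c ..
      also have "\<dots> = of_real ((norm (fourier h \<xi>))\<^sup>2 * gauss (e *\<^sub>R \<xi>))"
      proof -
        have "of_real ((norm (fourier h \<xi>))\<^sup>2) = fourier h \<xi> * cnj (fourier h \<xi>)"
          using complex_norm_square[of "fourier h \<xi>"] by simp
        then show ?thesis by (simp only: of_real_mult mult_ac)
      qed
      finally show ?thesis .
    qed
    then show ?thesis using 1 by simp
  qed
  have ki: "integrable lborel (\<lambda>\<xi>. (norm (fourier h \<xi>))\<^sup>2 * gauss (e *\<^sub>R \<xi>))" if e: "0 < e" for e
  proof (rule integrable_norm_le)
    show "integrable lborel (\<lambda>\<xi>::'a. (LINT s|lborel. norm (h s))\<^sup>2 * gauss (e *\<^sub>R \<xi>))"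
      by (intro integrable_mult_right gauss_scaled_integrable e)
    show "norm ((norm (fourier h \<xi>))\<^sup>2 * gauss (e *\<^sub>R \<xi>)) \<le> (LINT s|lborel. norm (h s))\<^sup>2 * gauss (e *\<^sub>R \<xi>)" for \<xi>
      using gauss_nonneg(1)[of "e *\<^sub>R \<xi>"] power_mono[OF fourier_bounded[OF h, of \<xi>], of 2] by (simp add: mult_right_mono)
  qed measurable
  have "(\<lambda>n. of_real (gauss (0::'a)) * (LINT u|lborel. of_real (gauss_dual u) * R (?e n *\<^sub>R u)))
     \<longlonglongrightarrow> of_real (gauss (0::'a)) * (LINT u::'a|lborel. of_real (gauss_dual u) * of_real E)"
  proof (rule tendsto_mult[OF tendsto_const], rule tendsto_integral_dominated)
    show "integrable lborel (\<lambda>u::'a. gauss_dual u * (2 * E))"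
      by (intro integrable_mult_left gauss_dual_integral)
    show "norm (of_real (gauss_dual u) * R (?e n *\<^sub>R u)) \<le> gauss_dual u * (2 * E)" for n u
      using mult_left_mono[OF R_le gauss_nonneg(2)[of u]] gauss_nonneg(2)[of u] by (simp add: norm_mult)
    show "(\<lambda>n. of_real (gauss_dual u) * R (?e n *\<^sub>R u)) \<longlonglongrightarrow> of_real (gauss_dual u) * of_real E" for u
      by (rule tendsto_mult[OF tendsto_const R_lim[OF inverse_Suc_scaleR_tendsto_0]])
  qed measurable
  also have "(LINT u::'a|lborel. complex_of_real (gauss_dual u) * of_real E) = of_real E"
    using gauss_dual_integral(2)[where 'a='a] by (simp add: integral_complex_of_real)
  finally have "(\<lambda>n. (LINT \<xi>|lborel. complex_of_real ((norm (fourier h \<xi>))\<^sup>2 * gauss (?e n *\<^sub>R \<xi>)))) \<longlonglongrightarrow> of_real (gauss (0::'a)) * of_real E"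
    by (subst key) simp_all
  then have "(\<lambda>n. complex_of_real (LINT \<xi>|lborel. (norm (fourier h \<xi>))\<^sup>2 * gauss (?e n *\<^sub>R \<xi>))) \<longlonglongrightarrow> of_real (gauss (0::'a)) * of_real E"
    by (simp only: integral_complex_of_real)
  then have lim: "(\<lambda>n. (LINT \<xi>|lborel. (norm (fourier h \<xi>))\<^sup>2 * gauss (?e n *\<^sub>R \<xi>))) \<longlonglongrightarrow> gauss (0::'a) * E"
    by (simp only: of_real_mult[symmetric] tendsto_of_real_iff)
  have mono: "mono (\<lambda>n. (norm (fourier h \<xi>))\<^sup>2 * gauss (?e n *\<^sub>R \<xi>))" for \<xi>
    by (intro monoI mult_left_mono gauss_mono) (auto simp: field_simps)
  have int: "integrable lborel (\<lambda>\<xi>. (norm (fourier h \<xi>))\<^sup>2 * gauss (?e n *\<^sub>R \<xi>))" for n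
    by (rule ki) simp
  have nn: "0 \<le> (norm (fourier h \<xi>))\<^sup>2 * gauss (?e n *\<^sub>R \<xi>)" for n \<xi>
    by (rule mult_nonneg_nonneg[OF zero_le_power2 gauss_nonneg(1)])
  have ptw: "(\<lambda>n. (norm (fourier h \<xi>))\<^sup>2 * gauss (?e n *\<^sub>R \<xi>)) \<longlonglongrightarrow> (norm (fourier h \<xi>))\<^sup>2 * gauss (0::'a)" for \<xi>
    by (rule tendsto_mult[OF tendsto_const gauss_scaled_tendsto])
  have m: "(\<lambda>\<xi>. (norm (fourier h \<xi>))\<^sup>2 * gauss (0::'a)) \<in> borel_measurable lborel" by measurable
  note mc = integral_monotone_convergence_nonneg[OF int AE_I2[OF mono] AE_I2[OF nn] AE_I2[OF ptw] lim m]
  have "integrable lborel (\<lambda>\<xi>. (norm (fourier h \<xi>))\<^sup>2 * gauss (0::'a)) \<and> (LINT \<xi>|lborel. (norm (fourier h \<xi>))\<^sup>2 * gauss (0::'a)) = gauss (0::'a) * E"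
    using mc by blast
  then show "integrable lborel (\<lambda>\<xi>. (norm (fourier h \<xi>))\<^sup>2)"
    "(LINT \<xi>|lborel. (norm (fourier h \<xi>))\<^sup>2) = (LINT s|lborel. (norm (h s))\<^sup>2)"
    using gauss_0_pos[where 'a='a] by (auto simp: E_def)
qed

section \<open>Schwartz functions\<close>

definition partial_deriv :: "'d \<Rightarrow> (real^'d \<Rightarrow> complex) \<Rightarrow> real^'d \<Rightarrow> complex" where
  "partial_deriv j f x = frechet_derivative f (at x) (axis j 1)"

lemma iterated_partial_Cons: "iterated_partial (j # js) f = partial_deriv j (iterated_partial js f)"
  by (simp add: partial_deriv_def fun_eq_iff)

text \<open>The definition adds derivatives on the outside. Where the first derivative of a function
  is known in closed form, inductions have to split off the innermost one.\<close>

lemma iterated_partial_snoc: "iterated_partial (js @ [j]) f = iterated_partial js (partial_deriv j f)"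
proof (induction js)
  case (Cons a js)
  show ?case unfolding append_Cons iterated_partial_Cons Cons.IH ..
qed (simp add: fun_eq_iff partial_deriv_def)

lemma tempered_distributionD:
  assumes "T \<in> tempered_distributions"
  shows "\<psi> \<notin> schwartz \<Longrightarrow> T \<psi> = 0"
    and "\<psi> \<in> schwartz \<Longrightarrow> \<eta> \<in> schwartz \<Longrightarrow> T (\<lambda>t. \<psi> t + \<eta> t) = T \<psi> + T \<eta>"
    and "\<psi> \<in> schwartz \<Longrightarrow> T (\<lambda>t. c * \<psi> t) = c * T \<psi>"
    and "schwartz_null_sequence \<Psi> \<Longrightarrow> (\<lambda>n. T (\<Psi> n)) \<longlonglongrightarrow> 0"
  using assms by (auto simp: tempered_distributions_def)

text \<open>Finite order provides an induction parameter: the derivative of a time-frequency shift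
  is a combination of such shifts, so smoothness of one order reduces to smoothness of lower order
  of functions of the same kind.\<close>

definition smooth_upto :: "nat \<Rightarrow> (real^'d \<Rightarrow> complex) \<Rightarrow> bool" where
  "smooth_upto n f \<longleftrightarrow> (\<forall>js x. length js \<le> n \<longrightarrow> iterated_partial js f differentiable (at x))"

definition smooth_fun :: "(real^'d \<Rightarrow> complex) \<Rightarrow> bool" where
  "smooth_fun f \<longleftrightarrow> (\<forall>js x. iterated_partial js f differentiable (at x))"

lemma smooth_fun_upto: "smooth_fun f \<longleftrightarrow> (\<forall>n. smooth_upto n f)"
  unfolding smooth_fun_def smooth_upto_def by blast

lemma smooth_fun_differentiable: "smooth_fun f \<Longrightarrow> f differentiable (at x)"
  unfolding smooth_fun_def by (metis iterated_partial.simps(1))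

lemma smooth_upto_SucI:
  assumes "\<And>x. f differentiable (at x)" "\<And>j. smooth_upto n (partial_deriv j f)"
  shows "smooth_upto (Suc n) f"
  unfolding smooth_upto_def
proof (intro allI impI)
  fix js :: "'a list" and x assume len: "length js \<le> Suc n"
  show "iterated_partial js f differentiable (at x)"
  proof (cases js rule: rev_cases)
    case Nil
    then show ?thesis using assms(1) by simp
  next
    case (snoc ys j)
    then show ?thesis
      using assms(2)[of j] len unfolding smooth_upto_def by (simp add: iterated_partial_snoc del: iterated_partial.simps)
  qed
qed

lemma smooth_fun_partial: "smooth_fun f \<Longrightarrow> smooth_fun (partial_deriv j f)"
  unfolding smooth_fun_def by (metis iterated_partial_snoc)

lemma partial_deriv_lincomb:
  assumes "f differentiable (at x)" "g differentiable (at x)"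
  shows "partial_deriv j (\<lambda>x. a * f x + b * g x) x = a * partial_deriv j f x + b * partial_deriv j g x"
proof -
  have "((\<lambda>x. a * f x + b * g x) has_derivative
      (\<lambda>h. a * frechet_derivative f (at x) h + b * frechet_derivative g (at x) h)) (at x)"
    using assms unfolding frechet_derivative_works
    by (intro has_derivative_add has_derivative_mult_right)
  from frechet_derivative_at[OF this] show ?thesis
    by (simp add: partial_deriv_def fun_eq_iff)
qed

lemma iterated_partial_lincomb_upto:
  assumes "smooth_upto n f" "smooth_upto n g" "length js \<le> Suc n"
  shows "iterated_partial js (\<lambda>x. a * f x + b * g x) = (\<lambda>x. a * iterated_partial js f x + b * iterated_partial js g x)"
  using assms(3)
proof (induction js)
  case (Cons j js)
  have d: "iterated_partial js f differentiable (at x)" "iterated_partial js g differentiable (at x)" for x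
    using assms(1,2) Cons.prems unfolding smooth_upto_def by auto
  have IH: "iterated_partial js (\<lambda>x. a * f x + b * g x) = (\<lambda>x. a * iterated_partial js f x + b * iterated_partial js g x)"
    using Cons by simp
  show ?case
    unfolding iterated_partial_Cons IH using partial_deriv_lincomb[OF d] by (simp add: fun_eq_iff)
qed simp

lemma smooth_upto_lincomb:
  assumes "smooth_upto n f" "smooth_upto n g"
  shows "smooth_upto n (\<lambda>x. a * f x + b * g x)"
  unfolding smooth_upto_def
proof (intro allI impI)
  fix js :: "'a list" and x assume len: "length js \<le> n"
  then have "iterated_partial js (\<lambda>x. a * f x + b * g x) = (\<lambda>x. a * iterated_partial js f x + b * iterated_partial js g x)"
    by (intro iterated_partial_lincomb_upto[OF assms]) simp
  then show "iterated_partial js (\<lambda>x. a * f x + b * g x) differentiable (at x)"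
    using assms len unfolding smooth_upto_def by (auto intro!: differentiable_add differentiable_mult)
qed

lemma smooth_fun_lincomb: "smooth_fun f \<Longrightarrow> smooth_fun g \<Longrightarrow> smooth_fun (\<lambda>x. a * f x + b * g x)"
  unfolding smooth_fun_upto by (blast intro: smooth_upto_lincomb)

lemma iterated_partial_lincomb:
  assumes "smooth_fun f" "smooth_fun g"
  shows "iterated_partial js (\<lambda>x. a * f x + b * g x) t = a * iterated_partial js f t + b * iterated_partial js g t"
  using iterated_partial_lincomb_upto[of "length js" f g js a b] assms unfolding smooth_fun_upto by simp

lemma iterated_partial_cnj:
  assumes "smooth_fun f"
  shows "iterated_partial js (\<lambda>x. cnj (f x)) = (\<lambda>x. cnj (iterated_partial js f x))"
    and "smooth_fun (\<lambda>x. cnj (f x))"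
proof -
  have D: "((\<lambda>x. cnj (iterated_partial js f x)) has_derivative (\<lambda>h. cnj (frechet_derivative (iterated_partial js f) (at x) h))) (at x)" for js x
    using assms unfolding smooth_fun_def frechet_derivative_works
    by (intro bounded_linear.has_derivative[OF bounded_linear_cnj]) blast
  show eq: "iterated_partial js (\<lambda>x. cnj (f x)) = (\<lambda>x. cnj (iterated_partial js f x))" for js
  proof (induction js)
    case (Cons j js)
    show ?case
      unfolding iterated_partial_Cons Cons.IH partial_deriv_def
      using frechet_derivative_at[OF D] by (simp add: fun_eq_iff)
  qed simp
  show "smooth_fun (\<lambda>x. cnj (f x))"
    unfolding smooth_fun_def eq using D by (auto simp: differentiable_def)
qed

text \<open>The product rule for modulation and translation. The factor \<open>1 *\<close> gives the
  derivative the shape expected by the lemmas on linear combinations.\<close>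

lemma partial_deriv_tf_shift:
  assumes "\<And>x. \<psi> differentiable (at x)"
  shows "(\<lambda>t. tf_shift z \<psi> t) differentiable (at t)"
    and "partial_deriv j (tf_shift z \<psi>) = (\<lambda>t. (\<i> * of_real (2 * pi * snd z $ j)) * tf_shift z \<psi> t + 1 * tf_shift z (partial_deriv j \<psi>) t)"
proof -
  have d\<psi>: "((\<lambda>t. \<psi> (t - fst z)) has_derivative frechet_derivative \<psi> (at (t - fst z))) (at t)" for t
  proof -
    have "(\<psi> has_derivative frechet_derivative \<psi> (at (t - fst z))) (at (t - fst z))"
      using assms frechet_derivative_works by blast
    moreover have "((\<lambda>t. t - fst z) has_derivative (\<lambda>h. h)) (at t)"
      by (auto intro!: derivative_eq_intros)
    ultimately show ?thesis
      using has_derivative_compose[of "\<lambda>t. t - fst z" "\<lambda>h. h" t UNIV \<psi>] by simp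
  qed
  have dcis: "((\<lambda>t. cis (2 * pi * (snd z \<bullet> t))) has_derivative (\<lambda>h. of_real (2 * pi * (snd z \<bullet> h)) * (\<i> * cis (2 * pi * (snd z \<bullet> t))))) (at t)" for t
  proof -
    have inner: "((\<lambda>t. \<i> * complex_of_real (2 * pi * (snd z \<bullet> t))) has_derivative (\<lambda>h. \<i> * complex_of_real (2 * pi * (snd z \<bullet> h)))) (at t)"
      by (auto intro!: derivative_eq_intros)
    have outer: "(exp has_derivative (\<lambda>h. exp w * h)) (at w)" for w :: complex
      using DERIV_exp[of w] by (simp add: has_field_derivative_def)
    show ?thesis
      unfolding cis_conv_exp using has_derivative_compose[OF inner outer] by (simp add: mult_ac)
  qed
  have D: "(tf_shift z \<psi> has_derivative (\<lambda>h. cis (2 * pi * (snd z \<bullet> t)) * frechet_derivative \<psi> (at (t - fst z)) h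
      + of_real (2 * pi * (snd z \<bullet> h)) * (\<i> * cis (2 * pi * (snd z \<bullet> t))) * \<psi> (t - fst z))) (at t)" for t
    unfolding tf_shift_def by (rule has_derivative_mult[OF dcis d\<psi>])
  then show "(\<lambda>t. tf_shift z \<psi> t) differentiable (at t)" by (auto simp: differentiable_def)
  show "partial_deriv j (tf_shift z \<psi>) = (\<lambda>t. (\<i> * of_real (2 * pi * snd z $ j)) * tf_shift z \<psi> t + 1 * tf_shift z (partial_deriv j \<psi>) t)"
  proof
    fix t
    show "partial_deriv j (tf_shift z \<psi>) t = (\<i> * of_real (2 * pi * snd z $ j)) * tf_shift z \<psi> t + 1 * tf_shift z (partial_deriv j \<psi>) t"
      unfolding partial_deriv_def frechet_derivative_at[OF D, symmetric]
      by (simp add: tf_shift_def partial_deriv_def inner_axis algebra_simps)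
  qed
qed

lemma smooth_fun_tf_shift:
  assumes "smooth_fun \<psi>"
  shows "smooth_fun (tf_shift z \<psi>)"
proof -
  have "smooth_upto n (tf_shift z \<psi>)" for n
    using assms
  proof (induction n arbitrary: \<psi>)
    case 0
    show ?case
      unfolding smooth_upto_def using partial_deriv_tf_shift(1)[OF smooth_fun_differentiable[OF 0]] by simp
  next
    case (Suc n)
    show ?case
    proof (rule smooth_upto_SucI)
      show "tf_shift z \<psi> differentiable (at x)" for x
        using partial_deriv_tf_shift(1)[OF smooth_fun_differentiable[OF Suc.prems]] by simp
      show "smooth_upto n (partial_deriv j (tf_shift z \<psi>))" for j
        unfolding partial_deriv_tf_shift(2)[OF smooth_fun_differentiable[OF Suc.prems]]
        by (intro smooth_upto_lincomb Suc.IH Suc.prems smooth_fun_partial)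
    qed
  qed
  then show ?thesis by (simp add: smooth_fun_upto)
qed

lemma schwartz_iff:
  "\<psi> \<in> schwartz \<longleftrightarrow> smooth_fun \<psi> \<and> (\<forall>js k. \<exists>C. \<forall>t. norm t ^ k * norm (iterated_partial js \<psi> t) \<le> C)"
  unfolding schwartz_def smooth_fun_def by (auto simp: bounded_iff)

lemma schwartz_smooth: "\<psi> \<in> schwartz \<Longrightarrow> smooth_fun \<psi>"
  by (simp add: schwartz_iff)

lemma schwartz_iterated_decay:
  assumes "\<psi> \<in> schwartz"
  shows "\<exists>C\<ge>0. \<forall>t. (1 + norm t) ^ k * norm (iterated_partial js \<psi> t) \<le> C"
proof -
  obtain C0 C1 where C0: "\<And>t. norm t ^ 0 * norm (iterated_partial js \<psi> t) \<le> C0"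
    and C1: "\<And>t. norm t ^ k * norm (iterated_partial js \<psi> t) \<le> C1"
    using assms unfolding schwartz_iff by metis
  have "(1 + norm t) ^ k * norm (iterated_partial js \<psi> t) \<le> 2 ^ k * (C0 + C1)" for t
  proof -
    have "(1 + norm t) ^ k \<le> (2 * max 1 (norm t)) ^ k" by (intro power_mono) auto
    also have "\<dots> = 2 ^ k * (max 1 (norm t)) ^ k" by (rule power_mult_distrib)
    also have "(max 1 (norm t)) ^ k \<le> 1 + norm t ^ k" by (simp add: max_def)
    finally have "(1 + norm t) ^ k \<le> 2 ^ k * (1 + norm t ^ k)" by simp
    then have "(1 + norm t) ^ k * norm (iterated_partial js \<psi> t) \<le> 2 ^ k * (1 + norm t ^ k) * norm (iterated_partial js \<psi> t)"
      by (intro mult_right_mono) auto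
    also have "\<dots> = 2 ^ k * (norm t ^ 0 * norm (iterated_partial js \<psi> t) + norm t ^ k * norm (iterated_partial js \<psi> t))"
      by (simp add: algebra_simps)
    also have "\<dots> \<le> 2 ^ k * (C0 + C1)" by (intro mult_left_mono add_mono C0 C1) auto
    finally show ?thesis .
  qed
  moreover from this[of 0] have "0 \<le> 2 ^ k * (C0 + C1)"
    by (rule order_trans[rotated]) simp
  ultimately show ?thesis by blast
qed

lemma schwartz_decay:
  assumes "\<psi> \<in> schwartz"
  shows "\<exists>C\<ge>0. \<forall>t. norm (\<psi> t) \<le> C / (1 + norm t) ^ k"
proof -
  obtain C where "0 \<le> C" and C: "\<And>t. (1 + norm t) ^ k * norm (\<psi> t) \<le> C"
    using schwartz_iterated_decay[OF assms, of k "[]"] by auto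
  have "norm (\<psi> t) \<le> C / (1 + norm t) ^ k" for t
    using C[of t] by (simp add: pos_le_divide_eq add_pos_nonneg mult.commute)
  with \<open>0 \<le> C\<close> show ?thesis by blast
qed

lemma schwartz_partial: "\<psi> \<in> schwartz \<Longrightarrow> partial_deriv j \<psi> \<in> schwartz"
  unfolding schwartz_iff by (metis iterated_partial_snoc smooth_fun_partial)

lemma schwartz_lincomb:
  assumes "f \<in> schwartz" "g \<in> schwartz"
  shows "(\<lambda>t. a * f t + b * g t) \<in> schwartz"
  unfolding schwartz_iff
proof (intro conjI allI)
  show "smooth_fun (\<lambda>t. a * f t + b * g t)" using assms by (intro smooth_fun_lincomb schwartz_smooth)
  fix js :: "'a list" and k
  obtain C1 C2 where C: "\<And>t. norm t ^ k * norm (iterated_partial js f t) \<le> C1"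
    "\<And>t. norm t ^ k * norm (iterated_partial js g t) \<le> C2"
    using assms unfolding schwartz_iff by metis
  have "norm t ^ k * norm (iterated_partial js (\<lambda>t. a * f t + b * g t) t) \<le> norm a * C1 + norm b * C2" for t
  proof -
    have "norm t ^ k * norm (iterated_partial js (\<lambda>t. a * f t + b * g t) t)
      \<le> norm t ^ k * (norm a * norm (iterated_partial js f t) + norm b * norm (iterated_partial js g t))"
      using norm_triangle_ineq[of "a * iterated_partial js f t" "b * iterated_partial js g t"]
      unfolding iterated_partial_lincomb[OF assms[THEN schwartz_smooth]]
      by (intro mult_left_mono) (auto simp: norm_mult)
    also have "\<dots> = norm a * (norm t ^ k * norm (iterated_partial js f t)) + norm b * (norm t ^ k * norm (iterated_partial js g t))"
      by (simp add: algebra_simps)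
    also have "\<dots> \<le> norm a * C1 + norm b * C2"
      by (intro add_mono mult_left_mono C) auto
    finally show ?thesis .
  qed
  then show "\<exists>C. \<forall>t. norm t ^ k * norm (iterated_partial js (\<lambda>t. a * f t + b * g t) t) \<le> C" by blast
qed

lemma schwartz_cmult: "f \<in> schwartz \<Longrightarrow> (\<lambda>t. a * f t) \<in> schwartz"
  using schwartz_lincomb[of f f a 0] by simp

lemma schwartz_cnj: "f \<in> schwartz \<Longrightarrow> (\<lambda>t. cnj (f t)) \<in> schwartz"
  unfolding schwartz_iff using iterated_partial_cnj[of f] by auto

lemma schwartz_continuous: "\<psi> \<in> schwartz \<Longrightarrow> continuous_on UNIV \<psi>"
  using smooth_fun_differentiable[OF schwartz_smooth]
  by (auto intro!: differentiable_imp_continuous_on differentiable_at_imp_differentiable_on)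

lemma schwartz_measurable: "\<psi> \<in> schwartz \<Longrightarrow> \<psi> \<in> borel_measurable borel"
  by (intro borel_measurable_continuous_onI schwartz_continuous)

lemma schwartz_integrable: "\<psi> \<in> schwartz \<Longrightarrow> integrable lborel \<psi>"
  using schwartz_decay[of \<psi>] schwartz_measurable[of \<psi>] by (metis integrable_decay)

lemma schwartz_bounded: "\<psi> \<in> schwartz \<Longrightarrow> \<exists>C\<ge>0. \<forall>t. norm (\<psi> t) \<le> C"
  using schwartz_decay[of \<psi> 0] by simp

lemma schwartz_sum:
  assumes "finite F" "F \<noteq> {}" "\<And>y. y \<in> F \<Longrightarrow> k y \<in> schwartz"
  shows "(\<lambda>t. \<Sum>y\<in>F. c y * k y t) \<in> schwartz"
    and "iterated_partial js (\<lambda>t. \<Sum>y\<in>F. c y * k y t) t = (\<Sum>y\<in>F. c y * iterated_partial js (k y) t)"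
    and "T \<in> tempered_distributions \<Longrightarrow> T (\<lambda>t. \<Sum>y\<in>F. c y * k y t) = (\<Sum>y\<in>F. c y * T (k y))"
proof -
  have "(\<lambda>t. \<Sum>y\<in>F. c y * k y t) \<in> schwartz \<and>
    iterated_partial js (\<lambda>t. \<Sum>y\<in>F. c y * k y t) t = (\<Sum>y\<in>F. c y * iterated_partial js (k y) t) \<and>
    (T \<in> tempered_distributions \<longrightarrow> T (\<lambda>t. \<Sum>y\<in>F. c y * k y t) = (\<Sum>y\<in>F. c y * T (k y)))"
    using assms
  proof (induction F rule: finite_ne_induct)
    case (singleton x)
    then show ?case
      using iterated_partial_lincomb[of "k x" "k x" js "c x" 0 t] schwartz_smooth[of "k x"]
      by (auto simp: schwartz_cmult tempered_distributions_def)
  next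
    case (insert x F)
    let ?S = "\<lambda>t. \<Sum>y\<in>F. c y * k y t"
    have S: "?S \<in> schwartz" and k: "k x \<in> schwartz" using insert by auto
    have eq: "(\<lambda>t. \<Sum>y\<in>insert x F. c y * k y t) = (\<lambda>t. c x * k x t + 1 * ?S t)"
      using insert by (simp add: fun_eq_iff)
    have T: "T (\<lambda>t. c x * k x t + 1 * ?S t) = c x * T (k x) + T ?S" if "T \<in> tempered_distributions"
      using tempered_distributionD(2)[OF that schwartz_cmult[OF k] S, of "c x"] tempered_distributionD(3)[OF that k] by simp
    show ?case
      unfolding eq using insert S k T schwartz_lincomb[OF k S, of "c x" 1]
        iterated_partial_lincomb[OF k[THEN schwartz_smooth] S[THEN schwartz_smooth], of js "c x" 1 t]
      by auto
  qed
  then show "(\<lambda>t. \<Sum>y\<in>F. c y * k y t) \<in> schwartz"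
    "iterated_partial js (\<lambda>t. \<Sum>y\<in>F. c y * k y t) t = (\<Sum>y\<in>F. c y * iterated_partial js (k y) t)"
    "T \<in> tempered_distributions \<Longrightarrow> T (\<lambda>t. \<Sum>y\<in>F. c y * k y t) = (\<Sum>y\<in>F. c y * T (k y))"
    by blast+
qed

section \<open>Families of Schwartz functions depending on a parameter\<close>

lemma norm_cis_diff_le: "norm (cis a - cis b) \<le> \<bar>a - b\<bar>"
proof -
  have "cis a - cis b = cis b * (cis (a - b) - 1)"
    by (simp add: cis_mult algebra_simps)
  then have "norm (cis a - cis b) = norm (iexp (a - b) - 1)"
    by (simp add: norm_mult cis_conv_exp)
  also have "\<dots> \<le> \<bar>a - b\<bar>"
    using iexp_approx1[of "a - b" 0] by simp
  finally show ?thesis .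
qed

lemma norm_frechet_derivative_le:
  fixes f :: "real^'d \<Rightarrow> complex"
  assumes "f differentiable (at x)"
  shows "norm (frechet_derivative f (at x) v) \<le> (\<Sum>j\<in>UNIV. norm (partial_deriv j f x)) * norm v"
proof -
  have lin: "linear (frechet_derivative f (at x))"
    using assms by (intro linear_frechet_derivative)
  have "frechet_derivative f (at x) v = frechet_derivative f (at x) (\<Sum>j\<in>UNIV. v $ j *\<^sub>R axis j 1)"
    using basis_expansion[of v] by (simp add: scalar_mult_eq_scaleR)
  also have "\<dots> = (\<Sum>j\<in>UNIV. v $ j *\<^sub>R partial_deriv j f x)"
    by (simp add: linear_sum[OF lin] linear_cmul[OF lin] partial_deriv_def)
  also have "norm \<dots> \<le> (\<Sum>j\<in>UNIV. norm v * norm (partial_deriv j f x))"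
    by (intro order_trans[OF norm_sum] sum_mono) (auto intro: mult_right_mono component_le_norm_cart)
  finally show ?thesis by (simp add: sum_distrib_left mult.commute)
qed

text \<open>Peetre's inequality in its elementary form: it trades a weight in \<open>t\<close> for
  weights in \<open>t - x\<close> and \<open>x\<close>.\<close>

lemma one_plus_norm_le: "norm (t::'b::real_normed_vector) \<le> (1 + norm (t - x)) * (1 + norm x)"
  and one_plus_norm_le': "1 + norm (t::'b::real_normed_vector) \<le> (1 + norm (t - x)) * (1 + norm x)"
proof -
  have "norm t \<le> norm (t - x) + norm x" using norm_triangle_ineq[of "t - x" x] by simp
  moreover have "0 \<le> norm (t - x) * norm x" by simp
  moreover have "(1 + norm (t - x)) * (1 + norm x) = 1 + norm (t - x) + norm x + norm (t - x) * norm x"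
    by (simp add: algebra_simps)
  ultimately show "1 + norm t \<le> (1 + norm (t - x)) * (1 + norm x)" by linarith
  then show "norm t \<le> (1 + norm (t - x)) * (1 + norm x)" by linarith
qed

text \<open>Every Schwartz seminorm is Lipschitz in the parameter, with a constant of polynomial
  growth. A tempered distribution is then continuous and of polynomial growth along the family, as
  its interchange with integrals against rapidly decaying weights requires.\<close>

definition poly_lipschitz :: "('e::real_normed_vector \<Rightarrow> real^'d \<Rightarrow> complex) \<Rightarrow> bool" where
  "poly_lipschitz k \<longleftrightarrow> (\<forall>js l. \<exists>C\<ge>0. \<exists>m. \<forall>w w' t. norm t ^ l * norm (iterated_partial js (k w) t - iterated_partial js (k w') t)
      \<le> C * (1 + norm w + norm w') ^ m * norm (w - w'))"

definition schwartz_family :: "('e::real_normed_vector \<Rightarrow> real^'d \<Rightarrow> complex) \<Rightarrow> bool" where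
  "schwartz_family k \<longleftrightarrow> (\<forall>w. smooth_fun (k w)) \<and> k 0 \<in> schwartz \<and> poly_lipschitz k"

lemma poly_lipschitz_bound:
  assumes L: "\<And>w w' t. norm t ^ l * norm (f w t - f w' t) \<le> C * (1 + norm w + norm w') ^ m * norm (w - w')"
    and C: "0 \<le> C" and B: "\<And>t. norm t ^ l * norm (f 0 t) \<le> (B :: real)"
  shows "norm t ^ l * norm (f (w :: 'e::real_normed_vector) (t :: 'b::real_normed_vector) :: complex) \<le> (B + C) * (1 + norm w) ^ (m + 1)"
proof -
  have B0: "0 \<le> B" by (rule order_trans[OF _ B[of 0]]) simp
  have "norm t ^ l * norm (f w t) \<le> norm t ^ l * (norm (f 0 t) + norm (f w t - f 0 t))"
    by (intro mult_left_mono norm_triangle_sub) simp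
  also have "\<dots> = norm t ^ l * norm (f 0 t) + norm t ^ l * norm (f w t - f 0 t)"
    by (rule distrib_left)
  also have "\<dots> \<le> B + C * (1 + norm w) ^ m * norm w"
    using B[of t] L[of t w 0] by simp
  also have "\<dots> \<le> B * (1 + norm w) ^ (m + 1) + C * ((1 + norm w) ^ m * (1 + norm w))"
  proof (intro add_mono)
    have "B * 1 \<le> B * (1 + norm w) ^ (m + 1)" by (intro mult_left_mono one_le_power B0) auto
    then show "B \<le> B * (1 + norm w) ^ (m + 1)" by simp
    show "C * (1 + norm w) ^ m * norm w \<le> C * ((1 + norm w) ^ m * (1 + norm w))"
      unfolding mult.assoc by (intro mult_left_mono C) auto
  qed
  also have "\<dots> = (B + C) * (1 + norm w) ^ (m + 1)" by (simp add: algebra_simps)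
  finally show ?thesis .
qed

lemma schwartz_family_bound:
  assumes "schwartz_family k"
  shows "\<exists>C\<ge>0. \<exists>m. \<forall>w t. norm t ^ l * norm (iterated_partial js (k w) t) \<le> C * (1 + norm w) ^ m"
proof -
  obtain C m where C: "0 \<le> C" and L: "\<And>w w' t. norm t ^ l * norm (iterated_partial js (k w) t - iterated_partial js (k w') t)
      \<le> C * (1 + norm w + norm w') ^ m * norm (w - w')"
    using assms unfolding schwartz_family_def poly_lipschitz_def by meson
  obtain B where B: "\<And>t. norm t ^ l * norm (iterated_partial js (k 0) t) \<le> B"
    using assms unfolding schwartz_family_def schwartz_iff by meson
  have B0: "0 \<le> B" by (rule order_trans[OF _ B[of 0]]) simp
  show ?thesis
    using poly_lipschitz_bound[where f="\<lambda>w. iterated_partial js (k w)", OF L C B] B0 C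
    by (intro exI[of _ "B + C"] conjI exI[of _ "m + 1"]) auto
qed

lemma schwartz_family_schwartz:
  assumes "schwartz_family k"
  shows "k w \<in> schwartz"
  unfolding schwartz_iff
proof (intro conjI allI)
  show "smooth_fun (k w)" using assms by (simp add: schwartz_family_def)
  fix js :: "'b list" and l
  obtain C m where "\<And>w t. norm t ^ l * norm (iterated_partial js (k w) t) \<le> C * (1 + norm w) ^ m"
    using schwartz_family_bound[OF assms] by meson
  then show "\<exists>C. \<forall>t. norm t ^ l * norm (iterated_partial js (k w) t) \<le> C" by blast
qed

lemma schwartz_family_cnj:
  assumes "schwartz_family k"
  shows "schwartz_family (\<lambda>w t. cnj (k w t))"
proof -
  have eq: "iterated_partial js (\<lambda>t. cnj (k w t)) = (\<lambda>t. cnj (iterated_partial js (k w) t))" for js w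
    using assms by (intro iterated_partial_cnj) (simp add: schwartz_family_def)
  show ?thesis
    using assms unfolding schwartz_family_def poly_lipschitz_def eq complex_cnj_diff[symmetric] complex_mod_cnj
    by (auto intro: iterated_partial_cnj schwartz_cnj)
qed

text \<open>The mean value inequality on the segment from \<open>t - x\<close> to
  \<open>t - x'\<close>: its points differ from \<open>t\<close> by at most
  \<open>norm x + norm x'\<close>, so Peetre's inequality converts the weight in \<open>t\<close>
  into decay of the partial derivatives of \<open>\<psi>\<close>.\<close>

lemma norm_schwartz_diff_le:
  fixes \<psi> :: "real^'d \<Rightarrow> complex"
  assumes "\<psi> \<in> schwartz"
  shows "\<exists>C\<ge>0. \<forall>t x x'. norm t ^ l * norm (\<psi> (t - x) - \<psi> (t - x')) \<le> C * (1 + norm x + norm x') ^ l * norm (x - x')"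
proof -
  have "\<forall>j. \<exists>C\<ge>0. \<forall>y. (1 + norm y) ^ l * norm (partial_deriv j \<psi> y) \<le> C"
    using schwartz_iterated_decay[OF schwartz_partial[OF assms], of l "[]"] by simp
  then obtain c where c: "\<And>j. 0 \<le> c j" "\<And>j y. (1 + norm y) ^ l * norm (partial_deriv j \<psi> y) \<le> c j" by metis
  define C where "C = (\<Sum>j\<in>UNIV. c j)"
  have C: "0 \<le> C" unfolding C_def by (intro sum_nonneg c)
  have "norm t ^ l * norm (\<psi> (t - x) - \<psi> (t - x')) \<le> C * (1 + norm x + norm x') ^ l * norm (x - x')" for t x x' :: "real^'d"
  proof -
    let ?S = "closed_segment (t - x) (t - x')"
    let ?f = "\<lambda>y. (norm t ^ l) *\<^sub>R \<psi> y"
    have "norm (?f (t - x) - ?f (t - x')) \<le> (C * (1 + norm x + norm x') ^ l) * norm ((t - x) - (t - x'))"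
    proof (rule differentiable_bound[where S="?S" and f'="\<lambda>y h. (norm t ^ l) *\<^sub>R frechet_derivative \<psi> (at y) h"])
      fix y assume y: "y \<in> ?S"
      have d: "\<psi> differentiable (at y)"
        using smooth_fun_differentiable[OF schwartz_smooth[OF assms]] .
      show "(?f has_derivative (\<lambda>h. (norm t ^ l) *\<^sub>R frechet_derivative \<psi> (at y) h)) (at y within ?S)"
        using d unfolding frechet_derivative_works
        by (rule has_derivative_scaleR_right[OF has_derivative_at_withinI])
      show "onorm (\<lambda>h. (norm t ^ l) *\<^sub>R frechet_derivative \<psi> (at y) h) \<le> C * (1 + norm x + norm x') ^ l"
      proof (rule onorm_bound)
        show "0 \<le> C * (1 + norm x + norm x') ^ l" using C by simp
        fix h :: "real^'d"
        obtain u where u: "0 \<le> u" "u \<le> 1" "y = (1 - u) *\<^sub>R (t - x) + u *\<^sub>R (t - x')"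
          using y by (auto simp: closed_segment_def)
        have "norm (t - y) = norm ((1 - u) *\<^sub>R x + u *\<^sub>R x')"
          unfolding u(3) by (simp add: algebra_simps)
        also have "\<dots> \<le> (1 - u) * norm x + u * norm x'"
          using u norm_triangle_ineq[of "(1 - u) *\<^sub>R x" "u *\<^sub>R x'"] by simp
        also have "\<dots> \<le> norm x + norm x'"
          using u by (intro add_mono mult_left_le_one_le) auto
        finally have ty: "norm (t - y) \<le> norm x + norm x'" .
        have "norm t \<le> (1 + norm y) * (1 + norm x + norm x')"
        proof -
          have "norm t \<le> (1 + norm (t - (t - y))) * (1 + norm (t - y))" by (rule one_plus_norm_le)
          also have "\<dots> \<le> (1 + norm y) * (1 + norm x + norm x')" using ty by (intro mult_mono) auto
          finally show ?thesis .
        qed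
        then have "norm t ^ l \<le> (1 + norm y) ^ l * (1 + norm x + norm x') ^ l"
          unfolding power_mult_distrib[symmetric] by (intro power_mono) auto
        then have "norm t ^ l * (\<Sum>j\<in>UNIV. norm (partial_deriv j \<psi> y)) \<le> (1 + norm y) ^ l * (1 + norm x + norm x') ^ l * (\<Sum>j\<in>UNIV. norm (partial_deriv j \<psi> y))"
          by (intro mult_right_mono sum_nonneg) auto
        also have "\<dots> = (1 + norm x + norm x') ^ l * (\<Sum>j\<in>UNIV. (1 + norm y) ^ l * norm (partial_deriv j \<psi> y))"
          unfolding sum_distrib_left[symmetric] by (simp only: mult_ac)
        also have "\<dots> \<le> (1 + norm x + norm x') ^ l * C"
          unfolding C_def by (intro mult_left_mono sum_mono c) auto
        finally have b: "norm t ^ l * (\<Sum>j\<in>UNIV. norm (partial_deriv j \<psi> y)) \<le> C * (1 + norm x + norm x') ^ l"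
          by (simp add: mult.commute)
        have "norm ((norm t ^ l) *\<^sub>R frechet_derivative \<psi> (at y) h) \<le> norm t ^ l * ((\<Sum>j\<in>UNIV. norm (partial_deriv j \<psi> y)) * norm h)"
          using norm_frechet_derivative_le[OF d, of h] by (simp add: mult_left_mono)
        also have "\<dots> \<le> C * (1 + norm x + norm x') ^ l * norm h"
          using mult_right_mono[OF b norm_ge_zero[of h]] by (simp add: mult.assoc)
        finally show "norm ((norm t ^ l) *\<^sub>R frechet_derivative \<psi> (at y) h) \<le> C * (1 + norm x + norm x') ^ l * norm h" .
      qed
    qed auto
    then show ?thesis
      by (simp add: scaleR_diff_right[symmetric] norm_minus_commute)
  qed
  then show ?thesis using C by blast
qed

lemma norm_fst_snd_le: "norm (fst z) \<le> norm z" "norm (snd z) \<le> norm z"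
  by (simp_all add: norm_fst_le[of "fst z" "snd z", simplified] norm_snd_le[of "snd z" "fst z", simplified])

text \<open>Modulation and translation are varied one after the other. Varying the modulation brings
  down a factor \<open>norm t\<close>, paid for by one more power of decay; hence the exponent
  \<open>l + 1\<close>.\<close>

lemma tf_shift_lipschitz:
  fixes \<psi> :: "real^'d \<Rightarrow> complex"
  assumes "\<psi> \<in> schwartz"
  shows "\<exists>C\<ge>0. \<exists>m. \<forall>w w' t. norm t ^ l * norm (tf_shift w \<psi> t - tf_shift w' \<psi> t)
    \<le> C * (1 + norm w + norm w') ^ m * norm (w - w')"
proof -
  obtain C1 where C1: "0 \<le> C1" "\<And>t x x'. norm t ^ l * norm (\<psi> (t - x) - \<psi> (t - x')) \<le> C1 * (1 + norm x + norm x') ^ l * norm (x - x')"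
    using norm_schwartz_diff_le[OF assms] by blast
  obtain C2 where C2: "0 \<le> C2" "\<And>t. (1 + norm t) ^ (l + 1) * norm (\<psi> t) \<le> C2"
    using schwartz_iterated_decay[OF assms, of "l + 1" "[]"] by auto
  have "norm t ^ l * norm (tf_shift w \<psi> t - tf_shift w' \<psi> t) \<le> (2 * pi * C2 + C1) * (1 + norm w + norm w') ^ (l + 1) * norm (w - w')" for w w' t
  proof -
    define X where "X = 1 + norm w + norm w'"
    have X: "1 \<le> X" by (simp add: X_def)
    let ?a = "2 * pi * (snd w \<bullet> t)" and ?b = "2 * pi * (snd w' \<bullet> t)"
    have d: "norm (fst w - fst w') \<le> norm (w - w')" "norm (snd w - snd w') \<le> norm (w - w')"
      using norm_fst_snd_le[of "w - w'"] by simp_all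
    have ab: "\<bar>?a - ?b\<bar> \<le> 2 * pi * (norm (w - w') * norm t)"
    proof -
      have "?a - ?b = 2 * pi * ((snd w - snd w') \<bullet> t)" by (simp add: inner_diff_left algebra_simps)
      then have "\<bar>?a - ?b\<bar> = 2 * pi * \<bar>(snd w - snd w') \<bullet> t\<bar>" by (simp add: abs_mult)
      also have "\<dots> \<le> 2 * pi * (norm (snd w - snd w') * norm t)"
        by (intro mult_left_mono Cauchy_Schwarz_ineq2) auto
      also have "\<dots> \<le> 2 * pi * (norm (w - w') * norm t)"
        by (intro mult_left_mono mult_right_mono d) auto
      finally show ?thesis .
    qed
    have p1: "norm t ^ (l + 1) * norm (\<psi> (t - fst w)) \<le> C2 * X ^ (l + 1)"
    proof -
      have "norm t \<le> (1 + norm (t - fst w)) * (1 + norm (fst w))" by (rule one_plus_norm_le)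
      also have "\<dots> \<le> (1 + norm (t - fst w)) * X"
        using norm_fst_snd_le(1)[of w] by (intro mult_left_mono) (simp_all add: X_def add_increasing2)
      finally have "norm t ^ (l + 1) \<le> (1 + norm (t - fst w)) ^ (l + 1) * X ^ (l + 1)"
        unfolding power_mult_distrib[symmetric] by (intro power_mono) auto
      then have "norm t ^ (l + 1) * norm (\<psi> (t - fst w)) \<le> (1 + norm (t - fst w)) ^ (l + 1) * X ^ (l + 1) * norm (\<psi> (t - fst w))"
        by (intro mult_right_mono) auto
      also have "\<dots> = ((1 + norm (t - fst w)) ^ (l + 1) * norm (\<psi> (t - fst w))) * X ^ (l + 1)" by (simp only: mult_ac)
      also have "\<dots> \<le> C2 * X ^ (l + 1)" using X by (intro mult_right_mono C2) auto
      finally show ?thesis .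
    qed
    have p2: "norm t ^ l * norm (\<psi> (t - fst w) - \<psi> (t - fst w')) \<le> C1 * X ^ (l + 1) * norm (w - w')"
    proof -
      have "norm t ^ l * norm (\<psi> (t - fst w) - \<psi> (t - fst w')) \<le> C1 * (1 + norm (fst w) + norm (fst w')) ^ l * norm (fst w - fst w')"
        by (rule C1(2))
      also have "\<dots> \<le> C1 * X ^ l * norm (w - w')"
        unfolding X_def using norm_fst_snd_le(1)[of w] norm_fst_snd_le(1)[of w'] C1(1)
        by (intro mult_mono power_mono d mult_left_mono) auto
      also have "\<dots> \<le> C1 * X ^ (l + 1) * norm (w - w')"
        using C1(1) X by (intro mult_right_mono mult_left_mono power_increasing) auto
      finally show ?thesis .
    qed
    have "tf_shift w \<psi> t - tf_shift w' \<psi> t = (cis ?a - cis ?b) * \<psi> (t - fst w) + cis ?b * (\<psi> (t - fst w) - \<psi> (t - fst w'))"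
      by (simp add: tf_shift_def algebra_simps)
    then have "norm (tf_shift w \<psi> t - tf_shift w' \<psi> t) \<le> norm (cis ?a - cis ?b) * norm (\<psi> (t - fst w)) + norm (\<psi> (t - fst w) - \<psi> (t - fst w'))"
      using norm_triangle_ineq[of "(cis ?a - cis ?b) * \<psi> (t - fst w)" "cis ?b * (\<psi> (t - fst w) - \<psi> (t - fst w'))"]
      by (simp add: norm_mult)
    also have "\<dots> \<le> 2 * pi * (norm (w - w') * norm t) * norm (\<psi> (t - fst w)) + norm (\<psi> (t - fst w) - \<psi> (t - fst w'))"
      using order_trans[OF norm_cis_diff_le ab] by (intro add_right_mono mult_right_mono) auto
    finally have "norm t ^ l * norm (tf_shift w \<psi> t - tf_shift w' \<psi> t)
      \<le> norm t ^ l * (2 * pi * (norm (w - w') * norm t) * norm (\<psi> (t - fst w)) + norm (\<psi> (t - fst w) - \<psi> (t - fst w')))"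
      by (intro mult_left_mono) auto
    also have "\<dots> = 2 * pi * (norm t ^ (l + 1) * norm (\<psi> (t - fst w))) * norm (w - w') + norm t ^ l * norm (\<psi> (t - fst w) - \<psi> (t - fst w'))"
      by (simp add: algebra_simps)
    also have "\<dots> \<le> 2 * pi * (C2 * X ^ (l + 1)) * norm (w - w') + C1 * X ^ (l + 1) * norm (w - w')"
      by (intro add_mono mult_right_mono mult_left_mono p1 p2) auto
    also have "\<dots> = (2 * pi * C2 + C1) * X ^ (l + 1) * norm (w - w')" by (simp add: algebra_simps)
    finally show ?thesis unfolding X_def .
  qed
  moreover have "0 \<le> 2 * pi * C2 + C1" using C1(1) C2(1) by simp
  ultimately show ?thesis by blast
qed

lemma tf_shift_0: "tf_shift 0 \<psi> = \<psi>"
  by (simp add: tf_shift_def)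

text \<open>Induction with the innermost derivative split off: it yields the shift of a derivative
  and the shift itself times \<open>2 * pi * snd w $ j\<close> up to a unimodular factor. That
  unbounded factor is Lipschitz and of linear growth, so the polynomial constants accommodate
  it.\<close>

lemma poly_lipschitz_tf_shift:
  assumes "\<psi> \<in> schwartz"
  shows "\<exists>C\<ge>0. \<exists>m. \<forall>w w' t. norm t ^ l * norm (iterated_partial js (tf_shift w \<psi>) t - iterated_partial js (tf_shift w' \<psi>) t)
    \<le> C * (1 + norm w + norm w') ^ m * norm (w - w')"
  using assms
proof (induction js arbitrary: \<psi> rule: rev_induct)
  case Nil
  then show ?case using tf_shift_lipschitz by simp
next
  case (snoc j js)
  let ?D = "\<lambda>w. iterated_partial js (tf_shift w \<psi>)" and ?E = "\<lambda>w. iterated_partial js (tf_shift w (partial_deriv j \<psi>))"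
  have sm: "smooth_fun \<psi>" by (rule schwartz_smooth[OF snoc.prems])
  obtain C1 m1 where C1: "0 \<le> C1" "\<And>w w' t. norm t ^ l * norm (?D w t - ?D w' t) \<le> C1 * (1 + norm w + norm w') ^ m1 * norm (w - w')"
    using snoc.IH[OF snoc.prems] by meson
  obtain C2 m2 where C2: "0 \<le> C2" "\<And>w w' t. norm t ^ l * norm (?E w t - ?E w' t) \<le> C2 * (1 + norm w + norm w') ^ m2 * norm (w - w')"
    using snoc.IH[OF schwartz_partial[OF snoc.prems]] by meson
  obtain B where B: "\<And>t. norm t ^ l * norm (iterated_partial js \<psi> t) \<le> B"
    using snoc.prems unfolding schwartz_iff by meson
  have B0: "0 \<le> B" by (rule order_trans[OF _ B[of 0]]) simp
  have D_le: "norm t ^ l * norm (?D w t) \<le> (B + C1) * (1 + norm w) ^ (m1 + 1)" for w t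
    by (rule poly_lipschitz_bound[where f="?D", OF C1(2,1)]) (simp add: tf_shift_0 B)
  have eq: "iterated_partial (js @ [j]) (tf_shift w \<psi>) t = (\<i> * of_real (2 * pi * snd w $ j)) * ?D w t + 1 * ?E w t" for w t
    unfolding iterated_partial_snoc partial_deriv_tf_shift(2)[OF smooth_fun_differentiable[OF sm]]
    by (intro iterated_partial_lincomb smooth_fun_tf_shift sm smooth_fun_partial)
  define m where "m = m1 + m2 + 1"
  have "norm t ^ l * norm (iterated_partial (js @ [j]) (tf_shift w \<psi>) t - iterated_partial (js @ [j]) (tf_shift w' \<psi>) t)
      \<le> (2 * pi * C1 + 2 * pi * (B + C1) + C2) * (1 + norm w + norm w') ^ m * norm (w - w')" for w w' t
  proof -
    define X where "X = 1 + norm w + norm w'"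
    have X: "1 \<le> X" by (simp add: X_def)
    have n: "norm ((\<i> * of_real (2 * pi * s)) * x) = 2 * pi * \<bar>s\<bar> * norm x" for s and x :: complex
      by (simp add: norm_mult abs_mult)
    have tri: "norm (a + b + c) \<le> norm a + norm b + norm c" for a b c :: complex
      using norm_triangle_ineq[of "a + b" c] norm_triangle_ineq[of a b] by linarith
    have dist: "c * (a * p + b * q + r) = a * (c * p) + b * (c * q) + c * r" for a b c p q r :: real
      by (simp add: algebra_simps)
    have wj: "\<bar>snd w $ j\<bar> \<le> X"
      using component_le_norm_cart[of "snd w" j] norm_fst_snd_le(2)[of w] norm_ge_zero[of w'] unfolding X_def by linarith
    have wwj: "\<bar>snd w $ j - snd w' $ j\<bar> \<le> norm (w - w')"
      using component_le_norm_cart[of "snd w - snd w'" j] norm_fst_snd_le(2)[of "w - w'"] by simp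
    have "iterated_partial (js @ [j]) (tf_shift w \<psi>) t - iterated_partial (js @ [j]) (tf_shift w' \<psi>) t
      = (\<i> * of_real (2 * pi * snd w $ j)) * (?D w t - ?D w' t) + (\<i> * of_real (2 * pi * (snd w $ j - snd w' $ j))) * ?D w' t + (?E w t - ?E w' t)"
      unfolding eq by (simp add: algebra_simps)
    also have "norm \<dots> \<le> norm ((\<i> * of_real (2 * pi * snd w $ j)) * (?D w t - ?D w' t)) + norm ((\<i> * of_real (2 * pi * (snd w $ j - snd w' $ j))) * ?D w' t) + norm (?E w t - ?E w' t)"
      by (rule tri)
    also have "\<dots> = 2 * pi * \<bar>snd w $ j\<bar> * norm (?D w t - ?D w' t) + 2 * pi * \<bar>snd w $ j - snd w' $ j\<bar> * norm (?D w' t) + norm (?E w t - ?E w' t)"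
      by (simp only: n)
    finally have "norm t ^ l * norm (iterated_partial (js @ [j]) (tf_shift w \<psi>) t - iterated_partial (js @ [j]) (tf_shift w' \<psi>) t)
      \<le> norm t ^ l * (2 * pi * \<bar>snd w $ j\<bar> * norm (?D w t - ?D w' t) + 2 * pi * \<bar>snd w $ j - snd w' $ j\<bar> * norm (?D w' t) + norm (?E w t - ?E w' t))"
      by (intro mult_left_mono) auto
    also have "\<dots> = 2 * pi * \<bar>snd w $ j\<bar> * (norm t ^ l * norm (?D w t - ?D w' t)) + 2 * pi * \<bar>snd w $ j - snd w' $ j\<bar> * (norm t ^ l * norm (?D w' t)) + norm t ^ l * norm (?E w t - ?E w' t)"
      by (rule dist)
    also have "\<dots> \<le> 2 * pi * X * (C1 * X ^ m1 * norm (w - w')) + 2 * pi * norm (w - w') * ((B + C1) * X ^ (m1 + 1)) + C2 * X ^ m2 * norm (w - w')"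
    proof -
      have t1: "2 * pi * \<bar>snd w $ j\<bar> * (norm t ^ l * norm (?D w t - ?D w' t)) \<le> 2 * pi * X * (C1 * X ^ m1 * norm (w - w'))"
        by (rule mult_mono[OF _ C1(2)[of t w w', folded X_def]]) (use wj X in auto)
      have "norm t ^ l * norm (?D w' t) \<le> (B + C1) * (1 + norm w') ^ (m1 + 1)" by (rule D_le)
      also have "\<dots> \<le> (B + C1) * X ^ (m1 + 1)"
        unfolding X_def using B0 C1(1) by (intro mult_left_mono power_mono) auto
      finally have "norm t ^ l * norm (?D w' t) \<le> (B + C1) * X ^ (m1 + 1)" .
      from mult_mono[OF _ this, of "2 * pi * \<bar>snd w $ j - snd w' $ j\<bar>" "2 * pi * norm (w - w')"]
      have t2: "2 * pi * \<bar>snd w $ j - snd w' $ j\<bar> * (norm t ^ l * norm (?D w' t)) \<le> 2 * pi * norm (w - w') * ((B + C1) * X ^ (m1 + 1))"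
        using wwj by simp
      show ?thesis by (rule add_mono[OF add_mono[OF t1 t2] C2(2)[of t w w', folded X_def]])
    qed
    also have "\<dots> = (2 * pi * C1 * X ^ (m1 + 1) + 2 * pi * (B + C1) * X ^ (m1 + 1) + C2 * X ^ m2) * norm (w - w')"
      by (simp add: algebra_simps)
    also have "\<dots> \<le> (2 * pi * C1 * X ^ m + 2 * pi * (B + C1) * X ^ m + C2 * X ^ m) * norm (w - w')"
      using C1 C2 B0 X unfolding m_def
      by (intro mult_right_mono add_mono mult_left_mono power_increasing) auto
    also have "\<dots> = (2 * pi * C1 + 2 * pi * (B + C1) + C2) * X ^ m * norm (w - w')" by (simp add: algebra_simps)
    finally show ?thesis unfolding X_def .
  qed
  moreover have "0 \<le> 2 * pi * C1 + 2 * pi * (B + C1) + C2" using C1 C2 B0 by simp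
  ultimately show ?case by blast
qed

lemma schwartz_family_tf_shift:
  assumes "\<psi> \<in> schwartz"
  shows "schwartz_family (\<lambda>w. tf_shift w \<psi>)"
  unfolding schwartz_family_def poly_lipschitz_def
  using assms poly_lipschitz_tf_shift[OF assms] smooth_fun_tf_shift[OF schwartz_smooth[OF assms]]
  by (simp add: tf_shift_0)

lemma schwartz_tf_shift: "\<psi> \<in> schwartz \<Longrightarrow> tf_shift w \<psi> \<in> schwartz"
  using schwartz_family_schwartz[OF schwartz_family_tf_shift] .

section \<open>Tempered distributions and integrals of Schwartz functions\<close>

lemma schwartz_seminorm_bounds:
  assumes "\<And>t. norm t ^ k * norm (iterated_partial js f t) \<le> B"
  shows "0 \<le> schwartz_seminorm k js f" "schwartz_seminorm k js f \<le> B"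
proof -
  have "bdd_above (range (\<lambda>t. norm t ^ k * norm (iterated_partial js f t)))"
    using assms by (intro bdd_aboveI2)
  then have "norm (0 :: real^'a) ^ k * norm (iterated_partial js f 0) \<le> schwartz_seminorm k js f"
    unfolding schwartz_seminorm_def by (intro cSUP_upper) auto
  then show "0 \<le> schwartz_seminorm k js f" by (rule order_trans[rotated]) simp
  show "schwartz_seminorm k js f \<le> B"
    unfolding schwartz_seminorm_def using assms by (intro cSUP_least) auto
qed

lemma schwartz_null_sequenceI:
  assumes "\<And>n. \<psi> n \<in> schwartz"
    and "\<And>k js. \<exists>B. B \<longlonglongrightarrow> 0 \<and> (\<forall>n t. norm t ^ k * norm (iterated_partial js (\<psi> n) t) \<le> B n)"
  shows "schwartz_null_sequence \<psi>"
  unfolding schwartz_null_sequence_def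
proof (intro conjI allI assms(1))
  fix k and js :: "'a list"
  obtain B where B: "B \<longlonglongrightarrow> 0" "\<And>n t. norm t ^ k * norm (iterated_partial js (\<psi> n) t) \<le> B n"
    using assms(2) by blast
  show "(\<lambda>n. schwartz_seminorm k js (\<psi> n)) \<longlonglongrightarrow> 0"
  proof (rule Lim_null_comparison[OF always_eventually B(1)], rule allI)
    fix n
    show "norm (schwartz_seminorm k js (\<psi> n)) \<le> B n"
      using schwartz_seminorm_bounds[OF B(2), of n] by simp
  qed
qed

lemma tempered_family_tendsto:
  assumes T: "T \<in> tempered_distributions" and k: "schwartz_family k" and w: "w \<longlonglongrightarrow> v"
  shows "(\<lambda>n. T (k (w n))) \<longlonglongrightarrow> T (k v)"
proof -
  have S: "k u \<in> schwartz" for u by (rule schwartz_family_schwartz[OF k])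
  have "schwartz_null_sequence (\<lambda>n t. 1 * k (w n) t + (-1) * k v t)"
  proof (rule schwartz_null_sequenceI)
    show "(\<lambda>t. 1 * k (w n) t + (-1) * k v t) \<in> schwartz" for n by (intro schwartz_lincomb S)
    fix l and js :: "'a list"
    obtain C m where C: "\<And>w w' t. norm t ^ l * norm (iterated_partial js (k w) t - iterated_partial js (k w') t) \<le> C * (1 + norm w + norm w') ^ m * norm (w - w')"
      using k unfolding schwartz_family_def poly_lipschitz_def by meson
    have "(\<lambda>n. C * (1 + norm (w n) + norm v) ^ m * norm (w n - v)) \<longlonglongrightarrow> C * (1 + norm v + norm v) ^ m * norm (v - v)"
      by (intro tendsto_intros w)
    then have "(\<lambda>n. C * (1 + norm (w n) + norm v) ^ m * norm (w n - v)) \<longlonglongrightarrow> 0" by simp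
    moreover have "norm t ^ l * norm (iterated_partial js (\<lambda>t. 1 * k (w n) t + (-1) * k v t) t) \<le> C * (1 + norm (w n) + norm v) ^ m * norm (w n - v)" for n t
      unfolding iterated_partial_lincomb[OF S[THEN schwartz_smooth] S[THEN schwartz_smooth]] using C[of t "w n" v] by simp
    ultimately show "\<exists>B. B \<longlonglongrightarrow> 0 \<and> (\<forall>n t. norm t ^ l * norm (iterated_partial js (\<lambda>t. 1 * k (w n) t + (-1) * k v t) t) \<le> B n)" by blast
  qed
  from tempered_distributionD(4)[OF T this]
  have "(\<lambda>n. T (\<lambda>t. 1 * k (w n) t + (-1) * k v t)) \<longlonglongrightarrow> 0" .
  moreover have "T (\<lambda>t. 1 * k (w n) t + (-1) * k v t) = T (k (w n)) - T (k v)" for n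
    using tempered_distributionD(2)[OF T schwartz_cmult[OF S] schwartz_cmult[OF S], of 1 "w n" "-1" v]
      tempered_distributionD(3)[OF T S[of v], of "-1"]
    by simp
  ultimately show ?thesis by (simp add: LIM_zero_iff)
qed

lemma tempered_family_continuous:
  fixes k :: "'e::euclidean_space \<Rightarrow> real^'d \<Rightarrow> complex"
  assumes "T \<in> tempered_distributions" "schwartz_family k"
  shows "continuous_on UNIV (\<lambda>w. T (k w))"
  unfolding continuous_on_sequentially o_def
  using tempered_family_tendsto[OF assms] by blast

text \<open>Continuity is given only along null sequences, so the proof is by contradiction: if the
  bound failed for every \<open>m\<close>, dividing \<open>k (w n)\<close> by
  \<open>(n + 1) * (1 + norm (w n)) ^ n\<close> would give a null sequence on which \<open>T\<close>
  stays above 1 in modulus. With \<open>m\<close> both in the exponent and in the constant, one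
  sequence violates all the bounds.\<close>

lemma tempered_family_growth:
  fixes k :: "'e::euclidean_space \<Rightarrow> real^'d \<Rightarrow> complex"
  assumes T: "T \<in> tempered_distributions" and k: "schwartz_family k"
  shows "\<exists>m. \<forall>w. norm (T (k w)) \<le> real (Suc m) * (1 + norm w) ^ m"
proof (rule ccontr)
  assume "\<not> ?thesis"
  then have "\<forall>n. \<exists>w. real (Suc n) * (1 + norm w) ^ n < norm (T (k w))" by (simp add: not_le)
  then obtain w where w: "\<And>n. real (Suc n) * (1 + norm (w n)) ^ n < norm (T (k (w n)))" by metis
  define a where "a n = 1 / (real (Suc n) * (1 + norm (w n)) ^ n)" for n
  have a_pos: "0 < a n" for n
    unfolding a_def by (intro divide_pos_pos mult_pos_pos zero_less_power) (auto simp: add_pos_nonneg)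
  have S: "k u \<in> schwartz" for u by (rule schwartz_family_schwartz[OF k])
  have "schwartz_null_sequence (\<lambda>n t. of_real (a n) * k (w n) t + 0 * k (w n) t)"
  proof (rule schwartz_null_sequenceI)
    show "(\<lambda>t. of_real (a n) * k (w n) t + 0 * k (w n) t) \<in> schwartz" for n by (intro schwartz_lincomb S)
    fix l and js :: "'d list"
    obtain C m where C: "0 \<le> C" "\<And>w t. norm t ^ l * norm (iterated_partial js (k w) t) \<le> C * (1 + norm w) ^ m"
      using schwartz_family_bound[OF k, of l js] by meson
    define B where "B n = a n * (C * (1 + norm (w n)) ^ m)" for n
    have "B \<longlonglongrightarrow> 0"
    proof (rule Lim_null_comparison)
      show "\<forall>\<^sub>F n in sequentially. norm (B n) \<le> C * inverse (real (Suc n))"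
        using eventually_ge_at_top[of m]
      proof eventually_elim
        case (elim n)
        have X: "0 < (1 + norm (w n)) ^ n" by (intro zero_less_power) (simp add: add_pos_nonneg)
        have "norm (B n) = a n * (C * (1 + norm (w n)) ^ m)"
          using a_pos[of n] C(1) by (simp add: B_def abs_mult)
        also have "\<dots> \<le> a n * (C * (1 + norm (w n)) ^ n)"
          using a_pos[of n] C(1) elim by (intro mult_left_mono power_increasing) auto
        also have "\<dots> = C * inverse (real (Suc n))"
        proof -
          have "1 / (S * Y) * (C * Y) = C * inverse S" if "0 < Y" for S Y :: real
            using that by (simp add: inverse_eq_divide)
          then show ?thesis unfolding a_def using X by blast
        qed
        finally show ?case .
      qed
      have "(\<lambda>n. C * inverse (real (Suc n))) \<longlonglongrightarrow> C * 0"
        by (intro tendsto_mult tendsto_const LIMSEQ_inverse_real_of_nat)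
      then show "(\<lambda>n. C * inverse (real (Suc n))) \<longlonglongrightarrow> 0" by simp
    qed
    moreover have "norm t ^ l * norm (iterated_partial js (\<lambda>t. of_real (a n) * k (w n) t + 0 * k (w n) t) t) \<le> B n" for n t
      unfolding iterated_partial_lincomb[OF S[THEN schwartz_smooth] S[THEN schwartz_smooth]] B_def
      using mult_left_mono[OF C(2)[of t "w n"], of "a n"] a_pos[of n] by (simp add: norm_mult mult.left_commute)
    ultimately show "\<exists>B. B \<longlonglongrightarrow> 0 \<and> (\<forall>n t. norm t ^ l * norm (iterated_partial js (\<lambda>t. of_real (a n) * k (w n) t + 0 * k (w n) t) t) \<le> B n)" by blast
  qed
  from tempered_distributionD(4)[OF T this]
  have "(\<lambda>n. T (\<lambda>t. of_real (a n) * k (w n) t + 0 * k (w n) t)) \<longlonglongrightarrow> 0" .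
  then have "(\<lambda>n. norm (of_real (a n) * T (k (w n)))) \<longlonglongrightarrow> 0"
    using tempered_distributionD(3)[OF T S] tendsto_norm_zero by simp
  then have "\<forall>\<^sub>F n in sequentially. norm (of_real (a n) * T (k (w n))) < 1"
    by (rule order_tendstoD(2)) simp
  then obtain n where n: "norm (of_real (a n) * T (k (w n))) < 1" by (auto simp: eventually_sequentially)
  have "a n * (real (Suc n) * (1 + norm (w n)) ^ n) < a n * norm (T (k (w n)))"
    by (intro mult_strict_left_mono w a_pos)
  moreover have "a n * (real (Suc n) * (1 + norm (w n)) ^ n) = 1"
    using a_pos[of n] unfolding a_def by (metis divide_eq_0_iff less_irrefl nonzero_eq_divide_eq)
  ultimately have "1 < a n * norm (T (k (w n)))" by (simp only:)
  then show False using n a_pos[of n] by (simp add: norm_mult)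
qed

text \<open>The difference quotient is taken along a sequence of steps, the form to which dominated
  convergence applies.\<close>

lemma directional_derivative_tendsto:
  assumes "f differentiable (at t)"
  shows "(\<lambda>n. real (Suc n) *\<^sub>R (f (t + inverse (real (Suc n)) *\<^sub>R axis j 1) - f t)) \<longlonglongrightarrow> partial_deriv j f t"
proof -
  let ?D = "frechet_derivative f (at t)" and ?s = "\<lambda>n. inverse (real (Suc n))"
  let ?h = "\<lambda>n. ?s n *\<^sub>R (axis j 1 :: real^'a)"
  have D: "(f has_derivative ?D) (at t)"
    using assms frechet_derivative_works by blast
  then have lim: "((\<lambda>h. norm (f (t + h) - f t - ?D h) / norm h) \<longlongrightarrow> 0) (at 0)"
    by (simp add: has_derivative_at)
  have h: "filterlim ?h (at 0) sequentially"
    unfolding filterlim_at by (intro conjI inverse_Suc_scaleR_tendsto_0 always_eventually) (simp add: axis_eq_0_iff)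
  have "(\<lambda>n. norm (f (t + ?h n) - f t - ?D (?h n)) / norm (?h n)) \<longlonglongrightarrow> 0"
    by (rule filterlim_compose[OF lim h])
  moreover have "norm (f (t + ?h n) - f t - ?D (?h n)) / norm (?h n) = norm (real (Suc n) *\<^sub>R (f (t + ?h n) - f t) - partial_deriv j f t)" for n
  proof -
    have "?D (?h n) = ?s n *\<^sub>R partial_deriv j f t"
      unfolding partial_deriv_def by (rule linear_cmul[OF linear_frechet_derivative[OF assms]])
    moreover have "norm (?h n) = ?s n" by simp
    ultimately have "norm (f (t + ?h n) - f t - ?D (?h n)) / norm (?h n) = norm (real (Suc n) *\<^sub>R (f (t + ?h n) - f t - ?s n *\<^sub>R partial_deriv j f t))"
      by (simp add: inverse_eq_divide divide_simps del: of_nat_Suc)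
    then show ?thesis by (simp add: scaleR_diff_right del: of_nat_Suc)
  qed
  ultimately show ?thesis
    by (simp only: tendsto_norm_zero_iff LIM_zero_iff)
qed

lemma line_difference_le:
  fixes f :: "real^'d \<Rightarrow> complex"
  assumes f: "\<And>x. f differentiable (at x)" and B: "\<And>x. norm (partial_deriv j f x) \<le> B"
  shows "norm (f (t + s *\<^sub>R axis j 1) - f t) \<le> B * \<bar>s\<bar>"
proof -
  have B0: "0 \<le> B" by (rule order_trans[OF norm_ge_zero B])
  have "norm (f (t + s *\<^sub>R axis j 1) - f (t + 0 *\<^sub>R axis j 1)) \<le> B * norm (s - 0)"
  proof (rule differentiable_bound[where S=UNIV and f'="\<lambda>\<tau> h. h *\<^sub>R partial_deriv j f (t + \<tau> *\<^sub>R axis j 1)"])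
    fix \<tau> :: real
    let ?x = "t + \<tau> *\<^sub>R axis j 1"
    have l: "((\<lambda>s::real. t + s *\<^sub>R axis j 1) has_derivative (\<lambda>s. s *\<^sub>R axis j 1)) (at \<tau>)"
      by (auto intro!: derivative_eq_intros)
    have D: "(f has_derivative frechet_derivative f (at ?x)) (at ?x)"
      using f frechet_derivative_works by blast
    show "((\<lambda>\<tau>. f (t + \<tau> *\<^sub>R axis j 1)) has_derivative (\<lambda>h. h *\<^sub>R partial_deriv j f ?x)) (at \<tau> within UNIV)"
      using has_derivative_compose[OF l D] linear_cmul[OF linear_frechet_derivative[OF f]]
      by (simp add: partial_deriv_def)
    show "onorm (\<lambda>h. h *\<^sub>R partial_deriv j f ?x) \<le> B"
      by (rule onorm_bound[OF B0]) (simp add: mult.commute[of B] mult_left_mono B)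
  qed auto
  then show ?thesis by simp
qed

text \<open>The coefficient of \<open>f y\<close> is the integral of \<open>b\<close> over a level
  set of \<open>s\<close>. Unlike the integral, the finite sum is something a linear functional can
  be pulled through.\<close>

lemma simple_function_integral_sum:
  fixes s :: "'e::euclidean_space \<Rightarrow> 'e" and b :: "'e \<Rightarrow> complex"
  assumes s: "simple_function lborel s" and b: "integrable lborel b"
  shows "(LINT w|lborel. b w * f (s w)) = (\<Sum>y\<in>range s. (LINT w|lborel. indicator (s -` {y}) w *\<^sub>R b w) * f y)"
proof -
  have fin: "finite (range s)" and [measurable]: "s -` {y} \<in> sets borel" for y
    using s simple_functionD[OF s] by auto
  have int: "integrable lborel (\<lambda>w. indicator (s -` {y}) w *\<^sub>R b w)" for y
  proof (rule integrable_norm_le[OF integrable_norm[OF b]])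
    have [measurable]: "b \<in> borel_measurable borel" "(indicator (s -` {y}) :: 'e \<Rightarrow> real) \<in> borel_measurable borel"
      using integrable_borelD[OF b] by simp_all
    show "(\<lambda>w. indicator (s -` {y}) w *\<^sub>R b w) \<in> borel_measurable lborel" by measurable
    show "norm (indicator (s -` {y}) w *\<^sub>R b w) \<le> norm (b w)" for w by (simp add: indicator_def)
  qed
  have "(\<Sum>y\<in>range s. (LINT w|lborel. indicator (s -` {y}) w *\<^sub>R b w) * f y)
    = (\<Sum>y\<in>range s. (LINT w|lborel. (indicator (s -` {y}) w *\<^sub>R b w) * f y))"
    by (simp only: Bochner_Integration.integral_mult_left_zero)
  also have "\<dots> = (LINT w|lborel. (\<Sum>y\<in>range s. (indicator (s -` {y}) w *\<^sub>R b w) * f y))"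
    by (rule Bochner_Integration.integral_sum[symmetric]) (intro integrable_mult_left int)
  also have "\<dots> = (LINT w|lborel. b w * f (s w))"
  proof (rule Bochner_Integration.integral_cong[OF refl])
    fix w
    have "(\<Sum>y\<in>range s. (indicator (s -` {y}) w *\<^sub>R b w) * f y) = (\<Sum>y\<in>{s w}. (indicator (s -` {y}) w *\<^sub>R b w) * f y)"
      by (rule sum.mono_neutral_right[OF fin]) auto
    then show "(\<Sum>y\<in>range s. (indicator (s -` {y}) w *\<^sub>R b w) * f y) = b w * f (s w)" by simp
  qed
  finally show ?thesis by simp
qed

text \<open>Simple functions approximating the identity discretize the parameter of a family; the
  bound by \<open>2 * norm w\<close> keeps polynomial weights under control.\<close>

lemma simple_approximation_id:
  "\<exists>s :: nat \<Rightarrow> 'e::euclidean_space \<Rightarrow> 'e. (\<forall>i. simple_function lborel (s i)) \<and> (\<forall>w. (\<lambda>i. s i w) \<longlonglongrightarrow> w) \<and> (\<forall>i w. norm (s i w) \<le> 2 * norm w)"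
proof -
  have "(\<lambda>w::'e. w) \<in> borel_measurable lborel" by simp
  from borel_measurable_implies_sequence_metric[OF this, of 0] show ?thesis
    by (simp add: dist_norm)
qed

definition rapidly_decaying :: "('e::euclidean_space \<Rightarrow> complex) \<Rightarrow> bool" where
  "rapidly_decaying b \<longleftrightarrow> b \<in> borel_measurable borel \<and> (\<forall>M. \<exists>C\<ge>0. \<forall>w. norm (b w) \<le> C / (1 + norm w) ^ M)"

lemma rapidly_decaying_integrable:
  fixes b :: "'e::euclidean_space \<Rightarrow> complex"
  assumes b: "rapidly_decaying b"
  shows "integrable lborel (\<lambda>w. norm (b w) * (c * (1 + norm w) ^ m))"
proof -
  have [measurable]: "b \<in> borel_measurable borel" using b by (simp add: rapidly_decaying_def)
  obtain C where C: "\<And>w. norm (b w) \<le> C / (1 + norm w) ^ (m + (DIM('e) + 2))"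
    using b unfolding rapidly_decaying_def by blast
  have "integrable lborel (\<lambda>w. norm (b w) * (1 + norm w) ^ m)"
  proof (rule integrable_decay)
    fix w :: 'e
    have pos: "0 < (1 + norm w) ^ m" by (intro zero_less_power) (simp add: add_pos_nonneg)
    have "norm (b w) * (1 + norm w) ^ m \<le> C / (1 + norm w) ^ (m + (DIM('e) + 2)) * (1 + norm w) ^ m"
      by (intro mult_right_mono C) (use pos in simp)
    also have "\<dots> = C / (1 + norm w) ^ (DIM('e) + 2)" unfolding power_add[of _ m] using pos by simp
    finally show "norm (norm (b w) * (1 + norm w) ^ m) \<le> C / (1 + norm w) ^ (DIM('e) + 2)" using pos by simp
  qed measurable
  then have "integrable lborel (\<lambda>w. c * (norm (b w) * (1 + norm w) ^ m))" by (rule integrable_mult_right)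
  then show ?thesis by (simp add: mult_ac)
qed

lemma rapidly_decaying_integrable0: "rapidly_decaying b \<Longrightarrow> integrable lborel b"
  using rapidly_decaying_integrable[of b 1 0] integrable_norm_iff[of b lborel]
  by (simp add: rapidly_decaying_def)

lemma iterated_partial_family_measurable:
  fixes k :: "'e::euclidean_space \<Rightarrow> real^'d \<Rightarrow> complex"
  assumes k: "schwartz_family k"
  shows "(\<lambda>w. iterated_partial js (k w) t) \<in> borel_measurable borel"
proof -
  obtain C m where C: "\<And>w w' t. norm t ^ 0 * norm (iterated_partial js (k w) t - iterated_partial js (k w') t) \<le> C * (1 + norm w + norm w') ^ m * norm (w - w')"
    using k unfolding schwartz_family_def poly_lipschitz_def by meson
  have "continuous_on UNIV (\<lambda>w. iterated_partial js (k w) t)"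
    unfolding continuous_on_sequentially o_def
  proof (intro allI ballI impI, elim conjE)
    fix x :: "nat \<Rightarrow> 'e" and v assume x: "x \<longlonglongrightarrow> v"
    have "(\<lambda>n. C * (1 + norm (x n) + norm v) ^ m * norm (x n - v)) \<longlonglongrightarrow> C * (1 + norm v + norm v) ^ m * norm (v - v)"
      by (intro tendsto_intros x)
    then have lim: "(\<lambda>n. C * (1 + norm (x n) + norm v) ^ m * norm (x n - v)) \<longlonglongrightarrow> 0" by simp
    have "(\<lambda>n. iterated_partial js (k (x n)) t - iterated_partial js (k v) t) \<longlonglongrightarrow> 0"
      by (rule Lim_null_comparison[OF always_eventually lim]) (use C[of t] in simp)
    then show "(\<lambda>n. iterated_partial js (k (x n)) t) \<longlonglongrightarrow> iterated_partial js (k v) t" by (simp add: LIM_zero_iff)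
  qed
  then show ?thesis by (rule borel_measurable_continuous_onI)
qed

text \<open>Differentiation under the integral, one derivative at a time; the difference quotients
  are dominated by means of \<open>line_difference_le\<close>.\<close>

lemma iterated_partial_integral:
  fixes k :: "'e::euclidean_space \<Rightarrow> real^'d \<Rightarrow> complex"
  assumes k: "schwartz_family k" and b: "rapidly_decaying b" and \<psi>: "\<psi> \<in> schwartz"
    and eq: "\<And>t. \<psi> t = (LINT w|lborel. b w * k w t)"
  shows "iterated_partial js \<psi> t = (LINT w|lborel. b w * iterated_partial js (k w) t)"
proof (induction js arbitrary: t)
  case Nil
  then show ?case by (simp add: eq)
next
  case (Cons j js)
  let ?f = "iterated_partial js \<psi>" and ?K = "\<lambda>w. iterated_partial js (k w)"
  have [measurable]: "b \<in> borel_measurable borel" using b by (simp add: rapidly_decaying_def)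
  have mK [measurable]: "(\<lambda>w. ?K w x) \<in> borel_measurable borel" for x by (rule iterated_partial_family_measurable[OF k])
  have [measurable]: "(\<lambda>w. partial_deriv j (?K w) x) \<in> borel_measurable borel" for x
    using iterated_partial_family_measurable[OF k, of "j # js" x] by (simp only: iterated_partial_Cons)
  have dK: "?K w differentiable (at x)" for w x
    using k unfolding schwartz_family_def smooth_fun_def by blast
  have df: "?f differentiable (at x)" for x
    using schwartz_smooth[OF \<psi>] unfolding smooth_fun_def by blast
  obtain C m where C: "\<And>w x. norm x ^ 0 * norm (iterated_partial (j # js) (k w) x) \<le> C * (1 + norm w) ^ m"
    using schwartz_family_bound[OF k, of 0 "j # js"] by meson
  then have C: "norm (partial_deriv j (?K w) x) \<le> C * (1 + norm w) ^ m" for w x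
    by (simp add: iterated_partial_Cons del: iterated_partial.simps)
  obtain C0 m0 where C0: "\<And>w x. norm x ^ 0 * norm (iterated_partial js (k w) x) \<le> C0 * (1 + norm w) ^ m0"
    using schwartz_family_bound[OF k, of 0 js] by meson
  have int: "integrable lborel (\<lambda>w. b w * ?K w x)" for x
    by (rule integrable_norm_le[OF rapidly_decaying_integrable[OF b, of C0 m0]])
       (measurable, use C0[of x] in \<open>simp add: norm_mult mult_left_mono\<close>)
  let ?h = "\<lambda>n. inverse (real (Suc n)) *\<^sub>R (axis j 1 :: real^'d)"
  have lim1: "(\<lambda>n. real (Suc n) *\<^sub>R (?f (t + ?h n) - ?f t)) \<longlonglongrightarrow> partial_deriv j ?f t"
    by (rule directional_derivative_tendsto[OF df])
  have "(\<lambda>n. LINT w|lborel. b w * (real (Suc n) *\<^sub>R (?K w (t + ?h n) - ?K w t))) \<longlonglongrightarrow> (LINT w|lborel. b w * partial_deriv j (?K w) t)"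
  proof (rule tendsto_integral_dominated[OF rapidly_decaying_integrable[OF b, of C m]])
    show "(\<lambda>n. b w * (real (Suc n) *\<^sub>R (?K w (t + ?h n) - ?K w t))) \<longlonglongrightarrow> b w * partial_deriv j (?K w) t" for w
      by (rule tendsto_mult[OF tendsto_const directional_derivative_tendsto[OF dK]])
    fix n w
    have "norm (?K w (t + ?h n) - ?K w t) \<le> (C * (1 + norm w) ^ m) * \<bar>inverse (real (Suc n))\<bar>"
      by (rule line_difference_le[OF dK C])
    then have "norm (real (Suc n) *\<^sub>R (?K w (t + ?h n) - ?K w t)) \<le> real (Suc n) * ((C * (1 + norm w) ^ m) * \<bar>inverse (real (Suc n))\<bar>)"
      unfolding norm_scaleR by (intro mult_mono) auto
    also have "\<dots> = C * (1 + norm w) ^ m" by (simp del: of_nat_Suc)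
    finally show "norm (b w * (real (Suc n) *\<^sub>R (?K w (t + ?h n) - ?K w t))) \<le> norm (b w) * (C * (1 + norm w) ^ m)"
      unfolding norm_mult by (intro mult_left_mono) auto
  qed measurable
  moreover have "(LINT w|lborel. b w * (real (Suc n) *\<^sub>R (?K w (t + ?h n) - ?K w t))) = real (Suc n) *\<^sub>R (?f (t + ?h n) - ?f t)" for n
  proof -
    have "(LINT w|lborel. b w * (real (Suc n) *\<^sub>R (?K w (t + ?h n) - ?K w t)))
      = (LINT w|lborel. real (Suc n) *\<^sub>R (b w * ?K w (t + ?h n) - b w * ?K w t))"
      by (simp add: algebra_simps del: of_nat_Suc)
    also have "\<dots> = real (Suc n) *\<^sub>R (LINT w|lborel. b w * ?K w (t + ?h n) - b w * ?K w t)"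
      by (rule integral_scaleR_right)
    also have "\<dots> = real (Suc n) *\<^sub>R (?f (t + ?h n) - ?f t)"
      unfolding Cons.IH by (simp add: int del: of_nat_Suc)
    finally show ?thesis .
  qed
  ultimately have "(\<lambda>n. real (Suc n) *\<^sub>R (?f (t + ?h n) - ?f t)) \<longlonglongrightarrow> (LINT w|lborel. b w * partial_deriv j (?K w) t)"
    by simp
  from LIMSEQ_unique[OF lim1 this] show ?case by (simp only: iterated_partial_Cons)
qed

text \<open>Replacing \<open>w\<close> by a simple approximation \<open>s i w\<close> turns
  \<open>\<psi>\<close> into a finite combination of members of the family, through which
  \<open>T\<close> passes. By the Lipschitz bound these combinations converge to
  \<open>\<psi>\<close> in every Schwartz seminorm, and continuity of \<open>T\<close> gives the
  limit; no integral with values in a function space is formed.\<close>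

theorem tempered_integral:
  fixes k :: "'e::euclidean_space \<Rightarrow> real^'d \<Rightarrow> complex"
  assumes T: "T \<in> tempered_distributions" and k: "schwartz_family k" and b: "rapidly_decaying b"
    and \<psi>: "\<psi> \<in> schwartz" and eq: "\<And>t. \<psi> t = (LINT w|lborel. b w * k w t)"
  shows "integrable lborel (\<lambda>w. b w * T (k w))" "T \<psi> = (LINT w|lborel. b w * T (k w))"
proof -
  have [measurable]: "b \<in> borel_measurable borel" using b by (simp add: rapidly_decaying_def)
  have S: "k u \<in> schwartz" for u by (rule schwartz_family_schwartz[OF k])
  have bi: "integrable lborel b" by (rule rapidly_decaying_integrable0[OF b])
  obtain s :: "nat \<Rightarrow> 'e \<Rightarrow> 'e" where s: "\<And>i. simple_function lborel (s i)" "\<And>w. (\<lambda>i. s i w) \<longlonglongrightarrow> w"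
    "\<And>i w. norm (s i w) \<le> 2 * norm w"
    using simple_approximation_id by metis
  have [measurable]: "s i \<in> borel \<rightarrow>\<^sub>M borel" for i
    using borel_measurable_simple_function[OF s(1)[of i]] by simp
  have Tk [measurable]: "(\<lambda>w. T (k w)) \<in> borel_measurable borel"
    by (intro borel_measurable_continuous_onI tempered_family_continuous[OF T k])
  obtain m where m: "\<And>w. norm (T (k w)) \<le> real (Suc m) * (1 + norm w) ^ m"
    using tempered_family_growth[OF T k] by blast
  have X3: "(1 + norm (s i w)) ^ m \<le> 2 ^ m * (1 + norm w) ^ m" for i w m
  proof -
    have "(1 + norm (s i w)) ^ m \<le> (2 * (1 + norm w)) ^ m"
      using s(3)[of i w] by (intro power_mono) auto
    then show ?thesis by (simp only: power_mult_distrib)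
  qed
  show bT: "integrable lborel (\<lambda>w. b w * T (k w))"
    by (rule integrable_norm_le[OF rapidly_decaying_integrable[OF b, of "real (Suc m)" m]])
       (measurable, use m in \<open>simp add: norm_mult mult_left_mono\<close>)
  define \<beta> where "\<beta> i y = (LINT w|lborel. indicator (s i -` {y}) w *\<^sub>R b w)" for i y
  define \<psi>s where "\<psi>s i t = (\<Sum>y\<in>range (s i). \<beta> i y * k y t)" for i t
  have fin: "finite (range (s i))" for i using simple_functionD(1)[OF s(1)[of i]] by simp
  note sum = schwartz_sum[OF fin _ S]
  have \<psi>s: "\<psi>s i \<in> schwartz" for i unfolding \<psi>s_def by (rule sum(1)) simp
  have d\<psi>s: "iterated_partial js (\<psi>s i) t = (LINT w|lborel. b w * iterated_partial js (k (s i w)) t)" for js i t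
  proof -
    have "iterated_partial js (\<psi>s i) t = (\<Sum>y\<in>range (s i). \<beta> i y * iterated_partial js (k y) t)"
      unfolding \<psi>s_def by (rule sum(2)) simp
    then show ?thesis
      unfolding \<beta>_def using simple_function_integral_sum[OF s(1)[of i] bi, of "\<lambda>y. iterated_partial js (k y) t"] by simp
  qed
  have T\<psi>s: "T (\<psi>s i) = (LINT w|lborel. b w * T (k (s i w)))" for i
  proof -
    have "T (\<psi>s i) = (\<Sum>y\<in>range (s i). \<beta> i y * T (k y))"
      unfolding \<psi>s_def by (rule sum(3)[OF _ T]) simp
    then show ?thesis
      unfolding \<beta>_def using simple_function_integral_sum[OF s(1)[of i] bi, of "\<lambda>y. T (k y)"] by simp
  qed
  have "schwartz_null_sequence (\<lambda>i t. 1 * \<psi>s i t + (-1) * \<psi> t)"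
  proof (rule schwartz_null_sequenceI)
    show "(\<lambda>t. 1 * \<psi>s i t + (-1) * \<psi> t) \<in> schwartz" for i by (intro schwartz_lincomb \<psi>s \<psi>)
    fix l and js :: "'d list"
    obtain C n where C: "0 \<le> C" "\<And>w w' t. norm t ^ l * norm (iterated_partial js (k w) t - iterated_partial js (k w') t) \<le> C * (1 + norm w + norm w') ^ n * norm (w - w')"
      using k unfolding schwartz_family_def poly_lipschitz_def by meson
    \<comment> \<open>The Lipschitz estimate of the discretization error, uniform in
      \<open>t\<close>; its integral over \<open>w\<close> is the null sequence that bounds the
      seminorm.\<close>
    define D where "D i w = norm (b w) * (C * (1 + norm (s i w) + norm w) ^ n * norm (s i w - w))" for i w
    have [measurable]: "D i \<in> borel_measurable borel" for i unfolding D_def by measurable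
    have D_nonneg: "0 \<le> D i w" for i w unfolding D_def using C(1) by simp
    have D_le: "D i w \<le> norm (b w) * (C * 3 ^ n * 3 * (1 + norm w) ^ (n + 1))" for i w
      unfolding D_def
    proof (rule mult_left_mono)
      have "(1 + norm (s i w) + norm w) ^ n \<le> (3 * (1 + norm w)) ^ n"
        using s(3)[of i w] by (intro power_mono) auto
      then have a: "(1 + norm (s i w) + norm w) ^ n \<le> 3 ^ n * (1 + norm w) ^ n" by (simp only: power_mult_distrib)
      have c: "norm (s i w - w) \<le> 3 * (1 + norm w)"
        using s(3)[of i w] norm_triangle_ineq4[of "s i w" w] norm_ge_zero[of w] by simp
      have "C * (1 + norm (s i w) + norm w) ^ n * norm (s i w - w) \<le> C * (3 ^ n * (1 + norm w) ^ n) * (3 * (1 + norm w))"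
        using C(1) by (intro mult_mono a c) auto
      then show "C * (1 + norm (s i w) + norm w) ^ n * norm (s i w - w) \<le> C * 3 ^ n * 3 * (1 + norm w) ^ (n + 1)"
        by (simp only: power_add power_one_right mult_ac)
    qed simp
    have Dmaj: "integrable lborel (\<lambda>w. norm (b w) * (C * 3 ^ n * 3 * (1 + norm w) ^ (n + 1)))"
      by (rule rapidly_decaying_integrable[OF b])
    have Dint: "integrable lborel (D i)" for i
      by (rule integrable_norm_le[OF Dmaj]) (use D_le D_nonneg in auto)
    have "(\<lambda>i. LINT w|lborel. D i w) \<longlonglongrightarrow> (LINT w::'e|lborel. 0::real)"
    proof (rule tendsto_integral_dominated[OF Dmaj])
      fix w
      have "(\<lambda>i. D i w) \<longlonglongrightarrow> norm (b w) * (C * (1 + norm w + norm w) ^ n * norm (w - w))"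
        unfolding D_def by (intro tendsto_intros s)
      then show "(\<lambda>i. D i w) \<longlonglongrightarrow> 0" by simp
    qed (use D_le D_nonneg in auto)
    then have "(\<lambda>i. LINT w|lborel. D i w) \<longlonglongrightarrow> 0" by simp
    moreover have "norm t ^ l * norm (iterated_partial js (\<lambda>t. 1 * \<psi>s i t + (-1) * \<psi> t) t) \<le> (LINT w|lborel. D i w)" for i t
    proof -
      obtain C0 m0 where C0: "0 \<le> C0" "\<And>w x. norm x ^ 0 * norm (iterated_partial js (k w) x) \<le> C0 * (1 + norm w) ^ m0"
        using schwartz_family_bound[OF k, of 0 js] by meson
      have [measurable]: "(\<lambda>w. iterated_partial js (k w) t) \<in> borel_measurable borel"
        by (rule iterated_partial_family_measurable[OF k])
      have [measurable]: "(\<lambda>w. iterated_partial js (k (s i w)) t) \<in> borel_measurable borel"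
        by (rule measurable_compose[OF _ iterated_partial_family_measurable[OF k]]) measurable
      have i1: "integrable lborel (\<lambda>w. b w * iterated_partial js (k w) t)"
        by (rule integrable_norm_le[OF rapidly_decaying_integrable[OF b, of C0 m0]])
           (measurable, use C0(2)[of t] in \<open>simp add: norm_mult mult_left_mono\<close>)
      have i2: "integrable lborel (\<lambda>w. b w * iterated_partial js (k (s i w)) t)"
      proof (rule integrable_norm_le[OF rapidly_decaying_integrable[OF b, of "C0 * 2 ^ m0" m0]])
        fix w
        have "norm (iterated_partial js (k (s i w)) t) \<le> C0 * (1 + norm (s i w)) ^ m0"
          using C0(2)[of t "s i w"] by simp
        also have "\<dots> \<le> C0 * 2 ^ m0 * (1 + norm w) ^ m0"
          unfolding mult.assoc by (intro mult_left_mono X3 C0(1))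
        finally show "norm (b w * iterated_partial js (k (s i w)) t) \<le> norm (b w) * (C0 * 2 ^ m0 * (1 + norm w) ^ m0)"
          unfolding norm_mult by (intro mult_left_mono) auto
      qed measurable
      have "iterated_partial js (\<lambda>t. 1 * \<psi>s i t + (-1) * \<psi> t) t = (LINT w|lborel. b w * (iterated_partial js (k (s i w)) t - iterated_partial js (k w) t))"
        unfolding iterated_partial_lincomb[OF \<psi>s[THEN schwartz_smooth] \<psi>[THEN schwartz_smooth]]
          d\<psi>s iterated_partial_integral[OF k b \<psi> eq]
        using i1 i2 by (simp add: right_diff_distrib)
      then have "norm t ^ l * norm (iterated_partial js (\<lambda>t. 1 * \<psi>s i t + (-1) * \<psi> t) t)
        = norm (LINT w|lborel. (norm t ^ l) *\<^sub>R (b w * (iterated_partial js (k (s i w)) t - iterated_partial js (k w) t)))"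
        by simp
      also have "\<dots> \<le> (LINT w|lborel. D i w)"
      proof (rule norm_integral_le[OF Dint])
        fix w
        have "norm ((norm t ^ l) *\<^sub>R (b w * (iterated_partial js (k (s i w)) t - iterated_partial js (k w) t)))
          = norm (b w) * (norm t ^ l * norm (iterated_partial js (k (s i w)) t - iterated_partial js (k w) t))"
          by (simp add: norm_mult)
        also have "\<dots> \<le> D i w" unfolding D_def by (intro mult_left_mono C(2)) auto
        finally show "norm ((norm t ^ l) *\<^sub>R (b w * (iterated_partial js (k (s i w)) t - iterated_partial js (k w) t))) \<le> D i w" .
      qed
      finally show ?thesis .
    qed
    ultimately show "\<exists>B. B \<longlonglongrightarrow> 0 \<and> (\<forall>i t. norm t ^ l * norm (iterated_partial js (\<lambda>t. 1 * \<psi>s i t + (-1) * \<psi> t) t) \<le> B i)" by blast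
  qed
  from tempered_distributionD(4)[OF T this]
  have "(\<lambda>i. T (\<lambda>t. 1 * \<psi>s i t + (-1) * \<psi> t)) \<longlonglongrightarrow> 0" .
  moreover have "T (\<lambda>t. 1 * \<psi>s i t + (-1) * \<psi> t) = T (\<psi>s i) - T \<psi>" for i
    using tempered_distributionD(2)[OF T schwartz_cmult[OF \<psi>s] schwartz_cmult[OF \<psi>], of 1 i "-1"]
      tempered_distributionD(3)[OF T \<psi>, of "-1"] by simp
  ultimately have lim: "(\<lambda>i. T (\<psi>s i)) \<longlonglongrightarrow> T \<psi>" by (simp add: LIM_zero_iff)
  have "(\<lambda>i. T (\<psi>s i)) \<longlonglongrightarrow> (LINT w|lborel. b w * T (k w))"
    unfolding T\<psi>s
  proof (rule tendsto_integral_dominated[OF rapidly_decaying_integrable[OF b, of "real (Suc m) * 2 ^ m" m]])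
    show "(\<lambda>i. b w * T (k (s i w))) \<longlonglongrightarrow> b w * T (k w)" for w
      by (rule tendsto_mult[OF tendsto_const tempered_family_tendsto[OF T k s(2)]])
    fix i w
    have "norm (T (k (s i w))) \<le> real (Suc m) * (1 + norm (s i w)) ^ m" by (rule m)
    also have "\<dots> \<le> real (Suc m) * 2 ^ m * (1 + norm w) ^ m"
      unfolding mult.assoc by (intro mult_left_mono X3) simp
    finally show "norm (b w * T (k (s i w))) \<le> norm (b w) * (real (Suc m) * 2 ^ m * (1 + norm w) ^ m)"
      unfolding norm_mult by (intro mult_left_mono) auto
  next
    show "(\<lambda>w. b w * T (k (s i w))) \<in> borel_measurable lborel" for i
      using measurable_compose[OF _ Tk, of "s i" borel] by measurable
  qed measurable
  from LIMSEQ_unique[OF lim this] show "T \<psi> = (LINT w|lborel. b w * T (k w))" .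
qed

section \<open>The short-time Fourier transform\<close>

text \<open>A bilinear cross-ambiguity function: without a conjugate it matches the linear action of
  distributions. The short-time Fourier transform is recovered by conjugation, see
  \<open>L2_inner_tf_shift_eq_amb\<close>.\<close>

definition amb :: "(real^'d \<Rightarrow> complex) \<Rightarrow> (real^'d \<Rightarrow> complex) \<Rightarrow> (real^'d) \<times> (real^'d) \<Rightarrow> complex" where
  "amb f h z = (LINT t|lborel. f t * tf_shift z h t)"

lemma norm_tf_shift: "norm (tf_shift z h t) = norm (h (t - fst z))"
  by (simp add: tf_shift_def norm_mult)

lemma tf_shift_measurable [measurable]:
  assumes [measurable]: "h \<in> borel_measurable borel"
  shows "tf_shift z h \<in> borel_measurable borel"
  unfolding tf_shift_def by measurable

text \<open>Integration by parts from translation invariance: the difference quotient of the product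
  integrates to 0, and it splits exactly into \<open>a n\<close> and \<open>b n\<close> because
  \<open>a n\<close> keeps the shift on \<open>g\<close>.\<close>

lemma schwartz_parts:
  assumes f: "f \<in> schwartz" and g: "g \<in> schwartz"
  shows "(LINT t|lborel. partial_deriv j f t * g t) = - (LINT t|lborel. f t * partial_deriv j g t)"
proof -
  let ?D = "DIM(real^'a) + 2"
  let ?h = "\<lambda>n. inverse (real (Suc n)) *\<^sub>R (axis j 1 :: real^'a)"
  have [measurable]: "f \<in> borel_measurable borel" "g \<in> borel_measurable borel"
    "partial_deriv j f \<in> borel_measurable borel" "partial_deriv j g \<in> borel_measurable borel"
    using schwartz_measurable schwartz_partial f g by blast+
  have df: "f differentiable (at x)" and dg: "g differentiable (at x)" for x
    using smooth_fun_differentiable schwartz_smooth f g by blast+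
  obtain A where A: "0 \<le> A" "\<And>x. norm (partial_deriv j f x) \<le> A" using schwartz_bounded[OF schwartz_partial[OF f]] by blast
  obtain B where B: "0 \<le> B" "\<And>x. norm (partial_deriv j g x) \<le> B" using schwartz_bounded[OF schwartz_partial[OF g]] by blast
  obtain C where C: "0 \<le> C" "\<And>x. norm (g x) \<le> C / (1 + norm x) ^ ?D" using schwartz_decay[OF g] by blast
  have fi: "integrable lborel f" and gi: "integrable lborel g" using schwartz_integrable f g by auto
  have h1: "norm (?h n) \<le> 1" for n by (simp add: inverse_le_1_iff)
  have gh: "norm (g (t + ?h n)) \<le> C * 2 ^ ?D * (1 / (1 + norm t) ^ ?D)" for t n
  proof -
    have p: "0 < 1 + norm t" "0 < 1 + norm (t + ?h n)" by (simp_all add: add_pos_nonneg)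
    have "1 + norm t \<le> (1 + norm (t - (- ?h n))) * (1 + norm (- ?h n))" by (rule one_plus_norm_le')
    also have "\<dots> \<le> (1 + norm (t + ?h n)) * 2"
      using h1[of n] by (intro mult_mono) auto
    finally have "(1 + norm t) ^ ?D \<le> ((1 + norm (t + ?h n)) * 2) ^ ?D" by (intro power_mono) auto
    also have "\<dots> = 2 ^ ?D * (1 + norm (t + ?h n)) ^ ?D" by (simp only: power_mult_distrib mult.commute)
    finally have "1 / (1 + norm (t + ?h n)) ^ ?D \<le> 2 ^ ?D * (1 / (1 + norm t) ^ ?D)"
      using zero_less_power[OF p(1), of ?D] zero_less_power[OF p(2), of ?D] by (simp only: divide_simps) simp
    then have "C * (1 / (1 + norm (t + ?h n)) ^ ?D) \<le> C * (2 ^ ?D * (1 / (1 + norm t) ^ ?D))"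
      using C(1) by (rule mult_left_mono)
    then show ?thesis using C(2)[of "t + ?h n"] by (simp only: mult_1_right times_divide_eq_right mult.assoc)
  qed
  define a where "a n t = (real (Suc n) *\<^sub>R (f (t + ?h n) - f t)) * g (t + ?h n)" for n t
  define b where "b n t = f t * (real (Suc n) *\<^sub>R (g (t + ?h n) - g t))" for n t
  have [measurable]: "a n \<in> borel_measurable borel" "b n \<in> borel_measurable borel" for n
    unfolding a_def b_def by measurable
  have slope: "norm (real (Suc n) *\<^sub>R (q (t + ?h n) - q t)) \<le> Q"
    if "\<And>x. q differentiable (at x)" "\<And>x. norm (partial_deriv j q x) \<le> Q" for q Q n t
  proof -
    have "norm (q (t + ?h n) - q t) \<le> Q * \<bar>inverse (real (Suc n))\<bar>"
      by (rule line_difference_le[OF that])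
    then have "real (Suc n) * norm (q (t + ?h n) - q t) \<le> real (Suc n) * (Q * \<bar>inverse (real (Suc n))\<bar>)"
      by (rule mult_left_mono) simp
    also have "real (Suc n) * (Q * \<bar>inverse (real (Suc n))\<bar>) = Q" by (simp del: of_nat_Suc)
    finally show ?thesis by (simp only: norm_scaleR abs_of_nat)
  qed
  have wa: "integrable lborel (\<lambda>t. A * (C * 2 ^ ?D * (1 / (1 + norm (t :: real^'a)) ^ ?D)))"
    by (intro integrable_mult_right integrable_inverse_power_norm)
  have wb: "integrable lborel (\<lambda>t. norm (f t) * B)" by (intro integrable_mult_left integrable_norm fi)
  have a_le: "norm (a n t) \<le> A * (C * 2 ^ ?D * (1 / (1 + norm t) ^ ?D))" for n t
    unfolding a_def norm_mult[of "real (Suc n) *\<^sub>R (f (t + ?h n) - f t)"] by (intro mult_mono slope df A gh) auto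
  have b_le: "norm (b n t) \<le> norm (f t) * B" for n t
    unfolding b_def norm_mult[of "f t"] by (intro mult_left_mono slope dg B) auto
  have ai: "integrable lborel (a n)" for n by (rule integrable_norm_le[OF wa _ a_le]) measurable
  have bi: "integrable lborel (b n)" for n by (rule integrable_norm_le[OF wb _ b_le]) measurable
  have g_lim: "(\<lambda>n. g (t + ?h n)) \<longlonglongrightarrow> g t" for t
  proof -
    have "(\<lambda>n. t + ?h n) \<longlonglongrightarrow> t + 0" by (intro tendsto_add tendsto_const inverse_Suc_scaleR_tendsto_0)
    moreover have "isCont g t" using schwartz_continuous[OF g] by (simp add: continuous_on_eq_continuous_at)
    ultimately show ?thesis using isCont_tendsto_compose[of t g] by simp
  qed
  have la: "(\<lambda>n. LINT t|lborel. a n t) \<longlonglongrightarrow> (LINT t|lborel. partial_deriv j f t * g t)"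
    by (rule tendsto_integral_dominated[OF wa _ _ _ a_le])
       (measurable, unfold a_def, rule tendsto_mult[OF directional_derivative_tendsto[OF df] g_lim])
  have lb: "(\<lambda>n. LINT t|lborel. b n t) \<longlonglongrightarrow> (LINT t|lborel. f t * partial_deriv j g t)"
    by (rule tendsto_integral_dominated[OF wb _ _ _ b_le])
       (measurable, unfold b_def, rule tendsto_mult[OF tendsto_const directional_derivative_tendsto[OF dg]])
  have "(LINT t|lborel. a n t) + (LINT t|lborel. b n t) = 0" for n
  proof -
    obtain G where G: "\<And>x. norm (g x) \<le> G" using schwartz_bounded[OF g] by blast
    have fg: "integrable lborel (\<lambda>t. f t * g t)"
      by (rule integrable_norm_le[OF integrable_mult_left[OF integrable_norm[OF fi], of G]])
         (measurable, simp add: norm_mult mult_left_mono G)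
    have "(LINT t|lborel. a n t) + (LINT t|lborel. b n t) = (LINT t|lborel. a n t + b n t)"
      by (rule Bochner_Integration.integral_add[OF ai bi, symmetric])
    also have "\<dots> = (LINT t|lborel. real (Suc n) *\<^sub>R (f (t + ?h n) * g (t + ?h n) - f t * g t))"
      unfolding a_def b_def by (simp add: algebra_simps del: of_nat_Suc)
    also have "\<dots> = real (Suc n) *\<^sub>R ((LINT t|lborel. f (t + ?h n) * g (t + ?h n)) - (LINT t|lborel. f t * g t))"
      using fg integrable_lborel_shift_iff(1)[of "\<lambda>t. f t * g t" "?h n"] by (simp del: of_nat_Suc)
    also have "(LINT t|lborel. f (t + ?h n) * g (t + ?h n)) = (LINT t|lborel. f t * g t)"
      by (rule integral_lborel_shift(1))
    finally show ?thesis by simp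
  qed
  then have "(\<lambda>n. 0) \<longlonglongrightarrow> (LINT t|lborel. partial_deriv j f t * g t) + (LINT t|lborel. f t * partial_deriv j g t)"
    using tendsto_add[OF la lb] by simp
  then have "(LINT t|lborel. partial_deriv j f t * g t) + (LINT t|lborel. f t * partial_deriv j g t) = 0"
    by (metis LIMSEQ_const_iff)
  then show ?thesis by (simp add: eq_neg_iff_add_eq_0)
qed

lemma integrable_mult_bounded:
  assumes "integrable lborel (f :: 'e::euclidean_space \<Rightarrow> complex)" "g \<in> borel_measurable borel" "\<And>t. norm (g t) \<le> C"
  shows "integrable lborel (\<lambda>t. f t * g t)"
  by (rule integrable_norm_le[OF integrable_mult_left[OF integrable_norm[OF assms(1)], of C]])
     (use assms integrable_borelD[OF assms(1)] in \<open>auto simp: norm_mult intro!: mult_left_mono\<close>)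

lemma amb_integrand_integrable:
  assumes "integrable lborel f" "h \<in> schwartz"
  shows "integrable lborel (\<lambda>t. f t * tf_shift z h t)"
proof -
  obtain C where "\<And>t. norm (h t) \<le> C" using schwartz_bounded[OF assms(2)] by blast
  then show ?thesis
    using schwartz_measurable[OF assms(2)]
    by (intro integrable_mult_bounded[OF assms(1), where C=C] tf_shift_measurable) (auto simp: norm_tf_shift)
qed

lemma amb_parts:
  assumes f: "f \<in> schwartz" and h: "h \<in> schwartz"
  shows "(\<i> * of_real (2 * pi * snd z $ j)) * amb f h z = - (amb (partial_deriv j f) h z + amb f (partial_deriv j h) z)"
proof -
  have i: "integrable lborel (\<lambda>t. f t * tf_shift z h t)" "integrable lborel (\<lambda>t. f t * tf_shift z (partial_deriv j h) t)"
    by (rule amb_integrand_integrable[OF schwartz_integrable[OF f] h],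
        rule amb_integrand_integrable[OF schwartz_integrable[OF f] schwartz_partial[OF h]])
  have "amb (partial_deriv j f) h z = - (LINT t|lborel. f t * partial_deriv j (tf_shift z h) t)"
    unfolding amb_def by (rule schwartz_parts[OF f schwartz_tf_shift[OF h]])
  also have "(LINT t|lborel. f t * partial_deriv j (tf_shift z h) t)
    = (LINT t|lborel. (\<i> * of_real (2 * pi * snd z $ j)) * (f t * tf_shift z h t) + f t * tf_shift z (partial_deriv j h) t)"
    unfolding partial_deriv_tf_shift(2)[OF smooth_fun_differentiable[OF schwartz_smooth[OF h]]]
    by (simp add: algebra_simps)
  also have "\<dots> = (\<i> * of_real (2 * pi * snd z $ j)) * amb f h z + amb f (partial_deriv j h) z"
    unfolding amb_def using i by (simp del: of_real_mult)
  finally show ?thesis by simp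
qed

text \<open>Induction on the power of the frequency: \<open>amb_parts\<close> trades each factor
  \<open>snd z $ j\<close> for a derivative of \<open>f\<close> or \<open>h\<close>. The start is
  decay in time, from Peetre's inequality.\<close>

lemma amb_decay_component:
  assumes "f \<in> schwartz" "h \<in> schwartz"
  shows "\<exists>C\<ge>0. \<forall>z. (1 + norm (fst z)) ^ L * (\<bar>snd z $ j\<bar> ^ M * norm (amb f h z)) \<le> C"
  using assms
proof (induction M arbitrary: f h)
  case 0
  let ?D = "DIM(real^'a) + 2"
  obtain A where A: "0 \<le> A" "\<And>t. norm (f t) \<le> A / (1 + norm t) ^ (L + ?D)" using schwartz_decay[OF 0(1)] by blast
  obtain B where B: "0 \<le> B" "\<And>t. (1 + norm t) ^ L * norm (h t) \<le> B" using schwartz_iterated_decay[OF 0(2), of L "[]"] by auto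
  let ?w = "\<lambda>t::real^'a. A * B * (1 / (1 + norm t) ^ ?D)"
  have wi: "integrable lborel ?w" by (intro integrable_mult_right integrable_inverse_power_norm)
  have "(1 + norm (fst z)) ^ L * norm (amb f h z) \<le> (LINT t|lborel. ?w t)" for z
  proof -
    have "(1 + norm (fst z)) ^ L * norm (amb f h z) = norm (LINT t|lborel. ((1 + norm (fst z)) ^ L) *\<^sub>R (f t * tf_shift z h t))"
      by (simp add: amb_def)
    also have "\<dots> \<le> (LINT t|lborel. ?w t)"
    proof (rule norm_integral_le[OF wi])
      fix t
      let ?X = "1 + norm t" and ?Y = "1 + norm (t - fst z)"
      have X: "0 < ?X" by (simp add: add_pos_nonneg)
      have "1 + norm (fst z) \<le> (1 + norm (fst z - t)) * ?X" by (rule one_plus_norm_le')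
      then have "(1 + norm (fst z)) ^ L \<le> (?Y * ?X) ^ L"
        by (intro power_mono) (auto simp: norm_minus_commute)
      then have x: "(1 + norm (fst z)) ^ L \<le> ?Y ^ L * ?X ^ L" by (simp only: power_mult_distrib)
      have "norm (((1 + norm (fst z)) ^ L) *\<^sub>R (f t * tf_shift z h t)) = (1 + norm (fst z)) ^ L * (norm (f t) * norm (h (t - fst z)))"
        by (simp add: norm_mult norm_tf_shift)
      also have "\<dots> \<le> (?Y ^ L * ?X ^ L) * (norm (f t) * norm (h (t - fst z)))"
        by (intro mult_right_mono x) simp
      also have "\<dots> = (?X ^ L * norm (f t)) * (?Y ^ L * norm (h (t - fst z)))" by (simp only: mult_ac)
      also have "\<dots> \<le> (?X ^ L * (A / ?X ^ (L + ?D))) * B"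
        using A(1) by (intro mult_mono B(2) mult_left_mono A(2)) auto
      also have "\<dots> = ?w t" unfolding power_add[of _ L] using X by simp
      finally show "norm (((1 + norm (fst z)) ^ L) *\<^sub>R (f t * tf_shift z h t)) \<le> ?w t" .
    qed
    finally show ?thesis .
  qed
  moreover have "0 \<le> (LINT t|lborel. ?w t)" using A(1) B(1) by simp
  ultimately show ?case by (intro exI[of _ "LINT t|lborel. ?w t"]) simp
next
  case (Suc M)
  obtain C1 where C1: "0 \<le> C1" "\<And>z. (1 + norm (fst z)) ^ L * (\<bar>snd z $ j\<bar> ^ M * norm (amb (partial_deriv j f) h z)) \<le> C1"
    using Suc.IH[OF schwartz_partial[OF Suc.prems(1)] Suc.prems(2)] by blast
  obtain C2 where C2: "0 \<le> C2" "\<And>z. (1 + norm (fst z)) ^ L * (\<bar>snd z $ j\<bar> ^ M * norm (amb f (partial_deriv j h) z)) \<le> C2"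
    using Suc.IH[OF Suc.prems(1) schwartz_partial[OF Suc.prems(2)]] by blast
  have "(1 + norm (fst z)) ^ L * (\<bar>snd z $ j\<bar> ^ Suc M * norm (amb f h z)) \<le> C1 + C2" for z
  proof -
    let ?u = "(1 + norm (fst z)) ^ L" and ?s = "\<bar>snd z $ j\<bar>"
    have "2 * pi * ?s * norm (amb f h z) = norm ((\<i> * of_real (2 * pi * snd z $ j)) * amb f h z)"
      by (simp add: norm_mult abs_mult)
    also have "\<dots> \<le> norm (amb (partial_deriv j f) h z) + norm (amb f (partial_deriv j h) z)"
      unfolding amb_parts[OF Suc.prems] norm_minus_cancel by (rule norm_triangle_ineq)
    finally have 1: "2 * pi * ?s * norm (amb f h z) \<le> norm (amb (partial_deriv j f) h z) + norm (amb f (partial_deriv j h) z)" .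
    have "1 * (?s * norm (amb f h z)) \<le> (2 * pi) * (?s * norm (amb f h z))"
      using pi_ge_two by (intro mult_right_mono) auto
    then have "?s * norm (amb f h z) \<le> norm (amb (partial_deriv j f) h z) + norm (amb f (partial_deriv j h) z)"
      using 1 by (simp only: mult_1 mult.assoc)
    then have "(?u * ?s ^ M) * (?s * norm (amb f h z)) \<le> (?u * ?s ^ M) * (norm (amb (partial_deriv j f) h z) + norm (amb f (partial_deriv j h) z))"
      by (rule mult_left_mono) simp
    also have "\<dots> = ?u * (?s ^ M * norm (amb (partial_deriv j f) h z)) + ?u * (?s ^ M * norm (amb f (partial_deriv j h) z))"
      by (simp only: distrib_left mult.assoc)
    also have "\<dots> \<le> C1 + C2" by (intro add_mono C1 C2)
    finally show ?thesis by (simp only: power_Suc mult_ac)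
  qed
  then show ?case using C1(1) C2(1) by (intro exI[of _ "C1 + C2"]) simp
qed

lemma amb_decay:
  assumes f: "f \<in> schwartz" and h: "h \<in> (schwartz :: (real^'d \<Rightarrow> complex) set)"
  shows "\<exists>C\<ge>0. \<forall>z. norm (amb f h z) \<le> C / (1 + norm z) ^ M"
proof -
  have "\<forall>j. \<exists>C\<ge>0. \<forall>z. (1 + norm (fst z)) ^ M * (\<bar>snd z $ j\<bar> ^ M * norm (amb f h z)) \<le> C"
    using amb_decay_component[OF f h] by blast
  then obtain c where c: "\<And>j. 0 \<le> c j" "\<And>j z. (1 + norm (fst z)) ^ M * (\<bar>snd z $ j\<bar> ^ M * norm (amb f h z)) \<le> c j" by metis
  \<comment> \<open>Exponent 0 gives decay in time alone; the coordinate \<open>undefined\<close> is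
    an arbitrary one.\<close>
  obtain c0 where c0: "0 \<le> c0" "\<And>z. (1 + norm (fst z)) ^ M * (\<bar>snd z $ undefined\<bar> ^ 0 * norm (amb f h z)) \<le> c0"
    using amb_decay_component[OF f h, of M undefined 0] by blast
  let ?d = "real CARD('d)"
  define C where "C = 2 ^ M * (c0 + ?d ^ M * (\<Sum>j\<in>UNIV. c j))"
  have C: "0 \<le> C" unfolding C_def using c0(1) by (intro mult_nonneg_nonneg add_nonneg_nonneg sum_nonneg c) auto
  have "norm (amb f h z) \<le> C / (1 + norm z) ^ M" for z
  proof -
    let ?\<zeta> = "snd z" and ?u = "(1 + norm (fst z)) ^ M" and ?a = "norm (amb f h z)"
    have z: "1 + norm z \<le> (1 + norm (fst z)) * (1 + norm ?\<zeta>)"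
    proof -
      have "norm z \<le> norm (fst z) + norm ?\<zeta>" using norm_Pair_le[of "fst z" "snd z"] by simp
      moreover have "0 \<le> norm (fst z) * norm ?\<zeta>" by simp
      moreover have "(1 + norm (fst z)) * (1 + norm ?\<zeta>) = 1 + norm (fst z) + norm ?\<zeta> + norm (fst z) * norm ?\<zeta>" by (simp add: algebra_simps)
      ultimately show ?thesis by linarith
    qed
    \<comment> \<open>A coordinate of largest modulus controls the norm of the frequency up to the
      factor \<open>?d\<close>, so the estimates for single coordinates suffice.\<close>
    have "\<exists>j. \<forall>i. \<bar>?\<zeta> $ i\<bar> \<le> \<bar>?\<zeta> $ j\<bar>"
    proof -
      have "Max (range (\<lambda>i. \<bar>?\<zeta> $ i\<bar>)) \<in> range (\<lambda>i. \<bar>?\<zeta> $ i\<bar>)" by (intro Max_in) auto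
      then obtain j where "Max (range (\<lambda>i. \<bar>?\<zeta> $ i\<bar>)) = \<bar>?\<zeta> $ j\<bar>" by (rule imageE)
      then show ?thesis using Max_ge[of "range (\<lambda>i. \<bar>?\<zeta> $ i\<bar>)"] by (intro exI[of _ j]) auto
    qed
    then obtain j where j: "\<And>i. \<bar>?\<zeta> $ i\<bar> \<le> \<bar>?\<zeta> $ j\<bar>" by blast
    have "norm ?\<zeta> \<le> (\<Sum>i\<in>UNIV. \<bar>?\<zeta> $ i\<bar>)" by (rule norm_le_l1_cart)
    also have "\<dots> \<le> (\<Sum>i\<in>(UNIV::'d set). \<bar>?\<zeta> $ j\<bar>)" by (intro sum_mono j)
    finally have "norm ?\<zeta> \<le> ?d * \<bar>?\<zeta> $ j\<bar>" by simp
    then have "norm ?\<zeta> ^ M \<le> (?d * \<bar>?\<zeta> $ j\<bar>) ^ M" by (intro power_mono) auto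
    then have pj: "norm ?\<zeta> ^ M \<le> ?d ^ M * \<bar>?\<zeta> $ j\<bar> ^ M" by (simp only: power_mult_distrib)
    have "(1 + norm ?\<zeta>) ^ M \<le> (2 * max 1 (norm ?\<zeta>)) ^ M" by (intro power_mono) auto
    also have "\<dots> = 2 ^ M * (max 1 (norm ?\<zeta>)) ^ M" by (rule power_mult_distrib)
    also have "\<dots> \<le> 2 ^ M * (1 + ?d ^ M * \<bar>?\<zeta> $ j\<bar> ^ M)"
      using pj by (intro mult_left_mono) (auto simp: max_def)
    finally have \<zeta>: "(1 + norm ?\<zeta>) ^ M \<le> 2 ^ M * (1 + ?d ^ M * \<bar>?\<zeta> $ j\<bar> ^ M)" .
    have "(1 + norm z) ^ M \<le> ((1 + norm (fst z)) * (1 + norm ?\<zeta>)) ^ M" by (intro power_mono z) auto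
    also have "\<dots> = ?u * (1 + norm ?\<zeta>) ^ M" by (rule power_mult_distrib)
    also have "\<dots> \<le> ?u * (2 ^ M * (1 + ?d ^ M * \<bar>?\<zeta> $ j\<bar> ^ M))" by (intro mult_left_mono \<zeta>) auto
    finally have "(1 + norm z) ^ M * ?a \<le> ?u * (2 ^ M * (1 + ?d ^ M * \<bar>?\<zeta> $ j\<bar> ^ M)) * ?a"
      by (rule mult_right_mono) simp
    also have "\<dots> = 2 ^ M * (?u * (\<bar>?\<zeta> $ undefined\<bar> ^ 0 * ?a) + ?d ^ M * (?u * (\<bar>?\<zeta> $ j\<bar> ^ M * ?a)))"
      by (simp only: distrib_left distrib_right mult_1_right mult_1_left power_0 mult_ac)
    also have "\<dots> \<le> 2 ^ M * (c0 + ?d ^ M * c j)"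
      by (intro mult_left_mono add_mono c0 c) auto
    also have "\<dots> \<le> C"
      unfolding C_def by (intro mult_left_mono add_left_mono member_le_sum) (auto intro: c)
    finally show ?thesis
      by (simp add: pos_le_divide_eq add_pos_nonneg mult.commute)
  qed
  then show ?thesis using C by blast
qed

lemma amb_continuous:
  assumes f: "integrable lborel f" and h: "h \<in> schwartz"
  shows "continuous_on UNIV (amb f h)"
  unfolding continuous_on_sequentially o_def
proof (intro allI ballI impI, elim conjE)
  fix x :: "nat \<Rightarrow> (real^'a) \<times> (real^'a)" and z assume x: "x \<longlonglongrightarrow> z"
  obtain C where C: "\<And>t. norm (h t) \<le> C" using schwartz_bounded[OF h] by blast
  have [measurable]: "h \<in> borel_measurable borel" "f \<in> borel_measurable borel"
    using schwartz_measurable[OF h] integrable_borelD[OF f] by auto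
  show "(\<lambda>n. amb f h (x n)) \<longlonglongrightarrow> amb f h z"
    unfolding amb_def
  proof (rule tendsto_integral_dominated[OF integrable_mult_left[OF integrable_norm[OF f], of C]])
    fix t
    have "isCont h (t - fst z)" using schwartz_continuous[OF h] by (simp add: continuous_on_eq_continuous_at)
    moreover have "(\<lambda>n. t - fst (x n)) \<longlonglongrightarrow> t - fst z" by (intro tendsto_intros x)
    ultimately have "(\<lambda>n. h (t - fst (x n))) \<longlonglongrightarrow> h (t - fst z)" by (rule isCont_tendsto_compose)
    moreover have "(\<lambda>n. cis (2 * pi * (snd (x n) \<bullet> t))) \<longlonglongrightarrow> cis (2 * pi * (snd z \<bullet> t))"
      by (intro tendsto_intros x)
    ultimately show "(\<lambda>n. f t * tf_shift (x n) h t) \<longlonglongrightarrow> f t * tf_shift z h t"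
      unfolding tf_shift_def by (intro tendsto_mult tendsto_const)
    show "norm (f t * tf_shift (x n) h t) \<le> norm (f t) * C" for n
      by (simp add: norm_mult norm_tf_shift mult_left_mono C)
  qed measurable
qed

lemma amb_rapidly_decaying: "f \<in> schwartz \<Longrightarrow> h \<in> schwartz \<Longrightarrow> rapidly_decaying (amb f h)"
  unfolding rapidly_decaying_def
  using amb_decay amb_continuous[OF schwartz_integrable] borel_measurable_continuous_onI by blast

section \<open>Inversion and Plancherel formulas for the short-time Fourier transform\<close>

lemma integral_pair_lborel:
  fixes f :: "'a::euclidean_space \<times> 'b::euclidean_space \<Rightarrow> 'c::{banach, second_countable_topology}"
  assumes "integrable lborel f"
  shows "(LINT p|lborel. f p) = (LINT x|lborel. LINT y|lborel. f (x, y))"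
  using assms lborel_pair.integral_fst'[of f] by (simp add: lborel_prod)

lemma fst_snd_borel_measurable [measurable]:
  "(fst :: 'a::{second_countable_topology} \<times> 'b::second_countable_topology \<Rightarrow> 'a) \<in> borel_measurable borel"
  "(snd :: 'a \<times> 'b \<Rightarrow> 'b) \<in> borel_measurable borel"
  by (auto intro!: borel_measurable_continuous_onI continuous_intros)

lemma tf_shift_pair_measurable:
  assumes [measurable]: "h \<in> borel_measurable borel"
  shows "(\<lambda>p. tf_shift (fst p) h (snd p)) \<in> borel_measurable borel"
  unfolding tf_shift_def by measurable

lemma tf_shift_measurable2 [measurable]:
  assumes "h \<in> borel_measurable borel"
  shows "(\<lambda>(w, t). tf_shift w h t) \<in> borel_measurable (borel \<Otimes>\<^sub>M borel)"
  using tf_shift_pair_measurable[OF assms] by (simp add: borel_prod case_prod_unfold)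

lemma tf_shift_measurable_index:
  assumes "h \<in> borel_measurable borel"
  shows "(\<lambda>w. tf_shift w h t) \<in> borel_measurable borel"
proof -
  have "(\<lambda>w. h (t - fst w)) \<in> borel_measurable borel"
    by (rule measurable_compose[OF _ assms]) (intro borel_measurable_continuous_onI continuous_intros)
  moreover have "(\<lambda>w. cis (2 * pi * (snd w \<bullet> t))) \<in> borel_measurable (borel :: ((real^'a) \<times> (real^'a)) measure)"
    by (intro borel_measurable_continuous_onI continuous_intros)
  ultimately show ?thesis unfolding tf_shift_def by (rule borel_measurable_times[rotated])
qed

lemma schwartz_L2: "\<psi> \<in> schwartz \<Longrightarrow> integrable lborel (\<lambda>t. (norm (\<psi> t))\<^sup>2)"
proof -
  assume \<psi>: "\<psi> \<in> schwartz"
  obtain C where C: "\<And>t. norm (\<psi> t) \<le> C" using schwartz_bounded[OF \<psi>] by blast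
  show ?thesis
  proof (rule integrable_norm_le[OF integrable_mult_left[OF integrable_norm[OF schwartz_integrable[OF \<psi>]], of C]])
    show "norm ((norm (\<psi> t))\<^sup>2) \<le> norm (\<psi> t) * C" for t
      by (simp add: power2_eq_square mult_left_mono C)
  qed (use schwartz_measurable[OF \<psi>] in measurable)
qed

lemma L2_schwartz_mult_integrable:
  assumes f: "f \<in> L2" and g: "integrable lborel (\<lambda>t. (norm (g t))\<^sup>2)" and [measurable]: "g \<in> borel_measurable borel"
  shows "integrable lborel (\<lambda>t. f t * g t)"
proof (rule integrable_norm_le)
  have [measurable]: "f \<in> borel_measurable borel" using f by (simp add: L2_def)
  show "(\<lambda>t. f t * g t) \<in> borel_measurable lborel" by measurable
  show "integrable lborel (\<lambda>t. (norm (f t))\<^sup>2 + (norm (g t))\<^sup>2)" using f g by (simp add: L2_def)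
  fix t
  have "0 \<le> (norm (f t) - norm (g t))\<^sup>2" by simp
  then have "2 * (norm (f t) * norm (g t)) \<le> (norm (f t))\<^sup>2 + (norm (g t))\<^sup>2" by (simp add: power2_diff)
  moreover have "0 \<le> norm (f t) * norm (g t)" by simp
  ultimately show "norm (f t * g t) \<le> (norm (f t))\<^sup>2 + (norm (g t))\<^sup>2" unfolding norm_mult by linarith
qed

lemma tf_shift_norm_integral:
  "(LINT t|lborel. norm (tf_shift z h t)) = (LINT t|lborel. norm (h t))"
  "(LINT t|lborel. (norm (tf_shift z h t))\<^sup>2) = (LINT t|lborel. (norm (h t))\<^sup>2)"
  unfolding norm_tf_shift by (rule integral_lborel_shift(2))+

lemma L2_inner_tf_shift_eq_amb: "L2_inner f (tf_shift w h) = cnj (amb (\<lambda>t. cnj (f t)) h w)"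
  unfolding L2_inner_def amb_def by (simp flip: Bochner_Integration.integral_cnj)

text \<open>Both integrals are recentred at \<open>fst z\<close>. Without the conjugate the
  frequencies add instead of being subtracted, which is the origin of the reflected points
  \<open>(fst z, - snd z)\<close> in later estimates.\<close>

lemma tf_shift_compose_integral:
  fixes f h :: "real^'d \<Rightarrow> complex"
  shows "(LINT t|lborel. cnj (tf_shift z f t) * tf_shift w h t)
      = cis (2 * pi * ((snd w - snd z) \<bullet> fst z)) * amb (\<lambda>t. cnj (f t)) h (w - z)"
    and "(LINT t|lborel. tf_shift z f t * tf_shift w h t)
      = cis (2 * pi * ((snd w + snd z) \<bullet> fst z)) * amb f h (fst w - fst z, snd w + snd z)"
proof -
  have "(LINT t|lborel. cnj (tf_shift z f t) * tf_shift w h t)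
      = (LINT t|lborel. cnj (tf_shift z f (t + fst z)) * tf_shift w h (t + fst z))"
    by (rule integral_lborel_shift(1)[symmetric])
  also have "\<dots> = (LINT t|lborel. cis (2 * pi * ((snd w - snd z) \<bullet> fst z)) * (cnj (f t) * tf_shift (w - z) h t))"
  proof (rule Bochner_Integration.integral_cong[OF refl])
    fix t
    have "- (2 * pi * (snd z \<bullet> (t + fst z))) + 2 * pi * (snd w \<bullet> (t + fst z))
      = 2 * pi * ((snd w - snd z) \<bullet> fst z) + 2 * pi * ((snd w - snd z) \<bullet> t)"
      by (simp add: inner_diff_left inner_add_right algebra_simps)
    then have "cis (- (2 * pi * (snd z \<bullet> (t + fst z)))) * cis (2 * pi * (snd w \<bullet> (t + fst z)))
      = cis (2 * pi * ((snd w - snd z) \<bullet> fst z)) * cis (2 * pi * ((snd w - snd z) \<bullet> t))"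
      by (simp only: cis_mult)
    then show "cnj (tf_shift z f (t + fst z)) * tf_shift w h (t + fst z)
      = cis (2 * pi * ((snd w - snd z) \<bullet> fst z)) * (cnj (f t) * tf_shift (w - z) h t)"
      by (simp add: tf_shift_def cis_cnj algebra_simps)
  qed
  finally show "(LINT t|lborel. cnj (tf_shift z f t) * tf_shift w h t)
      = cis (2 * pi * ((snd w - snd z) \<bullet> fst z)) * amb (\<lambda>t. cnj (f t)) h (w - z)"
    by (simp add: amb_def)
  have "(LINT t|lborel. tf_shift z f t * tf_shift w h t)
      = (LINT t|lborel. tf_shift z f (t + fst z) * tf_shift w h (t + fst z))"
    by (rule integral_lborel_shift(1)[symmetric])
  also have "\<dots> = (LINT t|lborel. cis (2 * pi * ((snd w + snd z) \<bullet> fst z)) * (f t * tf_shift (fst w - fst z, snd w + snd z) h t))"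
  proof (rule Bochner_Integration.integral_cong[OF refl])
    fix t
    have "2 * pi * (snd z \<bullet> (t + fst z)) + 2 * pi * (snd w \<bullet> (t + fst z))
      = 2 * pi * ((snd w + snd z) \<bullet> fst z) + 2 * pi * ((snd w + snd z) \<bullet> t)"
      by (simp add: inner_add_left inner_add_right algebra_simps)
    then have "cis (2 * pi * (snd z \<bullet> (t + fst z))) * cis (2 * pi * (snd w \<bullet> (t + fst z)))
      = cis (2 * pi * ((snd w + snd z) \<bullet> fst z)) * cis (2 * pi * ((snd w + snd z) \<bullet> t))"
      by (simp only: cis_mult)
    then show "tf_shift z f (t + fst z) * tf_shift w h (t + fst z)
      = cis (2 * pi * ((snd w + snd z) \<bullet> fst z)) * (f t * tf_shift (fst w - fst z, snd w + snd z) h t)"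
      by (simp add: tf_shift_def algebra_simps)
  qed
  finally show "(LINT t|lborel. tf_shift z f t * tf_shift w h t)
      = cis (2 * pi * ((snd w + snd z) \<bullet> fst z)) * amb f h (fst w - fst z, snd w + snd z)"
    by (simp add: amb_def)
qed

locale stft_window =
  fixes \<phi> :: "real^'d \<Rightarrow> complex"
  assumes window: "\<phi> \<in> schwartz" and nonzero: "\<phi> \<noteq> (\<lambda>t. 0)"
begin

text \<open>The normalization that makes the reproducing kernel idempotent; the squared L2 norm of
  the short-time Fourier transform of \<open>f\<close> is that of \<open>f\<close> divided by
  \<open>c\<close>.\<close>

definition c :: real where "c = 1 / (LINT t|lborel. (norm (\<phi> t))\<^sup>2)"

lemma window_measurable [measurable]: "\<phi> \<in> borel_measurable borel"
  by (rule schwartz_measurable[OF window])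

lemma window_ball: "\<exists>p e. 0 < e \<and> (\<forall>t\<in>ball p e. \<phi> t \<noteq> 0)"
proof -
  obtain p where p: "\<phi> p \<noteq> 0" using nonzero by blast
  have "open (\<phi> -` (- {0}))"
    using schwartz_continuous[OF window] open_vimage[of "- {0}" \<phi>] by (simp add: open_Compl)
  then obtain e where "0 < e" "ball p e \<subseteq> \<phi> -` (- {0})"
    using p unfolding open_contains_ball by force
  then show ?thesis by blast
qed

lemma c_pos: "0 < c"
proof -
  have "(LINT t|lborel. (norm (\<phi> t))\<^sup>2) \<noteq> 0"
  proof
    assume "(LINT t|lborel. (norm (\<phi> t))\<^sup>2) = 0"
    then have ae: "AE t in lborel. \<phi> t = 0"
      using integral_nonneg_eq_0_iff_AE[OF schwartz_L2[OF window]] by simp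
    obtain p e where e: "0 < e" "\<And>t. t \<in> ball p e \<Longrightarrow> \<phi> t \<noteq> 0" using window_ball by blast
    have "AE t in lborel. t \<notin> ball p e" using ae by eventually_elim (use e(2) in blast)
    then have "emeasure lborel (ball p e) = 0"
      by (subst (asm) AE_iff_measurable[of "ball p e"]) auto
    then have "measure lborel (ball p e) = 0" by (simp add: measure_def)
    then show False using content_ball_pos[OF e(1), of p] by simp
  qed
  then show ?thesis by (simp add: c_def less_le)
qed

lemma L2_stft_measurable:
  assumes [measurable]: "f \<in> borel_measurable borel"
  shows "(\<lambda>w. L2_inner f (tf_shift w \<phi>)) \<in> borel_measurable borel"
  unfolding L2_inner_def by measurable

text \<open>For fixed position \<open>x\<close> the short-time Fourier transform is the Fourier
  transform of \<open>\<psi>\<close> times the conjugated translate of the window. Fourier inversion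
  recovers that product, and integrating the squared modulus of the window over \<open>x\<close>
  produces \<open>1 / c\<close>.\<close>

lemma stft_inversion:
  assumes \<psi>: "\<psi> \<in> schwartz"
  shows "\<psi> t = (LINT w|lborel. of_real c * L2_inner \<psi> (tf_shift w \<phi>) * tf_shift w \<phi> t)"
proof -
  let ?D = "DIM((real^'d) \<times> (real^'d)) + 2" and ?d = "DIM(real^'d) + 2"
  let ?V = "\<lambda>w. L2_inner \<psi> (tf_shift w \<phi>)"
  have V_eq: "?V w = cnj (amb (\<lambda>t. cnj (\<psi> t)) \<phi> w)" for w by (rule L2_inner_tf_shift_eq_amb)
  have mV[measurable]: "?V \<in> borel_measurable borel"
    by (rule L2_stft_measurable[OF schwartz_measurable[OF \<psi>]])
  obtain B where B: "\<And>t. norm (\<phi> t) \<le> B" using schwartz_bounded[OF window] by blast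
  obtain A where A: "0 \<le> A" "\<And>w. norm (?V w) \<le> A / (1 + norm w) ^ ?D"
    using amb_decay[OF schwartz_cnj[OF \<psi>] window, of ?D] unfolding V_eq complex_mod_cnj by blast
  have int: "integrable lborel (\<lambda>w. ?V w * tf_shift w \<phi> t)"
  proof (rule integrable_decay)
    show "(\<lambda>w. ?V w * tf_shift w \<phi> t) \<in> borel_measurable borel"
      by (intro borel_measurable_times mV tf_shift_measurable_index window_measurable)
    show "norm (?V w * tf_shift w \<phi> t) \<le> (A * B) / (1 + norm w) ^ ?D" for w
      unfolding norm_mult norm_tf_shift using mult_mono[OF A(2) B[of "t - fst w"], of w] A(1) by simp
  qed
  have inner: "(LINT \<xi>|lborel. ?V (x, \<xi>) * tf_shift (x, \<xi>) \<phi> t) = \<psi> t * of_real ((norm (\<phi> (t - x)))\<^sup>2)" for x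
  proof -
    define h where "h s = \<psi> s * cnj (\<phi> (s - x))" for s
    have V_fourier: "?V (x, \<xi>) = fourier h \<xi>" for \<xi>
      unfolding L2_inner_def fourier_def h_def tf_shift_def by (simp add: cis_cnj mult_ac)
    have hi: "integrable lborel h"
      unfolding h_def by (rule integrable_mult_bounded[OF schwartz_integrable[OF \<psi>], of _ B]) (auto simp: B)
    have hc: "continuous_on UNIV h"
      unfolding h_def using schwartz_continuous[OF \<psi>] schwartz_continuous[OF window]
      by (intro continuous_intros continuous_on_compose2[OF schwartz_continuous[OF window]]) auto
    obtain P where P: "\<And>t. norm (\<psi> t) \<le> P" using schwartz_bounded[OF \<psi>] by blast
    have hb: "norm (h s) \<le> P * B" for s
      unfolding h_def norm_mult complex_mod_cnj
      by (intro mult_mono P B norm_ge_zero order_trans[OF norm_ge_zero P])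
    obtain A' where A': "0 \<le> A'" "\<And>w. norm (?V w) \<le> A' / (1 + norm w) ^ ?d"
        using amb_decay[OF schwartz_cnj[OF \<psi>] window, of ?d] unfolding V_eq complex_mod_cnj by blast
    have fh: "integrable lborel (fourier h)"
    proof (rule integrable_decay)
      show "fourier h \<in> borel_measurable borel" using integrable_borelD[OF hi] by measurable
      show "norm (fourier h \<xi>) \<le> A' / (1 + norm \<xi>) ^ ?d" for \<xi>
      proof -
        have "norm (fourier h \<xi>) \<le> A' / (1 + norm (x, \<xi>)) ^ ?d" using A'(2)[of "(x, \<xi>)"] by (simp add: V_fourier)
        also have "\<dots> \<le> A' / (1 + norm \<xi>) ^ ?d"
          using A'(1) norm_snd_le[of \<xi> x]
          by (intro divide_left_mono power_mono mult_pos_pos zero_less_power) (auto simp: add_pos_nonneg)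
        finally show ?thesis .
      qed
    qed
    have "(LINT \<xi>|lborel. ?V (x, \<xi>) * tf_shift (x, \<xi>) \<phi> t) = (LINT \<xi>|lborel. fourier h \<xi> * cis (2 * pi * (\<xi> \<bullet> t)) * \<phi> (t - x))"
      unfolding V_fourier unfolding tf_shift_def by (simp add: mult.assoc)
    also have "\<dots> = h t * \<phi> (t - x)"
      using fourier_inversion[OF hi hc hb fh, of t] by simp
    also have "\<dots> = \<psi> t * of_real ((norm (\<phi> (t - x)))\<^sup>2)"
      using complex_norm_square[of "\<phi> (t - x)"] by (simp add: h_def mult_ac)
    finally show ?thesis .
  qed
  have "(LINT w|lborel. ?V w * tf_shift w \<phi> t) = (LINT x|lborel. LINT \<xi>|lborel. ?V (x, \<xi>) * tf_shift (x, \<xi>) \<phi> t)"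
    by (rule integral_pair_lborel[OF int])
  also have "\<dots> = (LINT x|lborel. \<psi> t * of_real ((norm (\<phi> (t - x)))\<^sup>2))" by (simp only: inner)
  also have "\<dots> = \<psi> t * of_real (LINT x|lborel. (norm (\<phi> (t - x)))\<^sup>2)"
    by (simp only: Bochner_Integration.integral_mult_right_zero integral_complex_of_real)
  also have "(LINT x|lborel. (norm (\<phi> (t - x)))\<^sup>2) = (LINT x|lborel. (norm (\<phi> x))\<^sup>2)"
    by (rule integral_lborel_shift(3))
  also have "\<dots> = 1 / c" by (simp add: c_def)
  finally have "of_real c * (LINT w|lborel. ?V w * tf_shift w \<phi> t) = of_real c * (\<psi> t * of_real (1 / c))" by simp
  also have "\<dots> = \<psi> t" using c_pos by simp
  finally show ?thesis by (simp add: mult.assoc)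
qed

lemma stft_inversion_conj:
  assumes \<psi>: "\<psi> \<in> schwartz"
  shows "\<psi> t = (LINT w|lborel. of_real c * amb \<psi> \<phi> w * cnj (tf_shift w \<phi> t))"
proof -
  have "\<psi> t = cnj (cnj (\<psi> t))" by simp
  also have "\<dots> = cnj (LINT w|lborel. of_real c * L2_inner (\<lambda>t. cnj (\<psi> t)) (tf_shift w \<phi>) * tf_shift w \<phi> t)"
    by (subst stft_inversion[OF schwartz_cnj[OF \<psi>]]) simp
  also have "\<dots> = (LINT w|lborel. of_real c * amb \<psi> \<phi> w * cnj (tf_shift w \<phi> t))"
    unfolding Bochner_Integration.integral_cnj[symmetric] L2_inner_tf_shift_eq_amb by simp
  finally show ?thesis .
qed

lemma rapidly_decaying_mult: "rapidly_decaying b \<Longrightarrow> rapidly_decaying (\<lambda>w. of_real k * b w)"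
  unfolding rapidly_decaying_def
proof (elim conjE, intro conjI allI)
  fix M assume "\<forall>M. \<exists>C\<ge>0. \<forall>w. norm (b w) \<le> C / (1 + norm w) ^ M"
  then obtain C where C: "0 \<le> C" "\<And>w. norm (b w) \<le> C / (1 + norm w) ^ M" by blast
  have "norm (of_real k * b w) \<le> (\<bar>k\<bar> * C) / (1 + norm w) ^ M" for w
    using mult_left_mono[OF C(2)[of w], of "\<bar>k\<bar>"] by (simp add: norm_mult)
  then show "\<exists>C\<ge>0. \<forall>w. norm (of_real k * b w) \<le> C / (1 + norm w) ^ M"
    using C(1) by (intro exI[of _ "\<bar>k\<bar> * C"]) simp
qed measurable

lemma rapidly_decaying_cnj: "rapidly_decaying b \<Longrightarrow> rapidly_decaying (\<lambda>w. cnj (b w))"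
  unfolding rapidly_decaying_def complex_mod_cnj by (auto intro: measurable_compose[OF _ cnj_borel_measurable])

lemma tempered_reproducing:
  assumes T: "T \<in> tempered_distributions" and \<psi>: "\<psi> \<in> schwartz"
  shows "T \<psi> = (LINT w|lborel. of_real c * amb \<psi> \<phi> w * stft \<phi> T w)"
  unfolding stft_def distribution_pairing_def
  by (rule tempered_integral(2)[OF T schwartz_family_cnj[OF schwartz_family_tf_shift[OF window]]
      rapidly_decaying_mult[OF amb_rapidly_decaying[OF \<psi> window]] \<psi> stft_inversion_conj[OF \<psi>]])

text \<open>The expansion in shifted windows instead of their conjugates. As \<open>T\<close> is
  linear in its argument, the values \<open>T (tf_shift w \<phi>)\<close> appear; they are the
  short-time Fourier transform of \<open>T\<close> for the conjugated window at the reflected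
  frequency.\<close>

lemma tempered_reproducing':
  assumes T: "T \<in> tempered_distributions" and \<psi>: "\<psi> \<in> schwartz"
  shows "T \<psi> = (LINT w|lborel. of_real c * L2_inner \<psi> (tf_shift w \<phi>) * T (tf_shift w \<phi>))"
proof (rule tempered_integral(2)[OF T schwartz_family_tf_shift[OF window] _ \<psi> stft_inversion[OF \<psi>]])
  show "rapidly_decaying (\<lambda>w. of_real c * L2_inner \<psi> (tf_shift w \<phi>))"
    unfolding L2_inner_tf_shift_eq_amb
    by (intro rapidly_decaying_mult rapidly_decaying_cnj amb_rapidly_decaying schwartz_cnj \<psi> window)
qed

text \<open>For \<open>f\<close> in L2 the product with a translated window lies in both L1 and L2,
  so \<open>plancherel\<close> applies for each fixed position; Fubini over the positions
  finishes.\<close>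

lemma L2_plancherel:
  assumes f: "f \<in> L2"
  shows "integrable lborel (\<lambda>w. (norm (L2_inner f (tf_shift w \<phi>)))\<^sup>2)"
    and "(LINT w|lborel. (norm (L2_inner f (tf_shift w \<phi>)))\<^sup>2) = (LINT t|lborel. (norm (f t))\<^sup>2) / c"
proof -
  let ?V = "\<lambda>w. L2_inner f (tf_shift w \<phi>)"
  have [measurable]: "f \<in> borel_measurable borel" and f2: "integrable lborel (\<lambda>t. (norm (f t))\<^sup>2)"
    using f by (auto simp: L2_def)
  have mV[measurable]: "?V \<in> borel_measurable borel" by (rule L2_stft_measurable) measurable
  obtain B where B: "\<And>t. norm (\<phi> t) \<le> B" using schwartz_bounded[OF window] by blast
  let ?h = "\<lambda>x s. f s * cnj (\<phi> (s - x))"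
  have \<phi>2: "integrable lborel (\<lambda>s. (norm (cnj (\<phi> (s - x))))\<^sup>2)" for x
    using integrable_lborel_shift_iff(2)[of "\<lambda>t. (norm (\<phi> t))\<^sup>2" x] schwartz_L2[OF window] by simp
  have hi: "integrable lborel (?h x)" for x
    by (rule L2_schwartz_mult_integrable[OF f \<phi>2]) measurable
  have h2: "integrable lborel (\<lambda>s. (norm (?h x s))\<^sup>2)" for x
  proof (rule integrable_norm_le[OF integrable_mult_left[OF f2, of "B\<^sup>2"]])
    show "norm ((norm (?h x s))\<^sup>2) \<le> (norm (f s))\<^sup>2 * B\<^sup>2" for s
      using power_mono[OF B[of "s - x"], of 2] by (simp add: norm_mult power_mult_distrib mult_left_mono)
  qed measurable
  have V_fourier: "?V (x, \<xi>) = fourier (?h x) \<xi>" for x \<xi>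
    unfolding L2_inner_def fourier_def tf_shift_def by (simp add: cis_cnj mult_ac)
  let ?F = "\<lambda>s x. (norm (f s))\<^sup>2 * (norm (\<phi> (s - x)))\<^sup>2"
  have Fm: "(\<lambda>p. ?F (fst p) (snd p)) \<in> borel_measurable borel" by measurable
  have \<phi>s: "integrable lborel (\<lambda>x. (norm (\<phi> (s - x)))\<^sup>2)" "(LINT x|lborel. (norm (\<phi> (s - x)))\<^sup>2) = 1 / c" for s
    using integrable_lborel_shift_iff(3)[of "\<lambda>t. (norm (\<phi> t))\<^sup>2" s] schwartz_L2[OF window]
      integral_lborel_shift(3)[of "\<lambda>t. (norm (\<phi> t))\<^sup>2" s] by (auto simp: c_def)
  have Fi: "integrable lborel (?F s)" for s by (intro integrable_mult_right \<phi>s)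
  have Fw: "(LINT x|lborel. norm (?F s x)) \<le> (norm (f s))\<^sup>2 * (1 / c)" for s
    using \<phi>s(2)[of s] by simp
  have Fwi: "integrable lborel (\<lambda>s. (norm (f s))\<^sup>2 * (1 / c))" by (intro integrable_mult_left f2)
  note fub = fubini_dominated[where f="?F", OF Fm Fi Fw Fwi]
  have slice: "integrable lborel (\<lambda>\<xi>. (norm (?V (x, \<xi>)))\<^sup>2)"
    "(LINT \<xi>|lborel. (norm (?V (x, \<xi>)))\<^sup>2) = (LINT s|lborel. ?F s x)" for x
    unfolding V_fourier using plancherel[OF hi h2, of x] by (auto simp: norm_mult power_mult_distrib)
  let ?f = "\<lambda>x \<xi>. (norm (?V (x, \<xi>)))\<^sup>2"
  have m: "(\<lambda>p. ?f (fst p) (snd p)) \<in> borel_measurable borel" by simp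
  have w: "(LINT \<xi>|lborel. norm (?f x \<xi>)) \<le> (LINT s|lborel. ?F s x)" for x using slice(2)[of x] by simp
  have "integrable lborel (\<lambda>p. ?f (fst p) (snd p))"
    by (rule fubini_dominated(1)[where f="?f", OF m slice(1) w fub(4)])
  then show int: "integrable lborel (\<lambda>w. (norm (?V w))\<^sup>2)" by simp
  have "(LINT w|lborel. (norm (?V w))\<^sup>2) = (LINT x|lborel. LINT s|lborel. ?F s x)"
    unfolding integral_pair_lborel[OF int] by (simp only: slice)
  also have "\<dots> = (LINT s|lborel. LINT x|lborel. ?F s x)" by (rule fub(2)[symmetric])
  also have "\<dots> = (LINT t|lborel. (norm (f t))\<^sup>2) / c" using \<phi>s(2) by simp
  finally show "(LINT w|lborel. (norm (?V w))\<^sup>2) = (LINT t|lborel. (norm (f t))\<^sup>2) / c" .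
qed

end

section \<open>Off-diagonal decay, synthesis and membership in M1\<close>

definition decay :: "'a::euclidean_space \<Rightarrow> real" where
  "decay x = 1 / (1 + norm x) ^ (DIM('a) + 2)"

lemma decay_pos: "0 < decay x"
  unfolding decay_def by (intro divide_pos_pos zero_less_power) (simp_all add: add_pos_nonneg)

lemma decay_le_1: "decay (x :: 'a::euclidean_space) \<le> 1"
proof -
  have "1 \<le> (1 + norm x) ^ (DIM('a) + 2)" by (intro one_le_power) simp
  then show ?thesis unfolding decay_def by (subst divide_le_eq_1_pos) linarith+
qed

lemma decay_measurable [measurable]: "decay \<in> borel_measurable borel"
  unfolding decay_def by measurable

lemma decay_integrable: "integrable lborel (decay :: 'a::euclidean_space \<Rightarrow> real)"
  using integrable_inverse_power_norm[where 'a='a] by (simp add: decay_def[abs_def])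

lemma decay_minus_commute: "decay (x - y) = decay (y - x)"
  by (simp add: decay_def norm_minus_commute)

text \<open>Comparability at distance 1 makes bounds by \<open>decay\<close> stable under passing to
  maxima over unit neighbourhoods.\<close>

lemma decay_near:
  fixes x y :: "'a::euclidean_space"
  assumes "dist x y \<le> 1"
  shows "decay x \<le> 2 ^ (DIM('a) + 2) * decay y"
proof -
  have p: "0 < 1 + norm x" "0 < 1 + norm y" by (simp_all add: add_pos_nonneg)
  have "norm y \<le> norm x + dist x y" using norm_triangle_ineq2[of y x] by (simp add: dist_norm norm_minus_commute)
  then have "1 + norm y \<le> 2 * (1 + norm x)" using assms norm_ge_zero[of x] by (simp only: ring_distribs)
  then have "(1 + norm y) ^ (DIM('a) + 2) \<le> (2 * (1 + norm x)) ^ (DIM('a) + 2)" by (intro power_mono) auto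
  then have le: "(1 + norm y) ^ (DIM('a) + 2) \<le> 2 ^ (DIM('a) + 2) * (1 + norm x) ^ (DIM('a) + 2)"
    by (simp only: power_mult_distrib)
  show ?thesis
    unfolding decay_def using zero_less_power[OF p(1), of "DIM('a) + 2"] zero_less_power[OF p(2), of "DIM('a) + 2"]
    by (simp only: divide_simps mult_1_right) (use le in simp)
qed

lemma decay_convolution:
  fixes f :: "'a::euclidean_space \<Rightarrow> 'b::{banach, second_countable_topology}"
  assumes f: "integrable lborel f"
  shows "integrable lborel (\<lambda>v. LINT u|lborel. norm (f u) * decay (u - v))"
    and "(LINT v|lborel. LINT u|lborel. norm (f u) * decay (u - v)) = (LINT u|lborel. norm (f u)) * (LINT u|lborel. decay (u :: 'a))"
    and "integrable lborel (\<lambda>u. norm (f u) * decay (u - v))"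
    and "(LINT u|lborel. norm (f u) * decay (u - v)) \<le> (LINT u|lborel. norm (f u))"
proof -
  have [measurable]: "f \<in> borel_measurable borel" by (rule integrable_borelD[OF f])
  let ?f = "\<lambda>u v. norm (f u) * decay (u - v)"
  have m: "(\<lambda>p. ?f (fst p) (snd p)) \<in> borel_measurable borel" by measurable
  have i: "integrable lborel (?f u)" for u
    using integrable_lborel_shift_iff(3)[of "decay :: 'a \<Rightarrow> real" u] decay_integrable
    by (intro integrable_mult_right) simp
  have I: "(LINT v|lborel. ?f u v) = norm (f u) * (LINT u|lborel. decay (u :: 'a))" for u
    using integral_lborel_shift(3)[of "decay :: 'a \<Rightarrow> real" u] by simp
  have w: "(LINT v|lborel. norm (?f u v)) \<le> norm (f u) * (LINT u|lborel. decay (u :: 'a))" for u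
  proof -
    have "norm (?f u v) = ?f u v" for v by (simp add: abs_mult less_imp_le[OF decay_pos])
    then show ?thesis by (simp only: I)
  qed
  have wi: "integrable lborel (\<lambda>u. norm (f u) * (LINT u|lborel. decay (u :: 'a)))"
    by (intro integrable_mult_left integrable_norm f)
  note fub = fubini_dominated[where f="?f", OF m i w wi]
  show "integrable lborel (\<lambda>v. LINT u|lborel. norm (f u) * decay (u - v))" by (rule fub(4))
  show "(LINT v|lborel. LINT u|lborel. norm (f u) * decay (u - v)) = (LINT u|lborel. norm (f u)) * (LINT u|lborel. decay (u :: 'a))"
    unfolding fub(2)[symmetric] I by simp
  have le: "norm (norm (f u) * decay (u - v)) \<le> norm (f u)" for u
    using mult_left_mono[OF decay_le_1[of "u - v"], of "norm (f u)"] by (simp add: abs_mult less_imp_le[OF decay_pos])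
  show fi: "integrable lborel (\<lambda>u. norm (f u) * decay (u - v))"
    by (rule integrable_norm_le[OF integrable_norm[OF f] _ le]) measurable
  show "(LINT u|lborel. norm (f u) * decay (u - v)) \<le> (LINT u|lborel. norm (f u))"
    by (rule integral_mono[OF fi integrable_norm[OF f]]) (use le in \<open>auto simp: abs_mult less_imp_le[OF decay_pos]\<close>)
qed

lemma distribution_of_tempered:
  assumes h: "integrable lborel (h :: real^'d \<Rightarrow> complex)"
  shows "distribution_of h \<in> tempered_distributions"
proof -
  have i: "integrable lborel (\<lambda>t. h t * \<psi> t)" if \<psi>: "\<psi> \<in> schwartz" for \<psi>
    using amb_integrand_integrable[OF h \<psi>, of 0] by (simp add: tf_shift_0)
  have "(\<lambda>n. distribution_of h (\<psi> n)) \<longlonglongrightarrow> 0" if \<psi>: "schwartz_null_sequence \<psi>" for \<psi>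
  proof (rule Lim_null_comparison)
    have S: "\<psi> n \<in> schwartz" and "(\<lambda>n. schwartz_seminorm 0 [] (\<psi> n)) \<longlonglongrightarrow> 0" for n
      using \<psi> by (auto simp: schwartz_null_sequence_def)
    from tendsto_mult_right[OF this(2), of "LINT t|lborel. norm (h t)"]
    show "(\<lambda>n. (LINT t|lborel. norm (h t)) * schwartz_seminorm 0 [] (\<psi> n)) \<longlonglongrightarrow> 0" by (simp add: mult.commute)
    show "\<forall>\<^sub>F n in sequentially. norm (distribution_of h (\<psi> n)) \<le> (LINT t|lborel. norm (h t)) * schwartz_seminorm 0 [] (\<psi> n)"
    proof (intro always_eventually allI)
      fix n
      obtain C where C: "\<And>t. norm (\<psi> n t) \<le> C" using schwartz_bounded[OF S] by blast
      have "bdd_above (range (\<lambda>t. norm t ^ 0 * norm (iterated_partial [] (\<psi> n) t)))"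
        using C by (intro bdd_aboveI2[where M=C]) simp
      from cSUP_upper[OF UNIV_I this]
      have le: "norm (\<psi> n t) \<le> schwartz_seminorm 0 [] (\<psi> n)" for t
        by (simp add: schwartz_seminorm_def)
      have "norm (LINT t|lborel. h t * \<psi> n t) \<le> (LINT t|lborel. norm (h t) * schwartz_seminorm 0 [] (\<psi> n))"
        by (rule norm_integral_le[OF integrable_mult_left[OF integrable_norm[OF h]]])
           (simp add: norm_mult mult_left_mono le)
      then show "norm (distribution_of h (\<psi> n)) \<le> (LINT t|lborel. norm (h t)) * schwartz_seminorm 0 [] (\<psi> n)"
        using S by (simp add: distribution_of_def)
    qed
  qed
  moreover have "(\<lambda>t. \<psi> t + \<eta> t) \<in> schwartz" if "\<psi> \<in> schwartz" "\<eta> \<in> schwartz" for \<psi> \<eta> :: "real^'d \<Rightarrow> complex"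
    using schwartz_lincomb[OF that, of 1 1] by simp
  ultimately show ?thesis
    unfolding tempered_distributions_def
    by (auto simp: distribution_of_def i schwartz_cmult distrib_left mult.left_commute)
qed

context stft_window
begin

abbreviation V :: "(real^'d \<Rightarrow> complex) \<Rightarrow> (real^'d) \<times> (real^'d) \<Rightarrow> complex" where
  "V f w \<equiv> L2_inner f (tf_shift w \<phi>)"

lemma shift_window: "tf_shift w \<phi> \<in> schwartz"
  by (rule schwartz_tf_shift[OF window])

lemma stft_distribution_of: "stft \<phi> (distribution_of h) w = V h w"
  by (simp add: stft_def distribution_pairing_def distribution_of_def L2_inner_def schwartz_cnj[OF shift_window])

lemma window_L2: "tf_shift w \<phi> \<in> L2"
  using schwartz_L2[OF shift_window] schwartz_measurable[OF shift_window] by (simp add: L2_def)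

lemma window_sup: "\<exists>B\<ge>0. \<forall>w t. norm (tf_shift w \<phi> t) \<le> B"
  using schwartz_bounded[OF window] by (auto simp: norm_tf_shift)

lemma L2_inner_cnj: "L2_inner f h = cnj (L2_inner h f)"
  unfolding L2_inner_def Bochner_Integration.integral_cnj[symmetric] by (simp add: mult.commute)

lemma L2_inner_shifts:
  "L2_inner (tf_shift w h) (tf_shift z f) = cis (2 * pi * ((snd w - snd z) \<bullet> fst z)) * cnj (L2_inner f (tf_shift (w - z) h))"
proof -
  have "L2_inner (tf_shift w h) (tf_shift z f) = (LINT t|lborel. cnj (tf_shift z f t) * tf_shift w h t)"
    by (simp add: L2_inner_def mult.commute)
  then show ?thesis by (simp add: tf_shift_compose_integral(1) L2_inner_tf_shift_eq_amb)
qed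

text \<open>The first bound is the off-diagonal decay of the reproducing kernel. The second concerns
  the pairing without conjugate, which concentrates where the frequencies are opposite.\<close>

lemma window_ambiguity_bounds:
  "\<exists>C\<ge>0. (\<forall>w z. norm (L2_inner (tf_shift w \<phi>) (tf_shift z \<phi>)) \<le> C * decay (w - z)) \<and>
     (\<forall>w z. norm (amb (tf_shift z \<phi>) \<phi> w) \<le> C * decay (w - (fst z, - snd z)))"
proof -
  obtain C1 where C1: "0 \<le> C1" "\<And>w. norm (amb (\<lambda>t. cnj (\<phi> t)) \<phi> w) \<le> C1 / (1 + norm w) ^ (DIM((real^'d) \<times> (real^'d)) + 2)"
    using amb_decay[OF schwartz_cnj[OF window] window] by blast
  obtain C2 where C2: "0 \<le> C2" "\<And>w. norm (amb \<phi> \<phi> w) \<le> C2 / (1 + norm w) ^ (DIM((real^'d) \<times> (real^'d)) + 2)"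
    using amb_decay[OF window window] by blast
  have 1: "norm (L2_inner (tf_shift w \<phi>) (tf_shift z \<phi>)) \<le> C1 * decay (w - z)" for w z
  proof -
    have "norm (L2_inner (tf_shift w \<phi>) (tf_shift z \<phi>)) = norm (amb (\<lambda>t. cnj (\<phi> t)) \<phi> (w - z))"
      unfolding L2_inner_shifts unfolding L2_inner_tf_shift_eq_amb by (simp add: norm_mult)
    then show ?thesis using C1(2)[of "w - z"] by (simp only: decay_def mult_1_right times_divide_eq_right)
  qed
  have 2: "norm (amb (tf_shift z \<phi>) \<phi> w) \<le> C2 * decay (w - (fst z, - snd z))" for w z
  proof -
    have "amb (tf_shift z \<phi>) \<phi> w = cis (2 * pi * ((snd w + snd z) \<bullet> fst z)) * amb \<phi> \<phi> (fst w - fst z, snd w + snd z)"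
      unfolding amb_def[of "tf_shift z \<phi>"] by (rule tf_shift_compose_integral(2))
    moreover have "(fst w - fst z, snd w + snd z) = w - (fst z, - snd z)" by (simp add: prod_eq_iff)
    ultimately show ?thesis using C2(2)[of "w - (fst z, - snd z)"] by (simp only: norm_mult norm_cis mult_1_left mult_1_right decay_def times_divide_eq_right)
  qed
  have "C1 * decay x \<le> max C1 C2 * decay x" "C2 * decay x \<le> max C1 C2 * decay x" for x :: "(real^'d) \<times> (real^'d)"
    by (auto intro!: mult_right_mono less_imp_le[OF decay_pos])
  then show ?thesis
    using C1(1) by (intro exI[of _ "max C1 C2"] conjI allI order_trans[OF 1] order_trans[OF 2]) auto
qed

lemma V_integrand_integrable: "integrable lborel f \<Longrightarrow> integrable lborel (\<lambda>t. f t * cnj (tf_shift w \<phi> t))"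
proof -
  assume f: "integrable lborel f"
  obtain B where "\<And>w t. norm (tf_shift w \<phi> t) \<le> B" using window_sup by blast
  then show ?thesis
    by (intro integrable_mult_bounded[OF f, of _ B] schwartz_measurable schwartz_cnj shift_window) simp
qed

text \<open>The adjoint of the short-time Fourier transform times \<open>c\<close>, taken pointwise;
  for the coefficients of \<open>h\<close> in M1 it recovers \<open>h\<close> almost everywhere, see
  \<open>M1_representation\<close>.\<close>

definition synthesis :: "((real^'d) \<times> (real^'d) \<Rightarrow> complex) \<Rightarrow> real^'d \<Rightarrow> complex" where
  "synthesis b t = (LINT w|lborel. of_real c * b w * tf_shift w \<phi> t)"

lemma synthesis:
  assumes b: "integrable lborel b" and B: "\<And>w t. norm (tf_shift w \<phi> t) \<le> B"
  shows synthesis_integrable: "integrable lborel (synthesis b)"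
    and synthesis_bounded: "norm (synthesis b t) \<le> c * (LINT w|lborel. norm (b w)) * B"
    and synthesis_pairing: "\<And>k. k \<in> borel_measurable borel \<Longrightarrow>
      (\<And>w. integrable lborel (\<lambda>t. k t * tf_shift w \<phi> t)) \<Longrightarrow>
      (\<And>w. (LINT t|lborel. norm (k t * tf_shift w \<phi> t)) \<le> M) \<Longrightarrow>
      (LINT t|lborel. k t * synthesis b t) = (LINT w|lborel. of_real c * b w * (LINT t|lborel. k t * tf_shift w \<phi> t))"
proof -
  have [measurable]: "b \<in> borel_measurable borel" by (rule integrable_borelD[OF b])
  have pairing: "(LINT t|lborel. k t * synthesis b t) = (LINT w|lborel. of_real c * b w * (LINT t|lborel. k t * tf_shift w \<phi> t))"
    "integrable lborel (\<lambda>t. k t * synthesis b t)"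
    if [measurable]: "k \<in> borel_measurable borel" and k: "\<And>w. integrable lborel (\<lambda>t. k t * tf_shift w \<phi> t)"
      and M: "\<And>w. (LINT t|lborel. norm (k t * tf_shift w \<phi> t)) \<le> M" for k M
  proof -
    let ?f = "\<lambda>w t. of_real c * b w * (k t * tf_shift w \<phi> t)"
    have m: "(\<lambda>p. ?f (fst p) (snd p)) \<in> borel_measurable borel"
      by (intro borel_measurable_times tf_shift_pair_measurable window_measurable) measurable
    have i: "integrable lborel (?f w)" for w by (intro integrable_mult_right k)
    have w: "(LINT t|lborel. norm (?f w t)) \<le> c * norm (b w) * M" for w
      using mult_left_mono[OF M[of w], of "c * norm (b w)"] c_pos by (simp add: norm_mult)
    have wi: "integrable lborel (\<lambda>w. c * norm (b w) * M)"
      by (intro integrable_mult_left integrable_mult_right integrable_norm b)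
    note fub = fubini_dominated[where f="?f", OF m i w wi]
    have e: "k t * synthesis b t = (LINT w|lborel. ?f w t)" for t
      unfolding synthesis_def by (subst Bochner_Integration.integral_mult_right_zero[symmetric]) (simp only: mult_ac)
    show "(LINT t|lborel. k t * synthesis b t) = (LINT w|lborel. of_real c * b w * (LINT t|lborel. k t * tf_shift w \<phi> t))"
      unfolding e fub(2)[symmetric] by simp
    show "integrable lborel (\<lambda>t. k t * synthesis b t)" unfolding e by (rule fub(4))
  qed
  then show "\<And>k. k \<in> borel_measurable borel \<Longrightarrow>
      (\<And>w. integrable lborel (\<lambda>t. k t * tf_shift w \<phi> t)) \<Longrightarrow>
      (\<And>w. (LINT t|lborel. norm (k t * tf_shift w \<phi> t)) \<le> M) \<Longrightarrow>
      (LINT t|lborel. k t * synthesis b t) = (LINT w|lborel. of_real c * b w * (LINT t|lborel. k t * tf_shift w \<phi> t))"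
    by blast
  show "integrable lborel (synthesis b)"
    using pairing(2)[of "\<lambda>t. 1" "LINT t|lborel. norm (\<phi> t)"] schwartz_integrable[OF shift_window]
    by (simp add: tf_shift_norm_integral)
  have "norm (synthesis b t) \<le> (LINT w|lborel. c * norm (b w) * B)"
    unfolding synthesis_def
    by (rule norm_integral_le[OF integrable_mult_left[OF integrable_mult_right[OF integrable_norm[OF b]]]])
       (use c_pos B in \<open>auto simp: norm_mult intro!: mult_left_mono\<close>)
  then show "norm (synthesis b t) \<le> c * (LINT w|lborel. norm (b w)) * B" by simp
qed

text \<open>For each \<open>x\<close>, uniqueness of the Fourier transform annihilates
  \<open>k\<close> times the conjugated window translated by \<open>x\<close>. The window may have
  zeros, but since it is nonzero on a ball, translates by a countable dense set leave no point
  uncovered, and countably many null sets have a null union.\<close>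

lemma AE_zero_of_schwartz:
  assumes [measurable]: "k \<in> borel_measurable borel"
    and i: "\<And>w. integrable lborel (\<lambda>t. k t * cnj (tf_shift w \<phi> t))"
    and 0: "\<And>w. (LINT t|lborel. k t * cnj (tf_shift w \<phi> t)) = 0"
  shows "AE t in lborel. k t = 0"
proof -
  have "AE t in lborel. k t * cnj (\<phi> (t - x)) = 0" for x
  proof (rule fourier_unique)
    show "integrable lborel (\<lambda>t. k t * cnj (\<phi> (t - x)))"
      using i[of "(x, 0)"] by (simp add: tf_shift_def)
    show "fourier (\<lambda>t. k t * cnj (\<phi> (t - x))) \<xi> = 0" for \<xi>
      using 0[of "(x, \<xi>)"] by (simp add: fourier_def tf_shift_def cis_cnj mult_ac)
  qed
  moreover obtain Q :: "(real^'d) set" where Q: "countable Q" "\<And>X. open X \<Longrightarrow> X \<noteq> {} \<Longrightarrow> \<exists>d\<in>Q. d \<in> X"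
    using countable_dense_exists[where 'a="real^'d"] by blast
  ultimately have "AE t in lborel. \<forall>x\<in>Q. k t * cnj (\<phi> (t - x)) = 0"
    by (subst AE_ball_countable) auto
  then show ?thesis
  proof eventually_elim
    fix t assume t: "\<forall>x\<in>Q. k t * cnj (\<phi> (t - x)) = 0"
    obtain p e where e: "0 < e" "\<forall>s\<in>ball p e. \<phi> s \<noteq> 0" using window_ball by blast
    obtain x where x: "x \<in> Q" "x \<in> ball (t - p) e" using Q(2)[of "ball (t - p) e"] e(1) by auto
    have "dist p (t - x) = dist (t - p) x" by (simp add: dist_norm norm_minus_commute algebra_simps)
    then have "t - x \<in> ball p e" using x(2) by simp
    then show "k t = 0" using e(2) t x(1) by auto
  qed
qed

text \<open>\<open>tempered_reproducing\<close> shows that \<open>h\<close> and the synthesis of its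
  coefficients have equal pairings with all shifted windows; \<open>AE_zero_of_schwartz\<close>
  turns this into equality almost everywhere.\<close>

lemma M1_representation:
  assumes hm [measurable]: "h \<in> borel_measurable borel"
    and i: "\<And>\<psi>. \<psi> \<in> schwartz \<Longrightarrow> integrable lborel (\<lambda>t. h t * \<psi> t)"
    and T: "distribution_of h \<in> M1 \<phi>"
  shows "AE t in lborel. h t = synthesis (V h) t"
proof -
  have T': "distribution_of h \<in> tempered_distributions" and Vi: "integrable lborel (V h)"
    using T by (auto simp: M1_def stft_distribution_of[abs_def])
  obtain B where B: "0 \<le> B" "\<And>w t. norm (tf_shift w \<phi> t) \<le> B" using window_sup by blast
  note si = synthesis_integrable[OF Vi B(2)]
  have [measurable]: "synthesis (V h) \<in> borel_measurable borel" by (rule integrable_borelD[OF si])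
  have "AE t in lborel. h t - synthesis (V h) t = 0"
  proof (rule AE_zero_of_schwartz)
    fix z
    let ?\<psi> = "\<lambda>t. cnj (tf_shift z \<phi> t)"
    have \<psi>: "?\<psi> \<in> schwartz" by (intro schwartz_cnj shift_window)
    have i1: "integrable lborel (\<lambda>t. h t * ?\<psi> t)" by (rule i[OF \<psi>])
    have i2: "integrable lborel (\<lambda>t. synthesis (V h) t * ?\<psi> t)" by (rule V_integrand_integrable[OF si])
    show "integrable lborel (\<lambda>t. (h t - synthesis (V h) t) * ?\<psi> t)"
      unfolding left_diff_distrib by (intro Bochner_Integration.integrable_diff i1 i2)
    have "(LINT t|lborel. h t * ?\<psi> t) = distribution_of h ?\<psi>" using \<psi> by (simp add: distribution_of_def)
    also have "\<dots> = (LINT w|lborel. of_real c * amb ?\<psi> \<phi> w * V h w)"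
      unfolding tempered_reproducing[OF T' \<psi>] by (simp add: stft_distribution_of)
    also have "\<dots> = (LINT w|lborel. of_real c * V h w * (LINT t|lborel. ?\<psi> t * tf_shift w \<phi> t))"
      by (simp add: amb_def mult_ac)
    also have "\<dots> = (LINT t|lborel. ?\<psi> t * synthesis (V h) t)"
    proof (rule synthesis_pairing[OF Vi B(2), symmetric])
      show "integrable lborel (\<lambda>t. ?\<psi> t * tf_shift w \<phi> t)" for w
        by (rule amb_integrand_integrable[OF schwartz_integrable[OF \<psi>] window])
      show "(LINT t|lborel. norm (?\<psi> t * tf_shift w \<phi> t)) \<le> (LINT t|lborel. norm (?\<psi> t) * B)" for w
        by (intro integral_mono integrable_norm amb_integrand_integrable schwartz_integrable \<psi> window integrable_mult_left)
           (auto simp: norm_mult intro!: mult_left_mono B(2))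
    qed (rule schwartz_measurable[OF \<psi>])
    finally show "(LINT t|lborel. (h t - synthesis (V h) t) * ?\<psi> t) = 0"
      unfolding left_diff_distrib using i1 i2 by (simp add: mult.commute)
  qed measurable
  then show ?thesis by eventually_elim simp
qed

text \<open>The substantial point is integrability of \<open>h\<close>: almost everywhere it equals
  the synthesis of integrable coefficients.\<close>

lemma M1_functions_iff:
  "h \<in> M1_functions \<phi> \<longleftrightarrow> integrable lborel h \<and> integrable lborel (V h)"
proof
  assume "h \<in> M1_functions \<phi>"
  then have m: "h \<in> borel_measurable borel" and i: "\<And>\<psi>. \<psi> \<in> schwartz \<Longrightarrow> integrable lborel (\<lambda>t. h t * \<psi> t)"
    and T: "distribution_of h \<in> M1 \<phi>" by (auto simp: M1_functions_def)
  have Vi: "integrable lborel (V h)" using T by (auto simp: M1_def stft_distribution_of[abs_def])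
  obtain B where B: "\<And>w t. norm (tf_shift w \<phi> t) \<le> B" using window_sup by blast
  have "integrable lborel h"
  proof (rule integrable_cong_AE_imp[OF synthesis_integrable[OF Vi B]])
    have "h \<in> borel_measurable borel" using m by simp
    then show "h \<in> borel_measurable lborel" by simp
    have "AE t in lborel. h t = synthesis (V h) t"
      by (rule M1_representation[OF \<open>h \<in> borel_measurable borel\<close> _ T]) (rule i)
    then show "AE t in lborel. synthesis (V h) t = h t"
      by eventually_elim simp
  qed
  then show "integrable lborel h \<and> integrable lborel (V h)" using Vi by simp
next
  assume h: "integrable lborel h \<and> integrable lborel (V h)"
  have "integrable lborel (\<lambda>t. h t * \<psi> t)" if "\<psi> \<in> schwartz" for \<psi>
    using amb_integrand_integrable[OF _ that, of h 0] h by (simp add: tf_shift_0)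
  then show "h \<in> M1_functions \<phi>"
    using h distribution_of_tempered integrable_borelD
    by (auto simp: M1_functions_def M1_def stft_distribution_of[abs_def])
qed

lemma window_M1: "\<phi> \<in> M1_functions \<phi>"
  unfolding M1_functions_iff L2_inner_tf_shift_eq_amb
  by (intro conjI schwartz_integrable window rapidly_decaying_integrable0 rapidly_decaying_cnj
      amb_rapidly_decaying schwartz_cnj)

lemma M1_functions_tf_shift:
  assumes h: "h \<in> M1_functions \<phi>"
  shows "tf_shift z h \<in> M1_functions \<phi>"
  unfolding M1_functions_iff
proof
  have hi: "integrable lborel h" "integrable lborel (V h)" using h by (auto simp: M1_functions_iff)
  have [measurable]: "h \<in> borel_measurable borel" by (rule integrable_borelD[OF hi(1)])
  show "integrable lborel (tf_shift z h)"
  proof (rule integrable_norm_le)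
    show "integrable lborel (\<lambda>t. norm (h (t - fst z)))"
      by (subst integrable_lborel_shift_iff(2)) (rule integrable_norm[OF hi(1)])
  qed (simp_all add: norm_tf_shift)
  have e: "norm (V (tf_shift z h) w) = norm (V h (w - z))" for w
    by (subst L2_inner_cnj) (simp add: L2_inner_shifts norm_mult)
  show "integrable lborel (V (tf_shift z h))"
  proof (rule integrable_norm_le)
    show "integrable lborel (\<lambda>w. norm (V h (w - z)))"
      by (subst integrable_lborel_shift_iff(2)) (rule integrable_norm[OF hi(2)])
    show "V (tf_shift z h) \<in> borel_measurable lborel"
      using L2_stft_measurable[of "tf_shift z h"] by simp
  qed (simp add: e)
qed

text \<open>Conjugating the function amounts to conjugating the window, and \<open>M\<^sup>1\<close> does not see the difference.\<close>

lemma M1_conj_stft: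
  "\<exists>C\<ge>0. \<forall>T\<in>M1 \<phi>. integrable lborel (\<lambda>z. T (tf_shift z \<phi>)) \<and>
    (LINT z|lborel. norm (T (tf_shift z \<phi>))) \<le> C * M1_norm \<phi> T"
proof -
  obtain C where C: "0 \<le> C" "\<And>w z. norm (amb (tf_shift z \<phi>) \<phi> w) \<le> C * decay (w - (fst z, - snd z))"
    using window_ambiguity_bounds by blast
  let ?q = "LINT u|lborel. decay (u :: (real^'d) \<times> (real^'d))"
  have "integrable lborel (\<lambda>z. T (tf_shift z \<phi>)) \<and>
    (LINT z|lborel. norm (T (tf_shift z \<phi>))) \<le> c * C * ?q * M1_norm \<phi> T" if "T \<in> M1 \<phi>" for T
  proof -
    have T: "T \<in> tempered_distributions" "integrable lborel (stft \<phi> T)" using that by (auto simp: M1_def)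
    have [measurable]: "stft \<phi> T \<in> borel_measurable borel" by (rule integrable_borelD[OF T(2)])
    let ?f = "\<lambda>w z. norm (stft \<phi> T w) * decay (w - (fst z, - snd z))"
    \<comment> \<open>The reflection of the frequency is moved to the other point, so that for fixed
      \<open>w\<close> the integral over \<open>z\<close> is that of a translate of
      \<open>decay\<close>.\<close>
    have d: "decay (w - (fst z, - snd z)) = decay ((fst w, - snd w) - z)" for w z :: "(real^'d) \<times> (real^'d)"
    proof -
      have "norm (w - (fst z, - snd z)) = norm ((fst w, - snd w) - z)"
        using norm_minus_cancel[of "snd w + snd z"] by (simp add: norm_prod_def add.commute)
      then show ?thesis by (simp add: decay_def)
    qed
    have m: "(\<lambda>p. ?f (fst p) (snd p)) \<in> borel_measurable borel" by measurable
    have i: "integrable lborel (?f w)" for w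
      unfolding d using integrable_lborel_shift_iff(3)[of "decay" "(fst w, - snd w)"] decay_integrable
      by (intro integrable_mult_right) simp
    have I: "(LINT z|lborel. ?f w z) = norm (stft \<phi> T w) * ?q" for w
      unfolding d using integral_lborel_shift(3)[of decay "(fst w, - snd w)"] by simp
    have w: "(LINT z|lborel. norm (?f w z)) \<le> norm (stft \<phi> T w) * ?q" for w
    proof -
      have "norm (?f w z) = ?f w z" for z by (simp add: abs_mult less_imp_le[OF decay_pos])
      then show ?thesis by (simp only: I)
    qed
    have wi: "integrable lborel (\<lambda>w. norm (stft \<phi> T w) * ?q)" by (intro integrable_mult_left integrable_norm T)
    note fub = fubini_dominated[where f="?f", OF m i w wi]
    have le: "norm (T (tf_shift z \<phi>)) \<le> c * C * (LINT w|lborel. ?f w z)" for z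
    proof -
      have fi: "integrable lborel (\<lambda>w. ?f w z)" by (rule decay_convolution(3)[OF T(2)])
      have "norm (T (tf_shift z \<phi>)) \<le> (LINT w|lborel. c * C * ?f w z)"
        unfolding tempered_reproducing[OF T(1) shift_window]
      proof (rule norm_integral_le[OF integrable_mult_right[OF fi]])
        fix w
        have "norm (of_real c * amb (tf_shift z \<phi>) \<phi> w * stft \<phi> T w) = c * norm (amb (tf_shift z \<phi>) \<phi> w) * norm (stft \<phi> T w)"
          using c_pos by (simp add: norm_mult)
        also have "\<dots> \<le> c * (C * decay (w - (fst z, - snd z))) * norm (stft \<phi> T w)"
          using c_pos by (intro mult_right_mono mult_left_mono C) auto
        finally show "norm (of_real c * amb (tf_shift z \<phi>) \<phi> w * stft \<phi> T w) \<le> c * C * ?f w z" by (simp only: mult_ac)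
      qed
      then show ?thesis by simp
    qed
    have cont: "continuous_on UNIV (\<lambda>z. T (tf_shift z \<phi>))"
      by (rule tempered_family_continuous[OF T(1) schwartz_family_tf_shift[OF window]])
    have bi: "integrable lborel (\<lambda>z. c * C * (LINT w|lborel. ?f w z))" by (intro integrable_mult_right fub(4))
    have Ti: "integrable lborel (\<lambda>z. T (tf_shift z \<phi>))"
      by (rule integrable_norm_le[OF bi _ le]) (use borel_measurable_continuous_onI[OF cont] in simp)
    have "(LINT z|lborel. norm (T (tf_shift z \<phi>))) \<le> (LINT z|lborel. c * C * (LINT w|lborel. ?f w z))"
      by (intro integral_mono bi integrable_norm Ti le)
    also have "\<dots> = c * C * (LINT z|lborel. (LINT w|lborel. ?f w z))"
      by (rule Bochner_Integration.integral_mult_right_zero)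
    also have "(LINT z|lborel. (LINT w|lborel. ?f w z)) = (LINT w|lborel. norm (stft \<phi> T w) * ?q)"
      unfolding fub(2)[symmetric] by (simp only: I)
    also have "\<dots> = M1_norm \<phi> T * ?q" by (simp add: M1_norm_def)
    finally show ?thesis using Ti by (simp add: mult_ac)
  qed
  moreover have "0 \<le> c * C * ?q" using c_pos C(1) by (simp add: less_imp_le[OF decay_pos])
  ultimately show ?thesis by blast
qed

lemma M1_functions_cnj:
  assumes h: "h \<in> M1_functions \<phi>"
  shows "(\<lambda>t. cnj (h t)) \<in> M1_functions \<phi>"
  unfolding M1_functions_iff
proof
  have hi: "integrable lborel h" using h by (simp add: M1_functions_iff)
  then show "integrable lborel (\<lambda>t. cnj (h t))" by simp
  have "distribution_of h \<in> M1 \<phi>" using h by (simp add: M1_functions_def)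
  then have "integrable lborel (\<lambda>z. distribution_of h (tf_shift z \<phi>))" using M1_conj_stft by blast
  then have "integrable lborel (\<lambda>z. cnj (distribution_of h (tf_shift z \<phi>)))" by simp
  moreover have "cnj (distribution_of h (tf_shift z \<phi>)) = V (\<lambda>t. cnj (h t)) z" for z
    by (simp add: distribution_of_def shift_window L2_inner_def flip: Bochner_Integration.integral_cnj)
  ultimately show "integrable lborel (V (\<lambda>t. cnj (h t)))" by simp
qed

end

section \<open>Gabor kernels and the dual of \<open>M\<^sup>1\<close>\<close>

context stft_window
begin

text \<open>For \<open>h = \<phi>\<close> this is the reproducing kernel, for \<open>h = g\<close>
  the kernel taking \<open>V f\<close> to the coefficients of \<open>f\<close>; see
  \<open>L2_inner_eq_kernel_apply\<close>.\<close>

definition kern :: "(real^'d \<Rightarrow> complex) \<Rightarrow> (real^'d) \<times> (real^'d) \<Rightarrow> (real^'d) \<times> (real^'d) \<Rightarrow> complex" where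
  "kern h z w = of_real c * L2_inner (tf_shift w \<phi>) (tf_shift z h)"

lemma M1_functions_borel: "h \<in> M1_functions \<phi> \<Longrightarrow> h \<in> borel_measurable borel"
  using integrable_borelD by (auto simp: M1_functions_iff)

lemma synthesis_inner:
  assumes b: "integrable lborel b" and h: "h \<in> M1_functions \<phi>"
  shows "L2_inner (synthesis b) (tf_shift z h) = kernel_apply (kern h) b z"
proof -
  obtain B where B: "\<And>w t. norm (tf_shift w \<phi> t) \<le> B" using window_sup by blast
  let ?k = "\<lambda>t. cnj (tf_shift z h t)"
  have ki: "integrable lborel ?k" using M1_functions_tf_shift[OF h] by (simp add: M1_functions_iff)
  have "L2_inner (synthesis b) (tf_shift z h) = (LINT t|lborel. ?k t * synthesis b t)"
    by (simp add: L2_inner_def mult.commute)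
  also have "\<dots> = (LINT w|lborel. of_real c * b w * (LINT t|lborel. ?k t * tf_shift w \<phi> t))"
  proof (rule synthesis_pairing[OF b B integrable_borelD[OF ki]])
    show i: "integrable lborel (\<lambda>t. ?k t * tf_shift w \<phi> t)" for w
      by (rule amb_integrand_integrable[OF ki window])
    show "(LINT t|lborel. norm (?k t * tf_shift w \<phi> t)) \<le> (LINT t|lborel. norm (?k t) * B)" for w
      by (intro integral_mono integrable_norm i integrable_mult_left ki)
         (auto simp: norm_mult intro!: mult_left_mono B)
  qed
  also have "\<dots> = kernel_apply (kern h) b z"
    by (simp add: kernel_apply_def kern_def L2_inner_def mult_ac)
  finally show ?thesis .
qed

text \<open>\<open>f\<close> is only square integrable, so it is \<open>tf_shift z h\<close>, an
  element of M1, that is expanded by \<open>M1_representation\<close>; the inner product is then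
  exchanged with the synthesis integral.\<close>

lemma L2_inner_eq_kernel_apply:
  assumes f: "f \<in> L2" and h: "h \<in> M1_functions \<phi>"
  shows "L2_inner f (tf_shift z h) = kernel_apply (kern h) (V f) z"
proof -
  let ?k = "tf_shift z h"
  have k: "?k \<in> M1_functions \<phi>" by (rule M1_functions_tf_shift[OF h])
  then have Vk: "integrable lborel (V ?k)" by (simp add: M1_functions_iff)
  have [measurable]: "f \<in> borel_measurable borel" "?k \<in> borel_measurable borel"
    using f M1_functions_borel[OF k] by (auto simp: L2_def)
  obtain B where B: "\<And>w t. norm (tf_shift w \<phi> t) \<le> B" using window_sup by blast
  have [measurable]: "synthesis (V ?k) \<in> borel_measurable borel"
    by (rule integrable_borelD[OF synthesis_integrable[OF Vk B]])
  have "AE t in lborel. ?k t = synthesis (V ?k) t"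
    by (rule M1_representation) (use k M1_functions_borel[OF k] in \<open>auto simp: M1_functions_def\<close>)
  then have "AE t in lborel. f t * cnj (?k t) = f t * cnj (synthesis (V ?k) t)" by eventually_elim simp
  then have "L2_inner f ?k = L2_inner f (synthesis (V ?k))"
    unfolding L2_inner_def[of f] by (intro integral_cong_AE) measurable
  also have "\<dots> = cnj (LINT t|lborel. cnj (f t) * synthesis (V ?k) t)"
    unfolding L2_inner_def[of f] by (simp flip: Bochner_Integration.integral_cnj)
  also have "(LINT t|lborel. cnj (f t) * synthesis (V ?k) t)
    = (LINT w|lborel. of_real c * V ?k w * (LINT t|lborel. cnj (f t) * tf_shift w \<phi> t))"
  proof (rule synthesis_pairing[OF Vk B])
    have f': "(\<lambda>t. cnj (f t)) \<in> L2" using f by (simp add: L2_def)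
    have p: "integrable lborel (\<lambda>t. (norm (tf_shift w \<phi> t))\<^sup>2)" for w by (rule schwartz_L2[OF shift_window])
    show i: "integrable lborel (\<lambda>t. cnj (f t) * tf_shift w \<phi> t)" for w
      by (rule L2_schwartz_mult_integrable[OF f' p schwartz_measurable[OF shift_window]])
    show "(LINT t|lborel. norm (cnj (f t) * tf_shift w \<phi> t)) \<le> (LINT t|lborel. (norm (f t))\<^sup>2) + (LINT t|lborel. (norm (\<phi> t))\<^sup>2)" for w
    proof -
      have f2: "integrable lborel (\<lambda>t. (norm (f t))\<^sup>2)" using f by (simp add: L2_def)
      have le: "norm (cnj (f t) * tf_shift w \<phi> t) \<le> (norm (f t))\<^sup>2 + (norm (tf_shift w \<phi> t))\<^sup>2" for t
      proof -
        have "0 \<le> (norm (f t) - norm (tf_shift w \<phi> t))\<^sup>2" by simp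
        then have "2 * (norm (f t) * norm (tf_shift w \<phi> t)) \<le> (norm (f t))\<^sup>2 + (norm (tf_shift w \<phi> t))\<^sup>2"
          by (simp add: power2_diff)
        moreover have "0 \<le> norm (f t) * norm (tf_shift w \<phi> t)" by simp
        ultimately show ?thesis unfolding norm_mult complex_mod_cnj by linarith
      qed
      have "(LINT t|lborel. norm (cnj (f t) * tf_shift w \<phi> t)) \<le> (LINT t|lborel. (norm (f t))\<^sup>2 + (norm (tf_shift w \<phi> t))\<^sup>2)"
        by (intro integral_mono integrable_norm i Bochner_Integration.integrable_add f2 p le)
      also have "\<dots> = (LINT t|lborel. (norm (f t))\<^sup>2) + (LINT t|lborel. (norm (\<phi> t))\<^sup>2)"
        by (simp only: Bochner_Integration.integral_add[OF f2 p] tf_shift_norm_integral)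
      finally show ?thesis .
    qed
  qed measurable
  also have "cnj \<dots> = (LINT w|lborel. cnj (of_real c * V ?k w * (LINT t|lborel. cnj (f t) * tf_shift w \<phi> t)))"
    by (simp only: Bochner_Integration.integral_cnj)
  also have "\<dots> = kernel_apply (kern h) (V f) z"
    unfolding kernel_apply_def kern_def
  proof (rule Bochner_Integration.integral_cong[OF refl])
    fix w
    have "cnj (LINT t|lborel. cnj (f t) * tf_shift w \<phi> t) = V f w"
      unfolding L2_inner_def Bochner_Integration.integral_cnj[symmetric] by simp
    then show "cnj (of_real c * V ?k w * (LINT t|lborel. cnj (f t) * tf_shift w \<phi> t)) = of_real c * L2_inner (tf_shift w \<phi>) ?k * V f w"
      by (simp add: L2_inner_cnj[of "tf_shift w \<phi>" ?k])
  qed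
  finally show ?thesis .
qed

text \<open>This is \<open>L2_inner_eq_kernel_apply\<close> with a shifted window in the place of
  \<open>f\<close>.\<close>

lemma kern_reproducing:
  assumes h: "h \<in> M1_functions \<phi>"
  shows "(LINT u|lborel. kern h z u * kern \<phi> u w) = kern h z w"
proof -
  have "kern h z w = of_real c * (LINT u|lborel. kern h z u * V (tf_shift w \<phi>) u)"
    unfolding kern_def[of h z w] L2_inner_eq_kernel_apply[OF window_L2 h] by (simp add: kernel_apply_def)
  also have "\<dots> = (LINT u|lborel. kern h z u * kern \<phi> u w)"
    unfolding kern_def[of \<phi>] by (simp add: mult.left_commute)
  finally show ?thesis by simp
qed

lemma kern_continuous:
  assumes h: "h \<in> M1_functions \<phi>"
  shows "continuous_on UNIV (\<lambda>p. kern h (fst p) (snd p))"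
proof -
  have a: "continuous_on UNIV (amb (\<lambda>t. cnj (h t)) \<phi>)"
    by (rule amb_continuous[OF _ window]) (use h in \<open>simp add: M1_functions_iff\<close>)
  have "kern h z w = of_real c * (cis (2 * pi * ((snd w - snd z) \<bullet> fst z)) * amb (\<lambda>t. cnj (h t)) \<phi> (w - z))" for z w
    unfolding kern_def L2_inner_shifts by (simp add: L2_inner_tf_shift_eq_amb)
  then show ?thesis
    by (simp only:) (intro continuous_intros continuous_on_compose2[OF a]; simp)
qed

lemma norm_kern: "norm (kern h z w) = c * norm (V h (w - z))"
  unfolding kern_def L2_inner_shifts using c_pos by (simp add: norm_mult)

text \<open>Integrability of \<open>V h\<close> does not by itself control local maxima. The
  reproducing formula bounds \<open>V h\<close> pointwise by its convolution with
  \<open>decay\<close>, and this bound survives displacements of length 1 up to a constant. The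
  convolution is integrable and bounded because \<open>V h\<close> is integrable.\<close>

lemma kern_envelope:
  assumes h: "h \<in> M1_functions \<phi>"
  shows "\<exists>\<Theta> B. integrable lborel \<Theta> \<and> (\<forall>v. \<Theta> v \<le> B) \<and>
    (\<forall>v z w. dist v (z - w) \<le> 1 \<longrightarrow> norm (kern h z w) \<le> \<Theta> v)"
proof -
  obtain C where C: "0 \<le> C" "\<And>w z. norm (L2_inner (tf_shift w \<phi>) (tf_shift z \<phi>)) \<le> C * decay (w - z)"
    using window_ambiguity_bounds by blast
  have Vh: "integrable lborel (V h)" using h by (simp add: M1_functions_iff)
  let ?K = "c * (c * C * 2 ^ (DIM((real^'d) \<times> (real^'d)) + 2))"
  have K: "0 \<le> ?K" using C(1) c_pos by simp
  \<comment> \<open>The kernel involves \<open>w - z\<close>, whereas the envelope is a function of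
    \<open>z - w\<close>; hence the reflection \<open>0 - v\<close>.\<close>
  define \<Theta> where "\<Theta> v = ?K * (LINT u|lborel. norm (V h u) * decay (u - (0 - v)))" for v
  have "integrable lborel \<Theta>"
    unfolding \<Theta>_def
    using integrable_lborel_shift_iff(3)[of "\<lambda>v. LINT u|lborel. norm (V h u) * decay (u - v)" 0] decay_convolution(1)[OF Vh]
    by (intro integrable_mult_right) blast
  moreover have "\<Theta> v \<le> ?K * (LINT u|lborel. norm (V h u))" for v
    unfolding \<Theta>_def by (intro mult_left_mono K decay_convolution(4)[OF Vh])
  moreover have "norm (kern h z w) \<le> \<Theta> v" if v: "dist v (z - w) \<le> 1" for v z w
  proof -
    let ?y = "w - z"
    have "V h ?y = cnj (L2_inner (tf_shift ?y \<phi>) (tf_shift 0 h))"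
      unfolding tf_shift_0 by (rule L2_inner_cnj)
    also have "L2_inner (tf_shift ?y \<phi>) (tf_shift 0 h) = (LINT u|lborel. kern h 0 u * V (tf_shift ?y \<phi>) u)"
      unfolding L2_inner_eq_kernel_apply[OF window_L2 h] by (simp add: kernel_apply_def)
    finally have "norm (V h ?y) = norm (LINT u|lborel. kern h 0 u * V (tf_shift ?y \<phi>) u)" by simp
    also have "\<dots> \<le> (LINT u|lborel. (c * C * 2 ^ (DIM((real^'d) \<times> (real^'d)) + 2)) * (norm (V h u) * decay (u - (0 - v))))"
    proof (rule norm_integral_le[OF integrable_mult_right[OF decay_convolution(3)[OF Vh]]])
      fix u
      have "?y - u - (0 - v - u) = v - (z - w)" by simp
      then have "dist (?y - u) (0 - v - u) \<le> 1" using v by (simp only: dist_norm)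
      then have d: "decay (?y - u) \<le> 2 ^ (DIM((real^'d) \<times> (real^'d)) + 2) * decay (u - (0 - v))"
        using decay_near[of "?y - u" "0 - v - u"] decay_minus_commute[of u "0 - v"] by simp
      have "norm (kern h 0 u * V (tf_shift ?y \<phi>) u) = (c * norm (V h u)) * norm (V (tf_shift ?y \<phi>) u)"
        by (simp add: norm_mult norm_kern)
      also have "\<dots> \<le> (c * norm (V h u)) * (C * (2 ^ (DIM((real^'d) \<times> (real^'d)) + 2) * decay (u - (0 - v))))"
        using c_pos C(1) by (intro mult_left_mono order_trans[OF C(2)] d) auto
      finally show "norm (kern h 0 u * V (tf_shift ?y \<phi>) u) \<le> (c * C * 2 ^ (DIM((real^'d) \<times> (real^'d)) + 2)) * (norm (V h u) * decay (u - (0 - v)))"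
        by (simp only: mult_ac)
    qed
    also have "\<dots> = (c * C * 2 ^ (DIM((real^'d) \<times> (real^'d)) + 2)) * (LINT u|lborel. norm (V h u) * decay (u - (0 - v)))"
      by (rule Bochner_Integration.integral_mult_right_zero)
    finally have le: "norm (V h ?y) \<le> \<dots>" .
    have "c * norm (V h ?y) \<le> \<Theta> v"
      unfolding \<Theta>_def mult.assoc[of c] using mult_left_mono[OF le, of c] c_pos by simp
    then show ?thesis by (simp only: norm_kern)
  qed
  ultimately show ?thesis by blast
qed

text \<open>Such factors arise because time-frequency shifts compose only up to a unimodular
  constant.\<close>

definition phase :: "(real^'d) \<times> (real^'d) \<Rightarrow> (real^'d) \<times> (real^'d) \<Rightarrow> complex" where
  "phase a z = cis (- (2 * pi * (snd z \<bullet> fst a)))"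

lemma kern_covariant: "kern h (z + a) (w + a) = phase a z * cnj (phase a w) * kern h z w"
proof -
  have "2 * pi * ((snd (w + a) - snd (z + a)) \<bullet> fst (z + a))
    = - (2 * pi * (snd z \<bullet> fst a)) + 2 * pi * (snd w \<bullet> fst a) + 2 * pi * ((snd w - snd z) \<bullet> fst z)"
    by (simp add: inner_diff_left inner_add_right algebra_simps)
  then have "cis (2 * pi * ((snd (w + a) - snd (z + a)) \<bullet> fst (z + a)))
    = phase a z * cnj (phase a w) * cis (2 * pi * ((snd w - snd z) \<bullet> fst z))"
    unfolding phase_def cis_cnj by (simp only: cis_mult minus_minus)
  then show ?thesis
    unfolding kern_def L2_inner_shifts by (simp add: mult_ac)
qed

lemma kern_pair:
  assumes g: "g \<in> M1_functions \<phi>"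
  shows "\<exists>\<Theta> B. localized_kernel_pair (kern \<phi>) (kern g) \<Theta> B phase"
proof -
  obtain \<Theta>1 B1 where 1: "integrable lborel \<Theta>1" "\<And>v. \<Theta>1 v \<le> B1"
    "\<And>v z w. dist v (z - w) \<le> 1 \<Longrightarrow> norm (kern \<phi> z w) \<le> \<Theta>1 v"
    using kern_envelope[OF window_M1] by blast
  obtain \<Theta>2 B2 where 2: "integrable lborel \<Theta>2" "\<And>v. \<Theta>2 v \<le> B2"
    "\<And>v z w. dist v (z - w) \<le> 1 \<Longrightarrow> norm (kern g z w) \<le> \<Theta>2 v"
    using kern_envelope[OF g] by blast
  have n1: "0 \<le> \<Theta>1 v" and n2: "0 \<le> \<Theta>2 v" for v
    using order_trans[OF norm_ge_zero 1(3)[of v v 0]] order_trans[OF norm_ge_zero 2(3)[of v v 0]] by simp_all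
  have pm: "phase a \<in> borel_measurable borel" for a
    unfolding phase_def by (intro borel_measurable_continuous_onI continuous_intros)
  have "localized_kernel_pair (kern \<phi>) (kern g) (\<lambda>v. \<Theta>1 v + \<Theta>2 v) (B1 + B2) phase"
  proof (unfold_locales; (intro kern_continuous window_M1 g Bochner_Integration.integrable_add 1 2 add_mono
        pm kern_covariant kern_reproducing)?)
    show "norm (kern \<phi> z w) \<le> \<Theta>1 v + \<Theta>2 v" "norm (kern g z w) \<le> \<Theta>1 v + \<Theta>2 v" if "dist v (z - w) \<le> 1" for v z w
      using 1(3)[OF that] 2(3)[OF that] n1[of v] n2[of v] by linarith+
  qed (simp add: phase_def)
  then show ?thesis by blast
qed

lemma synthesis_L2:
  assumes b: "integrable lborel b"
  shows "synthesis b \<in> L2"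
proof -
  obtain B where B: "\<And>w t. norm (tf_shift w \<phi> t) \<le> B" using window_sup by blast
  note si = synthesis_integrable[OF b B]
  have [measurable]: "synthesis b \<in> borel_measurable borel" by (rule integrable_borelD[OF si])
  let ?K = "c * (LINT w|lborel. norm (b w)) * B"
  have "integrable lborel (\<lambda>t. (norm (synthesis b t))\<^sup>2)"
  proof (rule integrable_norm_le[OF integrable_mult_left[OF integrable_norm[OF si], of ?K]])
    show "norm ((norm (synthesis b t))\<^sup>2) \<le> norm (synthesis b t) * ?K" for t
      using mult_left_mono[OF synthesis_bounded[OF b B], of "norm (synthesis b t)" t] by (simp add: power2_eq_square)
  qed measurable
  then show ?thesis by (simp add: L2_def)
qed

section \<open>The dual of M1 and its representation by bounded functions\<close>

lemma M1_lincomb: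
  assumes T: "T \<in> M1 \<phi>" and U: "U \<in> M1 \<phi>"
  shows "(\<lambda>\<psi>. a * T \<psi> + b * U \<psi>) \<in> M1 \<phi>"
proof -
  have t: "T \<in> tempered_distributions" "U \<in> tempered_distributions" using T U by (auto simp: M1_def)
  have "(\<lambda>n. a * T (\<psi> n) + b * U (\<psi> n)) \<longlonglongrightarrow> a * 0 + b * 0" if "schwartz_null_sequence \<psi>" for \<psi>
    by (intro tendsto_intros tempered_distributionD(4) t that)
  then have "(\<lambda>\<psi>. a * T \<psi> + b * U \<psi>) \<in> tempered_distributions"
    using t unfolding tempered_distributions_def by (auto simp: algebra_simps)
  moreover have "integrable lborel (stft \<phi> (\<lambda>\<psi>. a * T \<psi> + b * U \<psi>))"
    using T U unfolding stft_def[abs_def] distribution_pairing_def M1_def by simp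
  ultimately show ?thesis by (simp add: M1_def)
qed

lemma M1_dualD:
  assumes "F \<in> M1_dual \<phi>"
  shows "T \<notin> M1 \<phi> \<Longrightarrow> F T = 0"
    and "T \<in> M1 \<phi> \<Longrightarrow> U \<in> M1 \<phi> \<Longrightarrow> F (\<lambda>\<psi>. T \<psi> + U \<psi>) = F T + F U"
    and "T \<in> M1 \<phi> \<Longrightarrow> F (\<lambda>\<psi>. a * T \<psi>) = a * F T"
    and "\<exists>K. \<forall>T\<in>M1 \<phi>. norm (F T) \<le> K * M1_norm \<phi> T"
  using assms by (simp_all add: M1_dual_def)

lemma M1_dual_lincomb:
  assumes F: "F \<in> M1_dual \<phi>" and T: "T \<in> M1 \<phi>" "U \<in> M1 \<phi>"
  shows "F (\<lambda>\<psi>. a * T \<psi> + b * U \<psi>) = a * F T + b * F U"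
proof -
  have "(\<lambda>\<psi>. a * T \<psi>) \<in> M1 \<phi>" "(\<lambda>\<psi>. b * U \<psi>) \<in> M1 \<phi>"
    using M1_lincomb[OF T(1,1), of a 0] M1_lincomb[OF T(2,2), of b 0] by auto
  then have "F (\<lambda>\<psi>. a * T \<psi> + b * U \<psi>) = F (\<lambda>\<psi>. a * T \<psi>) + F (\<lambda>\<psi>. b * U \<psi>)"
    by (rule M1_dualD(2)[OF F])
  then show ?thesis by (simp add: M1_dualD(3)[OF F] T)
qed

lemma M1_sum:
  assumes "finite Y" "Y \<noteq> {}" "\<And>y. y \<in> Y \<Longrightarrow> e y \<in> M1 \<phi>"
  shows "(\<lambda>\<psi>. \<Sum>y\<in>Y. \<beta> y * e y \<psi>) \<in> M1 \<phi> \<and>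
    (F \<in> M1_dual \<phi> \<longrightarrow> F (\<lambda>\<psi>. \<Sum>y\<in>Y. \<beta> y * e y \<psi>) = (\<Sum>y\<in>Y. \<beta> y * F (e y)))"
  using assms
proof (induction Y rule: finite_ne_induct)
  case (singleton y)
  then show ?case using M1_lincomb[of "e y" "e y" "\<beta> y" 0] M1_dual_lincomb[of F "e y" "e y" "\<beta> y" 0] by simp
next
  case (insert y Y)
  let ?S = "\<lambda>\<psi>. \<Sum>y\<in>Y. \<beta> y * e y \<psi>"
  have y: "e y \<in> M1 \<phi>" and S: "?S \<in> M1 \<phi>" "F \<in> M1_dual \<phi> \<longrightarrow> F ?S = (\<Sum>y\<in>Y. \<beta> y * F (e y))"
    using insert.IH insert.prems by auto
  have e: "(\<lambda>\<psi>. \<Sum>y\<in>insert y Y. \<beta> y * e y \<psi>) = (\<lambda>\<psi>. \<beta> y * e y \<psi> + 1 * ?S \<psi>)"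
    using insert.hyps by simp
  show ?case
    unfolding e using M1_lincomb[OF y S(1), of "\<beta> y" 1] M1_dual_lincomb[OF _ y S(1), of F "\<beta> y" 1] S(2) insert.hyps
    by simp
qed

text \<open>The conjugate makes the value of a functional at \<open>atom z h\<close> its antilinear
  pairing with \<open>tf_shift z h\<close>.\<close>

definition atom :: "(real^'d) \<times> (real^'d) \<Rightarrow> (real^'d \<Rightarrow> complex) \<Rightarrow> 'd distribution" where
  "atom z h = distribution_of (\<lambda>t. cnj (tf_shift z h t))"

lemma dual_pairing_atom: "dual_pairing F (tf_shift z h) = F (atom z h)"
  by (simp add: dual_pairing_def atom_def)

lemma atom_M1: "h \<in> M1_functions \<phi> \<Longrightarrow> atom z h \<in> M1 \<phi>"
  using M1_functions_cnj[OF M1_functions_tf_shift] by (simp add: atom_def M1_functions_def)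

lemma atom_apply: "\<psi> \<in> schwartz \<Longrightarrow> atom z h \<psi> = L2_inner \<psi> (tf_shift z h)"
  by (simp add: atom_def distribution_of_def L2_inner_def mult.commute)

lemma kern_eq_atom: "kern h z w = of_real c * atom z h (tf_shift w \<phi>)"
  by (simp add: kern_def atom_apply shift_window)

text \<open>The result of applying a functional to the expansion of \<open>T\<close> in atoms, with
  \<open>U w\<close> in place of its value at \<open>atom w \<phi>\<close>; the default 0 off M1 is
  the convention of \<open>M1_dual\<close>.\<close>

definition functional_of :: "((real^'d) \<times> (real^'d) \<Rightarrow> complex) \<Rightarrow> 'd distribution \<Rightarrow> complex" where
  "functional_of U T = (if T \<in> M1 \<phi> then LINT w|lborel. of_real c * T (tf_shift w \<phi>) * U w else 0)"

lemma functional_of_atom: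
  "h \<in> M1_functions \<phi> \<Longrightarrow> functional_of U (atom z h) = kernel_apply (kern h) U z"
  by (simp add: functional_of_def atom_M1 kernel_apply_def kern_eq_atom)

text \<open>The integral involves \<open>T (tf_shift w \<phi>)\<close>, not the short-time Fourier
  transform of \<open>T\<close>; \<open>M1_conj_stft\<close> provides the bound by the norm of
  M1.\<close>

lemma functional_of_M1_dual:
  assumes [measurable]: "U \<in> borel_measurable borel" and "bounded (range U)"
  shows "functional_of U \<in> M1_dual \<phi>"
proof -
  obtain M where M: "\<And>w. norm (U w) \<le> M" using assms(2) by (auto simp: bounded_iff)
  have M0: "0 \<le> M" by (rule order_trans[OF norm_ge_zero M])
  obtain C where C: "\<And>T. T \<in> M1 \<phi> \<Longrightarrow> integrable lborel (\<lambda>z. T (tf_shift z \<phi>))"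
    "\<And>T. T \<in> M1 \<phi> \<Longrightarrow> (LINT z|lborel. norm (T (tf_shift z \<phi>))) \<le> C * M1_norm \<phi> T"
    using M1_conj_stft by blast
  have wi: "integrable lborel (\<lambda>w. c * norm (T (tf_shift w \<phi>)) * M)" if "T \<in> M1 \<phi>" for T
    by (intro integrable_mult_left integrable_mult_right integrable_norm C that)
  have le: "norm (of_real c * T (tf_shift w \<phi>) * U w) \<le> c * norm (T (tf_shift w \<phi>)) * M" for T w
    using c_pos by (auto simp: norm_mult intro!: mult_left_mono M)
  have i: "integrable lborel (\<lambda>w. of_real c * T (tf_shift w \<phi>) * U w)" if "T \<in> M1 \<phi>" for T
  proof (rule integrable_norm_le[OF wi[OF that]])
    show "norm (of_real c * T (tf_shift w \<phi>) * U w) \<le> c * norm (T (tf_shift w \<phi>)) * M" for w by (rule le)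
    have [measurable]: "(\<lambda>w. T (tf_shift w \<phi>)) \<in> borel_measurable borel" by (rule integrable_borelD[OF C(1)[OF that]])
    show "(\<lambda>w. of_real c * T (tf_shift w \<phi>) * U w) \<in> borel_measurable lborel" by measurable
  qed
  have lin: "functional_of U (\<lambda>\<psi>. a * T \<psi> + b * T' \<psi>) = a * functional_of U T + b * functional_of U T'"
    if T: "T \<in> M1 \<phi>" "T' \<in> M1 \<phi>" for a b T T'
  proof -
    have "functional_of U (\<lambda>\<psi>. a * T \<psi> + b * T' \<psi>)
      = (LINT w|lborel. a * (of_real c * T (tf_shift w \<phi>) * U w) + b * (of_real c * T' (tf_shift w \<phi>) * U w))"
      using M1_lincomb[OF T] by (simp add: functional_of_def algebra_simps)
    also have "\<dots> = a * functional_of U T + b * functional_of U T'"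
      using i T by (simp add: functional_of_def)
    finally show ?thesis .
  qed
  have "norm (functional_of U T) \<le> (c * M * C) * M1_norm \<phi> T" if T: "T \<in> M1 \<phi>" for T
  proof -
    have "norm (functional_of U T) \<le> (LINT w|lborel. c * norm (T (tf_shift w \<phi>)) * M)"
    proof -
      have "norm (LINT w|lborel. of_real c * T (tf_shift w \<phi>) * U w) \<le> (LINT w|lborel. c * norm (T (tf_shift w \<phi>)) * M)"
        by (rule norm_integral_le[OF wi[OF T]]) (rule le)
      then show ?thesis using T by (simp add: functional_of_def)
    qed
    also have "\<dots> = c * M * (LINT w|lborel. norm (T (tf_shift w \<phi>)))" by simp
    also have "\<dots> \<le> c * M * (C * M1_norm \<phi> T)" using c_pos M0 by (intro mult_left_mono C(2) T) auto
    finally show ?thesis by (simp only: mult.assoc)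
  qed
  moreover have "functional_of U (\<lambda>\<psi>. T \<psi> + T' \<psi>) = functional_of U T + functional_of U T'" if "T \<in> M1 \<phi>" "T' \<in> M1 \<phi>" for T T'
    using lin[OF that, of 1 1] by simp
  moreover have "functional_of U (\<lambda>\<psi>. a * T \<psi>) = a * functional_of U T" if "T \<in> M1 \<phi>" for T a
    using lin[OF that that, of a 0] by simp
  moreover have "functional_of U T = 0" if "T \<notin> M1 \<phi>" for T using that by (simp add: functional_of_def)
  ultimately show ?thesis unfolding M1_dual_def by blast
qed

text \<open>The short-time Fourier transform of \<open>atom w \<phi>\<close> at \<open>v\<close>. As
  atoms are conjugated shifted windows, it concentrates near the reflected point
  \<open>(fst w, - snd w)\<close>.\<close>

definition atom_stft :: "(real^'d) \<times> (real^'d) \<Rightarrow> (real^'d) \<times> (real^'d) \<Rightarrow> complex" where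
  "atom_stft w v = cnj (amb (tf_shift v \<phi>) \<phi> w)"

lemma atom_stft_commute: "amb (tf_shift v \<phi>) \<phi> w = amb (tf_shift w \<phi>) \<phi> v"
  by (simp add: amb_def mult.commute)

lemma stft_atom: "stft \<phi> (atom w \<phi>) v = atom_stft w v"
  unfolding atom_def stft_distribution_of L2_inner_tf_shift_eq_amb atom_stft_def
  by (simp add: atom_stft_commute)

lemma atom_window_apply: "L2_inner (\<lambda>t. cnj (tf_shift v \<phi> t)) (tf_shift w \<phi>) = atom_stft w v"
  by (simp add: L2_inner_tf_shift_eq_amb atom_stft_def)

lemma atom_stft_measurable:
  "(\<lambda>p. atom_stft (fst p) (snd p)) \<in> borel_measurable borel"
  "atom_stft w \<in> borel_measurable borel" "(\<lambda>w. atom_stft w v) \<in> borel_measurable borel"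
proof -
  have a: "continuous_on UNIV (amb \<phi> \<phi>)" by (rule amb_continuous[OF schwartz_integrable[OF window] window])
  have "atom_stft w v = cnj (cis (2 * pi * ((snd w + snd v) \<bullet> fst v)) * amb \<phi> \<phi> (fst w - fst v, snd w + snd v))" for w v
    unfolding atom_stft_def amb_def[of "tf_shift v \<phi>"] by (simp only: tf_shift_compose_integral(2))
  then have c: "continuous_on UNIV (\<lambda>p. atom_stft (fst p) (snd p))"
    by (simp only:) (intro continuous_intros continuous_on_compose2[OF a]; simp)
  show "(\<lambda>p. atom_stft (fst p) (snd p)) \<in> borel_measurable borel" by (rule borel_measurable_continuous_onI[OF c])
  have "continuous_on UNIV (\<lambda>v. atom_stft (fst (w, v)) (snd (w, v)))"
    "continuous_on UNIV (\<lambda>w. atom_stft (fst (w, v)) (snd (w, v)))" for w v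
    by (rule continuous_on_compose2[OF c]; simp add: continuous_on_Pair)+
  then have "continuous_on UNIV (atom_stft w)" "continuous_on UNIV (\<lambda>w. atom_stft w v)"
    unfolding fst_conv snd_conv by blast+
  then show "atom_stft w \<in> borel_measurable borel" "(\<lambda>w. atom_stft w v) \<in> borel_measurable borel"
    by (simp_all add: borel_measurable_continuous_onI)
qed

lemma atom_stft_bound:
  "\<exists>C\<ge>0. (\<forall>w v. norm (atom_stft w v) \<le> C * decay ((fst w, - snd w) - v)) \<and> (\<forall>w v. norm (atom_stft w v) \<le> C) \<and>
    (\<forall>w. integrable lborel (atom_stft w) \<and> (LINT v|lborel. norm (atom_stft w v)) \<le> C)"
proof -
  obtain C where C: "0 \<le> C" "\<And>w z. norm (amb (tf_shift z \<phi>) \<phi> w) \<le> C * decay (w - (fst z, - snd z))"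
    using window_ambiguity_bounds by blast
  let ?q = "LINT u|lborel. decay (u :: (real^'d) \<times> (real^'d))"
  have q: "0 \<le> ?q" by (simp add: less_imp_le[OF decay_pos])
  have le: "norm (atom_stft w v) \<le> C * decay ((fst w, - snd w) - v)" for w v
    unfolding atom_stft_def complex_mod_cnj atom_stft_commute[of v w]
    using C(2)[of w v] by (simp only: decay_minus_commute)
  have le1: "C * decay x \<le> C" for x :: "(real^'d) \<times> (real^'d)"
    using mult_left_mono[OF decay_le_1[of x] C(1)] by simp
  have di: "integrable lborel (\<lambda>v. C * decay ((fst w, - snd w) - v))" for w :: "(real^'d) \<times> (real^'d)"
    using integrable_lborel_shift_iff(3)[of decay "(fst w, - snd w)"] decay_integrable
    by (intro integrable_mult_right) simp
  have ai: "integrable lborel (atom_stft w)" for w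
    by (rule integrable_norm_le[OF di _ le]) (use atom_stft_measurable(2) in simp)
  have I: "(LINT v|lborel. norm (atom_stft w v)) \<le> C * ?q" for w
  proof -
    have "(LINT v|lborel. norm (atom_stft w v)) \<le> (LINT v|lborel. C * decay ((fst w, - snd w) - v))"
      by (intro integral_mono integrable_norm ai di le)
    also have "\<dots> = C * ?q" using integral_lborel_shift(3)[of decay "(fst w, - snd w)"] by simp
    finally show ?thesis .
  qed
  let ?C = "C * (1 + ?q)"
  have "C \<le> ?C" "C * ?q \<le> ?C" using C(1) q by (auto simp: distrib_left)
  moreover have "C * decay x \<le> ?C * decay x" for x :: "(real^'d) \<times> (real^'d)"
    using \<open>C \<le> ?C\<close> by (intro mult_right_mono less_imp_le[OF decay_pos])
  ultimately have "0 \<le> ?C" "\<And>w v. norm (atom_stft w v) \<le> ?C * decay ((fst w, - snd w) - v)"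
    "\<And>w v. norm (atom_stft w v) \<le> ?C" "\<And>w. (LINT v|lborel. norm (atom_stft w v)) \<le> ?C"
    using order_trans[OF C(1) \<open>C \<le> ?C\<close>] order_trans[OF le] order_trans[OF order_trans[OF le le1]] order_trans[OF I]
    by blast+
  then show ?thesis using ai by blast
qed

text \<open>Continuity of \<open>atom w \<phi>\<close> in \<open>w\<close> for the norm of M1. Once
  \<open>x n\<close> is within distance 1 of \<open>w\<close>, \<open>decay_near\<close> transfers
  its decay bound to \<open>w\<close>, which gives a fixed majorant.\<close>

lemma atom_stft_tendsto:
  assumes x: "x \<longlonglongrightarrow> w"
  shows "(\<lambda>n. LINT v|lborel. norm (atom_stft w v - atom_stft (x n) v)) \<longlonglongrightarrow> 0"
proof -
  obtain C where C: "0 \<le> C" "\<And>w v. norm (atom_stft w v) \<le> C * decay ((fst w, - snd w) - v)"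
    using atom_stft_bound by blast
  note [measurable] = atom_stft_measurable(2)
  obtain N where N: "\<And>n. n \<ge> N \<Longrightarrow> dist (x n) w < 1"
    using x unfolding lim_sequentially by (meson zero_less_one)
  let ?M = "2 ^ (DIM((real^'d) \<times> (real^'d)) + 2) :: real"
  let ?r = "\<lambda>w :: (real^'d) \<times> (real^'d). (fst w, - snd w)"
  have "(\<lambda>n. LINT v|lborel. norm (atom_stft w v - atom_stft (x (n + N)) v)) \<longlonglongrightarrow> (LINT v|(lborel :: ((real^'d) \<times> (real^'d)) measure). (0 :: real))"
  proof (rule tendsto_integral_dominated)
    show "integrable lborel (\<lambda>v. C * decay (?r w - v) + C * (?M * decay (?r w - v)))"
      using integrable_lborel_shift_iff(3)[of decay "?r w"] decay_integrable
      by (intro Bochner_Integration.integrable_add integrable_mult_right) simp_all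
    fix v
    have "continuous_on UNIV (amb (tf_shift v \<phi>) \<phi>)"
      by (rule amb_continuous[OF schwartz_integrable[OF shift_window] window])
    then have "isCont (amb (tf_shift v \<phi>) \<phi>) w"
      unfolding continuous_on_eq_continuous_at[OF open_UNIV] by blast
    from isCont_tendsto_compose[OF this x] have "(\<lambda>n. atom_stft (x n) v) \<longlonglongrightarrow> atom_stft w v"
      unfolding atom_stft_def by (rule tendsto_cnj)
    from tendsto_norm_zero[OF LIM_zero[OF LIMSEQ_ignore_initial_segment[OF this, of N]]]
    show "(\<lambda>n. norm (atom_stft w v - atom_stft (x (n + N)) v)) \<longlonglongrightarrow> 0"
      by (simp add: norm_minus_commute)
    fix n
    have "norm (?r (x (n + N)) - v - (?r w - v)) = norm (x (n + N) - w)"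
      using norm_minus_commute[of "snd w" "snd (x (n + N))"] by (simp add: norm_prod_def)
    then have "dist (?r (x (n + N)) - v) (?r w - v) \<le> 1"
      using N[of "n + N"] unfolding dist_norm by linarith
    then have "norm (atom_stft (x (n + N)) v) \<le> C * (?M * decay (?r w - v))"
      by (intro order_trans[OF C(2)] mult_left_mono decay_near C(1))
    then show "norm (norm (atom_stft w v - atom_stft (x (n + N)) v)) \<le> C * decay (?r w - v) + C * (?M * decay (?r w - v))"
      unfolding real_norm_def abs_norm_cancel
      by (intro order_trans[OF norm_triangle_ineq4] add_mono C(2))
  qed measurable
  then have "(\<lambda>n. LINT v|lborel. norm (atom_stft w v - atom_stft (x (n + N)) v)) \<longlonglongrightarrow> 0" by simp
  then show ?thesis by (rule LIMSEQ_offset)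
qed

lemma dual_atom_continuous:
  assumes F: "F \<in> M1_dual \<phi>"
  shows "continuous_on UNIV (\<lambda>w. F (atom w \<phi>))" "bounded (range (\<lambda>w. F (atom w \<phi>)))"
proof -
  obtain K where K: "\<And>T. T \<in> M1 \<phi> \<Longrightarrow> norm (F T) \<le> K * M1_norm \<phi> T" using M1_dualD(4)[OF F] by blast
  note A = atom_M1[OF window_M1]
  have diff: "norm (F (atom w \<phi>) - F (atom w' \<phi>)) \<le> K * (LINT v|lborel. norm (atom_stft w v - atom_stft w' v))" for w w'
  proof -
    have "norm (F (\<lambda>\<psi>. 1 * atom w \<phi> \<psi> + (-1) * atom w' \<phi> \<psi>)) \<le> K * M1_norm \<phi> (\<lambda>\<psi>. 1 * atom w \<phi> \<psi> + (-1) * atom w' \<phi> \<psi>)"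
      by (rule K[OF M1_lincomb[OF A A]])
    moreover have "stft \<phi> (\<lambda>\<psi>. 1 * atom w \<phi> \<psi> + (-1) * atom w' \<phi> \<psi>) v = atom_stft w v - atom_stft w' v" for v
      unfolding stft_atom[symmetric] by (simp add: stft_def distribution_pairing_def)
    ultimately show ?thesis unfolding M1_dual_lincomb[OF F A A] M1_norm_def by simp
  qed
  show "continuous_on UNIV (\<lambda>w. F (atom w \<phi>))"
    unfolding continuous_on_sequentially o_def
  proof (intro allI ballI impI, elim conjE)
    fix x :: "nat \<Rightarrow> (real^'d) \<times> (real^'d)" and w assume "x \<longlonglongrightarrow> w"
    from tendsto_mult_left[OF atom_stft_tendsto[OF this], of K]
    have "(\<lambda>n. K * (LINT v|lborel. norm (atom_stft w v - atom_stft (x n) v))) \<longlonglongrightarrow> 0" by simp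
    then have "(\<lambda>n. F (atom w \<phi>) - F (atom (x n) \<phi>)) \<longlonglongrightarrow> 0"
      by (rule Lim_null_comparison[rotated]) (simp add: diff)
    from tendsto_diff[OF tendsto_const[of "F (atom w \<phi>)"] this]
    show "(\<lambda>n. F (atom (x n) \<phi>)) \<longlonglongrightarrow> F (atom w \<phi>)" by simp
  qed
  obtain C where C: "0 \<le> C" "\<And>w. (LINT v|lborel. norm (atom_stft w v)) \<le> C" using atom_stft_bound by blast
  have "norm (F (atom w \<phi>)) \<le> \<bar>K\<bar> * C" for w
  proof -
    have "norm (F (atom w \<phi>)) \<le> K * M1_norm \<phi> (atom w \<phi>)" by (rule K[OF A])
    also have "\<dots> \<le> \<bar>K\<bar> * M1_norm \<phi> (atom w \<phi>)" by (intro mult_right_mono) (auto simp: M1_norm_def)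
    also have "\<dots> \<le> \<bar>K\<bar> * C" using C(2)[of w] by (intro mult_left_mono) (auto simp: M1_norm_def stft_atom)
    finally show ?thesis .
  qed
  then show "bounded (range (\<lambda>w. F (atom w \<phi>)))" unfolding bounded_iff by blast
qed

text \<open>
  Elements of \<open>M\<^sup>1\<close> are norm limits of finite combinations of atoms, obtained by discretizing the
  inversion formula; this avoids integrals of functions with values in \<open>M\<^sup>1\<close>.
\<close>

lemma dual_representation:
  assumes F: "F \<in> M1_dual \<phi>"
  shows "F = functional_of (\<lambda>w. F (atom w \<phi>))"
proof
  fix T
  let ?U = "\<lambda>w. F (atom w \<phi>)"
  note A = atom_M1[OF window_M1]
  show "F T = functional_of ?U T"
  proof (cases "T \<in> M1 \<phi>")
    case False
    then show ?thesis using F by (simp add: functional_of_def M1_dual_def)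
  next
    case T: True
    then have Tt: "T \<in> tempered_distributions" by (simp add: M1_def)
    define b where "b w = of_real c * T (tf_shift w \<phi>)" for w
    have bi: "integrable lborel b" unfolding b_def using M1_conj_stft T by (intro integrable_mult_right) blast
    have [measurable]: "b \<in> borel_measurable borel" by (rule integrable_borelD[OF bi])
    obtain s :: "nat \<Rightarrow> (real^'d) \<times> (real^'d) \<Rightarrow> (real^'d) \<times> (real^'d)"
      where s: "\<And>i. simple_function lborel (s i)" "\<And>w. (\<lambda>i. s i w) \<longlonglongrightarrow> w"
      using simple_approximation_id by blast
    have [measurable]: "s i \<in> borel_measurable borel" for i
      using borel_measurable_simple_function[OF s(1)[of i]] by simp
    obtain K where K: "\<And>T. T \<in> M1 \<phi> \<Longrightarrow> norm (F T) \<le> K * M1_norm \<phi> T" using M1_dualD(4)[OF F] by blast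
    obtain C where C: "0 \<le> C" "\<And>w v. norm (atom_stft w v) \<le> C" "\<And>w. integrable lborel (atom_stft w)"
        "\<And>w. (LINT v|lborel. norm (atom_stft w v)) \<le> C"
      using atom_stft_bound by blast
    note [measurable] = atom_stft_measurable
    define \<beta> where "\<beta> i y = (LINT w|lborel. indicator (s i -` {y}) w *\<^sub>R b w)" for i y
    \<comment> \<open>A sum of Riemann type for the expansion of \<open>T\<close> in atoms, sampled
      at the values of the simple function \<open>s i\<close>.\<close>
    define Ts where "Ts i = (\<lambda>\<psi>. \<Sum>y\<in>range (s i). \<beta> i y * atom y \<phi> \<psi>)" for i
    have fin: "finite (range (s i))" for i using simple_functionD(1)[OF s(1)[of i]] by simp
    have Ts: "Ts i \<in> M1 \<phi>" "F (Ts i) = (LINT w|lborel. b w * ?U (s i w))" for i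
      using M1_sum[of "range (s i)" "\<lambda>y. atom y \<phi>" "\<beta> i" F] fin[of i] F A
      unfolding Ts_def simple_function_integral_sum[OF s(1) bi, of ?U] \<beta>_def by auto
    have Ts_apply: "Ts i \<psi> = (LINT w|lborel. b w * atom (s i w) \<phi> \<psi>)" for i \<psi>
      unfolding Ts_def \<beta>_def by (rule simple_function_integral_sum[OF s(1) bi, symmetric])
    let ?f = "\<lambda>i w v. norm (b w) * norm (atom_stft w v - atom_stft (s i w) v)"
    have m: "(\<lambda>p. ?f i (fst p) (snd p)) \<in> borel_measurable borel" for i
    proof -
      have "(\<lambda>p :: ((real^'d) \<times> (real^'d)) \<times> ((real^'d) \<times> (real^'d)). (s i (fst p), snd p)) \<in> borel_measurable borel"
        by (rule borel_measurable_Pair[OF measurable_compose[OF fst_snd_borel_measurable(1)] fst_snd_borel_measurable(2)]) measurable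
      from measurable_compose[OF this atom_stft_measurable(1)]
      have [measurable]: "(\<lambda>p. atom_stft (s i (fst p)) (snd p)) \<in> borel_measurable borel" by simp
      then show ?thesis by measurable
    qed
    have i: "integrable lborel (?f i w)" for i w
      by (intro integrable_mult_right integrable_norm Bochner_Integration.integrable_diff C)
    have fw: "(LINT v|lborel. norm (?f i w v)) \<le> norm (b w) * (C + C)" for i w
    proof -
      have "(LINT v|lborel. norm (atom_stft w v - atom_stft (s i w) v)) \<le> (LINT v|lborel. norm (atom_stft w v) + norm (atom_stft (s i w) v))"
        by (intro integral_mono integrable_norm Bochner_Integration.integrable_diff Bochner_Integration.integrable_add C norm_triangle_ineq4)
      also have "\<dots> \<le> C + C"
        unfolding Bochner_Integration.integral_add[OF integrable_norm[OF C(3)] integrable_norm[OF C(3)]]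
        by (intro add_mono C(4))
      finally show ?thesis by (simp add: mult_left_mono)
    qed
    have fwi: "integrable lborel (\<lambda>w. norm (b w) * (C + C))" by (intro integrable_mult_left integrable_norm bi)
    note fub = fubini_dominated[where f="?f _", OF m i fw fwi]
    have Vs: "norm (stft \<phi> (\<lambda>\<psi>. 1 * T \<psi> + (-1) * Ts i \<psi>) v) \<le> (LINT w|lborel. ?f i w v)" for i v
    proof -
      have \<psi>: "(\<lambda>t. cnj (tf_shift v \<phi> t)) \<in> schwartz" by (intro schwartz_cnj shift_window)
      have b1: "integrable lborel (\<lambda>w. b w * atom_stft w v)"
        by (rule integrable_norm_le[OF integrable_mult_left[OF integrable_norm[OF bi], of C]])
           (measurable, simp add: norm_mult mult_left_mono C)
      have m2 [measurable]: "(\<lambda>w. atom_stft (s i w) v) \<in> borel_measurable borel"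
        by (rule measurable_compose[OF _ atom_stft_measurable(3)]) measurable
      have b2: "integrable lborel (\<lambda>w. b w * atom_stft (s i w) v)"
        by (rule integrable_norm_le[OF integrable_mult_left[OF integrable_norm[OF bi], of C]])
           (measurable, simp add: norm_mult mult_left_mono C)
      have fi: "integrable lborel (\<lambda>w. ?f i w v)"
        using integrable_norm[OF Bochner_Integration.integrable_diff[OF b1 b2]]
        by (simp add: norm_mult flip: right_diff_distrib)
      have "T (\<lambda>t. cnj (tf_shift v \<phi> t)) = (LINT w|lborel. b w * atom_stft w v)"
        unfolding tempered_reproducing'[OF Tt \<psi>] atom_window_apply b_def by (simp add: mult_ac)
      moreover have "Ts i (\<lambda>t. cnj (tf_shift v \<phi> t)) = (LINT w|lborel. b w * atom_stft (s i w) v)"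
        unfolding Ts_apply atom_apply[OF \<psi>] atom_window_apply ..
      ultimately have "stft \<phi> (\<lambda>\<psi>. 1 * T \<psi> + (-1) * Ts i \<psi>) v = (LINT w|lborel. b w * atom_stft w v - b w * atom_stft (s i w) v)"
        using b1 b2 by (simp add: stft_def distribution_pairing_def)
      also have "norm \<dots> \<le> (LINT w|lborel. ?f i w v)"
        by (rule norm_integral_le[OF fi]) (simp add: norm_mult flip: right_diff_distrib)
      finally show ?thesis .
    qed
    \<comment> \<open>The transform of the error is bounded pointwise by an integral over
      \<open>w\<close>. Exchanging the integrals leaves, for each \<open>w\<close>, the M1 distance
      of two nearby atoms, which tends to 0.\<close>
    have M1_le: "M1_norm \<phi> (\<lambda>\<psi>. 1 * T \<psi> + (-1) * Ts i \<psi>) \<le> (LINT w|lborel. LINT v|lborel. ?f i w v)" for i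
      unfolding M1_norm_def fub(2)
      by (rule integral_mono[OF integrable_norm fub(4) Vs]) (use M1_lincomb[OF T Ts(1)] in \<open>unfold M1_def, blast\<close>)
    have "(\<lambda>i. LINT w|lborel. LINT v|lborel. ?f i w v) \<longlonglongrightarrow> (LINT w|(lborel :: ((real^'d) \<times> (real^'d)) measure). (0 :: real))"
    proof (rule tendsto_integral_dominated[OF fwi])
      show "(\<lambda>w. LINT v|lborel. ?f i w v) \<in> borel_measurable lborel" for i
        using fub(3)[of i] by (rule borel_measurable_integrable)
      show "(\<lambda>i. LINT v|lborel. ?f i w v) \<longlonglongrightarrow> 0" for w
        using tendsto_mult_left[OF atom_stft_tendsto[OF s(2)[of w]], of "norm (b w)"] by simp
      show "norm (LINT v|lborel. ?f i w v) \<le> norm (b w) * (C + C)" for i w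
        using fw[of w i] by (rule order_trans[OF integral_norm_bound])
    qed simp
    then have K0: "(\<lambda>i. \<bar>K\<bar> * (LINT w|lborel. LINT v|lborel. ?f i w v)) \<longlonglongrightarrow> 0"
      using tendsto_mult_left[of _ 0 _ "\<bar>K\<bar>"] by simp
    have diff: "norm (F T - F (Ts i)) \<le> \<bar>K\<bar> * (LINT w|lborel. LINT v|lborel. ?f i w v)" for i
    proof -
      let ?D = "\<lambda>\<psi>. 1 * T \<psi> + (-1) * Ts i \<psi>"
      have "norm (F T - F (Ts i)) = norm (F ?D)" unfolding M1_dual_lincomb[OF F T Ts(1)] by simp
      also have "\<dots> \<le> K * M1_norm \<phi> ?D" by (rule K[OF M1_lincomb[OF T Ts(1)]])
      also have "\<dots> \<le> \<bar>K\<bar> * M1_norm \<phi> ?D" by (intro mult_right_mono) (auto simp: M1_norm_def)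
      also have "\<dots> \<le> \<bar>K\<bar> * (LINT w|lborel. LINT v|lborel. ?f i w v)" by (intro mult_left_mono M1_le) simp
      finally show ?thesis .
    qed
    have "(\<lambda>i. F T - F (Ts i)) \<longlonglongrightarrow> 0"
      by (rule Lim_null_comparison[OF always_eventually[OF allI[OF diff]] K0])
    from tendsto_diff[OF tendsto_const[of "F T"] this] have lim: "(\<lambda>i. F (Ts i)) \<longlonglongrightarrow> F T" by simp
    obtain M where M: "\<And>w. norm (?U w) \<le> M" using dual_atom_continuous(2)[OF F] by (auto simp: bounded_iff)
    have [measurable]: "?U \<in> borel_measurable borel"
      by (rule borel_measurable_continuous_onI[OF dual_atom_continuous(1)[OF F]])
    have "(\<lambda>i. F (Ts i)) \<longlonglongrightarrow> (LINT w|lborel. b w * ?U w)"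
      unfolding Ts(2)
    proof (rule tendsto_integral_dominated[OF integrable_mult_left[OF integrable_norm[OF bi], of M]])
      show "(\<lambda>w. b w * ?U (s i w)) \<in> borel_measurable lborel" for i
      proof -
        have "(\<lambda>w. ?U (s i w)) \<in> borel_measurable borel"
          by (rule measurable_compose[of "s i" borel borel ?U borel]) measurable
        then show ?thesis by measurable
      qed
      show "(\<lambda>i. b w * ?U (s i w)) \<longlonglongrightarrow> b w * ?U w" for w
      proof -
        have "isCont ?U w"
          using dual_atom_continuous(1)[OF F] unfolding continuous_on_eq_continuous_at[OF open_UNIV] by blast
        from tendsto_mult[OF tendsto_const isCont_tendsto_compose[OF this s(2)[of w]]] show ?thesis .
      qed
      show "norm (b w * ?U (s i w)) \<le> norm (b w) * M" for i w
        by (simp add: norm_mult mult_left_mono M)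
    qed measurable
    from LIMSEQ_unique[OF lim this] show ?thesis
      using T by (simp add: functional_of_def b_def)
  qed
qed

section \<open>Frames and injectivity on weak limits\<close>

lemma frame_iff_injective:
  assumes g: "g \<in> M1_functions \<phi>" and \<Lambda>: "relatively_separated \<Lambda>"
  shows "gabor_frame g \<Lambda> \<longleftrightarrow>
    (\<forall>\<Gamma>. weak_limit_of_translates \<Lambda> \<Gamma> \<longrightarrow>
      inj_on (\<lambda>F. \<lambda>\<gamma>\<in>\<Gamma>. dual_pairing F (tf_shift \<gamma> g)) (M1_dual \<phi>))"
proof -
  obtain \<Theta> B where "localized_kernel_pair (kern \<phi>) (kern g) \<Theta> B phase" using kern_pair[OF g] by blast
  then interpret K: localized_kernel_pair "kern \<phi>" "kern g" \<Theta> B phase .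
  obtain N where N: "\<And>x. finite (\<Lambda> \<inter> ball x 1) \<and> card (\<Lambda> \<inter> ball x 1) \<le> N"
    using \<Lambda> by (auto simp: relatively_separated_def)
  have V_L2: "square_integrable (V f)" "kernel_apply (kern \<phi>) (V f) = V f"
    "(LINT w|lborel. (norm (V f w))\<^sup>2) = (L2_norm f)\<^sup>2 / c" if f: "f \<in> L2" for f
  proof -
    have "f \<in> borel_measurable borel" using f by (simp add: L2_def)
    then show "square_integrable (V f)"
      unfolding square_integrable_def using L2_stft_measurable L2_plancherel(1)[OF f] by blast
    show "kernel_apply (kern \<phi>) (V f) = V f"
      by (rule ext, rule L2_inner_eq_kernel_apply[OF f window_M1, symmetric])
    show "(LINT w|lborel. (norm (V f w))\<^sup>2) = (L2_norm f)\<^sup>2 / c"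
      unfolding L2_plancherel(2)[OF f] by (simp add: L2_norm_def)
  qed
  show ?thesis
  proof (intro iffI allI impI inj_onI)
    fix \<Gamma> F1 F2
    assume "gabor_frame g \<Lambda>" and \<Gamma>: "weak_limit_of_translates \<Lambda> \<Gamma>"
      and F: "F1 \<in> M1_dual \<phi>" "F2 \<in> M1_dual \<phi>"
      and eq: "(\<lambda>\<gamma>\<in>\<Gamma>. dual_pairing F1 (tf_shift \<gamma> g)) = (\<lambda>\<gamma>\<in>\<Gamma>. dual_pairing F2 (tf_shift \<gamma> g))"
    then obtain A where A: "0 < A" "\<And>f. f \<in> L2 \<Longrightarrow>
        A * (L2_norm f)\<^sup>2 \<le> (\<Sum>\<^sub>\<infinity>l\<in>\<Lambda>. (norm (L2_inner f (tf_shift l g)))\<^sup>2)"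
      unfolding gabor_frame_def by blast
    let ?U1 = "\<lambda>w. F1 (atom w \<phi>)" and ?U2 = "\<lambda>w. F2 (atom w \<phi>)"
    \<comment> \<open>Equality of the two functionals is reduced to the vanishing of one bounded
      function, which is fixed by the kernel of \<open>\<phi>\<close> and mapped by the kernel of
      \<open>g\<close> to a function vanishing on \<open>\<Gamma>\<close>.\<close>
    define U where "U w = ?U1 w - ?U2 w" for w
    have apply_U: "kernel_apply (kern h) U z = F1 (atom z h) - F2 (atom z h)" if h: "h \<in> M1_functions \<phi>" for h z
    proof -
      have i: "integrable lborel (\<lambda>w. kern h z w * F (atom w \<phi>))" if F: "F \<in> M1_dual \<phi>" for F
      proof -
        obtain M where M: "\<And>w. norm (F (atom w \<phi>)) \<le> M"
          using dual_atom_continuous(2)[OF F] by (auto simp: bounded_iff)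
        have "integrable lborel (\<lambda>w. of_real c * atom z h (tf_shift w \<phi>))"
          using M1_conj_stft atom_M1[OF h] by (intro integrable_mult_right) blast
        then have "integrable lborel (kern h z)" by (simp add: kern_eq_atom[abs_def])
        from integrable_mult_bounded[OF this borel_measurable_continuous_onI[OF dual_atom_continuous(1)[OF F]] M]
        show ?thesis .
      qed
      have "F (atom z h) = kernel_apply (kern h) (\<lambda>w. F (atom w \<phi>)) z" if F: "F \<in> M1_dual \<phi>" for F
        using functional_of_atom[OF h, of "\<lambda>w. F (atom w \<phi>)" z] dual_representation[OF F] by simp
      then show ?thesis
        using i F unfolding kernel_apply_def U_def by (simp add: right_diff_distrib)
    qed
    have "U = (\<lambda>z. 0)"
    proof (rule K.bounded_fixed_eq_zero[OF N _ _ \<Gamma>])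
      \<comment> \<open>The factor \<open>c\<close> converts the squared L2 norm of the short-time
        Fourier transform of \<open>synthesis W\<close>, which is the image of \<open>W\<close>
        under the kernel of \<open>\<phi>\<close>, into that of \<open>synthesis W\<close>.\<close>
      show "0 < A * c" using A(1) c_pos by simp
      show "(A * c) * (LINT z|lborel. (norm (kernel_apply (kern \<phi>) W z))\<^sup>2) \<le> (\<Sum>\<^sub>\<infinity>l\<in>\<Lambda>. (norm (kernel_apply (kern g) W l))\<^sup>2)"
        if W: "W \<in> borel_measurable borel" "bounded (range W)" "\<exists>r. \<forall>z. r \<le> norm z \<longrightarrow> W z = 0" for W
      proof -
        obtain M where M: "\<And>z. norm (W z) \<le> M" using W(2) by (auto simp: bounded_iff)
        have M0: "0 \<le> M" by (rule order_trans[OF norm_ge_zero M])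
        obtain r where r: "\<And>z. r \<le> norm z \<Longrightarrow> W z = 0" using W(3) by blast
        have Wi: "integrable lborel W"
        proof (rule integrable_norm_le[OF integrable_indicator_ball[of 0 r M]])
          show "norm (W z) \<le> indicator (ball 0 r) z * M" for z
            using M[of z] r[of z] by (cases "norm z < r") (auto simp: indicator_def)
        qed (use W(1) in simp)
        have f: "synthesis W \<in> L2" by (rule synthesis_L2[OF Wi])
        have "(LINT z|lborel. (norm (kernel_apply (kern \<phi>) W z))\<^sup>2) = (L2_norm (synthesis W))\<^sup>2 / c"
          using V_L2(3)[OF f] by (simp only: synthesis_inner[OF Wi window_M1])
        then have "(A * c) * (LINT z|lborel. (norm (kernel_apply (kern \<phi>) W z))\<^sup>2) = A * (L2_norm (synthesis W))\<^sup>2"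
          using c_pos by simp
        also have "\<dots> \<le> (\<Sum>\<^sub>\<infinity>l\<in>\<Lambda>. (norm (kernel_apply (kern g) W l))\<^sup>2)"
          using A(2)[OF f] by (simp only: synthesis_inner[OF Wi g])
        finally show ?thesis .
      qed
      have "kernel_apply (kern \<phi>) U = U"
        by (rule ext) (simp add: apply_U[OF window_M1] U_def)
      moreover have "continuous_on UNIV U"
        unfolding U_def by (intro continuous_intros dual_atom_continuous F)
      moreover have "bounded (range U)"
        unfolding U_def by (rule bounded_minus_comp[OF dual_atom_continuous(2)[OF F(1)] dual_atom_continuous(2)[OF F(2)]])
      ultimately show "K.bounded_fixed U"
        unfolding K.bounded_fixed_def using borel_measurable_continuous_onI by blast
      fix \<gamma> assume "\<gamma> \<in> \<Gamma>"
      then show "kernel_apply (kern g) U \<gamma> = 0"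
        using fun_cong[OF eq, of \<gamma>] by (simp add: apply_U[OF g] dual_pairing_atom)
    qed
    then have "?U1 = ?U2" unfolding U_def by (auto simp: fun_eq_iff)
    then show "F1 = F2" using dual_representation F by metis
  next
    assume inj: "\<forall>\<Gamma>. weak_limit_of_translates \<Lambda> \<Gamma> \<longrightarrow>
      inj_on (\<lambda>F. \<lambda>\<gamma>\<in>\<Gamma>. dual_pairing F (tf_shift \<gamma> g)) (M1_dual \<phi>)"
    \<comment> \<open>Injectivity is applied to \<open>functional_of U\<close> and the functional of
      the zero function; evaluating them at \<open>atom z \<phi>\<close> recovers
      \<open>U\<close>.\<close>
    have zero: "U = (\<lambda>z. 0)" if \<Gamma>: "weak_limit_of_translates \<Lambda> \<Gamma>" and U: "K.bounded_fixed U"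
      and 0: "\<And>\<gamma>. \<gamma> \<in> \<Gamma> \<Longrightarrow> kernel_apply (kern g) U \<gamma> = 0" for \<Gamma> U
    proof -
      have "U \<in> borel_measurable borel" "bounded (range U)" and fixd: "kernel_apply (kern \<phi>) U = U"
        using U by (auto simp: K.bounded_fixed_def)
      then have F: "functional_of U \<in> M1_dual \<phi>" and "functional_of (\<lambda>w. 0) \<in> M1_dual \<phi>"
        by (auto intro!: functional_of_M1_dual)
      moreover have "(\<lambda>\<gamma>\<in>\<Gamma>. dual_pairing (functional_of U) (tf_shift \<gamma> g))
        = (\<lambda>\<gamma>\<in>\<Gamma>. dual_pairing (functional_of (\<lambda>w. 0)) (tf_shift \<gamma> g))"
        by (rule restrict_ext)
          (simp add: dual_pairing_atom functional_of_atom[OF g] 0, simp add: kernel_apply_def)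
      ultimately have "functional_of U = functional_of (\<lambda>w. 0)"
        using inj \<Gamma> by (auto dest: inj_onD)
      then have "kernel_apply (kern \<phi>) U z = 0" for z
        using functional_of_atom[OF window_M1, of U z] functional_of_atom[OF window_M1, of "\<lambda>w. 0" z]
        by (simp add: kernel_apply_def)
      then show ?thesis using fixd by auto
    qed
    have "\<exists>C>0. \<forall>U s. K.bounded_fixed U \<longrightarrow> 0 \<le> s \<longrightarrow>
      (\<forall>l\<in>\<Lambda>. norm (kernel_apply (kern g) U l) \<le> s) \<longrightarrow> (\<forall>z. norm (U z) \<le> C * s)"
      by (rule K.bounded_lower_bound) (rule zero)
    then obtain C where C: "0 < C" "\<And>U s z. K.bounded_fixed U \<Longrightarrow> 0 \<le> s \<Longrightarrow>
      (\<And>l. l \<in> \<Lambda> \<Longrightarrow> norm (kernel_apply (kern g) U l) \<le> s) \<Longrightarrow> norm (U z) \<le> C * s" by blast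
    have "\<exists>A>0. \<forall>U. square_integrable U \<longrightarrow> kernel_apply (kern \<phi>) U = U \<longrightarrow>
      A * (LINT u|lborel. (norm (U u))\<^sup>2) \<le> (\<Sum>\<^sub>\<infinity>l\<in>\<Lambda>. (norm (kernel_apply (kern g) U l))\<^sup>2)"
    proof (rule K.square_integrable_lower_bound[OF N C(1)])
      fix U s z assume "K.bounded_fixed U" "0 \<le> s" "\<And>l. l \<in> \<Lambda> \<Longrightarrow> norm (kernel_apply (kern g) U l) \<le> s"
      then show "norm (U z) \<le> C * s" by (rule C(2)[of U s z])
    qed
    then obtain A where A: "0 < A" "\<And>U. square_integrable U \<Longrightarrow> kernel_apply (kern \<phi>) U = U \<Longrightarrow>
      A * (LINT u|lborel. (norm (U u))\<^sup>2) \<le> (\<Sum>\<^sub>\<infinity>l\<in>\<Lambda>. (norm (kernel_apply (kern g) U l))\<^sup>2)"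
      by blast
    \<comment> \<open>The upper frame bound is the Bessel constant \<open>D / c\<close>; the maximum
      with \<open>A / c\<close> secures the required order of the two bounds.\<close>
    define D where "D = real N / measure lborel (ball (0 :: (real^'d) \<times> (real^'d)) 1) * K.G.mass\<^sup>2"
    show "gabor_frame g \<Lambda>"
      unfolding gabor_frame_def
    proof (rule exI[of _ "A / c"], rule exI[of _ "max (A / c) (D / c)"], intro conjI ballI)
      show "0 < A / c" using A(1) c_pos by simp
      show "A / c \<le> max (A / c) (D / c)" by simp
      fix f :: "real^'d \<Rightarrow> complex" assume f: "f \<in> L2"
      have e: "L2_inner f (tf_shift l g) = kernel_apply (kern g) (V f) l" for l
        by (rule L2_inner_eq_kernel_apply[OF f g])
      note b = K.G.bessel_summable[OF V_L2(1)[OF f] N]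
      show "(\<lambda>l. (norm (L2_inner f (tf_shift l g)))\<^sup>2) summable_on \<Lambda>"
        unfolding e by (rule b(1))
      show "A / c * (L2_norm f)\<^sup>2 \<le> (\<Sum>\<^sub>\<infinity>l\<in>\<Lambda>. (norm (L2_inner f (tf_shift l g)))\<^sup>2)"
        unfolding e using A(2)[OF V_L2(1,2)[OF f]] V_L2(3)[OF f] by simp
      have "(\<Sum>\<^sub>\<infinity>l\<in>\<Lambda>. (norm (L2_inner f (tf_shift l g)))\<^sup>2) \<le> D / c * (L2_norm f)\<^sup>2"
        unfolding e using b(2) V_L2(3)[OF f] by (simp add: D_def mult.assoc)
      also have "\<dots> \<le> max (A / c) (D / c) * (L2_norm f)\<^sup>2" by (intro mult_right_mono) auto
      finally show "(\<Sum>\<^sub>\<infinity>l\<in>\<Lambda>. (norm (L2_inner f (tf_shift l g)))\<^sup>2) \<le> max (A / c) (D / c) * (L2_norm f)\<^sup>2" .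
    qed
  qed
qed

end

theorem theorem1p3:
  fixes \<phi> g :: "real^'d \<Rightarrow> complex"
    and \<Lambda> :: "((real^'d) \<times> (real^'d)) set"
  assumes "\<phi> \<in> schwartz" and "\<phi> \<noteq> (\<lambda>t. 0)"
    and "g \<in> M1_functions \<phi>"
    and "relatively_separated \<Lambda>"
  shows "gabor_frame g \<Lambda> \<longleftrightarrow>
    (\<forall>\<Gamma>. weak_limit_of_translates \<Lambda> \<Gamma> \<longrightarrow>
      inj_on (\<lambda>F. \<lambda>\<gamma>\<in>\<Gamma>. dual_pairing F (tf_shift \<gamma> g)) (M1_dual \<phi>))"
proof -
  interpret stft_window \<phi> by (rule stft_window.intro) (rule assms)+
  show ?thesis by (rule frame_iff_injective) (rule assms)+
qed

end
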